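(* Let $q$ be a prime power and let $1\le r\le n$ be integers. Then the Hilbert series of the Chow ring $A\big(M_r(\mathbb{F}_q^n)\big)$ is \[ H\big(A(M_r(\mathbb{F}_q^n)),t\big)=\sum_{\sigma\in\mathfrak{S}_n}q^{\operatorname{maj}(\sigma)-\operatorname{exc}(\sigma)}t^{\operatorname{exc}(\sigma)}\;-\;\sum_{j=r}^{n-1}\;\sum_{\sigma\in F_{n,n-j}}q^{\operatorname{maj}(\sigma)-\operatorname{exc}(\sigma)}t^{\,j-\operatorname{exc}(\sigma)}, \] where $F_{n,m}$ denotes the set of permutations in $\mathfrak{S}_n$ with at least $m$ fixed points. In particular, for $r=n$ the Hilbert series equals $\sum_{\sigma\in\mathfrak{S}_n}q^{\operatorname{maj}(\sigma)-\operatorname{exc}(\sigma)}t^{\operatorname{exc}(\sigma)}$.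
   Context: Chow ring of a lattice: for a finite ranked lattice $L$ with minimum $\bot$ and maximum $\top$, $A(L)=\mathbb{Z}[x_F : F\in L\setminus\{\bot\}]/I$, where $I$ is generated by the products $x_Fx_G$ for incomparable $F,G$ and, for each atom $a$ of $L$, by $\sum_{F\ge a}x_F$. It is graded by polynomial degree, each graded piece $A(L)_d$ is a free abelian group of finite rank, and the Hilbert series is $H(A(L),t)=\sum_{d\ge0}\operatorname{rank}_{\mathbb{Z}}A(L)_d\,t^d$. The matroid $M_r(\mathbb{F}_q^n)$ has as independent sets the linearly independent subsets of $\mathbb{F}_q^n$ of size at most $r$; its lattice of flats is the set of all subspaces of $\mathbb{F}_q^n$ of dimension at most $r-1$ together with $\mathbb{F}_q^n$, ordered by inclusion (rank = dimension for proper subspaces, and $\mathbb{F}_q^n$ has rank $r$). $A(M_r(\mathbb{F}_q^n))$ denotes the Chow ring of this lattice. For $\sigma\in\mathfrak{S}_n$: $\operatorname{exc}(\sigma)=\#\{i\in[n]:\sigma(i)>i\}$ and $\operatorname{maj}(\sigma)=\sum_{i\in[n-1],\ \sigma(i)>\sigma(i+1)}i$. *)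

theory Defs
  imports "HOL-Analysis.Analysis" "HOL-Library.Poly_Mapping" "HOL-Combinatorics.Permutations"
begin

text \<open>Multivariate integer polynomials in variables of type 'v:
  finitely supported maps from monomials (exponent vectors 'v =>0 nat) to int.\<close>
type_synonym 'v zpoly = "('v \<Rightarrow>\<^sub>0 nat) \<Rightarrow>\<^sub>0 int"

definition Var :: "'v \<Rightarrow> 'v zpoly" where
  "Var v = Poly_Mapping.single (Poly_Mapping.single v 1) 1"

definition poly_ring :: "'v set \<Rightarrow> 'v zpoly set" where
  "poly_ring V = {p. \<forall>m\<in>Poly_Mapping.keys p. Poly_Mapping.keys m \<subseteq> V}"

definition hom_part :: "'v set \<Rightarrow> nat \<Rightarrow> 'v zpoly set" where
  "hom_part V d = {p. \<forall>m\<in>Poly_Mapping.keys p. Poly_Mapping.keys m \<subseteq> V \<and> (\<Sum>v\<in>Poly_Mapping.keys m. Poly_Mapping.lookup m v) = d}"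

text \<open>Lattice given as a finite family L of sets ordered by inclusion, with minimum z.\<close>
definition lat_atoms :: "'b set set \<Rightarrow> 'b set \<Rightarrow> 'b set set" where
  "lat_atoms L z = {a \<in> L. a \<noteq> z \<and> \<not> (\<exists>F\<in>L. z \<subset> F \<and> F \<subset> a)}"

definition chow_gens :: "'b set set \<Rightarrow> 'b set \<Rightarrow> 'b set zpoly set" where
  "chow_gens L z =
     {Var F * Var G | F G. F \<in> L - {z} \<and> G \<in> L - {z} \<and> \<not> F \<subseteq> G \<and> \<not> G \<subseteq> F}
     \<union> {(\<Sum>F\<in>{F\<in>L. a \<subseteq> F}. Var F) | a. a \<in> lat_atoms L z}"

text \<open>The ideal I of Z[x_F : F in L - {z}] generated by chow_gens (a finite set when L is finite).\<close>
definition chow_ideal :: "'b set set \<Rightarrow> 'b set \<Rightarrow> 'b set zpoly set" where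
  "chow_ideal L z = {(\<Sum>g\<in>chow_gens L z. c g * g) | c.
                         \<forall>g\<in>chow_gens L z. c g \<in> poly_ring (L - {z})}"

text \<open>A(L)_d is a free abelian group of rank k: there is a finite family B of
  degree-d homogeneous polynomials whose classes form a Z-basis of A(L)_d
  = (degree d part) / (I intersected with degree d part).\<close>
definition chow_has_rank :: "'b set set \<Rightarrow> 'b set \<Rightarrow> nat \<Rightarrow> nat \<Rightarrow> bool" where
  "chow_has_rank L z d k \<longleftrightarrow>
     (\<exists>B. finite B \<and> card B = k \<and> B \<subseteq> hom_part (L - {z}) d \<and>
        (\<forall>p\<in>hom_part (L - {z}) d. \<exists>c::'b set zpoly \<Rightarrow> int.
            p - (\<Sum>b\<in>B. of_int (c b) * b) \<in> chow_ideal L z) \<and>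
        (\<forall>c::'b set zpoly \<Rightarrow> int.
            (\<Sum>b\<in>B. of_int (c b) * b) \<in> chow_ideal L z \<longrightarrow> (\<forall>b\<in>B. c b = 0)))"

definition chow_rank :: "'b set set \<Rightarrow> 'b set \<Rightarrow> nat \<Rightarrow> nat" where
  "chow_rank L z d = (THE k. chow_has_rank L z d k)"

definition flats_Mr :: "nat \<Rightarrow> ('a::field ^ 'n) set set" where
  "flats_Mr r = {W. vec.subspace W \<and> vec.dim W \<le> r - 1} \<union> {UNIV}"

definition exc :: "nat \<Rightarrow> (nat \<Rightarrow> nat) \<Rightarrow> nat" where
  "exc n \<sigma> = card {i \<in> {1..n}. \<sigma> i > i}"

definition maj :: "nat \<Rightarrow> (nat \<Rightarrow> nat) \<Rightarrow> nat" where
  "maj n \<sigma> = (\<Sum>i\<in>{i \<in> {1..n-1}. \<sigma> i > \<sigma> (i+1)}. i)"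

definition fixpts :: "nat \<Rightarrow> (nat \<Rightarrow> nat) \<Rightarrow> nat" where
  "fixpts n \<sigma> = card {i \<in> {1..n}. \<sigma> i = i}"

end

theory Submission
  imports Defs "HOL-Computational_Algebra.Formal_Power_Series"
begin

text \<open>Algebra: the Feichtner--Yuzvinsky monomials $x_{F_1}^{a_1} \cdots x_{F_k}^{a_k}$
  with $F_1 \subset \dots \subset F_k$ and $0 < a_i < \mathrm{rk} F_i - \mathrm{rk} F_{i-1}$
  form a basis of the Chow ring. They span because $x_H y_G^{\mathrm{rk} G - \mathrm{rk} H}$ lies in the ideal for
  $H \subset G$ and $y_G = \sum_{F \supseteq G} x_F$. They are independent because a degree map, given on monomials in
  the $y_G$ by the dragon Hall--Rado condition, vanishes on the ideal and pairs them triangularly with complementary monomials.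

  Counting: grouping these monomials by their largest flat and the flats by dimension expresses the Hilbert series
  through Gaussian binomials and the polynomials given by $P_0 = 1$ and $P_n = \sum_{k<n} {n \brack k}_q P_k (t + \dots + t^{n-k-1})$.

  Permutations: the sum of $q^{maj - exc} t^{exc}$ over the permutations of $[n]$ with $m$ fixed points is
  ${n \brack m}_q P_{n-m}$. This follows by counting words, that is, permutations with a compatible decreasing sequence,
  where the generating function obeys a recursion that removes the largest letter. Symmetry of $P_n$ under
  $P_n(t) = t^n P_n(1/t)$ turns the Hilbert series into the difference in the theorem.\<close>

section \<open>Weighted words\<close>

text \<open>Neither \<open>maj\<close> nor the number of excedances behaves well when a letter is
  removed from a permutation. A compatible sequence turns \<open>maj\<close> into a weight of
  letters, summed over all sequences, and an excedance into a comparison of position and rank in a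
  word; both survive the removal of the largest letter, at the price of an extra prefix. An
  excedance on the letter \<open>i\<close> weighs \<open>t * q ^ (i - 1)\<close> and not
  \<open>t * q ^ i\<close>: the shift produces the exponent maj - exc and makes the product formulas
  telescope. The limit over alphabets exists only for \<open>0 < q < 1\<close>, whereas a field has
  more than one element; polynomiality in \<open>q\<close> bridges the gap.

  In the algebra the obstacle is a linear form that vanishes on the whole ideal. On monomials in the
  \<open>x_F\<close> it has no simple values, on monomials in the \<open>y_F\<close> it is a 0/1
  rule; in exchange, the vanishing of \<open>x_F x_G\<close> for incomparable flats has to be
  derived from quadratic relations among the \<open>y_F\<close>. The lattice stays abstract there,
  which keeps the truncation at rank \<open>r\<close> out of the argument.\<close>

definition words :: "'a set \<Rightarrow> nat \<Rightarrow> 'a list set" where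
  "words A n = {xs. set xs \<subseteq> A \<and> length xs = n}"

lemma finite_words [simp]: "finite A \<Longrightarrow> finite (words A n)"
  unfolding words_def by (rule finite_lists_length_eq)

lemma words_0 [simp]: "words A 0 = {[]}"
  by (auto simp: words_def)

lemma sum_words_append:
  assumes "finite A"
  shows "(\<Sum>xs\<in>words A (m + n). F xs) = (\<Sum>xs\<in>words A m. \<Sum>ys\<in>words A n. (F (xs @ ys) :: real))"
proof -
  have "(\<Sum>xs\<in>words A m. \<Sum>ys\<in>words A n. F (xs @ ys)) = (\<Sum>(xs, ys)\<in>words A m \<times> words A n. F (xs @ ys))"
    using assms by (simp add: sum.cartesian_product)
  also have "\<dots> = (\<Sum>xs\<in>words A (m + n). F xs)"
    by (rule sum.reindex_bij_witness[where i = "\<lambda>xs. (take m xs, drop m xs)" and j = "\<lambda>(xs, ys). xs @ ys"])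
       (auto simp: words_def dest: in_set_takeD in_set_dropD)
  finally show ?thesis by simp
qed

lemma sum_words_1: "(\<Sum>xs\<in>words A 1. F xs) = (\<Sum>x\<in>A. (F [x] :: real))"
  by (rule sum.reindex_bij_witness[where i = "\<lambda>x. [x]" and j = hd])
     (auto simp: words_def length_Suc_conv)

lemma sum_words_Suc:
  assumes "finite A"
  shows "(\<Sum>xs\<in>words A (Suc n). F xs) = (\<Sum>x\<in>A. \<Sum>ys\<in>words A n. (F (x # ys) :: real))"
  using sum_words_append[OF assms, where m = 1 and n = n and F = F] sum_words_1[where A = A and F = "\<lambda>xs. \<Sum>ys\<in>words A n. F (xs @ ys)"]
  by simp

text \<open>A word over the letters $0, 1, \dots$ is sorted decreasingly, equal letters from left to right; this gives each
  letter a rank. A letter $v$ weighs $u_v$, $R u_v$ or $e_v$ as its position is less than, equal to or greater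
  than its rank; \<open>\<delta> v\<close> is the position minus the rank of the next occurrence of $v$.\<close>

context
  fixes u e :: "nat \<Rightarrow> real" and R :: real
begin

definition letter_weight :: "nat \<Rightarrow> int \<Rightarrow> real" where
  "letter_weight v \<delta> = (if \<delta> < 0 then u v else if \<delta> = 0 then R * u v else e v)"

text \<open>Reading \<open>v\<close> advances the position for every letter, but it also raises the
  rank of the next \<open>v\<close>; hence only the offsets of the other letters grow. Letters from
  \<open>k\<close> on are placeholders of weight 1.\<close>

fun word_weight :: "nat \<Rightarrow> (nat \<Rightarrow> int) \<Rightarrow> nat list \<Rightarrow> real" where
  "word_weight k \<delta> [] = 1"
| "word_weight k \<delta> (v # vs) = (if v < k then letter_weight v (\<delta> v) else 1) * word_weight k (\<lambda>x. if x = v then \<delta> x else \<delta> x + 1) vs"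

fun top_weight :: "nat \<Rightarrow> int \<Rightarrow> nat list \<Rightarrow> real" where
  "top_weight k \<delta> [] = 1"
| "top_weight k \<delta> (v # vs) = (if v = k then letter_weight k \<delta> * top_weight k \<delta> vs else top_weight k (\<delta> + 1) vs)"

text \<open>The sum of \<open>top_weight\<close> over all interleavings of \<open>j\<close> letters
  \<open>k\<close> with \<open>m\<close> other letters. Only the number of the other letters
  matters, so their identities can be summed separately.\<close>

fun top_coeff :: "nat \<Rightarrow> int \<Rightarrow> nat \<Rightarrow> nat \<Rightarrow> real" where
  "top_coeff k \<delta> 0 0 = 1"
| "top_coeff k \<delta> (Suc m) 0 = top_coeff k (\<delta> + 1) m 0"
| "top_coeff k \<delta> 0 (Suc j) = letter_weight k \<delta> * top_coeff k \<delta> 0 j"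
| "top_coeff k \<delta> (Suc m) (Suc j) = letter_weight k \<delta> * top_coeff k \<delta> (Suc m) j + top_coeff k (\<delta> + 1) m (Suc j)"

definition advance :: "(nat \<Rightarrow> int) \<Rightarrow> nat list \<Rightarrow> nat \<Rightarrow> int" where
  "advance \<delta> xs v = \<delta> v + int (length xs) - int (count_list xs v)"

text \<open>The first \<open>v\<close> of a word has rank one plus the number of larger letters and
  is compared with position 1.\<close>

definition start_offset :: "nat list \<Rightarrow> nat \<Rightarrow> int" where
  "start_offset W v = - int (length (filter (\<lambda>x. x > v) W))"

lemma word_weight_append: "word_weight k \<delta> (xs @ ys) = word_weight k \<delta> xs * word_weight k (advance \<delta> xs) ys"
proof (induction xs arbitrary: \<delta>)
  case Nil then show ?case by (simp add: advance_def[abs_def])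
next
  case (Cons x xs)
  have "advance (\<lambda>y. if y = x then \<delta> y else \<delta> y + 1) xs = advance \<delta> (x # xs)"
    by (auto simp: advance_def fun_eq_iff)
  then show ?case by (simp add: Cons.IH)
qed

text \<open>An offset grows by at most one per letter read, so within \<open>xs\<close> it stays
  below \<open>\<delta> v + int (length xs)\<close>. Every weighted letter thus stands before its
  rank, and the arrangement has no influence.\<close>

lemma word_weight_neg:
  assumes "\<And>v. v \<in> set xs \<Longrightarrow> v < k \<Longrightarrow> \<delta> v + int (length xs) \<le> 0"
  shows "word_weight k \<delta> xs = prod_list (map u (filter (\<lambda>v. v < k) xs))"
  using assms
proof (induction xs arbitrary: \<delta>)
  case (Cons x xs)
  have "word_weight k (\<lambda>y. if y = x then \<delta> y else \<delta> y + 1) xs = prod_list (map u (filter (\<lambda>v. v < k) xs))"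
    using Cons.prems by (intro Cons.IH) force
  then show ?case using Cons.prems[of x] by (auto simp: letter_weight_def)
qed simp

lemma word_weight_top_weight:
  assumes "\<And>v. v < k \<Longrightarrow> \<delta> v + int (length xs) \<le> 0"
  shows "word_weight (Suc k) \<delta> xs = top_weight k (\<delta> k) xs * prod_list (map u (filter (\<lambda>v. v < k) xs))"
  using assms
proof (induction xs arbitrary: \<delta>)
  case (Cons x xs)
  have "word_weight (Suc k) (\<lambda>y. if y = x then \<delta> y else \<delta> y + 1) xs
      = top_weight k (if k = x then \<delta> k else \<delta> k + 1) xs * prod_list (map u (filter (\<lambda>v. v < k) xs))"
    using Cons.prems by (intro Cons.IH) force
  then show ?case using Cons.prems[of x] by (auto simp: letter_weight_def)
qed simp

text \<open>A positive offset of \<open>k\<close> stays positive, so each remaining \<open>k\<close>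
  weighs \<open>e k\<close>. The offsets of smaller letters only count how many other letters were
  read and cannot tell \<open>k\<close> from \<open>Suc k\<close>; the two can be merged into one
  placeholder.\<close>

lemma word_weight_suffix:
  assumes "\<delta> k \<ge> 1 \<or> k \<notin> set S" and "\<And>v. v < k \<Longrightarrow> \<delta> v = \<delta>' v" and "set S \<subseteq> {..Suc k}"
  shows "word_weight (Suc k) \<delta> S = e k ^ count_list S k * word_weight k \<delta>' (map (min k) S)"
  using assms
proof (induction S arbitrary: \<delta> \<delta>')
  case (Cons x xs)
  have "word_weight (Suc k) (\<lambda>y. if y = x then \<delta> y else \<delta> y + 1) xs
     = e k ^ count_list xs k * word_weight k (\<lambda>y. if y = min k x then \<delta>' y else \<delta>' y + 1) (map (min k) xs)"
    using Cons.prems by (intro Cons.IH) auto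
  moreover have "x < k \<or> x = k \<or> x = Suc k" using Cons.prems by auto
  ultimately show ?case using Cons.prems by (auto simp: letter_weight_def)
qed simp

lemma length_split_top:
  assumes "set xs \<subseteq> {..Suc k}"
  shows "length xs = length (filter (\<lambda>x. x < k) xs) + count_list xs k + count_list xs (Suc k)"
  using assms by (induction xs) auto

lemma filter_gt_split:
  assumes "set xs \<subseteq> {..Suc k}" "v < k"
  shows "length (filter (\<lambda>x. x > v) xs) = length (filter (\<lambda>x. x > v) (filter (\<lambda>x. x < k) xs)) + count_list xs k + count_list xs (Suc k)"
  using assms by (induction xs) auto

lemma filter_gt_min:
  fixes v k :: nat
  assumes "v < k"
  shows "length (filter (\<lambda>x. x > v) (map (min k) xs)) = length (filter (\<lambda>x. x > v) xs)"
proof -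
  have "v < min k x \<longleftrightarrow> v < x" for x using assms by auto
  then show ?thesis by (induction xs) auto
qed

text \<open>In decreasing order the placeholders \<open>Suc k\<close> take the first
  \<open>length P1\<close> ranks and the letters \<open>k\<close> the next \<open>length P2\<close>.
  So weighted letters of \<open>P1\<close> precede their ranks, in \<open>P2\<close> only the
  letters \<open>k\<close> depend on the arrangement, and in \<open>S\<close> each \<open>k\<close>
  comes after its rank. What is left is again a word whose prefix \<open>os\<close> is as long as
  the number of placeholders in \<open>S'\<close>, which allows the step to be repeated.\<close>

lemma word_weight_split:
  fixes P1 P2 S k
  defines "W \<equiv> P1 @ P2 @ S"
    and "os \<equiv> filter (\<lambda>v. v < k) P1 @ filter (\<lambda>v. v < k) P2" and "S' \<equiv> map (min k) S"
  assumes P1: "set P1 \<subseteq> {..k}" and P2: "set P2 \<subseteq> {..Suc k}" and S: "set S \<subseteq> {..Suc k}"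
    and ck: "count_list P1 k + count_list P2 k + count_list S k = length P2"
    and ck1: "count_list P2 (Suc k) + count_list S (Suc k) = length P1"
  shows "word_weight (Suc k) (start_offset W) W = u k ^ count_list P1 k * top_weight k (- int (count_list P1 k)) P2
      * e k ^ count_list S k * word_weight k (start_offset (os @ S')) (os @ S')"
proof -
  define D where "D = start_offset W"
  have nP1: "count_list P1 (Suc k) = 0" using P1 by (auto simp: count_list_0_iff)
  have P1': "set P1 \<subseteq> {..Suc k}" using P1 by auto
  have gk: "D k = - int (length P1)"
  proof -
    have "length (filter (\<lambda>x. x > k) xs) = count_list xs (Suc k)" if "set xs \<subseteq> {..Suc k}" for xs
      using that by (induction xs) auto
    then show ?thesis using P1' P2 S nP1 ck1 unfolding D_def start_offset_def W_def by simp
  qed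
  have g: "D v = - int (length P1) - int (length P2) - int (length (filter (\<lambda>x. x > v) os)) - int (length (filter (\<lambda>x. x > v) (filter (\<lambda>x. x < k) S)))"
    if "v < k" for v
    using filter_gt_split[OF P1' that] filter_gt_split[OF P2 that] filter_gt_split[OF S that] ck ck1 nP1
    unfolding D_def start_offset_def W_def os_def by simp
  have a: "word_weight (Suc k) D P1 = u k ^ count_list P1 k * prod_list (map u (filter (\<lambda>v. v < k) P1))"
  proof -
    have "D v + int (length P1) \<le> 0" if "v < Suc k" for v
      using that g[of v] gk by (cases "v = k") auto
    then have "word_weight (Suc k) D P1 = prod_list (map u (filter (\<lambda>v. v < Suc k) P1))"
      by (intro word_weight_neg) auto
    moreover have "prod_list (map u (filter (\<lambda>v. v < Suc k) xs)) = u k ^ count_list xs k * prod_list (map u (filter (\<lambda>v. v < k) xs))" for xs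
      by (induction xs) (auto simp: less_Suc_eq)
    ultimately show ?thesis by simp
  qed
  have b: "word_weight (Suc k) (advance D P1) P2 = top_weight k (- int (count_list P1 k)) P2 * prod_list (map u (filter (\<lambda>v. v < k) P2))"
  proof -
    have "advance D P1 v + int (length P2) \<le> 0" if "v < k" for v
      using g[OF that] by (simp add: advance_def)
    from word_weight_top_weight[where k = k and \<delta> = "advance D P1", OF this] show ?thesis using gk by (simp add: advance_def)
  qed
  define E where "E = start_offset (os @ S')"
  have los: "int (length os) = int (length P1) + int (length P2) - int (count_list P1 k) - int (count_list P2 k) - int (count_list P2 (Suc k))"
    using length_split_top[OF P1'] length_split_top[OF P2] nP1 by (simp add: os_def)
  have Ev: "E v = - int (length (filter (\<lambda>x. x > v) os)) - int (length (filter (\<lambda>x. x > v) (filter (\<lambda>x. x < k) S))) - int (count_list S k) - int (count_list S (Suc k))"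
    if "v < k" for v
    using filter_gt_split[OF S that] filter_gt_min[OF that, of S] unfolding E_def start_offset_def S'_def by simp
  have c: "word_weight (Suc k) (advance (advance D P1) P2) S = e k ^ count_list S k * word_weight k (advance E os) S'"
    unfolding S'_def
  proof (rule word_weight_suffix)
    \<comment> \<open>By \<open>ck\<close> this offset equals \<open>count_list S k\<close>, so it
      is positive as soon as \<open>S\<close> contains a \<open>k\<close>.\<close>
    show "advance (advance D P1) P2 k \<ge> 1 \<or> k \<notin> set S"
      using gk ck by (auto simp: advance_def count_list_0_iff[symmetric])
    fix v assume v: "v < k"
    have co: "count_list os v = count_list P1 v + count_list P2 v"
    proof -
      have "count_list (filter (\<lambda>x. x < k) xs) v = count_list xs v" for xs using v by (induction xs) auto
      then show ?thesis by (simp add: os_def)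
    qed
    show "advance (advance D P1) P2 v = advance E os v"
      unfolding advance_def using co los Ev[OF v] g[OF v] ck ck1 by simp
  qed (use S in auto)
  have d: "word_weight k E os = prod_list (map u os)"
  proof -
    have "word_weight k E os = prod_list (map u (filter (\<lambda>v. v < k) os))"
    proof (rule word_weight_neg)
      fix v assume "v < k"
      then show "E v + int (length os) \<le> 0" using Ev[of v] los ck ck1 by simp
    qed
    moreover have "filter (\<lambda>v. v < k) os = os" by (simp add: os_def)
    ultimately show ?thesis by simp
  qed
  have "word_weight (Suc k) D W = word_weight (Suc k) D P1 * (word_weight (Suc k) (advance D P1) P2 * word_weight (Suc k) (advance (advance D P1) P2) S)"
    unfolding W_def by (simp add: word_weight_append)
  also have "\<dots> = u k ^ count_list P1 k * top_weight k (- int (count_list P1 k)) P2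
      * e k ^ count_list S k * (prod_list (map u os) * word_weight k (advance E os) S')"
    unfolding a b c os_def by simp
  also have "prod_list (map u os) * word_weight k (advance E os) S' = word_weight k E (os @ S')"
    by (simp add: word_weight_append d)
  finally show ?thesis unfolding D_def E_def .
qed

section \<open>Summation over the three blocks of a word\<close>

lemma atMost_Suc_insert: "{..Suc k} = insert k (insert (Suc k) {..<k})" by auto

text \<open>Each of the \<open>a + g\<close> merged symbols comes from \<open>k\<close> or from
  \<open>Suc k\<close>, and the binomial coefficient counts the choices of those from
  \<open>k\<close>. The induction on the length is Pascal's rule.\<close>

lemma sum_suffix_merge_top:
  fixes F :: "nat list \<Rightarrow> real"
  shows "(\<Sum>S\<in>words {..Suc k} m. if count_list S k = a \<and> count_list S (Suc k) = g then F (map (min k) S) else 0)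
    = real ((a + g) choose a) * (\<Sum>S\<in>words {..k} m. if count_list S k = a + g then F S else 0)"
proof (induction m arbitrary: a g F)
  case 0
  show ?case unfolding words_0 by auto
next
  case (Suc m)
  have split1: "(\<Sum>x\<in>{..Suc k}. H x) = H k + H (Suc k) + (\<Sum>x<k. H x)" for H :: "nat \<Rightarrow> real"
    by (simp add: atMost_Suc_insert)
  have split2: "(\<Sum>x\<in>{..k}. H x) = H k + (\<Sum>x<k. H x)" for H :: "nat \<Rightarrow> real"
    by (simp add: lessThan_Suc_atMost[symmetric])
  have lt: "(\<Sum>S\<in>words {..Suc k} m. if count_list (x # S) k = a \<and> count_list (x # S) (Suc k) = g then F (map (min k) (x # S)) else 0)
     = real ((a + g) choose a) * (\<Sum>S\<in>words {..k} m. if count_list (x # S) k = a + g then F (x # S) else 0)" if "x < k" for x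
    using that Suc.IH[of a g "\<lambda>S. F (x # S)"] by (simp cong: if_cong)
  have k0: "(\<Sum>S\<in>words {..Suc k} m. if count_list (k # S) k = a \<and> count_list (k # S) (Suc k) = g then F (map (min k) (k # S)) else 0)
     = (if a = 0 then 0 else real ((a - 1 + g) choose (a - 1)) * (\<Sum>S\<in>words {..k} m. if count_list S k = a - 1 + g then F (k # S) else 0))"
  proof (cases a)
    case (Suc a')
    then show ?thesis using Suc.IH[of a' g "\<lambda>S. F (k # S)"] by (simp cong: if_cong)
  qed simp
  have k1: "(\<Sum>S\<in>words {..Suc k} m. if count_list (Suc k # S) k = a \<and> count_list (Suc k # S) (Suc k) = g then F (map (min k) (Suc k # S)) else 0)
     = (if g = 0 then 0 else real ((a + (g - 1)) choose a) * (\<Sum>S\<in>words {..k} m. if count_list S k = a + (g - 1) then F (k # S) else 0))"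
  proof (cases g)
    case (Suc g')
    then show ?thesis using Suc.IH[of a g' "\<lambda>S. F (k # S)"] by (simp cong: if_cong)
  qed simp
  have kk: "(if a = 0 then 0 else real ((a - 1 + g) choose (a - 1)) * (\<Sum>S\<in>words {..k} m. if count_list S k = a - 1 + g then F (k # S) else 0))
     + (if g = 0 then 0 else real ((a + (g - 1)) choose a) * (\<Sum>S\<in>words {..k} m. if count_list S k = a + (g - 1) then F (k # S) else 0))
     = real ((a + g) choose a) * (\<Sum>S\<in>words {..k} m. if count_list (k # S) k = a + g then F (k # S) else 0)"
    by (cases a; cases g) (auto simp: algebra_simps)
  show ?case
    unfolding sum_words_Suc[OF finite_atMost] split1 split2 k0 k1 kk
    by (simp add: lt kk sum_distrib_left ring_distribs del: count_list.simps list.map)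
qed

text \<open>\<open>top_weight\<close> sees only which positions carry \<open>k\<close>. Among the
  \<open>m\<close> other positions the \<open>f\<close> symbols \<open>Suc k\<close> are placed
  freely, and the rest is an arbitrary word in smaller letters. For \<open>f > m\<close> the
  truncated \<open>m - f\<close> is harmless, as the binomial coefficient is 0.\<close>

lemma sum_prefix_two_top:
  fixes F :: "nat list \<Rightarrow> real"
  shows "(\<Sum>P\<in>words {..Suc k} (m + j). if count_list P k = j \<and> count_list P (Suc k) = f then top_weight k \<delta> P * F (filter (\<lambda>v. v < k) P) else 0)
    = real (m choose f) * top_coeff k \<delta> m j * (\<Sum>os\<in>words {..<k} (m - f). F os)"
proof (induction "m + j" arbitrary: m j f \<delta> F)
  case 0
  then have "m = 0" "j = 0" by auto
  then show ?case unfolding words_0 by (cases f) auto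
next
  case (Suc b)
  have split1: "(\<Sum>x\<in>{..Suc k}. H x) = H k + H (Suc k) + (\<Sum>x<k. H x)" for H :: "nat \<Rightarrow> real"
    by (simp add: atMost_Suc_insert)
  let ?s = "\<lambda>\<delta> j f F. (\<Sum>P\<in>words {..Suc k} b. if count_list P k = j \<and> count_list P (Suc k) = f then top_weight k \<delta> P * F (filter (\<lambda>v. v < k) P) else (0::real))"
  have z: "?s \<delta> j f F = 0" if "j > b" for \<delta> j f F
  proof (rule sum.neutral, intro ballI)
    fix P assume "P \<in> words {..Suc k} b"
    then have "count_list P k \<le> b" using count_le_length[of P k] by (simp add: words_def)
    then show "(if count_list P k = j \<and> count_list P (Suc k) = f then top_weight k \<delta> P * F (filter (\<lambda>v. v < k) P) else 0) = (0::real)"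
      using that by auto
  qed
  have A: "(\<Sum>P\<in>words {..Suc k} b. if count_list (k # P) k = j \<and> count_list (k # P) (Suc k) = f then top_weight k \<delta> (k # P) * F (filter (\<lambda>v. v < k) (k # P)) else 0)
     = (if j = 0 then 0 else letter_weight k \<delta> * ?s \<delta> (j - 1) f F)"
    by (cases j) (auto simp: sum_distrib_left intro!: sum.cong)
  have B: "(\<Sum>P\<in>words {..Suc k} b. if count_list (Suc k # P) k = j \<and> count_list (Suc k # P) (Suc k) = f then top_weight k \<delta> (Suc k # P) * F (filter (\<lambda>v. v < k) (Suc k # P)) else 0)
     = (if f = 0 then 0 else ?s (\<delta> + 1) j (f - 1) F)"
    by (cases f) (auto intro!: sum.cong)
  have C: "(\<Sum>P\<in>words {..Suc k} b. if count_list (x # P) k = j \<and> count_list (x # P) (Suc k) = f then top_weight k \<delta> (x # P) * F (filter (\<lambda>v. v < k) (x # P)) else 0)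
     = ?s (\<delta> + 1) j f (\<lambda>os. F (x # os))" if "x < k" for x
    using that by (auto intro!: sum.cong)
  have D: "(\<Sum>P\<in>words {..Suc k} (Suc b). if count_list P k = j \<and> count_list P (Suc k) = f then top_weight k \<delta> P * F (filter (\<lambda>v. v < k) P) else 0)
     = (if j = 0 then 0 else letter_weight k \<delta> * ?s \<delta> (j - 1) f F) + (if f = 0 then 0 else ?s (\<delta> + 1) j (f - 1) F)
       + (\<Sum>x<k. ?s (\<delta> + 1) j f (\<lambda>os. F (x # os)))"
    unfolding sum_words_Suc[OF finite_atMost] split1 A B using C by simp
  have E: "(if j = 0 then 0 else letter_weight k \<delta> * ?s \<delta> (j - 1) f F)
     = (if j = 0 then 0 else letter_weight k \<delta> * (real (m choose f) * top_coeff k \<delta> m (j - 1) * (\<Sum>os\<in>words {..<k} (m - f). F os)))"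
  proof (cases j)
    case (Suc j')
    then have "b = m + j'" using Suc.hyps(2) by simp
    with Suc.hyps(1)[OF this] Suc show ?thesis by simp
  qed simp
  have G: "(if f = 0 then 0 else ?s (\<delta> + 1) j (f - 1) F) + (\<Sum>x<k. ?s (\<delta> + 1) j f (\<lambda>os. F (x # os)))
     = (if m = 0 then 0 else real (m choose f) * top_coeff k (\<delta> + 1) (m - 1) j * (\<Sum>os\<in>words {..<k} (m - f). F os))"
  proof (cases m)
    case 0
    then have "j > b" using Suc.hyps(2) by simp
    then have "(\<Sum>x<k. ?s (\<delta> + 1) j f (\<lambda>os. F (x # os))) = 0" "?s (\<delta> + 1) j (f - 1) F = 0"
      using z[where j = j and \<delta> = "\<delta> + 1" and f = f and F = "\<lambda>os. F (x # os)" for x] z[where j = j and \<delta> = "\<delta> + 1" and f = "f - 1" and F = F] by auto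
    then show ?thesis using 0 by simp
  next
    case (Suc m')
    then have b: "b = m' + j" using Suc.hyps(2) by simp
    have ih: "?s \<delta> j f F = real (m' choose f) * top_coeff k \<delta> m' j * (\<Sum>os\<in>words {..<k} (m' - f). F os)" for \<delta> f F
      using Suc.hyps(1)[OF b, of f \<delta> F] b by simp
    have "(\<Sum>x<k. ?s (\<delta> + 1) j f (\<lambda>os. F (x # os))) = real (m' choose f) * top_coeff k (\<delta> + 1) m' j * (\<Sum>x<k. \<Sum>os\<in>words {..<k} (m' - f). F (x # os))"
      unfolding ih[where \<delta> = "\<delta> + 1" and f = f and F = "\<lambda>os. F (x # os)" for x] by (simp add: sum_distrib_left)
    also have "\<dots> = (if f \<le> m' then real (m' choose f) * top_coeff k (\<delta> + 1) m' j * (\<Sum>os\<in>words {..<k} (m - f). F os) else 0)"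
      using Suc sum_words_Suc[where A = "{..<k}" and n = "m' - f" and F = F] by (simp add: Suc_diff_le)
    finally have 1: "(\<Sum>x<k. ?s (\<delta> + 1) j f (\<lambda>os. F (x # os))) = \<dots>" .
    show ?thesis
    proof (cases f)
      case 0
      then show ?thesis unfolding 1 using Suc by simp
    next
      case (Suc f')
      then show ?thesis unfolding 1 unfolding ih using \<open>m = Suc m'\<close>
        by (auto simp: ring_distribs binomial_eq_0)
    qed
  qed
  have "top_coeff k \<delta> m j = (if j = 0 then 0 else letter_weight k \<delta> * top_coeff k \<delta> m (j - 1)) + (if m = 0 then 0 else top_coeff k (\<delta> + 1) (m - 1) j)"
    using Suc.hyps(2) by (cases m; cases j) auto
  then show ?case
    unfolding Suc.hyps(2)[symmetric] D add.assoc G E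
    by (cases "m = 0"; cases "j = 0") (simp_all add: ring_distribs)
qed

lemma sum_prefix_top:
  fixes F :: "nat list \<Rightarrow> real"
  shows "(\<Sum>P\<in>words {..k} h. if count_list P k = d then F (filter (\<lambda>v. v < k) P) else 0)
    = real (h choose d) * (\<Sum>os\<in>words {..<k} (h - d). F os)"
proof (induction h arbitrary: d F)
  case 0
  show ?case unfolding words_0 by (cases d) auto
next
  case (Suc h)
  have split2: "(\<Sum>x\<in>{..k}. H x) = H k + (\<Sum>x<k. H x)" for H :: "nat \<Rightarrow> real"
    by (simp add: lessThan_Suc_atMost[symmetric])
  let ?s = "\<lambda>d F. (\<Sum>P\<in>words {..k} h. if count_list P k = d then F (filter (\<lambda>v. v < k) P) else (0::real))"
  have A: "(\<Sum>P\<in>words {..k} h. if count_list (k # P) k = d then F (filter (\<lambda>v. v < k) (k # P)) else 0)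
     = (if d = 0 then 0 else ?s (d - 1) F)"
    by (cases d) (auto intro!: sum.cong)
  have C: "(\<Sum>P\<in>words {..k} h. if count_list (x # P) k = d then F (filter (\<lambda>v. v < k) (x # P)) else 0)
     = ?s d (\<lambda>os. F (x # os))" if "x < k" for x
    using that by (auto intro!: sum.cong)
  have "(\<Sum>P\<in>words {..k} (Suc h). if count_list P k = d then F (filter (\<lambda>v. v < k) P) else 0)
     = (if d = 0 then 0 else ?s (d - 1) F) + (\<Sum>x<k. ?s d (\<lambda>os. F (x # os)))"
    unfolding sum_words_Suc[OF finite_atMost] split2 A using C by simp
  also have "(\<Sum>x<k. ?s d (\<lambda>os. F (x # os))) = real (h choose d) * (\<Sum>x<k. \<Sum>os\<in>words {..<k} (h - d). F (x # os))"
    unfolding Suc.IH[of d "\<lambda>os. F (x # os)" for x] by (simp add: sum_distrib_left)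
  also have "\<dots> = (if d \<le> h then real (h choose d) * (\<Sum>os\<in>words {..<k} (Suc h - d). F os) else 0)"
    using sum_words_Suc[where A = "{..<k}" and n = "h - d" and F = F] by (simp add: Suc_diff_le)
  finally show ?case unfolding Suc.IH by (cases d) (auto simp: ring_distribs binomial_eq_0)
qed

text \<open>In \<open>S\<close> the symbol $k$ has weight 1 and stands for the letters $\ge k$ that are already removed; the
  prefix \<open>os\<close> occupies as many positions as there are such letters.\<close>

definition Phi :: "nat \<Rightarrow> nat \<Rightarrow> nat \<Rightarrow> real" where
  "Phi k h n = (\<Sum>os\<in>words {..<k} h. \<Sum>S\<in>words {..k} n.
     if count_list S k = h then word_weight k (start_offset (os @ S)) (os @ S) else 0)"

text \<open>In this order: the number of letters \<open>k\<close> in the prefix, in the next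
  \<open>b\<close> positions, in the remainder, and the number of placeholders in those
  \<open>b\<close> positions. The bounds by \<open>h\<close> keep the subtractions
  \<open>h - d\<close> and \<open>h - f\<close> exact.\<close>

definition peel_index :: "nat \<Rightarrow> nat \<Rightarrow> (nat \<times> nat \<times> nat \<times> nat) set" where
  "peel_index h b = {(d, j, e', f). d \<le> h \<and> f \<le> h \<and> d + j + e' = b}"

lemma finite_peel_index [simp]: "finite (peel_index h b)"
  by (rule finite_subset[of _ "{..h} \<times> {..b} \<times> {..b} \<times> {..h}"]) (auto simp: peel_index_def)

definition peel_coeff :: "nat \<Rightarrow> nat \<Rightarrow> nat \<times> nat \<times> nat \<times> nat \<Rightarrow> real" where
  "peel_coeff k h = (\<lambda>(d, j, e', f). u k ^ d * real (h choose d) * (real ((d + e') choose f) * top_coeff k (- int d) (d + e') j)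
      * (e k ^ e' * real ((e' + (h - f)) choose e')))"

text \<open>Only the actual tuple of counts, \<open>a\<close>, can give a nonzero term on the right.
  If it lies outside the index set or has the wrong totals, both sides are 0.\<close>

lemma Phi_indicator:
  assumes P1: "P1 \<in> words {..k} h" and P2: "P2 \<in> words {..Suc k} b" and S: "S \<in> words {..Suc k} m"
  shows "(if count_list (P2 @ S) (Suc k) = h \<and> count_list P1 k + count_list (P2 @ S) k = b
        then word_weight (Suc k) (start_offset (P1 @ P2 @ S)) (P1 @ P2 @ S) else 0)
   = (\<Sum>(d, j, e', f)\<in>peel_index h b.
       if count_list P1 k = d then
         if count_list P2 k = j \<and> count_list P2 (Suc k) = f then
           top_weight k (- int d) P2 *
           (if count_list S k = e' \<and> count_list S (Suc k) = h - f then
             u k ^ d * e k ^ e' *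
              word_weight k (start_offset ((filter (\<lambda>v. v < k) P1 @ filter (\<lambda>v. v < k) P2) @ map (min k) S))
                 ((filter (\<lambda>v. v < k) P1 @ filter (\<lambda>v. v < k) P2) @ map (min k) S)
           else 0) else 0 else 0)" (is "?L = (\<Sum>(d, j, e', f)\<in>_. ?T d j e' f)")
proof -
  define a where "a = (count_list P1 k, count_list P2 k, count_list S k, count_list P2 (Suc k))"
  have lh: "count_list P1 k \<le> h" using P1 count_le_length[of P1 k] by (auto simp: words_def)
  have z: "?T d j e' f = 0" if "(d, j, e', f) \<noteq> a" for d j e' f
    using that unfolding a_def by auto
  have "(\<Sum>(d, j, e', f)\<in>peel_index h b. ?T d j e' f) = (\<Sum>(d, j, e', f)\<in>peel_index h b \<inter> {a}. ?T d j e' f)"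
    by (rule sum.mono_neutral_right) (use z in \<open>auto simp: split_beta\<close>)
  also have "\<dots> = ?L"
  proof (cases "count_list (P2 @ S) (Suc k) = h \<and> count_list P1 k + count_list (P2 @ S) k = b")
    case True
    then have "peel_index h b \<inter> {a} = {a}" using lh unfolding a_def peel_index_def by auto
    moreover have "word_weight (Suc k) (start_offset (P1 @ P2 @ S)) (P1 @ P2 @ S) = u k ^ count_list P1 k * top_weight k (- int (count_list P1 k)) P2
      * e k ^ count_list S k * word_weight k (start_offset ((filter (\<lambda>v. v < k) P1 @ filter (\<lambda>v. v < k) P2) @ map (min k) S))
                 ((filter (\<lambda>v. v < k) P1 @ filter (\<lambda>v. v < k) P2) @ map (min k) S)"
      using True P1 P2 S by (intro word_weight_split) (auto simp: words_def)
    ultimately show ?thesis using True unfolding a_def by auto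
  next
    case False
    show ?thesis
    proof (cases "a \<in> peel_index h b")
      case True
      then have "peel_index h b \<inter> {a} = {a}" by auto
      moreover have "count_list S (Suc k) \<noteq> h - count_list P2 (Suc k)"
        using True False unfolding a_def peel_index_def by auto
      ultimately show ?thesis using False unfolding a_def by auto
    next
      case F: False
      then have "peel_index h b \<inter> {a} = {}" by auto
      then show ?thesis using False by auto
    qed
  qed
  finally show ?thesis by simp
qed

text \<open>The cut after the first \<open>b\<close> letters of \<open>T\<close>, where
  \<open>b\<close> is the number of letters \<open>k\<close> in the whole word, is the one that
  \<open>word_weight_split\<close> requires. The new prefix collects \<open>h - d\<close> letters
  from the old one and \<open>d + e' - f\<close> from the middle block.\<close>

lemma Phi_Suc:
  "Phi (Suc k) h n = (\<Sum>b\<le>n. \<Sum>i\<in>peel_index h b. peel_coeff k h i * (case i of (d, j, e', f) \<Rightarrow> Phi k (h + e' - f) (n - b)))"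
proof -
  let ?o = "filter (\<lambda>v::nat. v < k)"
  define \<Psi> where "\<Psi> W = word_weight k (start_offset W) W" for W
  have "Phi (Suc k) h n = (\<Sum>P1\<in>words {..k} h. \<Sum>T\<in>words {..Suc k} n.
     if count_list T (Suc k) = h then word_weight (Suc k) (start_offset (P1 @ T)) (P1 @ T) else 0)"
    unfolding Phi_def lessThan_Suc_atMost ..
  also have "\<dots> = (\<Sum>P1\<in>words {..k} h. \<Sum>T\<in>words {..Suc k} n. \<Sum>b\<le>n.
     if count_list T (Suc k) = h \<and> count_list P1 k + count_list T k = b then word_weight (Suc k) (start_offset (P1 @ T)) (P1 @ T) else 0)"
  proof (intro sum.cong refl)
    fix P1 T assume *: "P1 \<in> words {..k} h" "T \<in> words {..Suc k} n"
    have le: "count_list P1 k + count_list T k \<le> n" if "count_list T (Suc k) = h"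
      using * that length_split_top[of T k] count_le_length[of P1 k] by (auto simp: words_def)
    show "(if count_list T (Suc k) = h then word_weight (Suc k) (start_offset (P1 @ T)) (P1 @ T) else 0) =
      (\<Sum>b\<le>n. if count_list T (Suc k) = h \<and> count_list P1 k + count_list T k = b then word_weight (Suc k) (start_offset (P1 @ T)) (P1 @ T) else 0)"
      using le by (cases "count_list T (Suc k) = h") (auto simp: sum.delta)
  qed
  also have "\<dots> = (\<Sum>b\<le>n. \<Sum>P1\<in>words {..k} h. \<Sum>T\<in>words {..Suc k} n.
     if count_list T (Suc k) = h \<and> count_list P1 k + count_list T k = b then word_weight (Suc k) (start_offset (P1 @ T)) (P1 @ T) else 0)"
    by (simp only: sum.swap[of _ "{..n}"])
  also have "\<dots> = (\<Sum>b\<le>n. \<Sum>i\<in>peel_index h b. peel_coeff k h i * (case i of (d, j, e', f) \<Rightarrow> Phi k (h + e' - f) (n - b)))"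
  proof (rule sum.cong[OF refl])
    fix b assume "b \<in> {..n}"
    then have n: "n = b + (n - b)" by simp
    define m where "m = n - b"
    let ?T = "\<lambda>P1 P2 S. \<lambda>(d, j, e', f). 
       if count_list P1 k = d then
         if count_list P2 k = j \<and> count_list P2 (Suc k) = f then
           top_weight k (- int d) P2 *
           (if count_list S k = e' \<and> count_list S (Suc k) = h - f then
             u k ^ d * e k ^ e' * \<Psi> ((?o P1 @ ?o P2) @ map (min k) S)
           else 0) else 0 else 0"
    have "(\<Sum>P1\<in>words {..k} h. \<Sum>T\<in>words {..Suc k} n.
     if count_list T (Suc k) = h \<and> count_list P1 k + count_list T k = b then word_weight (Suc k) (start_offset (P1 @ T)) (P1 @ T) else 0)
     = (\<Sum>P1\<in>words {..k} h. \<Sum>P2\<in>words {..Suc k} b. \<Sum>S\<in>words {..Suc k} m. \<Sum>i\<in>peel_index h b. ?T P1 P2 S i)"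
      unfolding m_def by (subst n, subst sum_words_append) (auto simp only: finite_atMost Phi_indicator \<Psi>_def intro!: sum.cong)
    also have "\<dots> = (\<Sum>i\<in>peel_index h b. \<Sum>P1\<in>words {..k} h. \<Sum>P2\<in>words {..Suc k} b. \<Sum>S\<in>words {..Suc k} m. ?T P1 P2 S i)"
      by (simp only: sum.swap[of _ "peel_index h b"])
    also have "\<dots> = (\<Sum>i\<in>peel_index h b. peel_coeff k h i * (case i of (d, j, e', f) \<Rightarrow> Phi k (h + e' - f) m))"
    proof (rule sum.cong[OF refl])
      fix i assume i: "i \<in> peel_index h b"
      obtain d j e' f where ide: "i = (d, j, e', f)" by (cases i)
      from i have d: "d \<le> h" and f: "f \<le> h" and b: "b = (d + e') + j" by (auto simp: ide peel_index_def)
      define G where "G os = (\<Sum>S\<in>words {..k} m. if count_list S k = h + e' - f then \<Psi> (os @ S) else 0)" for os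
      have s3: "(\<Sum>S\<in>words {..Suc k} m. if count_list S k = e' \<and> count_list S (Suc k) = h - f then
             u k ^ d * e k ^ e' * \<Psi> (os @ map (min k) S) else 0)
            = u k ^ d * e k ^ e' * real ((e' + (h - f)) choose e') * G os" for os
        using sum_suffix_merge_top[where k = k and m = m and a = e' and g = "h - f" and F = "\<lambda>S'. u k ^ d * e k ^ e' * \<Psi> (os @ S')"] f
        by (simp add: add.commute[of h e'] G_def sum_distrib_left if_distrib[of "\<lambda>x. _ * x"] mult_ac cong: if_cong)
      define A where "A = u k ^ d * e k ^ e' * real ((e' + (h - f)) choose e')"
      have s3': "(\<Sum>S\<in>words {..Suc k} m. ?T P1 P2 S i)
          = (if count_list P1 k = d then
         if count_list P2 k = j \<and> count_list P2 (Suc k) = f then top_weight k (- int d) P2 * (A * G (?o P1 @ ?o P2)) else 0 else 0)" for P1 P2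
        unfolding ide using s3[of "?o P1 @ ?o P2"]
          by (cases "count_list P2 k = j"; cases "count_list P2 (Suc k) = f") (simp_all add: A_def sum_distrib_left[symmetric] del: append_assoc)
      have s2: "(\<Sum>P2\<in>words {..Suc k} b. if count_list P2 k = j \<and> count_list P2 (Suc k) = f then top_weight k (- int d) P2 * (A * G (os1 @ ?o P2)) else 0)
         = real ((d + e') choose f) * top_coeff k (- int d) (d + e') j * (\<Sum>os2\<in>words {..<k} (d + e' - f). A * G (os1 @ os2))" for os1
        unfolding b by (rule sum_prefix_two_top[where F = "\<lambda>os2. A * G (os1 @ os2)"])
      have s2': "(\<Sum>P2\<in>words {..Suc k} b. \<Sum>S\<in>words {..Suc k} m. ?T P1 P2 S i)
          = (if count_list P1 k = d then real ((d + e') choose f) * top_coeff k (- int d) (d + e') j * (\<Sum>os2\<in>words {..<k} (d + e' - f). A * G (?o P1 @ os2)) else 0)" for P1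
        unfolding s3' using s2[of "?o P1"] by simp
      have s1: "(\<Sum>P1\<in>words {..k} h. \<Sum>P2\<in>words {..Suc k} b. \<Sum>S\<in>words {..Suc k} m. ?T P1 P2 S i)
         = real (h choose d) * (\<Sum>os1\<in>words {..<k} (h - d). real ((d + e') choose f) * top_coeff k (- int d) (d + e') j * (\<Sum>os2\<in>words {..<k} (d + e' - f). A * G (os1 @ os2)))"
        unfolding s2' by (rule sum_prefix_top[where F = "\<lambda>os1. real ((d + e') choose f) * top_coeff k (- int d) (d + e') j * (\<Sum>os2\<in>words {..<k} (d + e' - f). A * G (os1 @ os2))"])
      also have "\<dots> = peel_coeff k h i * (if f \<le> d + e' then (\<Sum>os1\<in>words {..<k} (h - d). \<Sum>os2\<in>words {..<k} (d + e' - f). G (os1 @ os2)) else 0)"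
        by (cases "f \<le> d + e'") (simp_all add: peel_coeff_def ide A_def sum_distrib_left binomial_eq_0 mult_ac)
      also have "(if f \<le> d + e' then (\<Sum>os1\<in>words {..<k} (h - d). \<Sum>os2\<in>words {..<k} (d + e' - f). G (os1 @ os2)) else 0)
         = (if f \<le> d + e' then (\<Sum>os\<in>words {..<k} (h + e' - f). G os) else 0)"
      proof (cases "f \<le> d + e'")
        case True
        then have "(h - d) + (d + e' - f) = h + e' - f" using d by simp
        then show ?thesis using sum_words_append[where A = "{..<k}" and m = "h - d" and n = "d + e' - f" and F = G] by simp
      qed simp
      also have "(\<Sum>os\<in>words {..<k} (h + e' - f). G os) = Phi k (h + e' - f) m"
        unfolding Phi_def G_def \<Psi>_def ..
      also have "peel_coeff k h i * (if f \<le> d + e' then Phi k (h + e' - f) m else 0) = peel_coeff k h i * (case i of (d, j, e', f) \<Rightarrow> Phi k (h + e' - f) m)"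
        by (simp add: ide peel_coeff_def binomial_eq_0)
      finally show "(\<Sum>P1\<in>words {..k} h. \<Sum>P2\<in>words {..Suc k} b. \<Sum>S\<in>words {..Suc k} m. ?T P1 P2 S i) = peel_coeff k h i * (case i of (d, j, e', f) \<Rightarrow> Phi k (h + e' - f) m)" .
    qed
    finally show "(\<Sum>P1\<in>words {..k} h. \<Sum>T\<in>words {..Suc k} n.
     if count_list T (Suc k) = h \<and> count_list P1 k + count_list T k = b then word_weight (Suc k) (start_offset (P1 @ T)) (P1 @ T) else 0)
     = (\<Sum>i\<in>peel_index h b. peel_coeff k h i * (case i of (d, j, e', f) \<Rightarrow> Phi k (h + e' - f) (n - b)))"
      unfolding m_def .
  qed
  finally show ?thesis .
qed

end

unbundle no vec_syntax
unbundle fps_syntax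

section \<open>Generating functions of weighted words\<close>

definition lin_fps :: "real \<Rightarrow> real fps" where
  "lin_fps c = 1 - fps_const c * fps_X"

lemma lin_fps_nth0 [simp]: "lin_fps c $ 0 = 1" by (simp add: lin_fps_def)

lemma lin_fps_inv [simp]: "lin_fps c * inverse (lin_fps c) = 1" "inverse (lin_fps c) * lin_fps c = 1"
  using inverse_mult_eq_1'[of "lin_fps c"] inverse_mult_eq_1[of "lin_fps c"] by simp_all

lemma fps_const_sum: "fps_const (sum f A) = (\<Sum>x\<in>A. fps_const (f x :: real))"
  by (induction A rule: infinite_finite_induct) (simp_all add: fps_const_add[symmetric] del: fps_const_add)

text \<open>This is the series of \<open>1 / (1 - X) ^ Suc h\<close>. As \<open>X\<close> has no
  constant term, powers beyond \<open>N\<close> do not reach the coefficient \<open>i\<close>, so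
  finite sums can be used throughout.\<close>

lemma fps_negative_binomial:
  fixes X :: "real fps"
  assumes "X $ 0 = 0" "i \<le> N"
  shows "inverse ((1 - X) ^ Suc h) $ i = (\<Sum>j\<le>N. fps_const (real ((h + j) choose j)) * X ^ j) $ i"
proof -
  define Q where "Q h = Abs_fps (\<lambda>j. real ((h + j) choose j))" for h
  have Q: "Q h * (1 - fps_X) ^ Suc h = 1" for h
  proof (induction h)
    case 0
    have "Q 0 = Abs_fps (\<lambda>n. 1)" by (simp add: Q_def)
    then show ?case using fps_inverse_gp'[where ?'a = real] inverse_mult_eq_1'[of "Abs_fps (\<lambda>n. 1) :: real fps"] by simp
  next
    case (Suc h)
    have "Q (Suc h) * (1 - fps_X) = Q h"
    proof (rule fps_ext)
      fix n show "(Q (Suc h) * (1 - fps_X)) $ n = Q h $ n"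
        by (cases n) (auto simp: Q_def algebra_simps)
    qed
    then show ?case using Suc by (simp add: mult.assoc[symmetric])
  qed
  have "(Q h oo X) * (1 - X) ^ Suc h = (Q h * (1 - fps_X) ^ Suc h) oo X"
    using assms by (simp add: fps_compose_mult_distrib fps_compose_power fps_compose_sub_distrib fps_compose_power[symmetric] del: power_Suc)
  then have "(Q h oo X) * (1 - X) ^ Suc h = 1" using Q by simp
  then have "inverse ((1 - X) ^ Suc h) = Q h oo X"
    by (metis fps_inverse_unique mult.commute)
  then have "inverse ((1 - X) ^ Suc h) $ i = (\<Sum>j=0..i. real ((h + j) choose j) * (X ^ j) $ i)"
    by (simp add: fps_compose_nth Q_def)
  also have "\<dots> = (\<Sum>j\<le>N. real ((h + j) choose j) * (X ^ j) $ i)"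
    using assms startsby_zero_power_prefix[OF assms(1)] by (intro sum.mono_neutral_left) auto
  finally show ?thesis by (simp add: fps_sum_nth)
qed

lemma power_mult_cong:
  fixes X a b :: "real fps"
  assumes "X $ 0 = 0" and "\<And>i. i + f \<le> N \<Longrightarrow> a $ i = b $ i" and "i \<le> N"
  shows "(X ^ f * a) $ i = (X ^ f * b) $ i"
  unfolding fps_mult_nth
proof (rule sum.cong[OF refl])
  fix j assume "j \<in> {0..i}"
  then show "(X ^ f) $ j * a $ (i - j) = (X ^ f) $ j * b $ (i - j)"
    using assms startsby_zero_power_prefix[OF assms(1), of f] by (cases "j < f") auto
qed

lemma mult_cong_upto:
  fixes Y a b :: "real fps"
  assumes "\<And>i. i \<le> N \<Longrightarrow> a $ i = b $ i" "i \<le> N"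
  shows "(Y * a) $ i = (Y * b) $ i"
  unfolding fps_mult_nth using assms by (auto intro!: sum.cong)

text \<open>For \<open>f \<le> h\<close> both products are the multinomial coefficient with parts
  \<open>f\<close>, \<open>o'\<close> and \<open>h - f\<close>; otherwise both vanish.\<close>

lemma choose_exchange: "((f + o') choose f) * ((h + o') choose (f + o')) = (h choose f) * ((h + o') choose o')"
proof (cases "f \<le> h")
  case True
  have 1: "real (((f + o') choose f) * ((h + o') choose (f + o'))) = fact (h + o') / (fact f * fact o' * fact (h - f))"
    using True by (simp add: binomial_fact)
  have 2: "real ((h choose f) * ((h + o') choose o')) = fact (h + o') / (fact f * fact o' * fact (h - f))"
    using True by (simp add: binomial_fact)
  show ?thesis using 1 2 by (metis of_nat_eq_iff)
next
  case False then show ?thesis by (simp add: binomial_eq_0 not_le)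
qed

text \<open>For fixed \<open>f\<close>, \<open>choose_exchange\<close> turns the sum over
  \<open>e\<close> into a negative binomial series in \<open>\<theta> * B\<close>; the sum over
  \<open>f\<close> is then the binomial theorem for \<open>(1 + \<theta>) ^ h\<close>. Terms with
  \<open>e > N\<close> have order above \<open>N\<close>, whence the finite range.\<close>

lemma exc_block_sum:
  fixes B \<theta> :: "real fps"
  assumes "\<theta> $ 0 = 0" "i \<le> N"
  shows "(\<Sum>e\<le>N. \<Sum>f\<le>h. fps_const (real (e choose f) * real ((e + h - f) choose e)) * \<theta> ^ e * B ^ (h + e - f)) $ i
    = (B ^ h * (1 + \<theta>) ^ h * inverse ((1 - \<theta> * B) ^ Suc h)) $ i"
proof -
  define X where "X = \<theta> * B"
  have X0: "X $ 0 = 0" using assms by (simp add: X_def)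
  have "(\<Sum>e\<le>N. \<Sum>f\<le>h. fps_const (real (e choose f) * real ((e + h - f) choose e)) * \<theta> ^ e * B ^ (h + e - f))
     = (\<Sum>f\<le>h. \<Sum>e\<le>N. fps_const (real (e choose f) * real ((e + h - f) choose e)) * \<theta> ^ e * B ^ (h + e - f))"
    by (rule sum.swap)
  also have "\<dots> = (\<Sum>f\<le>h. fps_const (real (h choose f)) * B ^ h * (\<theta> ^ f *
      (if f \<le> N then \<Sum>j\<le>N - f. fps_const (real ((h + j) choose j)) * X ^ j else 0)))"
  proof (rule sum.cong[OF refl])
    fix f assume f: "f \<in> {..h}"
    show "(\<Sum>e\<le>N. fps_const (real (e choose f) * real ((e + h - f) choose e)) * \<theta> ^ e * B ^ (h + e - f))
      = fps_const (real (h choose f)) * B ^ h * (\<theta> ^ f * (if f \<le> N then \<Sum>j\<le>N - f. fps_const (real ((h + j) choose j)) * X ^ j else 0))"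
    proof (cases "f \<le> N")
      case False
      have "(\<Sum>e\<le>N. fps_const (real (e choose f) * real ((e + h - f) choose e)) * \<theta> ^ e * B ^ (h + e - f)) = 0"
        by (rule sum.neutral) (use False in auto)
      then show ?thesis using False by simp
    next
      case True
      have "(\<Sum>e\<le>N. fps_const (real (e choose f) * real ((e + h - f) choose e)) * \<theta> ^ e * B ^ (h + e - f))
        = (\<Sum>e\<in>{f..N}. fps_const (real (e choose f) * real ((e + h - f) choose e)) * \<theta> ^ e * B ^ (h + e - f))"
        by (rule sum.mono_neutral_right) auto
      also have "\<dots> = (\<Sum>j\<le>N - f. fps_const (real ((f + j) choose f) * real ((h + j) choose (f + j))) * \<theta> ^ (f + j) * B ^ (h + j))"
        by (rule sum.reindex_bij_witness[where i = "\<lambda>j. f + j" and j = "\<lambda>e. e - f"]) (use True f in \<open>auto simp: add.commute\<close>)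
      also have "\<dots> = (\<Sum>j\<le>N - f. fps_const (real (h choose f)) * B ^ h * (\<theta> ^ f * (fps_const (real ((h + j) choose j)) * X ^ j)))"
      proof (rule sum.cong[OF refl])
        fix j
        have "real ((f + j) choose f) * real ((h + j) choose (f + j)) = real (h choose f) * real ((h + j) choose j)"
          using choose_exchange[of f j h] by (metis of_nat_mult)
        then show "fps_const (real ((f + j) choose f) * real ((h + j) choose (f + j))) * \<theta> ^ (f + j) * B ^ (h + j) =
          fps_const (real (h choose f)) * B ^ h * (\<theta> ^ f * (fps_const (real ((h + j) choose j)) * X ^ j))"
          by (simp only: fps_const_mult[symmetric]) (simp add: X_def power_add power_mult_distrib mult_ac)
      qed
      finally show ?thesis using True by (simp add: sum_distrib_left)
    qed
  qed
  also have "\<dots> $ i = (\<Sum>f\<le>h. fps_const (real (h choose f)) * B ^ h * (\<theta> ^ f * inverse ((1 - X) ^ Suc h))) $ i"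
    unfolding fps_sum_nth
  proof (rule sum.cong[OF refl])
    fix f
    show "(fps_const (real (h choose f)) * B ^ h * (\<theta> ^ f * (if f \<le> N then \<Sum>j\<le>N - f. fps_const (real ((h + j) choose j)) * X ^ j else 0))) $ i
      = (fps_const (real (h choose f)) * B ^ h * (\<theta> ^ f * inverse ((1 - X) ^ Suc h))) $ i"
    proof (rule mult_cong_upto[OF _ \<open>i \<le> N\<close>], rule power_mult_cong[OF assms(1)])
      fix i' i assume "i + f \<le> N"
      then show "(if f \<le> N then \<Sum>j\<le>N - f. fps_const (real ((h + j) choose j)) * X ^ j else 0) $ i = inverse ((1 - X) ^ Suc h) $ i"
        using fps_negative_binomial[OF X0, of i "N - f" h] by simp
    qed
  qed
  also have "(\<Sum>f\<le>h. fps_const (real (h choose f)) * B ^ h * (\<theta> ^ f * inverse ((1 - X) ^ Suc h)))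
     = B ^ h * (\<Sum>f\<le>h. of_nat (h choose f) * \<theta> ^ f * 1 ^ (h - f)) * inverse ((1 - X) ^ Suc h)"
    by (simp add: sum_distrib_left sum_distrib_right mult_ac fps_of_nat)
  also have "(\<Sum>f\<le>h. of_nat (h choose f) * \<theta> ^ f * 1 ^ (h - f)) = (1 + \<theta>) ^ h"
    using binomial_ring[of \<theta> 1 h] by (simp add: add.commute)
  finally show ?thesis unfolding X_def .
qed

section \<open>The functional equation and its solution\<close>

context
  fixes u e :: "nat \<Rightarrow> real" and R :: real
begin

abbreviation "top_coeff_uR \<equiv> top_coeff u e R"

definition top_fps :: "nat \<Rightarrow> int \<Rightarrow> nat \<Rightarrow> real fps" where
  "top_fps k \<delta> m = Abs_fps (top_coeff_uR k \<delta> m)"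

lemma top_fps_rec:
  "lin_fps (letter_weight u e R k \<delta>) * top_fps k \<delta> 0 = 1"
  "lin_fps (letter_weight u e R k \<delta>) * top_fps k \<delta> (Suc m) = top_fps k (\<delta> + 1) m"
proof -
  show "lin_fps (letter_weight u e R k \<delta>) * top_fps k \<delta> 0 = 1"
  proof (rule fps_ext)
    fix n show "(lin_fps (letter_weight u e R k \<delta>) * top_fps k \<delta> 0) $ n = 1 $ n"
      by (cases n) (simp_all add: lin_fps_def top_fps_def algebra_simps mult.assoc)
  qed
  show "lin_fps (letter_weight u e R k \<delta>) * top_fps k \<delta> (Suc m) = top_fps k (\<delta> + 1) m"
  proof (rule fps_ext)
    fix n show "(lin_fps (letter_weight u e R k \<delta>) * top_fps k \<delta> (Suc m)) $ n = top_fps k (\<delta> + 1) m $ n"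
      by (cases n) (simp_all add: lin_fps_def top_fps_def algebra_simps mult.assoc)
  qed
qed

lemma top_fps_rec':
  "top_fps k \<delta> 0 = inverse (lin_fps (letter_weight u e R k \<delta>))"
  "top_fps k \<delta> (Suc m) = inverse (lin_fps (letter_weight u e R k \<delta>)) * top_fps k (\<delta> + 1) m"
proof -
  show "top_fps k \<delta> 0 = inverse (lin_fps (letter_weight u e R k \<delta>))"
    using top_fps_rec(1)[of k \<delta>] by (metis fps_inverse_unique)
  have "inverse (lin_fps (letter_weight u e R k \<delta>)) * (lin_fps (letter_weight u e R k \<delta>) * top_fps k \<delta> (Suc m)) = inverse (lin_fps (letter_weight u e R k \<delta>)) * top_fps k (\<delta> + 1) m"
    unfolding top_fps_rec(2) ..
  then show "top_fps k \<delta> (Suc m) = inverse (lin_fps (letter_weight u e R k \<delta>)) * top_fps k (\<delta> + 1) m"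
    by (simp add: mult.assoc[symmetric])
qed

lemma top_fps_pos: "\<delta> > 0 \<Longrightarrow> top_fps k \<delta> m = inverse (lin_fps (e k)) ^ Suc m"
  by (induction m arbitrary: \<delta>) (simp_all add: top_fps_rec' letter_weight_def)

lemma top_fps_zero: "top_fps k 0 m = inverse (lin_fps (R * u k)) * inverse (lin_fps (e k)) ^ m"
  by (cases m) (simp_all add: top_fps_rec' top_fps_pos letter_weight_def)

text \<open>The letters \<open>k\<close> are distributed over the \<open>d + m + 1\<close> gaps
  around the other letters, and each gap contributes a geometric series. Counted from 0, the gap
  \<open>i\<close> has offset \<open>i - d\<close>: there are \<open>d\<close> gaps before the rank,
  one at it and \<open>m\<close> after it.\<close>

lemma top_fps_neg: "top_fps k (- int d) (d + m) = inverse (lin_fps (u k)) ^ d * inverse (lin_fps (R * u k)) * inverse (lin_fps (e k)) ^ m"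
proof (induction d)
  case 0 then show ?case by (simp add: top_fps_zero)
next
  case (Suc d)
  have "top_fps k (- int (Suc d)) (Suc d + m) = inverse (lin_fps (u k)) * top_fps k (- int d) (d + m)"
    by (simp add: top_fps_rec' letter_weight_def)
  then show ?case by (simp add: Suc mult_ac)
qed

definition Phi_fps :: "nat \<Rightarrow> nat \<Rightarrow> real fps" where
  "Phi_fps k h = Abs_fps (Phi u e R k h)"

lemma Phi_fps_Suc_nth:
  "Phi_fps (Suc k) h $ n = (\<Sum>d\<le>h. \<Sum>f\<le>h. \<Sum>e'\<le>n.
     fps_const (u k ^ d * real (h choose d) * real ((d + e') choose f) * e k ^ e' * real ((e' + (h - f)) choose e'))
       * fps_X ^ (d + e') * top_fps k (- int d) (d + e') * Phi_fps k (h + e' - f)) $ n"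
proof -
  let ?c = "\<lambda>d e' f. u k ^ d * real (h choose d) * real ((d + e') choose f) * e k ^ e' * real ((e' + (h - f)) choose e')"
  have nth: "(fps_const (?c d e' f) * fps_X ^ (d + e') * top_fps k (- int d) (d + e') * Phi_fps k (h + e' - f)) $ n
     = (\<Sum>b\<le>n. if d + e' \<le> b then ?c d e' f * top_coeff_uR k (- int d) (d + e') (b - (d + e')) * Phi u e R k (h + e' - f) (n - b) else 0)" for d e' f
  proof -
    have "(fps_const (?c d e' f) * fps_X ^ (d + e') * top_fps k (- int d) (d + e')) $ b
       = (if d + e' \<le> b then ?c d e' f * top_coeff_uR k (- int d) (d + e') (b - (d + e')) else 0)" for b
      by (simp add: mult.assoc fps_X_power_mult_nth top_fps_def)
    then show ?thesis
      unfolding fps_mult_nth[of "fps_const (?c d e' f) * fps_X ^ (d + e') * top_fps k (- int d) (d + e')"]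
      by (auto simp: Phi_fps_def atLeast0AtMost intro!: sum.cong)
  qed
  have "Phi_fps (Suc k) h $ n = (\<Sum>b\<le>n. \<Sum>i\<in>peel_index h b. peel_coeff u e R k h i * (case i of (d, j, e', f) \<Rightarrow> Phi u e R k (h + e' - f) (n - b)))"
    by (simp add: Phi_fps_def Phi_Suc)
  also have "\<dots> = (\<Sum>b\<le>n. \<Sum>d\<le>h. \<Sum>f\<le>h. \<Sum>e'\<le>n. if d + e' \<le> b then ?c d e' f * top_coeff_uR k (- int d) (d + e') (b - (d + e')) * Phi u e R k (h + e' - f) (n - b) else 0)"
  proof (rule sum.cong[OF refl])
    fix b assume b: "b \<in> {..n}"
    let ?g = "\<lambda>(d, f, e'). ?c d e' f * top_coeff_uR k (- int d) (d + e') (b - (d + e')) * Phi u e R k (h + e' - f) (n - b)"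
    have "(\<Sum>i\<in>peel_index h b. peel_coeff u e R k h i * (case i of (d, j, e', f) \<Rightarrow> Phi u e R k (h + e' - f) (n - b)))
      = (\<Sum>x\<in>{x \<in> {..h} \<times> {..h} \<times> {..n}. (case x of (d, f, e') \<Rightarrow> d + e' \<le> b)}. ?g x)"
      by (rule sum.reindex_bij_witness[where i = "\<lambda>(d, f, e'). (d, b - (d + e'), e', f)" and j = "\<lambda>(d, j, e', f). (d, f, e')"])
         (use b in \<open>auto simp: peel_index_def peel_coeff_def mult_ac\<close>)
    also have "\<dots> = (\<Sum>x\<in>{..h} \<times> {..h} \<times> {..n}. if (case x of (d, f, e') \<Rightarrow> d + e' \<le> b) then ?g x else 0)"
      by (rule sum.inter_filter) auto
    also have "\<dots> = (\<Sum>d\<le>h. \<Sum>f\<le>h. \<Sum>e'\<le>n. if d + e' \<le> b then ?g (d, f, e') else 0)"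
      unfolding sum.cartesian_product by (rule sum.cong) auto
    finally show "(\<Sum>i\<in>peel_index h b. peel_coeff u e R k h i * (case i of (d, j, e', f) \<Rightarrow> Phi u e R k (h + e' - f) (n - b)))
      = (\<Sum>d\<le>h. \<Sum>f\<le>h. \<Sum>e'\<le>n. if d + e' \<le> b then ?c d e' f * top_coeff_uR k (- int d) (d + e') (b - (d + e')) * Phi u e R k (h + e' - f) (n - b) else 0)"
      by (simp only: prod.case)
  qed
  also have "\<dots> = (\<Sum>d\<le>h. \<Sum>f\<le>h. \<Sum>e'\<le>n. \<Sum>b\<le>n. if d + e' \<le> b then ?c d e' f * top_coeff_uR k (- int d) (d + e') (b - (d + e')) * Phi u e R k (h + e' - f) (n - b) else 0)"
    by (rule trans[OF sum.swap], rule sum.cong[OF refl], rule trans[OF sum.swap], rule sum.cong[OF refl], rule sum.swap)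
  finally show ?thesis unfolding nth[symmetric] by (simp only: fps_sum_nth)
qed

text \<open>The recursion changes \<open>h\<close>, but it preserves a geometric dependence on
  \<open>h\<close>, and this makes it solvable. Vandermonde's convolution splits the
  \<open>f\<close> placeholders into \<open>f1\<close> and \<open>f2\<close>, belonging to the
  \<open>d\<close> and the \<open>e'\<close> positions. The sums over \<open>e'\<close> and
  \<open>f2\<close> are \<open>exc_block_sum\<close> with \<open>h - f1\<close> for
  \<open>h\<close>; those over \<open>f1\<close> and \<open>d\<close> are binomial.\<close>

lemma Phi_fps_step:
  fixes k
  defines "\<theta> \<equiv> fps_const (e k) * fps_X * inverse (lin_fps (e k))"
    and "\<theta>1 \<equiv> fps_const (u k) * fps_X * inverse (lin_fps (u k))"
  assumes IH: "\<And>h. Phi_fps k h = A * B ^ h"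
  shows "Phi_fps (Suc k) h = A * inverse (lin_fps (R * u k)) * inverse (1 - \<theta> * B)
     * (B * (1 + \<theta>) * inverse (1 - \<theta> * B) + \<theta>1 * (1 + B * (1 + \<theta>) * inverse (1 - \<theta> * B))) ^ h"
proof (rule fps_ext)
  fix n
  define G0 where "G0 = inverse (lin_fps (R * u k))"
  define V where "V = inverse (1 - \<theta> * B)"
  define B2 where "B2 = B * (1 + \<theta>) * V"
  have t0: "\<theta> $ 0 = 0" by (simp add: \<theta>_def)
  \<comment> \<open>A truncation of \<open>V * B2 ^ h1\<close>; only coefficients up to
    \<open>n\<close> are compared.\<close>
  define Mx where "Mx h1 = (\<Sum>e'\<le>n. \<Sum>f\<le>h1. fps_const (real (e' choose f) * real ((e' + h1 - f) choose e')) * \<theta> ^ e' * B ^ (h1 + e' - f))" for h1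
  have Mx: "Mx h1 $ i = (V * B2 ^ h1) $ i" if "i \<le> n" for h1 i
  proof -
    have "Mx h1 $ i = (B ^ h1 * (1 + \<theta>) ^ h1 * inverse ((1 - \<theta> * B) ^ Suc h1)) $ i"
      unfolding Mx_def by (rule exc_block_sum[OF t0 that])
    also have "inverse ((1 - \<theta> * B) ^ Suc h1) = V ^ Suc h1"
      unfolding V_def by (rule fps_inverse_power)
    finally show ?thesis by (simp add: B2_def power_mult_distrib mult_ac)
  qed
  have "Phi_fps (Suc k) h $ n = (\<Sum>d\<le>h. \<Sum>f\<le>h. \<Sum>e'\<le>n.
     fps_const (real (h choose d) * real ((d + e') choose f) * real ((e' + (h - f)) choose e')) * \<theta>1 ^ d * \<theta> ^ e' * (A * G0) * B ^ (h + e' - f)) $ n"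
    unfolding Phi_fps_Suc_nth top_fps_neg IH
    by (intro arg_cong[where f = "\<lambda>x. x $ n"] sum.cong refl)
       (simp add: \<theta>_def \<theta>1_def G0_def power_mult_distrib power_add mult_ac fps_const_mult[symmetric] fps_const_power[symmetric] del: fps_const_mult fps_const_power)
  also have "(\<Sum>d\<le>h. \<Sum>f\<le>h. \<Sum>e'\<le>n.
     fps_const (real (h choose d) * real ((d + e') choose f) * real ((e' + (h - f)) choose e')) * \<theta>1 ^ d * \<theta> ^ e' * (A * G0) * B ^ (h + e' - f))
     = (\<Sum>d\<le>h. (\<Sum>f1\<le>d. (fps_const (real (h choose d) * real (d choose f1)) * \<theta>1 ^ d * (A * G0)) * Mx (h - f1)))"
  proof (rule sum.cong[OF refl])
    fix d assume d: "d \<in> {..h}"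
    have "(\<Sum>f\<le>h. fps_const (real (h choose d) * real ((d + e') choose f) * real ((e' + (h - f)) choose e')) * \<theta>1 ^ d * \<theta> ^ e' * (A * G0) * B ^ (h + e' - f))
      = (\<Sum>f1\<le>d. \<Sum>f2\<le>h - f1. (fps_const (real (h choose d) * real (d choose f1)) * \<theta>1 ^ d * (A * G0)) * (fps_const (real (e' choose f2) * real ((e' + (h - f1) - f2) choose e')) * \<theta> ^ e' * B ^ ((h - f1) + e' - f2)))" for e'
    proof -
      define C where "C f = fps_const (real ((e' + (h - f)) choose e')) * B ^ (h + e' - f)" for f
      have v: "real ((d + e') choose f) = (\<Sum>f1\<le>f. real (d choose f1) * real (e' choose (f - f1)))" for f
        using vandermonde[of d e' f] by (metis (mono_tags, lifting) of_nat_mult of_nat_sum sum.cong)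
      have "(\<Sum>f\<le>h. fps_const (real ((d + e') choose f)) * C f) = (\<Sum>f\<le>h. \<Sum>f1\<le>f. fps_const (real (d choose f1) * real (e' choose (f - f1))) * C f)"
        unfolding v by (simp add: fps_const_sum sum_distrib_right del: fps_const_mult)
      also have "\<dots> = (\<Sum>f1\<le>h. \<Sum>f2\<le>h - f1. fps_const (real (d choose f1) * real (e' choose f2)) * C (f1 + f2))"
        unfolding sum.Sigma[OF finite_atMost ballI, OF finite_atMost]
        by (rule sum.reindex_bij_witness[where i = "\<lambda>(f1, f2). (f1 + f2, f1)" and j = "\<lambda>(f, f1). (f1, f - f1)"]) auto
      also have "\<dots> = (\<Sum>f1\<le>d. \<Sum>f2\<le>h - f1. fps_const (real (d choose f1) * real (e' choose f2)) * C (f1 + f2))"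
      proof (rule sum.mono_neutral_right)
        show "\<forall>f1\<in>{..h} - {..d}. (\<Sum>f2\<le>h - f1. fps_const (real (d choose f1) * real (e' choose f2)) * C (f1 + f2)) = 0"
          by (simp add: binomial_eq_0 not_le)
      qed (use d in auto)
      finally have eq: "(\<Sum>f\<le>h. fps_const (real ((d + e') choose f)) * C f) = \<dots>" .
      have "(\<Sum>f\<le>h. fps_const (real (h choose d) * real ((d + e') choose f) * real ((e' + (h - f)) choose e')) * \<theta>1 ^ d * \<theta> ^ e' * (A * G0) * B ^ (h + e' - f))
        = (fps_const (real (h choose d)) * \<theta>1 ^ d * (A * G0) * \<theta> ^ e') * (\<Sum>f\<le>h. fps_const (real ((d + e') choose f)) * C f)"
        unfolding sum_distrib_left C_def
        by (intro sum.cong refl) (simp add: fps_const_mult[symmetric] mult_ac del: fps_const_mult)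
      also have "\<dots> = (\<Sum>f1\<le>d. \<Sum>f2\<le>h - f1. (fps_const (real (h choose d) * real (d choose f1)) * \<theta>1 ^ d * (A * G0)) * (fps_const (real (e' choose f2) * real ((e' + (h - f1) - f2) choose e')) * \<theta> ^ e' * B ^ ((h - f1) + e' - f2)))"
        unfolding eq unfolding sum_distrib_left
      proof (intro sum.cong refl)
        fix f1 f2 assume "f1 \<in> {..d}" "f2 \<in> {..h - f1}"
        then have "h + e' - (f1 + f2) = (h - f1) + e' - f2" "e' + (h - (f1 + f2)) = e' + (h - f1) - f2" using d by auto
        then show "fps_const (real (h choose d)) * \<theta>1 ^ d * (A * G0) * \<theta> ^ e' * (fps_const (real (d choose f1) * real (e' choose f2)) * C (f1 + f2))
          = (fps_const (real (h choose d) * real (d choose f1)) * \<theta>1 ^ d * (A * G0)) * (fps_const (real (e' choose f2) * real ((e' + (h - f1) - f2) choose e')) * \<theta> ^ e' * B ^ ((h - f1) + e' - f2))"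
          by (simp add: C_def fps_const_mult[symmetric] mult_ac del: fps_const_mult)
      qed
      finally show ?thesis .
    qed
    then have "(\<Sum>f\<le>h. \<Sum>e'\<le>n. fps_const (real (h choose d) * real ((d + e') choose f) * real ((e' + (h - f)) choose e')) * \<theta>1 ^ d * \<theta> ^ e' * (A * G0) * B ^ (h + e' - f))
      = (\<Sum>e'\<le>n. \<Sum>f1\<le>d. \<Sum>f2\<le>h - f1. (fps_const (real (h choose d) * real (d choose f1)) * \<theta>1 ^ d * (A * G0)) * (fps_const (real (e' choose f2) * real ((e' + (h - f1) - f2) choose e')) * \<theta> ^ e' * B ^ ((h - f1) + e' - f2)))"
      by (subst sum.swap) simp
    also have "\<dots> = (\<Sum>f1\<le>d. (fps_const (real (h choose d) * real (d choose f1)) * \<theta>1 ^ d * (A * G0)) * Mx (h - f1))"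
      unfolding Mx_def sum_distrib_left by (rule sum.swap)
    finally show "(\<Sum>f\<le>h. \<Sum>e'\<le>n. fps_const (real (h choose d) * real ((d + e') choose f) * real ((e' + (h - f)) choose e')) * \<theta>1 ^ d * \<theta> ^ e' * (A * G0) * B ^ (h + e' - f))
      = (\<Sum>f1\<le>d. (fps_const (real (h choose d) * real (d choose f1)) * \<theta>1 ^ d * (A * G0)) * Mx (h - f1))" .
  qed
  also have "\<dots> $ n = (\<Sum>d\<le>h. (\<Sum>f1\<le>d. (fps_const (real (h choose d) * real (d choose f1)) * \<theta>1 ^ d * (A * G0)) * (V * B2 ^ (h - f1)))) $ n"
    unfolding fps_sum_nth by (intro sum.cong refl mult_cong_upto[where N = n] Mx) auto
  also have "(\<Sum>d\<le>h. (\<Sum>f1\<le>d. (fps_const (real (h choose d) * real (d choose f1)) * \<theta>1 ^ d * (A * G0)) * (V * B2 ^ (h - f1))))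
     = A * G0 * V * (\<Sum>d\<le>h. of_nat (h choose d) * (\<theta>1 * (1 + B2)) ^ d * B2 ^ (h - d))"
    unfolding sum_distrib_left
  proof (rule sum.cong[OF refl])
    fix d assume d: "d \<in> {..h}"
    have "(\<Sum>f1\<le>d. (fps_const (real (h choose d) * real (d choose f1)) * \<theta>1 ^ d * (A * G0)) * (V * B2 ^ (h - f1)))
      = A * G0 * V * of_nat (h choose d) * \<theta>1 ^ d * B2 ^ (h - d) * (\<Sum>f1\<le>d. of_nat (d choose f1) * 1 ^ f1 * B2 ^ (d - f1))"
      unfolding sum_distrib_left
    proof (rule sum.cong[OF refl])
      fix f1 assume "f1 \<in> {..d}"
      then have "h - f1 = (h - d) + (d - f1)" using d by auto
      then show "(fps_const (real (h choose d) * real (d choose f1)) * \<theta>1 ^ d * (A * G0)) * (V * B2 ^ (h - f1)) = A * G0 * V * of_nat (h choose d) * \<theta>1 ^ d * B2 ^ (h - d) * (of_nat (d choose f1) * 1 ^ f1 * B2 ^ (d - f1))"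
        by (simp add: fps_const_mult[symmetric] fps_of_nat power_add mult_ac del: fps_const_mult)
    qed
    then show "(\<Sum>f1\<le>d. (fps_const (real (h choose d) * real (d choose f1)) * \<theta>1 ^ d * (A * G0)) * (V * B2 ^ (h - f1)))
      = A * G0 * V * (of_nat (h choose d) * (\<theta>1 * (1 + B2)) ^ d * B2 ^ (h - d))"
      unfolding binomial_ring[symmetric] by (simp add: power_mult_distrib mult_ac)
  qed
  also have "(\<Sum>d\<le>h. of_nat (h choose d) * (\<theta>1 * (1 + B2)) ^ d * B2 ^ (h - d)) = (B2 + \<theta>1 * (1 + B2)) ^ h"
    unfolding binomial_ring[symmetric] by (simp add: add.commute)
  finally show "Phi_fps (Suc k) h $ n = (A * inverse (lin_fps (R * u k)) * inverse (1 - \<theta> * B)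
     * (B * (1 + \<theta>) * inverse (1 - \<theta> * B) + \<theta>1 * (1 + B * (1 + \<theta>) * inverse (1 - \<theta> * B))) ^ h) $ n"
    unfolding G0_def V_def B2_def .
qed

text \<open>Without letters the prefix is empty, and then the suffix has no placeholder either. So
  the geometric form starts with \<open>A = 1\<close> and \<open>B = 0\<close>.\<close>

lemma Phi_fps_0: "Phi_fps 0 h = 1 * 0 ^ h"
proof (rule fps_ext)
  fix n
  show "Phi_fps 0 h $ n = (1 * 0 ^ h) $ n"
  proof (cases h)
    case (Suc h')
    then have "words {..<0::nat} h = {}" by (auto simp: words_def)
    then show ?thesis using Suc by (simp add: Phi_fps_def Phi_def)
  next
    case 0
    have "Phi u e R 0 0 n = (if n = 0 then 1 else 0)"
    proof -
      have "Phi u e R 0 0 n = (\<Sum>S\<in>words {..0} n. if count_list S 0 = 0 then word_weight u e R 0 (start_offset S) S else 0)"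
        unfolding Phi_def words_0 by (simp cong: if_cong)
      also have "\<dots> = (if n = 0 then 1 else 0)"
      proof (cases "n = 0")
        case True
        then show ?thesis unfolding True words_0 by simp
      next
        case False
        have *: "count_list S 0 \<noteq> 0" if "S \<in> words {..0} n" for S :: "nat list"
          using that False by (cases S) (auto simp: words_def)
        then have "(\<Sum>S\<in>words {..0} n. if count_list S 0 = 0 then word_weight u e R 0 (start_offset S) S else 0) = (0::real)"
          by (intro sum.neutral ballI) (simp only: * if_False)
        then show ?thesis using False by simp
      qed
      finally show ?thesis .
    qed
    then show ?thesis using 0 by (simp add: Phi_fps_def)
  qed
qed

end

definition lin_prod :: "(nat \<Rightarrow> real) \<Rightarrow> nat \<Rightarrow> real \<Rightarrow> real fps" where
  "lin_prod x k s = (\<Prod>i<k. lin_fps (s * x i))"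

lemma lin_prod_Suc: "lin_prod x (Suc k) s = lin_prod x k s * lin_fps (s * x k)"
  by (simp add: lin_prod_def)

lemma lin_prod_0 [simp]: "lin_prod x 0 s = 1"
  by (simp add: lin_prod_def)

lemma lin_prod_nth0 [simp]: "lin_prod x k s $ 0 = 1"
  by (induction k) (simp_all add: lin_prod_Suc)

text \<open>In terms of \<open>1 + B\<close> a step is a fractional linear map. The two relations
  are its form without denominators.\<close>

lemma Phi_fps_step':
  fixes u e :: "nat \<Rightarrow> real"
  assumes IH: "\<And>h. Phi_fps u e R k h = A * B ^ h" and B0: "B $ 0 = 0"
  shows "\<exists>A' B'. (\<forall>h. Phi_fps u e R (Suc k) h = A' * B' ^ h) \<and> B' $ 0 = 0
     \<and> (1 + B') * lin_fps (u k) * (1 - fps_const (e k) * fps_X * (1 + B)) = (1 + B) * lin_fps (e k)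
     \<and> A' * lin_fps (R * u k) * (1 + B) = A * ((1 + B') * lin_fps (u k))"
proof -
  define y where "y = fps_const (e k) * fps_X"
  define \<theta> where "\<theta> = y * inverse (lin_fps (e k))"
  define \<theta>1 where "\<theta>1 = fps_const (u k) * fps_X * inverse (lin_fps (u k))"
  define V where "V = inverse (1 - \<theta> * B)"
  define B2 where "B2 = B * (1 + \<theta>) * V"
  define A' where "A' = A * inverse (lin_fps (R * u k)) * V"
  define B' where "B' = B2 + \<theta>1 * (1 + B2)"
  have 1: "Phi_fps u e R (Suc k) h = A' * B' ^ h" for h
    unfolding Phi_fps_step[OF IH] A'_def B'_def B2_def V_def \<theta>_def \<theta>1_def y_def ..
  have 2: "B' $ 0 = 0" by (simp add: B'_def B2_def \<theta>1_def B0)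
  have V: "V * (1 - \<theta> * B) = 1"
    unfolding V_def using B0 by (intro inverse_mult_eq_1) simp
  have ly: "lin_fps (e k) = 1 - y" by (simp add: lin_fps_def y_def)
  have th: "\<theta> * (1 - y) = y"
    by (simp add: \<theta>_def ly[symmetric] mult.assoc)
  have b2: "1 + B2 = (1 + B) * V"
    using V unfolding B2_def by algebra
  have l1: "(1 + \<theta>1) * lin_fps (u k) = 1"
  proof -
    have "(1 + \<theta>1) * lin_fps (u k) = lin_fps (u k) + fps_const (u k) * fps_X"
      by (simp add: \<theta>1_def ring_distribs mult.assoc)
    then show ?thesis by (simp add: lin_fps_def)
  qed
  have b': "(1 + B') * lin_fps (u k) = (1 + B) * V"
  proof -
    have "1 + B' = (1 + B2) * (1 + \<theta>1)" unfolding B'_def by algebra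
    then show ?thesis using l1 b2 by (simp add: mult.assoc)
  qed
  have 3: "(1 + B') * lin_fps (u k) * (1 - y * (1 + B)) = (1 + B) * lin_fps (e k)"
  proof -
    have "(1 - y) * (1 - \<theta> * B) = 1 - y - (\<theta> * (1 - y)) * B" by (simp add: algebra_simps)
    then have "1 - y * (1 + B) = (1 - y) * (1 - \<theta> * B)" unfolding th by (simp add: algebra_simps)
    then show ?thesis unfolding b' ly using V by algebra
  qed
  have 4: "A' * lin_fps (R * u k) * (1 + B) = A * ((1 + B') * lin_fps (u k))"
    unfolding b' A'_def by (simp add: mult_ac)
  show ?thesis using 1 2 3 4 unfolding y_def by blast
qed

text \<open>With \<open>e i = t * x (i - 1)\<close> the excedance factor of a new letter is the
  factor by which \<open>lin_prod x k t\<close> grows at the preceding letter, so the fractional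
  linear maps telescope. At the smallest letter the truncated index gives
  \<open>e 0 = t * x 0\<close>, which cancels since \<open>B = 0\<close> there.\<close>

lemma Phi_fps_solution:
  fixes x :: "nat \<Rightarrow> real" and R t :: real
  defines "e \<equiv> \<lambda>i. t * x (i - 1)"
  shows "\<exists>A B. (\<forall>h. Phi_fps x e R (Suc k) h = A * B ^ h) \<and> B $ 0 = 0
     \<and> (1 + B) * (lin_prod x k 1 - fps_const t * lin_prod x k t) * lin_fps (x k) = fps_const (1 - t) * lin_prod x k t
     \<and> A * lin_prod x (Suc k) R = (1 + B) * lin_prod x (Suc k) 1"
proof (induction k)
  case 0
  obtain A' B' where h: "\<forall>h. Phi_fps x e R (Suc 0) h = A' * B' ^ h" and b0: "B' $ 0 = 0"
    and b: "(1 + B') * lin_fps (x 0) * (1 - fps_const (e 0) * fps_X * (1 + 0)) = (1 + 0) * lin_fps (e 0)"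
    and a: "A' * lin_fps (R * x 0) * (1 + 0) = 1 * ((1 + B') * lin_fps (x 0))"
    using Phi_fps_step'[OF Phi_fps_0, of x e R] by auto
  have l: "1 - fps_const (e 0) * fps_X * (1 + 0) = lin_fps (e 0)" by (simp add: lin_fps_def)
  have "lin_fps (e 0) \<noteq> 0" using lin_fps_nth0[of "e 0"] by (metis fps_zero_nth zero_neq_one)
  then have b1: "(1 + B') * lin_fps (x 0) = 1" using b unfolding l by simp
  have "(1 + B') * (lin_prod x 0 1 - fps_const t * lin_prod x 0 t) * lin_fps (x 0) = fps_const (1 - t) * ((1 + B') * lin_fps (x 0))"
    by (simp add: fps_const_sub[symmetric] mult_ac del: fps_const_sub)
  then have c: "(1 + B') * (lin_prod x 0 1 - fps_const t * lin_prod x 0 t) * lin_fps (x 0) = fps_const (1 - t) * lin_prod x 0 t"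
    unfolding b1 by simp
  have "A' * lin_prod x (Suc 0) R = (1 + B') * lin_prod x (Suc 0) 1"
    using a by (simp add: lin_prod_Suc)
  with h b0 c show ?case by blast
next
  case (Suc k)
  then obtain A B where IH: "\<And>h. Phi_fps x e R (Suc k) h = A * B ^ h" and B0: "B $ 0 = 0"
    and B: "(1 + B) * (lin_prod x k 1 - fps_const t * lin_prod x k t) * lin_fps (x k) = fps_const (1 - t) * lin_prod x k t"
    and A: "A * lin_prod x (Suc k) R = (1 + B) * lin_prod x (Suc k) 1" by blast
  obtain A' B' where h: "\<forall>h. Phi_fps x e R (Suc (Suc k)) h = A' * B' ^ h" and b0: "B' $ 0 = 0"
    and b: "(1 + B') * lin_fps (x (Suc k)) * (1 - fps_const (e (Suc k)) * fps_X * (1 + B)) = (1 + B) * lin_fps (e (Suc k))"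
    and a: "A' * lin_fps (R * x (Suc k)) * (1 + B) = A * ((1 + B') * lin_fps (x (Suc k)))"
    using Phi_fps_step'[OF IH B0] by auto
  define P where "P = lin_prod x k 1"
  define Q where "Q = lin_prod x k t"
  define T where "T = fps_const t"
  define w where "w = fps_const (x k) * fps_X"
  define C where "C = (1 + B)"
  define C' where "C' = (1 + B') * lin_fps (x (Suc k))"
  have T1: "fps_const (1 - t) = 1 - T" by (simp add: T_def fps_const_sub[symmetric] del: fps_const_sub)
  have lx: "lin_fps (x k) = 1 - w" by (simp add: lin_fps_def w_def)
  have ek: "fps_const (e (Suc k)) * fps_X = T * w" by (simp add: e_def T_def w_def mult.assoc[symmetric])
  have le: "lin_fps (e (Suc k)) = 1 - T * w" using ek by (simp add: lin_fps_def)
  have le': "lin_fps (t * x k) = 1 - T * w" using le by (simp add: e_def)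
  have nz: "F \<noteq> 0" if "F $ 0 = 1" for F :: "real fps" using that by (metis fps_zero_nth zero_neq_one)
  have C0: "C \<noteq> 0" by (rule nz) (simp add: C_def B0)
  have B': "C * (P - T * Q) * (1 - w) = (1 - T) * Q"
    using B by (simp only: T1 lx C_def P_def Q_def T_def)
  have bb: "C' * (1 - T * w * C) = C * (1 - T * w)"
    using b by (simp only: ek le C_def C'_def)
  have "C * (C' * (P * (1 - w) - T * (Q * (1 - T * w)))) = C * ((1 - T) * (Q * (1 - T * w)))"
    using B' bb by algebra
  then have "C' * (P * (1 - w) - T * (Q * (1 - T * w))) = (1 - T) * (Q * (1 - T * w))"
    using C0 by simp
  moreover have "lin_prod x (Suc k) 1 = P * (1 - w)" "lin_prod x (Suc k) t = Q * (1 - T * w)"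
    by (simp_all add: lin_prod_Suc P_def Q_def lx[symmetric] le'[symmetric])
  ultimately have c: "(1 + B') * (lin_prod x (Suc k) 1 - fps_const t * lin_prod x (Suc k) t) * lin_fps (x (Suc k)) = fps_const (1 - t) * lin_prod x (Suc k) t"
    unfolding T1 unfolding C'_def T_def[symmetric] by (simp add: mult_ac)
  have "C * (A' * lin_prod x (Suc (Suc k)) R) = C * ((1 + B') * lin_prod x (Suc (Suc k)) 1)"
    using a A unfolding lin_prod_Suc[of x "Suc k"] C_def mult_1 by algebra
  then have "A' * lin_prod x (Suc (Suc k)) R = (1 + B') * lin_prod x (Suc (Suc k)) 1" using C0 by simp
  with h b0 c show ?case by blast
qed

text \<open>With \<open>H s\<close> for the series of complete homogeneous symmetric polynomials in
  the \<open>s * x i\<close>, this is the shape \<open>(1 - t) * H R / (H t - t * H 1)\<close>. The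
  denominator has one letter less than the numerator, a difference that disappears as the alphabet
  grows.\<close>

theorem Phi_fps_closed:
  fixes x :: "nat \<Rightarrow> real" and R t :: real
  defines "e \<equiv> \<lambda>i. t * x (i - 1)"
  shows "Phi_fps x e R (Suc k) 0 * (inverse (lin_prod x k t) - fps_const t * inverse (lin_prod x k 1))
     = fps_const (1 - t) * inverse (lin_prod x (Suc k) R)"
proof -
  obtain A B where IH: "\<And>h. Phi_fps x e R (Suc k) h = A * B ^ h"
    and B: "(1 + B) * (lin_prod x k 1 - fps_const t * lin_prod x k t) * lin_fps (x k) = fps_const (1 - t) * lin_prod x k t"
    and A: "A * lin_prod x (Suc k) R = (1 + B) * lin_prod x (Suc k) 1"
    using Phi_fps_solution[of x t R k] unfolding e_def by blast
  have inv: "lin_prod x j s * inverse (lin_prod x j s) = 1" for j s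
    using inverse_mult_eq_1'[of "lin_prod x j s"] by simp
  have nz: "lin_prod x j s \<noteq> 0" for j s
    using lin_prod_nth0[of x j s] by (metis fps_zero_nth zero_neq_one)
  define Pt It P1 I1 PR IR where "Pt = lin_prod x k t" "It = inverse (lin_prod x k t)" "P1 = lin_prod x k 1" "I1 = inverse (lin_prod x k 1)"
    "PR = lin_prod x (Suc k) R" "IR = inverse (lin_prod x (Suc k) R)"
  note defs = this
  have i: "Pt * It = 1" "P1 * I1 = 1" "PR * IR = 1" using inv by (simp_all add: defs)
  define T where "T = fps_const t"
  define S where "S = fps_const (1 - t)"
  define l where "l = lin_fps (x k)"
  have b: "(1 + B) * (P1 - T * Pt) * l = S * Pt" using B unfolding defs T_def S_def l_def .
  have a: "A * PR = (1 + B) * (P1 * l)" using A unfolding defs l_def by (simp add: lin_prod_Suc)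
  have "Pt * P1 * PR * (A * (It - T * I1)) = Pt * P1 * PR * (S * IR)"
    using a b i by algebra
  moreover have "Pt * P1 * PR \<noteq> 0" using nz by (simp add: defs)
  ultimately have "A * (It - T * I1) = S * IR" by simp
  then show ?thesis using IH[of 0] by (simp add: defs T_def S_def)
qed

lemma word_weight_prod:
  "word_weight u e R k \<delta> xs = (\<Prod>p<length xs. if xs ! p < k
      then letter_weight u e R (xs ! p) (\<delta> (xs ! p) + int p - int (count_list (take p xs) (xs ! p))) else 1)"
proof (induction xs arbitrary: \<delta>)
  case Nil then show ?case by simp
next
  case (Cons x xs)
  show ?case
    unfolding word_weight.simps Cons.IH length_Cons prod.lessThan_Suc_shift
    by (intro arg_cong2[where f = "(*)"] prod.cong) (auto simp: algebra_simps)
qed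

lemma Phi_h0: "Phi u e R k 0 n = (\<Sum>S\<in>words {..<k} n. word_weight u e R k (start_offset S) S)"
proof -
  have "Phi u e R k 0 n = (\<Sum>S\<in>words {..k} n. if count_list S k = 0 then word_weight u e R k (start_offset S) S else 0)"
    unfolding Phi_def words_0 by (simp cong: if_cong)
  also have "\<dots> = (\<Sum>S\<in>{S\<in>words {..k} n. count_list S k = 0}. word_weight u e R k (start_offset S) S)"
    by (simp add: sum.inter_filter)
  also have "{S\<in>words {..k} n. count_list S k = 0} = words {..<k} n"
  proof -
    have "set S \<subseteq> {..k} \<and> k \<notin> set S \<longleftrightarrow> set S \<subseteq> {..<k}" for S
      by (metis lessThan_Suc_atMost lessThan_Suc subset_insert lessThan_iff less_irrefl subsetD subset_insertI order_trans)
    then show ?thesis unfolding words_def count_list_0_iff by blast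
  qed
  finally show ?thesis .
qed

section \<open>From words to permutations\<close>

definition precedes :: "(nat \<Rightarrow> nat) \<Rightarrow> nat \<Rightarrow> nat \<Rightarrow> bool" where
  "precedes w i j \<longleftrightarrow> w i > w j \<or> w i = w j \<and> i < j"

definition word_rank :: "nat \<Rightarrow> (nat \<Rightarrow> nat) \<Rightarrow> nat \<Rightarrow> nat" where
  "word_rank n w j = Suc (card {i \<in> {1..n}. precedes w i j})"

text \<open>These are P-partitions of the linear order given by \<open>\<sigma>\<close>: strictness
  at descents makes \<open>\<sigma>\<close> recoverable from the word.\<close>

definition compatible :: "nat \<Rightarrow> nat \<Rightarrow> (nat \<Rightarrow> nat) \<Rightarrow> (nat \<Rightarrow> nat) set" where
  "compatible k n \<sigma> = {s \<in> {1..n} \<rightarrow>\<^sub>E {..<k}. \<forall>i\<in>{1..<n}. s (Suc i) \<le> s i \<and> (\<sigma> (Suc i) < \<sigma> i \<longrightarrow> s (Suc i) < s i)}"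

lemma finite_compatible [simp]: "finite (compatible k n \<sigma>)"
  by (rule finite_subset[of _ "{1..n} \<rightarrow>\<^sub>E {..<k}"]) (auto simp: compatible_def finite_PiE)

lemma compatible_lt:
  assumes s: "s \<in> compatible k n \<sigma>" and "\<sigma> permutes {1..n}" and "1 \<le> i" "i < j" "j \<le> n"
  shows "s i > s j \<or> s i = s j \<and> \<sigma> i < \<sigma> j"
  using assms(4,5)
proof (induction j rule: less_induct)
  case (less j)
  have inj: "\<sigma> a = \<sigma> b \<longleftrightarrow> a = b" for a b using assms(2) by (metis permutes_inj injD)
  obtain j' where j: "j = Suc j'" using less.prems by (cases j) auto
  have st: "s j \<le> s j' \<and> (\<sigma> j < \<sigma> j' \<longrightarrow> s j < s j')"
    using s less.prems assms(3) unfolding compatible_def j by auto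
  have st': "s j' > s j \<or> s j' = s j \<and> \<sigma> j' < \<sigma> j"
    using st inj[of j j'] j by (metis le_neq_implies_less n_not_Suc_n nat_neq_iff)
  show ?case
  proof (cases "i = j'")
    case True then show ?thesis using st' by simp
  next
    case False
    then have "s i > s j' \<or> s i = s j' \<and> \<sigma> i < \<sigma> j'" using less j by auto
    then show ?thesis using st' by auto
  qed
qed

text \<open>The conditions on neighbours propagate to all pairs. So the order of the indices is the
  sorting order of the letters, with ties broken by position, and a word determines its
  permutation.\<close>

lemma compatible_iff:
  assumes s: "s \<in> compatible k n \<sigma>" and "\<sigma> permutes {1..n}" and "i \<in> {1..n}" "j \<in> {1..n}"
  shows "i < j \<longleftrightarrow> s i > s j \<or> s i = s j \<and> \<sigma> i < \<sigma> j"
  using compatible_lt[OF s assms(2), of i j] compatible_lt[OF s assms(2), of j i] assms(3,4)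
  by (cases i j rule: linorder_cases) auto

lemma rank_compatible:
  assumes s: "s \<in> compatible k n \<sigma>" and p: "\<sigma> permutes {1..n}" and i: "i \<in> {1..n}"
    and w: "\<And>j. j \<in> {1..n} \<Longrightarrow> w (\<sigma> j) = s j"
  shows "word_rank n w (\<sigma> i) = i"
proof -
  have "{j \<in> {1..n}. precedes w j (\<sigma> i)} = {j \<in> \<sigma> ` {1..n}. precedes w j (\<sigma> i)}"
    unfolding permutes_image[OF p] ..
  also have "\<dots> = \<sigma> ` {i' \<in> {1..n}. precedes w (\<sigma> i') (\<sigma> i)}" by auto
  also have "{i' \<in> {1..n}. precedes w (\<sigma> i') (\<sigma> i)} = {1..<i}"
  proof -
    have "precedes w (\<sigma> i') (\<sigma> i) \<longleftrightarrow> i' < i" if "i' \<in> {1..n}" for i'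
      using compatible_iff[OF s p that i] w[OF that] w[OF i] unfolding precedes_def by metis
    then show ?thesis using i by auto
  qed
  finally show ?thesis using i by (simp add: word_rank_def card_image inj_on_subset[OF permutes_inj[OF p]])
qed

lemma precedes_linear: "precedes w i j \<or> precedes w j i \<or> i = j" "\<not> (precedes w i j \<and> precedes w j i)" "\<not> precedes w i i" "precedes w i j \<Longrightarrow> precedes w j l \<Longrightarrow> precedes w i l"
  unfolding precedes_def by auto

lemma rank_less:
  assumes "i \<in> {1..n}" "precedes w i j"
  shows "word_rank n w i < word_rank n w j"
proof -
  have "{l \<in> {1..n}. precedes w l i} \<subset> {l \<in> {1..n}. precedes w l j}"
  proof
    show "{l \<in> {1..n}. precedes w l i} \<subseteq> {l \<in> {1..n}. precedes w l j}"
      using precedes_linear(4)[of w _ i j] assms(2) by auto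
    show "{l \<in> {1..n}. precedes w l i} \<noteq> {l \<in> {1..n}. precedes w l j}"
      using assms precedes_linear(3)[of w i] by blast
  qed
  then show ?thesis unfolding word_rank_def by (simp add: psubset_card_mono)
qed

lemma rank_bij: "bij_betw (word_rank n w) {1..n} {1..n}"
proof -
  have inj: "inj_on (word_rank n w) {1..n}"
  proof (rule inj_onI)
    fix i j assume "i \<in> {1..n}" "j \<in> {1..n}" "word_rank n w i = word_rank n w j"
    then show "i = j" using rank_less[of i n w j] rank_less[of j n w i] precedes_linear(1)[of w i j] by auto
  qed
  have "word_rank n w j \<in> {1..n}" if "j \<in> {1..n}" for j
  proof -
    have "{i \<in> {1..n}. precedes w i j} \<subseteq> {1..n} - {j}" using precedes_linear(3)[of w j] by auto
    from card_mono[OF _ this] have "card {i \<in> {1..n}. precedes w i j} \<le> n - 1"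
      using that by simp
    then show ?thesis using that unfolding word_rank_def atLeastAtMost_iff by linarith
  qed
  then have "word_rank n w ` {1..n} \<subseteq> {1..n}" by auto
  with inj show ?thesis unfolding bij_betw_def by (intro conjI endo_inj_surj) auto
qed

definition letter_at :: "nat list \<Rightarrow> nat \<Rightarrow> nat" where "letter_at xs j = xs ! (j - 1)"

definition word_of :: "nat \<Rightarrow> (nat \<Rightarrow> nat) \<times> (nat \<Rightarrow> nat) \<Rightarrow> nat list" where
  "word_of n = (\<lambda>(\<sigma>, s). map (\<lambda>j. s (inv \<sigma> (Suc j))) [0..<n])"

lemma letter_at_word_of:
  assumes "\<sigma> permutes {1..n}" "i \<in> {1..n}"
  shows "letter_at (word_of n (\<sigma>, s)) (\<sigma> i) = s i"
proof -
  have "\<sigma> i \<in> {1..n}" using assms(2) permutes_in_image[OF assms(1)] by blast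
  then show ?thesis using assms by (auto simp: letter_at_def word_of_def permutes_inverses)
qed

text \<open>The inverse sorts a word: \<open>\<sigma> i\<close> is the position of the
  \<open>i\<close>-th letter in decreasing order, ties from left to right, and \<open>s i\<close> is
  that letter. Equal letters have increasing positions, so \<open>s\<close> drops strictly at each
  descent.\<close>

lemma bij_words:
  "bij_betw (word_of n) (SIGMA \<sigma>:{\<sigma>. \<sigma> permutes {1..n}}. compatible k n \<sigma>) (words {..<k} n)"
  unfolding bij_betw_def
proof
  show "inj_on (word_of n) (SIGMA \<sigma>:{\<sigma>. \<sigma> permutes {1..n}}. compatible k n \<sigma>)"
  proof (rule inj_onI, clarify)
    fix \<sigma> s \<sigma>' s'
    assume p: "\<sigma> permutes {1..n}" and s: "s \<in> compatible k n \<sigma>" and p': "\<sigma>' permutes {1..n}" and s': "s' \<in> compatible k n \<sigma>'"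
      and eq: "word_of n (\<sigma>, s) = word_of n (\<sigma>', s')"
    define w where "w = letter_at (word_of n (\<sigma>, s))"
    have r: "word_rank n w (\<sigma> i) = i" if "i \<in> {1..n}" for i
      by (rule rank_compatible[OF s p that]) (simp add: w_def letter_at_word_of[OF p])
    have r': "word_rank n w (\<sigma>' i) = i" if "i \<in> {1..n}" for i
      by (rule rank_compatible[OF s' p' that]) (simp add: w_def eq letter_at_word_of[OF p'])
    have "\<sigma> i = \<sigma>' i" for i
    proof (cases "i \<in> {1..n}")
      case True
      then have "\<sigma> i \<in> {1..n}" "\<sigma>' i \<in> {1..n}" using p p' by (simp_all only: permutes_in_image)
      then show ?thesis
        using r[OF True] r'[OF True] inj_onD[OF bij_betw_imp_inj_on[OF rank_bij[of n w]], of "\<sigma> i" "\<sigma>' i"] by simp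
    next
      case False then show ?thesis using p p' by (metis permutes_not_in)
    qed
    then have \<sigma>: "\<sigma> = \<sigma>'" by auto
    have "s i = s' i" for i
    proof (cases "i \<in> {1..n}")
      case True then show ?thesis using letter_at_word_of[OF p True, of s] letter_at_word_of[OF p' True, of s'] eq \<sigma> by simp
    next
      case False then show ?thesis using s s' unfolding compatible_def by (auto simp: PiE_def extensional_def)
    qed
    with \<sigma> show "\<sigma> = \<sigma>' \<and> s = s'" by auto
  qed
  show "word_of n ` (SIGMA \<sigma>:{\<sigma>. \<sigma> permutes {1..n}}. compatible k n \<sigma>) = words {..<k} n"
  proof (intro equalityI subsetI)
    fix w assume "w \<in> word_of n ` (SIGMA \<sigma>:{\<sigma>. \<sigma> permutes {1..n}}. compatible k n \<sigma>)"
    then obtain \<sigma> s where p: "\<sigma> permutes {1..n}" and s: "s \<in> compatible k n \<sigma>" and w: "w = word_of n (\<sigma>, s)" by auto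
    have "s (inv \<sigma> (Suc j)) < k" if "j < n" for j
    proof -
      have "inv \<sigma> (Suc j) \<in> {1..n}" using that permutes_in_image[OF permutes_inv[OF p], of "Suc j"] by auto
      then show ?thesis using s unfolding compatible_def by (auto simp: PiE_def)
    qed
    then show "w \<in> words {..<k} n" unfolding w by (auto simp: words_def word_of_def)
  next
    fix xs assume xs: "xs \<in> words {..<k} n"
    define w where "w = letter_at xs"
    define \<tau> where "\<tau> j = (if j \<in> {1..n} then word_rank n w j else j)" for j
    have t: "\<tau> permutes {1..n}"
    proof (rule bij_imp_permutes)
      have "bij_betw \<tau> {1..n} {1..n} = bij_betw (word_rank n w) {1..n} {1..n}"
        by (rule bij_betw_cong) (simp add: \<tau>_def)
      then show "bij_betw \<tau> {1..n} {1..n}" using rank_bij by blast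
    qed (auto simp: \<tau>_def)
    define \<sigma> where "\<sigma> = inv \<tau>"
    have p: "\<sigma> permutes {1..n}" unfolding \<sigma>_def by (rule permutes_inv[OF t])
    have inv: "inv \<sigma> = \<tau>" unfolding \<sigma>_def by (rule inv_inv_eq) (rule permutes_bij[OF t])
    define s where "s = restrict (w \<circ> \<sigma>) {1..n}"
    have sin: "\<sigma> i \<in> {1..n}" if "i \<in> {1..n}" for i using that permutes_in_image[OF p] by blast
    have wk: "w j < k" if "j \<in> {1..n}" for j
      using that xs nth_mem[of "j - 1" xs] unfolding w_def letter_at_def words_def by force
    have rs: "word_rank n w (\<sigma> i) = i" if "i \<in> {1..n}" for i
      using sin[OF that] permutes_inverses(1)[OF t, of i] unfolding \<sigma>_def \<tau>_def by auto
    have "s \<in> compatible k n \<sigma>"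
    proof -
      have "s (Suc i) \<le> s i \<and> (\<sigma> (Suc i) < \<sigma> i \<longrightarrow> s (Suc i) < s i)" if "i \<in> {1..<n}" for i
      proof -
        have i: "i \<in> {1..n}" "Suc i \<in> {1..n}" using that by auto
        have "\<not> precedes w (\<sigma> (Suc i)) (\<sigma> i)"
          using rank_less[of "\<sigma> (Suc i)" n w "\<sigma> i"] sin i rs by auto
        moreover have "\<sigma> i \<noteq> \<sigma> (Suc i)" using permutes_inj[OF p] by (metis injD n_not_Suc_n)
        ultimately show ?thesis using i by (auto simp: s_def precedes_def)
      qed
      then show ?thesis using wk sin by (auto simp: compatible_def s_def)
    qed
    moreover have "word_of n (\<sigma>, s) = xs"
    proof (rule nth_equalityI)
      show "length (word_of n (\<sigma>, s)) = length xs" using xs by (simp add: word_of_def words_def)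
      fix j assume j: "j < length (word_of n (\<sigma>, s))"
      then have j': "Suc j \<in> {1..n}" by (simp add: word_of_def)
      then have "\<tau> (Suc j) \<in> {1..n}" using permutes_in_image[OF t] by blast
      then have "s (\<tau> (Suc j)) = w (Suc j)"
        using permutes_inverses(2)[OF t, of "Suc j"] by (simp add: s_def \<sigma>_def)
      then show "word_of n (\<sigma>, s) ! j = xs ! j" using j' by (simp add: word_of_def inv w_def letter_at_def)
    qed
    ultimately show "xs \<in> word_of n ` (SIGMA \<sigma>:{\<sigma>. \<sigma> permutes {1..n}}. compatible k n \<sigma>)"
      using p by (intro image_eqI[of _ _ "(\<sigma>, s)"]) auto
  qed
qed

lemma card_shift: "card {p :: nat. p < n \<and> P p} = card {j \<in> {1..n}. P (j - 1)}"
proof -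
  have "j \<in> {j \<in> {1..n}. P (j - 1)} \<longleftrightarrow> j \<in> Suc ` {p. p < n \<and> P p}" for j
    by (cases j) auto
  then have "{j \<in> {1..n}. P (j - 1)} = Suc ` {p. p < n \<and> P p}" by blast
  then show ?thesis by (simp only: card_image[OF inj_on_subset[OF inj_Suc subset_UNIV]])
qed

text \<open>An occurrence of \<open>v\<close> is preceded in sorted order by the larger letters,
  which \<open>start_offset\<close> subtracts, and by the equal letters to its left, which the
  running offset subtracts.\<close>

lemma word_weight_rank:
  assumes xs: "xs \<in> words {..<k} n"
  shows "word_weight u e R k (start_offset xs) xs = (\<Prod>j\<in>{1..n}. letter_weight u e R (letter_at xs j) (int j - int (word_rank n (letter_at xs) j)))"
proof -
  have len: "length xs = n" using xs by (simp add: words_def)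
  have eq: "start_offset xs (xs ! p) + int p - int (count_list (take p xs) (xs ! p)) = int (Suc p) - int (word_rank n (letter_at xs) (Suc p))"
    if p: "p < n" for p
  proof -
    let ?v = "xs ! p"
    have a: "length (filter (\<lambda>x. x > ?v) xs) = card {i \<in> {1..n}. letter_at xs i > ?v}"
      using card_shift[of n "\<lambda>i. xs ! i > ?v"] by (simp add: length_filter_conv_card len letter_at_def)
    have "count_list (take p xs) ?v = length (filter (\<lambda>x. x = ?v) (take p xs))"
      unfolding count_list_eq_length_filter by (intro arg_cong[where f = length] filter_cong) auto
    also have "\<dots> = card {i. i < p \<and> xs ! i = ?v}"
    proof -
      have "{i. i < length (take p xs) \<and> take p xs ! i = ?v} = {i. i < p \<and> xs ! i = ?v}"
        using p len by auto
      then show ?thesis by (simp only: length_filter_conv_card)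
    qed
    also have "{i. i < p \<and> xs ! i = ?v} = {i. i < n \<and> (i < p \<and> xs ! i = ?v)}" using p by auto
    also have "card \<dots> = card {i \<in> {1..n}. i - 1 < p \<and> letter_at xs i = ?v}"
      using card_shift[of n "\<lambda>i. i < p \<and> xs ! i = ?v"] by (simp add: letter_at_def)
    finally have b: "count_list (take p xs) ?v = card {i \<in> {1..n}. i - 1 < p \<and> letter_at xs i = ?v}" .
    have "{i \<in> {1..n}. precedes (letter_at xs) i (Suc p)} = {i \<in> {1..n}. letter_at xs i > ?v} \<union> {i \<in> {1..n}. i - 1 < p \<and> letter_at xs i = ?v}"
      unfolding precedes_def letter_at_def by (intro Collect_cong set_eqI) (simp, linarith)
    moreover have "{i \<in> {1..n}. letter_at xs i > ?v} \<inter> {i \<in> {1..n}. i - 1 < p \<and> letter_at xs i = ?v} = {}" by auto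
    ultimately have "word_rank n (letter_at xs) (Suc p) = Suc (card {i \<in> {1..n}. letter_at xs i > ?v} + card {i \<in> {1..n}. i - 1 < p \<and> letter_at xs i = ?v})"
      by (simp add: word_rank_def card_Un_disjoint)
    then show ?thesis using a b by (simp add: start_offset_def)
  qed
  have "word_weight u e R k (start_offset xs) xs = (\<Prod>p<n. letter_weight u e R (xs ! p) (int (Suc p) - int (word_rank n (letter_at xs) (Suc p))))"
    unfolding word_weight_prod len
  proof (rule prod.cong[OF refl])
    fix p assume "p \<in> {..<n}"
    then have p: "p < n" by simp
    then have "xs ! p < k" using xs nth_mem[of p xs] unfolding words_def by blast
    then show "(if xs ! p < k then letter_weight u e R (xs ! p) (start_offset xs (xs ! p) + int p - int (count_list (take p xs) (xs ! p))) else 1)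
      = letter_weight u e R (xs ! p) (int (Suc p) - int (word_rank n (letter_at xs) (Suc p)))"
      using eq[OF p] by (simp only: if_True)
  qed
  also have "\<dots> = (\<Prod>j\<in>{1..n}. letter_weight u e R (letter_at xs j) (int j - int (word_rank n (letter_at xs) j)))"
    by (rule prod.reindex_bij_witness[where i = "\<lambda>j. j - 1" and j = Suc]) (auto simp: letter_at_def)
  finally show ?thesis .
qed

text \<open>The letter of rank \<open>i\<close> stands at position \<open>\<sigma> i\<close>, so the
  sign of \<open>\<sigma> i - i\<close> selects the weight: \<open>e\<close> for an excedance,
  \<open>R * u\<close> for a fixed point, \<open>u\<close> otherwise.\<close>

theorem Phi_permutations:
  "Phi u e R k 0 n = (\<Sum>\<sigma> | \<sigma> permutes {1..n}. \<Sum>s\<in>compatible k n \<sigma>. \<Prod>i\<in>{1..n}. letter_weight u e R (s i) (int (\<sigma> i) - int i))"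
proof -
  have "Phi u e R k 0 n = (\<Sum>x\<in>(SIGMA \<sigma>:{\<sigma>. \<sigma> permutes {1..n}}. compatible k n \<sigma>). word_weight u e R k (start_offset (word_of n x)) (word_of n x))"
    unfolding Phi_h0 by (rule sum.reindex_bij_betw[OF bij_words, symmetric])
  also have "\<dots> = (\<Sum>(\<sigma>, s)\<in>(SIGMA \<sigma>:{\<sigma>. \<sigma> permutes {1..n}}. compatible k n \<sigma>). \<Prod>i\<in>{1..n}. letter_weight u e R (s i) (int (\<sigma> i) - int i))"
  proof (rule sum.cong[OF refl], clarify)
    fix \<sigma> s assume p: "\<sigma> permutes {1..n}" and s: "s \<in> compatible k n \<sigma>"
    let ?w = "letter_at (word_of n (\<sigma>, s))"
    have "word_of n (\<sigma>, s) \<in> words {..<k} n"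
      using bij_betwE[OF bij_words] p s by blast
    then have "word_weight u e R k (start_offset (word_of n (\<sigma>, s))) (word_of n (\<sigma>, s)) = (\<Prod>j\<in>{1..n}. letter_weight u e R (?w j) (int j - int (word_rank n ?w j)))"
      by (rule word_weight_rank)
    also have "\<dots> = (\<Prod>i\<in>{1..n}. letter_weight u e R (?w (\<sigma> i)) (int (\<sigma> i) - int (word_rank n ?w (\<sigma> i))))"
      by (rule prod.reindex_bij_betw[OF permutes_imp_bij[OF p], symmetric])
    also have "\<dots> = (\<Prod>i\<in>{1..n}. letter_weight u e R (s i) (int (\<sigma> i) - int i))"
      using letter_at_word_of[OF p] rank_compatible[OF s p] by (intro prod.cong) auto
    finally show "word_weight u e R k (start_offset (word_of n (\<sigma>, s))) (word_of n (\<sigma>, s)) = (\<Prod>i\<in>{1..n}. letter_weight u e R (s i) (int (\<sigma> i) - int i))" .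
  qed
  also have "\<dots> = (\<Sum>\<sigma> | \<sigma> permutes {1..n}. \<Sum>s\<in>compatible k n \<sigma>. \<Prod>i\<in>{1..n}. letter_weight u e R (s i) (int (\<sigma> i) - int i))"
    by (rule sum.Sigma[symmetric]) (auto simp: finite_permutations)
  finally show ?thesis .
qed

section \<open>Major index as a limit over alphabets\<close>

text \<open>The sequences of \<open>compatible\<close> with the descents as a parameter, so that the
  length can vary in a recursion.\<close>

definition descent_seqs :: "nat \<Rightarrow> nat \<Rightarrow> (nat \<Rightarrow> bool) \<Rightarrow> (nat \<Rightarrow> nat) set" where
  "descent_seqs k m D = {s \<in> {1..m} \<rightarrow>\<^sub>E {..<k}. \<forall>i\<in>{1..<m}. s (Suc i) \<le> s i \<and> (D i \<longrightarrow> s (Suc i) < s i)}"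

definition descent_sum :: "real \<Rightarrow> (nat \<Rightarrow> bool) \<Rightarrow> nat \<Rightarrow> nat \<Rightarrow> real" where
  "descent_sum q D m k = (\<Sum>s\<in>descent_seqs k m D. \<Prod>i\<in>{1..m}. q ^ s i)"

lemma finite_descent_seqs [simp]: "finite (descent_seqs k m D)"
  by (rule finite_subset[of _ "{1..m} \<rightarrow>\<^sub>E {..<k}"]) (auto simp: descent_seqs_def finite_PiE)

lemma descent_seqs_antimono:
  assumes "s \<in> descent_seqs k m D" "1 \<le> i" "i \<le> j" "j \<le> m"
  shows "s j \<le> s i"
  using assms(3,4)
proof (induction j rule: dec_induct)
  case (step j)
  then have "s (Suc j) \<le> s j" using assms(1,2) by (auto simp: descent_seqs_def)
  then show ?case using step by simp
qed simp

lemma descent_sum_0: "descent_sum q D 0 k = 1"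
  by (simp add: descent_sum_def descent_seqs_def)

lemma descent_sum_Suc_0: "descent_sum q D (Suc m) 0 = 0"
proof -
  have "descent_seqs 0 (Suc m) D = {}" by (auto simp: descent_seqs_def)
  then show ?thesis by (simp add: descent_sum_def)
qed

lemma descent_sum_shift:
  "(\<Sum>s | s \<in> descent_seqs (Suc k) m D \<and> (\<forall>i\<in>{1..m}. s i > 0). \<Prod>i\<in>{1..m}. q ^ s i) = q ^ m * descent_sum q D m k"
proof -
  have "descent_sum q D m k * q ^ m = (\<Sum>s\<in>descent_seqs k m D. \<Prod>i\<in>{1..m}. q ^ Suc (s i))"
    unfolding descent_sum_def sum_distrib_right by (intro sum.cong) (simp_all add: prod.distrib)
  also have "\<dots> = (\<Sum>s | s \<in> descent_seqs (Suc k) m D \<and> (\<forall>i\<in>{1..m}. s i > 0). \<Prod>i\<in>{1..m}. q ^ s i)"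
  proof (rule sum.reindex_bij_witness[where i = "\<lambda>s. restrict (\<lambda>i. s i - 1) {1..m}" and j = "\<lambda>s. restrict (\<lambda>i. Suc (s i)) {1..m}"])
    fix s assume s: "s \<in> descent_seqs k m D"
    show "restrict (\<lambda>i. restrict (\<lambda>i. Suc (s i)) {1..m} i - 1) {1..m} = s"
    proof (rule ext)
      fix i show "restrict (\<lambda>i. restrict (\<lambda>i. Suc (s i)) {1..m} i - 1) {1..m} i = s i"
        using s by (cases "i \<in> {1..m}") (auto simp: descent_seqs_def PiE_def extensional_def)
    qed
    show "restrict (\<lambda>i. Suc (s i)) {1..m} \<in> {s. s \<in> descent_seqs (Suc k) m D \<and> (\<forall>i\<in>{1..m}. s i > 0)}"
      using s by (auto simp: descent_seqs_def PiE_def Pi_def)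
    show "(\<Prod>i\<in>{1..m}. q ^ restrict (\<lambda>i. Suc (s i)) {1..m} i) = (\<Prod>i\<in>{1..m}. q ^ Suc (s i))"
      by (intro prod.cong) auto
  next
    fix s assume s: "s \<in> {s. s \<in> descent_seqs (Suc k) m D \<and> (\<forall>i\<in>{1..m}. s i > 0)}"
    show "restrict (\<lambda>i. Suc (restrict (\<lambda>i. s i - 1) {1..m} i)) {1..m} = s"
    proof (rule ext)
      fix i show "restrict (\<lambda>i. Suc (restrict (\<lambda>i. s i - 1) {1..m} i)) {1..m} i = s i"
        using s by (cases "i \<in> {1..m}") (auto simp: descent_seqs_def PiE_def extensional_def)
    qed
    show "restrict (\<lambda>i. s i - 1) {1..m} \<in> descent_seqs k m D"
    proof -
      have p: "s i > 0" if "i \<in> {1..m}" for i using s that by auto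
      have k: "s i - 1 < k" if "i \<in> {1..m}" for i
      proof -
        have "s i < Suc k" using s that unfolding descent_seqs_def by blast
        then show ?thesis using p[OF that] by linarith
      qed
      have "s (Suc i) - 1 \<le> s i - 1 \<and> (D i \<longrightarrow> s (Suc i) - 1 < s i - 1)" if i: "i \<in> {1..<m}" for i
      proof -
        have "s (Suc i) \<le> s i" "D i \<longrightarrow> s (Suc i) < s i" "s (Suc i) > 0" using s i p[of "Suc i"] unfolding descent_seqs_def by auto
        then show ?thesis by (auto intro: diff_less_mono)
      qed
      then show ?thesis using k by (auto simp: descent_seqs_def)
    qed
  qed
  finally show ?thesis by (simp add: mult.commute)
qed

lemma descent_sum_rec:
  "descent_sum q D (Suc m) (Suc k) = q ^ Suc m * descent_sum q D (Suc m) k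
     + (if m \<ge> 1 \<and> D m then q ^ m * descent_sum q D m k else descent_sum q D m (Suc k))"
proof -
  let ?W = "\<lambda>m s. \<Prod>i\<in>{1..m}. q ^ (s i :: nat)"
  have "descent_sum q D (Suc m) (Suc k) = (\<Sum>s | s \<in> descent_seqs (Suc k) (Suc m) D \<and> s (Suc m) > 0. ?W (Suc m) s)
      + (\<Sum>s | s \<in> descent_seqs (Suc k) (Suc m) D \<and> s (Suc m) = 0. ?W (Suc m) s)"
    unfolding descent_sum_def by (subst sum.union_disjoint[symmetric]) (auto intro!: sum.cong)
  also have "{s. s \<in> descent_seqs (Suc k) (Suc m) D \<and> s (Suc m) > 0} = {s. s \<in> descent_seqs (Suc k) (Suc m) D \<and> (\<forall>i\<in>{1..Suc m}. s i > 0)}"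
    using descent_seqs_antimono[of _ "Suc k" "Suc m" D _ "Suc m"] by (fastforce simp: Ball_def)
  also have "(\<Sum>s | s \<in> descent_seqs (Suc k) (Suc m) D \<and> (\<forall>i\<in>{1..Suc m}. s i > 0). ?W (Suc m) s) = q ^ Suc m * descent_sum q D (Suc m) k"
    by (rule descent_sum_shift)
  also have "(\<Sum>s | s \<in> descent_seqs (Suc k) (Suc m) D \<and> s (Suc m) = 0. ?W (Suc m) s)
     = (\<Sum>s | s \<in> descent_seqs (Suc k) m D \<and> (m \<ge> 1 \<and> D m \<longrightarrow> s m > 0). ?W m s)"
  proof (rule sum.reindex_bij_witness[where i = "\<lambda>s. s(Suc m := 0)" and j = "\<lambda>s. restrict s {1..m}"])
    fix s assume s: "s \<in> {s. s \<in> descent_seqs (Suc k) (Suc m) D \<and> s (Suc m) = 0}"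
    show "(restrict s {1..m})(Suc m := 0) = s"
    proof (rule ext)
      fix i show "((restrict s {1..m})(Suc m := 0)) i = s i"
        using s by (cases "i \<in> {1..m}") (auto simp: descent_seqs_def PiE_def extensional_def)
    qed
    have "m \<ge> 1 \<and> D m \<longrightarrow> s m > 0" using s by (auto simp: descent_seqs_def)
    moreover have "restrict s {1..m} \<in> descent_seqs (Suc k) m D" using s by (auto simp: descent_seqs_def PiE_def Pi_def)
    ultimately show "restrict s {1..m} \<in> {s. s \<in> descent_seqs (Suc k) m D \<and> (m \<ge> 1 \<and> D m \<longrightarrow> s m > 0)}" by auto
    show "?W m (restrict s {1..m}) = ?W (Suc m) s" using s by simp
  next
    fix s assume s: "s \<in> {s. s \<in> descent_seqs (Suc k) m D \<and> (m \<ge> 1 \<and> D m \<longrightarrow> s m > 0)}"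
    show "restrict (s(Suc m := 0)) {1..m} = s"
    proof (rule ext)
      fix i show "restrict (s(Suc m := 0)) {1..m} i = s i"
        using s by (cases "i \<in> {1..m}") (auto simp: descent_seqs_def PiE_def extensional_def)
    qed
    show "s(Suc m := 0) \<in> {s. s \<in> descent_seqs (Suc k) (Suc m) D \<and> s (Suc m) = 0}"
      using s by (auto simp: descent_seqs_def PiE_def Pi_def extensional_def less_Suc_eq)
  qed
  also have "\<dots> = (if m \<ge> 1 \<and> D m then q ^ m * descent_sum q D m k else descent_sum q D m (Suc k))"
  proof (cases "m \<ge> 1 \<and> D m")
    case True
    have "{s. s \<in> descent_seqs (Suc k) m D \<and> s m > 0} = {s. s \<in> descent_seqs (Suc k) m D \<and> (\<forall>i\<in>{1..m}. s i > 0)}"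
      using descent_seqs_antimono[of _ "Suc k" m D _ m] True by (fastforce simp: Ball_def)
    then show ?thesis using True descent_sum_shift[where k = k and m = m and D = D and q = q] by simp
  next
    case False
    then show ?thesis by (auto simp: descent_sum_def)
  qed
  finally show ?thesis .
qed

lemma linear_recurrence_limit:
  fixes x b :: "nat \<Rightarrow> real"
  assumes rec: "\<And>k. x (Suc k) = r * x k + b k" and b: "b \<longlonglongrightarrow> L" and r: "0 \<le> r" "r < 1"
  shows "x \<longlonglongrightarrow> L / (1 - r)"
proof -
  define y where "y k = x k - L / (1 - r)" for k
  have yrec: "y (Suc k) = r * y k + (b k - L)" for k
    using r by (simp add: y_def rec field_simps)
  have "y \<longlonglongrightarrow> 0"
  proof (rule LIMSEQ_I)
    fix \<epsilon> :: real assume \<epsilon>: "\<epsilon> > 0"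
    \<comment> \<open>Errors of size \<open>d\<close> accumulate to at most
      \<open>d / (1 - r)\<close>, which is \<open>\<epsilon> / 2\<close>.\<close>
    define d where "d = \<epsilon> * (1 - r) / 2"
    have d: "d > 0" using \<epsilon> r by (simp add: d_def)
    obtain N where N: "\<And>k. k \<ge> N \<Longrightarrow> \<bar>b k - L\<bar> < d"
      using LIMSEQ_D[OF b d] by auto
    have bd: "\<bar>y (N + j)\<bar> \<le> r ^ j * \<bar>y N\<bar> + \<epsilon> / 2" for j
    proof (induction j)
      case 0 then show ?case using \<epsilon> by simp
    next
      case (Suc j)
      have "\<bar>y (N + Suc j)\<bar> \<le> r * \<bar>y (N + j)\<bar> + d"
        using yrec[of "N + j"] N[of "N + j"] r abs_triangle_ineq[of "r * y (N + j)" "b (N + j) - L"] by (simp add: abs_mult)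
      also have "\<dots> \<le> r * (r ^ j * \<bar>y N\<bar> + \<epsilon> / 2) + d"
        using Suc r by (simp add: mult_left_mono)
      also have "\<dots> = r ^ Suc j * \<bar>y N\<bar> + \<epsilon> / 2" by (simp add: d_def field_simps)
      finally show ?case .
    qed
    have "(\<lambda>j. r ^ j * \<bar>y N\<bar>) \<longlonglongrightarrow> 0"
      using r by (intro tendsto_mult_left_zero LIMSEQ_realpow_zero) auto
    then obtain M where M: "\<And>j. j \<ge> M \<Longrightarrow> \<bar>r ^ j * \<bar>y N\<bar>\<bar> < \<epsilon> / 2"
      using LIMSEQ_D[of _ 0 "\<epsilon> / 2"] \<epsilon> by (metis diff_zero half_gt_zero real_norm_def)
    show "\<exists>no. \<forall>n\<ge>no. norm (y n - 0) < \<epsilon>"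
    proof (intro exI allI impI)
      fix n assume n: "n \<ge> N + M"
      have "\<bar>y n\<bar> \<le> r ^ (n - N) * \<bar>y N\<bar> + \<epsilon> / 2" using bd[of "n - N"] n by simp
      moreover have "\<bar>r ^ (n - N) * \<bar>y N\<bar>\<bar> < \<epsilon> / 2" using M[of "n - N"] n by simp
      ultimately show "norm (y n - 0) < \<epsilon>" unfolding real_norm_def by linarith
    qed
  qed
  then have "(\<lambda>k. y k + L / (1 - r)) \<longlonglongrightarrow> 0 + L / (1 - r)" by (intro tendsto_intros)
  then show ?thesis by (simp add: y_def)
qed

definition q_prod :: "real \<Rightarrow> nat \<Rightarrow> real" where
  "q_prod q n = (\<Prod>i\<in>{1..n}. 1 - q ^ i)"

lemma q_prod_Suc: "q_prod q (Suc n) = q_prod q n * (1 - q ^ Suc n)" and q_prod_0 [simp]: "q_prod q 0 = 1"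
  by (simp_all add: q_prod_def)

text \<open>In the limit \<open>descent_sum_rec\<close> reads \<open>x = q ^ Suc m * x + b\<close>,
  and a descent at \<open>m\<close> puts a factor \<open>q ^ m\<close> into \<open>b\<close>. The
  exponents add up to the major index, the denominators to \<open>q_prod\<close>.\<close>

lemma descent_sum_limit:
  assumes q: "0 < q" "q < 1"
  shows "descent_sum q D m \<longlonglongrightarrow> q ^ (\<Sum>i | i \<in> {1..m - 1} \<and> D i. i) / q_prod q m"
proof (induction m)
  case 0 then show ?case by (simp add: descent_sum_0[abs_def])
next
  case (Suc m)
  define L where "L = q ^ (\<Sum>i | i \<in> {1..m} \<and> D i. i) / q_prod q m"
  let ?b = "\<lambda>k. if m \<ge> 1 \<and> D m then q ^ m * descent_sum q D m k else descent_sum q D m (Suc k)"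
  have "?b \<longlonglongrightarrow> L"
  proof (cases "m \<ge> 1 \<and> D m")
    case True
    then have "{i. i \<in> {1..m} \<and> D i} = insert m {i. i \<in> {1..m - 1} \<and> D i}" "m \<notin> {i. i \<in> {1..m - 1} \<and> D i}" by auto
    then have "(\<Sum>i | i \<in> {1..m} \<and> D i. i) = m + (\<Sum>i | i \<in> {1..m - 1} \<and> D i. i)" by simp
    then have "L = q ^ m * (q ^ (\<Sum>i | i \<in> {1..m - 1} \<and> D i. i) / q_prod q m)" by (simp add: L_def power_add)
    then show ?thesis using True tendsto_mult[OF tendsto_const Suc, of "q ^ m"] by simp
  next
    case False
    then have "i \<in> {1..m} \<and> D i \<longleftrightarrow> i \<in> {1..m - 1} \<and> D i" for i
      by (cases "i = m") auto
    then have "L = q ^ (\<Sum>i | i \<in> {1..m - 1} \<and> D i. i) / q_prod q m" by (simp add: L_def)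
    then show ?thesis using LIMSEQ_Suc[OF Suc] unfolding if_not_P[OF False] by simp
  qed
  moreover have "0 \<le> q ^ Suc m" "q ^ Suc m < 1" using q by (simp_all add: power_Suc_less_one del: power_Suc)
  ultimately have "descent_sum q D (Suc m) \<longlonglongrightarrow> L / (1 - q ^ Suc m)"
    using descent_sum_rec by (intro linear_recurrence_limit[where b = ?b]) auto
  then show ?case by (simp add: L_def q_prod_Suc)
qed

text \<open>The coefficients are the complete homogeneous polynomials in
  \<open>s, s * q, ...\<close>. Adding a letter amounts to replacing \<open>fps_X\<close> by
  \<open>q\<close> times it and multiplying by one factor, which matches the shift by 1 in
  \<open>descent_sum_rec\<close>.\<close>

lemma inverse_lin_prod_nth: "inverse (lin_prod (\<lambda>i. q ^ i) k s) $ n = s ^ n * descent_sum q (\<lambda>_. False) n k"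
proof -
  define F where "F k = Abs_fps (\<lambda>n. s ^ n * descent_sum q (\<lambda>_. False) n k)" for k
  have P: "lin_prod (\<lambda>i. q ^ i) (Suc k) s = lin_fps s * (lin_prod (\<lambda>i. q ^ i) k s oo (fps_const q * fps_X))" for k
  proof (induction k)
    case 0 then show ?case by (simp add: lin_prod_Suc)
  next
    case (Suc k)
    have "lin_fps (s * q ^ k) oo (fps_const q * fps_X) = lin_fps (s * q ^ Suc k)"
      by (simp add: lin_fps_def fps_compose_sub_distrib fps_compose_mult_distrib mult_ac fps_const_mult[symmetric] del: fps_const_mult)
    then have "lin_prod (\<lambda>i. q ^ i) (Suc k) s oo (fps_const q * fps_X) = (lin_prod (\<lambda>i. q ^ i) k s oo (fps_const q * fps_X)) * lin_fps (s * q ^ Suc k)"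
      unfolding lin_prod_Suc[of _ k] by (simp add: fps_compose_mult_distrib)
    then show ?case
      unfolding lin_prod_Suc[of _ "Suc k"] using Suc by (simp only: mult.assoc)
  qed
  have "F k * lin_prod (\<lambda>i. q ^ i) k s = 1"
  proof (induction k)
    case 0
    have "F 0 = 1"
    proof (rule fps_ext)
      fix n show "F 0 $ n = 1 $ n" by (cases n) (simp_all add: F_def descent_sum_0 descent_sum_Suc_0)
    qed
    then show ?case by simp
  next
    case (Suc k)
    have "F (Suc k) * lin_fps s = F k oo (fps_const q * fps_X)"
    proof (rule fps_ext)
      fix n show "(F (Suc k) * lin_fps s) $ n = (F k oo (fps_const q * fps_X)) $ n"
      proof (cases n)
        case 0 then show ?thesis by (simp add: F_def descent_sum_0)
      next
        case (Suc n')
        have "F (Suc k) * lin_fps s = F (Suc k) - fps_const s * F (Suc k) * fps_X" by (simp add: lin_fps_def algebra_simps)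
        then have "(F (Suc k) * lin_fps s) $ n = s ^ n * descent_sum q (\<lambda>_. False) n (Suc k) - s * (s ^ n' * descent_sum q (\<lambda>_. False) n' (Suc k))"
          by (simp add: F_def Suc)
        also have "\<dots> = q ^ n * (s ^ n * descent_sum q (\<lambda>_. False) n k)"
          unfolding Suc descent_sum_rec by (simp add: algebra_simps)
        also have "\<dots> = (F k oo (fps_const q * fps_X)) $ n"
          by (simp add: F_def fps_compose_linear)
        finally show ?thesis .
      qed
    qed
    then have "F (Suc k) * lin_prod (\<lambda>i. q ^ i) (Suc k) s = (F k * lin_prod (\<lambda>i. q ^ i) k s) oo (fps_const q * fps_X)"
      unfolding P by (simp add: fps_compose_mult_distrib mult.assoc[symmetric])
    then show ?case using Suc by simp
  qed
  then have "inverse (lin_prod (\<lambda>i. q ^ i) k s) = F k"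
    by (metis fps_inverse_unique mult.commute)
  then show ?thesis by (simp add: F_def)
qed

text \<open>If \<open>s i = 0\<close>, then \<open>s\<close> vanishes from \<open>i\<close> on and
  \<open>\<sigma>\<close> increases there; with \<open>\<sigma> i > i\<close> it would inject
  \<open>{i..n}\<close> into \<open>{Suc i..n}\<close>. Hence the exponent \<open>s i - 1\<close> in
  the weight of an excedance is never truncated.\<close>

lemma compatible_exc_pos:
  assumes s: "s \<in> compatible k n \<sigma>" and p: "\<sigma> permutes {1..n}" and i: "i \<in> {1..n}" and ex: "\<sigma> i > i"
  shows "s i > 0"
proof (rule ccontr)
  assume "\<not> s i > 0"
  then have s0: "s i = 0" by simp
  have "\<sigma> j \<in> {Suc i..n}" if "j \<in> {i..n}" for j
  proof -
    have j: "j \<in> {1..n}" using that i by auto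
    have "\<sigma> j \<ge> \<sigma> i"
      using compatible_lt[OF s p, of i j] that i s0 by (cases "i = j") auto
    moreover have "\<sigma> j \<in> {1..n}" using j permutes_in_image[OF p] by blast
    ultimately show ?thesis using ex by auto
  qed
  then have "\<sigma> ` {i..n} \<subseteq> {Suc i..n}" by auto
  then have "card (\<sigma> ` {i..n}) \<le> card {Suc i..n}" by (intro card_mono) auto
  moreover have "card (\<sigma> ` {i..n}) = card {i..n}"
    by (rule card_image) (rule inj_on_subset[OF permutes_inj[OF p]], simp)
  ultimately show False using i unfolding card_atLeastAtMost atLeastAtMost_iff by linarith
qed

definition exmaj_poly :: "real \<Rightarrow> real \<Rightarrow> real \<Rightarrow> nat \<Rightarrow> real" where
  "exmaj_poly q t R n = (\<Sum>\<sigma> | \<sigma> permutes {1..n}. q ^ maj n \<sigma> * (t / q) ^ exc n \<sigma> * R ^ fixpts n \<sigma>)"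

lemma Phi_perm_weights:
  assumes q: "q \<noteq> 0"
  shows "Phi (\<lambda>i. q ^ i) (\<lambda>i. t * q ^ (i - 1)) R k 0 n
   = (\<Sum>\<sigma> | \<sigma> permutes {1..n}. (t / q) ^ exc n \<sigma> * R ^ fixpts n \<sigma> * descent_sum q (\<lambda>i. \<sigma> (Suc i) < \<sigma> i) n k)"
proof -
  have "(\<Sum>s\<in>compatible k n \<sigma>. \<Prod>i\<in>{1..n}. letter_weight (\<lambda>i. q ^ i) (\<lambda>i. t * q ^ (i - 1)) R (s i) (int (\<sigma> i) - int i))
     = (t / q) ^ exc n \<sigma> * R ^ fixpts n \<sigma> * descent_sum q (\<lambda>i. \<sigma> (Suc i) < \<sigma> i) n k" if p: "\<sigma> permutes {1..n}" for \<sigma>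
  proof -
    have "(\<Prod>i\<in>{1..n}. letter_weight (\<lambda>i. q ^ i) (\<lambda>i. t * q ^ (i - 1)) R (s i) (int (\<sigma> i) - int i))
      = (t / q) ^ exc n \<sigma> * R ^ fixpts n \<sigma> * (\<Prod>i\<in>{1..n}. q ^ s i)" if s: "s \<in> compatible k n \<sigma>" for s
    proof -
      have "(\<Prod>i\<in>{1..n}. letter_weight (\<lambda>i. q ^ i) (\<lambda>i. t * q ^ (i - 1)) R (s i) (int (\<sigma> i) - int i))
        = (\<Prod>i\<in>{1..n}. (if \<sigma> i > i then t / q else 1) * (if \<sigma> i = i then R else 1) * q ^ s i)"
      proof (rule prod.cong[OF refl])
        fix i assume i: "i \<in> {1..n}"
        show "letter_weight (\<lambda>i. q ^ i) (\<lambda>i. t * q ^ (i - 1)) R (s i) (int (\<sigma> i) - int i)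
          = (if \<sigma> i > i then t / q else 1) * (if \<sigma> i = i then R else 1) * q ^ s i"
        proof (cases "\<sigma> i > i")
          case True
          then obtain s' where "s i = Suc s'" using compatible_exc_pos[OF s p i] by (metis gr0_implies_Suc)
          then show ?thesis using True q by (simp add: letter_weight_def)
        next
          case False
          then show ?thesis by (auto simp: letter_weight_def)
        qed
      qed
      also have "\<dots> = (\<Prod>i\<in>{1..n}. if \<sigma> i > i then t / q else 1) * (\<Prod>i\<in>{1..n}. if \<sigma> i = i then R else 1) * (\<Prod>i\<in>{1..n}. q ^ s i)"
        by (simp add: prod.distrib)
      also have "(\<Prod>i\<in>{1..n}. if \<sigma> i > i then t / q else 1) = (t / q) ^ exc n \<sigma>"
        unfolding exc_def by (subst prod.inter_filter[symmetric]) auto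
      also have "(\<Prod>i\<in>{1..n}. if \<sigma> i = i then R else 1) = R ^ fixpts n \<sigma>"
        unfolding fixpts_def by (subst prod.inter_filter[symmetric]) auto
      finally show ?thesis .
    qed
    moreover have "compatible k n \<sigma> = descent_seqs k n (\<lambda>i. \<sigma> (Suc i) < \<sigma> i)"
      by (simp add: compatible_def descent_seqs_def)
    ultimately show ?thesis by (simp add: descent_sum_def sum_distrib_left)
  qed
  then show ?thesis unfolding Phi_permutations by (intro sum.cong) auto
qed

text \<open>Each coefficient in \<open>Phi_fps_closed\<close> converges as the alphabet grows, and
  the limit of a compatible sum carries \<open>q ^ maj\<close>. The convergence is what restricts
  \<open>q\<close> to the unit interval.\<close>

lemma exmaj_poly_identity_unit:
  assumes q: "0 < q" "q < 1"
  shows "(\<Sum>j\<le>n. exmaj_poly q t R j / q_prod q j * ((t ^ (n - j) - t) / q_prod q (n - j))) = (1 - t) * R ^ n / q_prod q n"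
proof -
  let ?x = "\<lambda>i. q ^ i" and ?e = "\<lambda>i. t * q ^ (i - 1)"
  have eq: "(\<Sum>j\<le>n. Phi ?x ?e R (Suc k) 0 j * ((t ^ (n - j) - t) * descent_sum q (\<lambda>_. False) (n - j) k))
     = (1 - t) * R ^ n * descent_sum q (\<lambda>_. False) n (Suc k)" for k
  proof -
    have d: "(inverse (lin_prod ?x k t) - fps_const t * inverse (lin_prod ?x k 1)) $ m = (t ^ m - t) * descent_sum q (\<lambda>_. False) m k" for m
      by (simp add: inverse_lin_prod_nth algebra_simps)
    have "(Phi_fps ?x ?e R (Suc k) 0 * (inverse (lin_prod ?x k t) - fps_const t * inverse (lin_prod ?x k 1))) $ n
      = (fps_const (1 - t) * inverse (lin_prod ?x (Suc k) R)) $ n"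
      using Phi_fps_closed[of ?x t R k] by simp
    then show ?thesis
      unfolding fps_mult_nth[of "Phi_fps ?x ?e R (Suc k) 0"] d
      by (simp add: inverse_lin_prod_nth atLeast0AtMost Phi_fps_def mult.assoc)
  qed
  have lim0: "descent_sum q (\<lambda>_. False) m \<longlonglongrightarrow> 1 / q_prod q m" for m
    using descent_sum_limit[OF q, of "\<lambda>_. False" m] by simp
  have limP: "(\<lambda>k. Phi ?x ?e R k 0 j) \<longlonglongrightarrow> exmaj_poly q t R j / q_prod q j" for j
  proof -
    have "(\<lambda>k. Phi ?x ?e R k 0 j) \<longlonglongrightarrow> (\<Sum>\<sigma> | \<sigma> permutes {1..j}. (t / q) ^ exc j \<sigma> * R ^ fixpts j \<sigma> * (q ^ maj j \<sigma> / q_prod q j))"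
    proof -
      have "q \<noteq> 0" using q by simp
      show ?thesis
        unfolding Phi_perm_weights[OF \<open>q \<noteq> 0\<close>]
      proof (intro tendsto_intros)
        fix \<sigma> :: "nat \<Rightarrow> nat"
        have "maj j \<sigma> = (\<Sum>i | i \<in> {1..j - 1} \<and> \<sigma> (Suc i) < \<sigma> i. i)"
          unfolding maj_def by simp
        then show "descent_sum q (\<lambda>i. \<sigma> (Suc i) < \<sigma> i) j \<longlonglongrightarrow> q ^ maj j \<sigma> / q_prod q j"
          using descent_sum_limit[OF q, of "\<lambda>i. \<sigma> (Suc i) < \<sigma> i" j] by simp
      qed
    qed
    then show ?thesis by (simp add: exmaj_poly_def sum_divide_distrib mult_ac)
  qed
  have "(\<lambda>k. \<Sum>j\<le>n. Phi ?x ?e R (Suc k) 0 j * ((t ^ (n - j) - t) * descent_sum q (\<lambda>_. False) (n - j) k))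
    \<longlonglongrightarrow> (\<Sum>j\<le>n. exmaj_poly q t R j / q_prod q j * ((t ^ (n - j) - t) * (1 / q_prod q (n - j))))"
    by (intro tendsto_intros LIMSEQ_Suc[OF limP] lim0)
  moreover have "(\<lambda>k. (1 - t) * R ^ n * descent_sum q (\<lambda>_. False) n (Suc k)) \<longlonglongrightarrow> (1 - t) * R ^ n * (1 / q_prod q n)"
    by (intro tendsto_intros LIMSEQ_Suc[OF lim0])
  ultimately have "(\<Sum>j\<le>n. exmaj_poly q t R j / q_prod q j * ((t ^ (n - j) - t) * (1 / q_prod q (n - j)))) = (1 - t) * R ^ n * (1 / q_prod q n)"
    unfolding eq by (rule LIMSEQ_unique)
  then show ?thesis by simp
qed

lemma finite_perms [simp]: "finite {\<sigma>. \<sigma> permutes {1..n::nat}}"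
  by (simp add: finite_permutations)

lemma exc_le: "exc n \<sigma> \<le> n"
proof -
  have "exc n \<sigma> \<le> card {1..n}" unfolding exc_def by (intro card_mono) auto
  then show ?thesis by simp
qed

lemma exc_fix_le: "exc n \<sigma> + fixpts n \<sigma> \<le> n"
proof -
  have "exc n \<sigma> + fixpts n \<sigma> = card ({i \<in> {1..n}. \<sigma> i > i} \<union> {i \<in> {1..n}. \<sigma> i = i})"
    unfolding exc_def fixpts_def by (subst card_Un_disjoint) auto
  also have "\<dots> \<le> card {1..n}" by (intro card_mono) auto
  finally show ?thesis by simp
qed

section \<open>Gaussian binomials and the permutation identity\<close>

fun gauss_binomial :: "real \<Rightarrow> nat \<Rightarrow> nat \<Rightarrow> real" where
  "gauss_binomial q n 0 = 1"
| "gauss_binomial q 0 (Suc k) = 0"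
| "gauss_binomial q (Suc n) (Suc k) = gauss_binomial q n k + q ^ Suc k * gauss_binomial q n (Suc k)"

lemma gauss_binomial_eq_0: "k > n \<Longrightarrow> gauss_binomial q n k = 0"
  by (induction q n k rule: gauss_binomial.induct) auto

lemma gauss_binomial_n_n: "gauss_binomial q n n = 1"
  by (induction n) (auto simp: gauss_binomial_eq_0)

lemma gauss_binomial_q_prod: "gauss_binomial q (k + m) k * q_prod q k * q_prod q m = q_prod q (k + m)"
proof (induction "k + m" arbitrary: k m)
  case 0 then show ?case by simp
next
  case (Suc n)
  show ?case
  proof (cases k)
    case 0 then show ?thesis by simp
  next
    case (Suc k')
    have n: "n = k' + m" using Suc Suc.hyps(2) by simp
    have 1: "gauss_binomial q n k' * q_prod q k' * q_prod q m = q_prod q n" using Suc.hyps(1)[OF n] n by simp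
    have 2: "gauss_binomial q n (Suc k') * q_prod q (Suc k') * q_prod q m = (1 - q ^ m) * q_prod q n"
    proof (cases m)
      case 0 then show ?thesis using n by (simp add: gauss_binomial_eq_0)
    next
      case (Suc m')
      have "gauss_binomial q n (Suc k') * q_prod q (Suc k') * q_prod q m' = q_prod q n"
        using Suc.hyps(1)[of "Suc k'" m'] Suc n by simp
      then show ?thesis unfolding Suc q_prod_Suc[of q m'] by (simp add: mult_ac)
    qed
    have "gauss_binomial q (Suc n) (Suc k') * q_prod q (Suc k') * q_prod q m
       = gauss_binomial q n k' * q_prod q k' * q_prod q m * (1 - q ^ Suc k') + q ^ Suc k' * (gauss_binomial q n (Suc k') * q_prod q (Suc k') * q_prod q m)"
      by (simp add: q_prod_Suc algebra_simps)
    also have "\<dots> = q_prod q n * (1 - q ^ (Suc k' + m))"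
      unfolding 1 2 by (simp add: algebra_simps power_add)
    also have "\<dots> = q_prod q (Suc n)" unfolding q_prod_Suc using n by simp
    finally show ?thesis using Suc n by simp
  qed
qed

lemma q_prod_nonzero: "0 < q \<Longrightarrow> q \<noteq> 1 \<Longrightarrow> q_prod q n \<noteq> 0"
proof (induction n)
  case (Suc n)
  have "q ^ Suc n \<noteq> 1" using Suc.prems by (metis power_eq_1_iff abs_of_pos real_norm_def nat.distinct(1))
  then show ?case using Suc by (simp add: q_prod_Suc)
qed simp

lemma gauss_binomial_div:
  assumes "0 < q" "q \<noteq> 1"
  shows "gauss_binomial q (k + m) k = q_prod q (k + m) / (q_prod q k * q_prod q m)"
  using gauss_binomial_q_prod[of q k m] q_prod_nonzero[OF assms] by (simp add: field_simps)

lemma real_polynomial_zero: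
  fixes f :: "real \<Rightarrow> real"
  assumes f: "real_polynomial_function f" and S: "infinite S" and z: "\<And>x. x \<in> S \<Longrightarrow> f x = 0"
  shows "f x = 0"
proof -
  obtain a n where fa: "f = (\<lambda>x. \<Sum>i\<le>n. a i * x ^ i)"
    using f real_polynomial_function_iff_sum by blast
  have "S \<subseteq> {x. (\<Sum>i\<le>n. a i * x ^ i) = 0}" using z fa by auto
  then have "\<not> finite {x. (\<Sum>i\<le>n. a i * x ^ i) = 0}" using S finite_subset by blast
  then have "\<forall>i\<le>n. a i = 0" using polyfun_finite_roots by blast
  then show ?thesis by (simp add: fa)
qed

lemma real_poly_id: "real_polynomial_function (\<lambda>x :: real. x)"
  by (rule real_polynomial_function.intros(1)) (rule bounded_linear_ident)

lemma real_poly_gauss_binomial: "real_polynomial_function (\<lambda>q. gauss_binomial q n k)"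
proof (induction n arbitrary: k)
  case 0 then show ?case by (cases k) auto
next
  case (Suc n)
  show ?case
  proof (cases k)
    case (Suc k')
    have "real_polynomial_function (\<lambda>q. gauss_binomial q n k' + q ^ Suc k' * gauss_binomial q n (Suc k'))"
      by (intro real_polynomial_function.intros(3) real_polynomial_function.intros(4) real_polynomial_function_power real_poly_id Suc.IH)
    then show ?thesis by (simp add: Suc)
  qed auto
qed

text \<open>Gaussian binomials absorb the denominators \<open>q_prod\<close>, and a factor
  \<open>q ^ n\<close> removes the negative powers. The difference is then a polynomial in
  \<open>q\<close> with infinitely many zeros in the unit interval, so it vanishes for all
  \<open>q\<close>, in particular for field sizes.\<close>

lemma exmaj_poly_identity:
  assumes q: "0 < q"
  shows "(\<Sum>j\<le>n. exmaj_poly q t R j * gauss_binomial q n j * (t ^ (n - j) - t)) = (1 - t) * R ^ n"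
proof -
  define E where "E q j = (\<Sum>\<sigma> | \<sigma> permutes {1..j}. q ^ (maj j \<sigma> + (n - exc j \<sigma>)) * t ^ exc j \<sigma> * R ^ fixpts j \<sigma>)" for q j
  have E: "exmaj_poly q t R j * q ^ n = E q j" if "q > 0" "j \<le> n" for q j
    unfolding exmaj_poly_def E_def sum_distrib_right
  proof (rule sum.cong[OF refl])
    fix \<sigma>
    have "q ^ n = q ^ exc j \<sigma> * q ^ (n - exc j \<sigma>)"
      using exc_le[of j \<sigma>] that(2) by (simp add: power_add[symmetric])
    then show "q ^ maj j \<sigma> * (t / q) ^ exc j \<sigma> * R ^ fixpts j \<sigma> * q ^ n = q ^ (maj j \<sigma> + (n - exc j \<sigma>)) * t ^ exc j \<sigma> * R ^ fixpts j \<sigma>"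
      using that(1) by (simp add: power_add power_divide)
  qed
  define f where "f q = (\<Sum>j\<le>n. E q j * gauss_binomial q n j * (t ^ (n - j) - t)) - (1 - t) * R ^ n * q ^ n" for q
  have rf: "real_polynomial_function f"
    unfolding f_def[abs_def] E_def
    by (intro real_polynomial_function_diff real_polynomial_function_sum real_polynomial_function.intros(4)
        real_polynomial_function_power real_poly_id real_poly_gauss_binomial real_polynomial_function.intros(2) finite_perms finite_atMost)
  have fx: "f q = ((\<Sum>j\<le>n. exmaj_poly q t R j * gauss_binomial q n j * (t ^ (n - j) - t)) - (1 - t) * R ^ n) * q ^ n" if "q > 0" for q
  proof -
    have "(\<Sum>j\<le>n. E q j * gauss_binomial q n j * (t ^ (n - j) - t)) = (\<Sum>j\<le>n. exmaj_poly q t R j * gauss_binomial q n j * (t ^ (n - j) - t)) * q ^ n"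
      unfolding sum_distrib_right using E[OF that] by (intro sum.cong) (auto simp: mult_ac)
    then show ?thesis by (simp add: f_def left_diff_distrib)
  qed
  have unit: "f q = 0" if q: "q \<in> {0<..<1}" for q
  proof -
    have q': "0 < q" "q < 1" using that by auto
    have "exmaj_poly q t R j * gauss_binomial q n j * (t ^ (n - j) - t) = q_prod q n * (exmaj_poly q t R j / q_prod q j * ((t ^ (n - j) - t) / q_prod q (n - j)))"
      if "j \<in> {..n}" for j
      using gauss_binomial_div[of q j "n - j"] q' that by simp
    then have "(\<Sum>j\<le>n. exmaj_poly q t R j * gauss_binomial q n j * (t ^ (n - j) - t)) = q_prod q n * (\<Sum>j\<le>n. exmaj_poly q t R j / q_prod q j * ((t ^ (n - j) - t) / q_prod q (n - j)))"
      unfolding sum_distrib_left by (rule sum.cong[OF refl])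
    also have "\<dots> = (1 - t) * R ^ n"
      unfolding exmaj_poly_identity_unit[OF q'] using q_prod_nonzero[of q n] q' by simp
    finally show ?thesis using fx q' by simp
  qed
  have "f q = 0"
    by (rule real_polynomial_zero[where S = "{0<..<1}", OF rf _ unit]) (simp_all add: infinite_Ioo)
  then show ?thesis using fx[OF q] q by simp
qed

text \<open>Enumerates the exponents allowed at a flat whose rank exceeds that of its predecessor by
  \<open>m\<close>.\<close>

definition geom_gap :: "real \<Rightarrow> nat \<Rightarrow> real" where
  "geom_gap t m = (\<Sum>i\<in>{1..<m}. t ^ i)"

lemma geom_gap_geometric: "m \<ge> 1 \<Longrightarrow> (1 - t) * geom_gap t m = t - t ^ m"
proof (induction m rule: dec_induct)
  case base show ?case by (simp add: geom_gap_def)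
next
  case (step m)
  then have "geom_gap t (Suc m) = geom_gap t m + t ^ m" by (simp add: geom_gap_def)
  then have "(1 - t) * geom_gap t (Suc m) = (1 - t) * geom_gap t m + (1 - t) * t ^ m" by (simp add: ring_distribs)
  then show ?case unfolding step.IH by (simp add: left_diff_distrib)
qed

text \<open>The summand \<open>j = n\<close> of the identity has the factor \<open>1 - t\<close>,
  and by \<open>geom_gap_geometric\<close> so have all others; dividing by it isolates
  \<open>exmaj_poly q t R n\<close>.\<close>

lemma exmaj_poly_rec:
  assumes q: "0 < q" and t: "t \<noteq> 1"
  shows "exmaj_poly q t R n = R ^ n + (\<Sum>j<n. gauss_binomial q n j * exmaj_poly q t R j * geom_gap t (n - j))"
proof -
  have "(\<Sum>j<n. exmaj_poly q t R j * gauss_binomial q n j * (t ^ (n - j) - t)) = - (1 - t) * (\<Sum>j<n. gauss_binomial q n j * exmaj_poly q t R j * geom_gap t (n - j))"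
    unfolding sum_distrib_left
  proof (rule sum.cong[OF refl])
    fix j assume "j \<in> {..<n}"
    then have "t ^ (n - j) - t = - ((1 - t) * geom_gap t (n - j))" by (simp add: geom_gap_geometric)
    then show "exmaj_poly q t R j * gauss_binomial q n j * (t ^ (n - j) - t) = - (1 - t) * (gauss_binomial q n j * exmaj_poly q t R j * geom_gap t (n - j))"
      by (simp only:) (simp add: algebra_simps)
  qed
  moreover have "(\<Sum>j\<le>n. exmaj_poly q t R j * gauss_binomial q n j * (t ^ (n - j) - t))
     = (\<Sum>j<n. exmaj_poly q t R j * gauss_binomial q n j * (t ^ (n - j) - t)) + exmaj_poly q t R n * (1 - t)"
    by (simp add: lessThan_Suc_atMost[symmetric] gauss_binomial_n_n)
  ultimately have "(1 - t) * (exmaj_poly q t R n - (\<Sum>j<n. gauss_binomial q n j * exmaj_poly q t R j * geom_gap t (n - j))) = (1 - t) * R ^ n"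
    using exmaj_poly_identity[OF q, of t R n] by (simp add: algebra_simps)
  then show ?thesis using t by simp
qed

text \<open>By \<open>perm_fix_derange_poly\<close> with \<open>m = 0\<close> these are the
  q-Eulerian polynomials of derangements. The same recursion will appear for flats.\<close>

fun derange_poly :: "real \<Rightarrow> real \<Rightarrow> nat \<Rightarrow> real" where
  "derange_poly q t n = (if n = 0 then 1 else \<Sum>k\<in>{..<n}. gauss_binomial q n k * derange_poly q t k * geom_gap t (n - k))"

declare derange_poly.simps [simp del]

lemma derange_poly_0 [simp]: "derange_poly q t 0 = 1" by (simp add: derange_poly.simps)

lemma derange_poly_rec: "n > 0 \<Longrightarrow> derange_poly q t n = (\<Sum>k<n. gauss_binomial q n k * derange_poly q t k * geom_gap t (n - k))"
  by (subst derange_poly.simps) simp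

text \<open>Inserting the convolution into \<open>exmaj_poly_rec\<close> and exchanging the sums
  reproduces the recursion of \<open>derange_poly\<close> at \<open>n - m\<close>. The exchange
  rests on \<open>tri\<close>, the trinomial revision for Gaussian binomials; the summand
  \<open>m = n\<close> is the free term \<open>R ^ n\<close>.\<close>

lemma exmaj_poly_derange_poly:
  assumes q: "1 < q" and t: "t \<noteq> 1"
  shows "exmaj_poly q t R n = (\<Sum>m\<le>n. gauss_binomial q n m * R ^ m * derange_poly q t (n - m))"
proof (induction n rule: less_induct)
  case (less n)
  have gb': "gauss_binomial q (a + b) a = q_prod q (a + b) / (q_prod q a * q_prod q b)" for a b
    using gauss_binomial_div[of q a b] q by simp
  have nz: "q_prod q i \<noteq> 0" for i using q_prod_nonzero[of q i] q by simp
  have tri: "gauss_binomial q n j * gauss_binomial q j m = gauss_binomial q n m * gauss_binomial q (n - m) (j - m)" if "m \<le> j" "j \<le> n" for j m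
    using gb'[of j "n - j"] gb'[of m "j - m"] gb'[of m "n - m"] gb'[of "j - m" "n - j"] that nz by simp
  have "exmaj_poly q t R n = R ^ n + (\<Sum>j<n. gauss_binomial q n j * (\<Sum>m\<le>j. gauss_binomial q j m * R ^ m * derange_poly q t (j - m)) * geom_gap t (n - j))"
    using exmaj_poly_rec[of q t R n] q t less by simp
  also have "(\<Sum>j<n. gauss_binomial q n j * (\<Sum>m\<le>j. gauss_binomial q j m * R ^ m * derange_poly q t (j - m)) * geom_gap t (n - j))
     = (\<Sum>j<n. \<Sum>m\<le>j. gauss_binomial q n m * R ^ m * (gauss_binomial q (n - m) (j - m) * derange_poly q t (j - m) * geom_gap t (n - j)))"
    unfolding sum_distrib_left sum_distrib_right
  proof (intro sum.cong refl)
    fix j m assume "j \<in> {..<n}" "m \<in> {..j}"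
    then have eq: "gauss_binomial q n j * gauss_binomial q j m = gauss_binomial q n m * gauss_binomial q (n - m) (j - m)" using tri by simp
    have "gauss_binomial q n j * (gauss_binomial q j m * R ^ m * derange_poly q t (j - m)) * geom_gap t (n - j) = (gauss_binomial q n j * gauss_binomial q j m) * (R ^ m * derange_poly q t (j - m) * geom_gap t (n - j))"
      by (simp only: mult_ac)
    then show "gauss_binomial q n j * (gauss_binomial q j m * R ^ m * derange_poly q t (j - m)) * geom_gap t (n - j) = gauss_binomial q n m * R ^ m * (gauss_binomial q (n - m) (j - m) * derange_poly q t (j - m) * geom_gap t (n - j))"
      unfolding eq by (simp only: mult_ac)
  qed
  also have "\<dots> = (\<Sum>m<n. \<Sum>k<n - m. gauss_binomial q n m * R ^ m * (gauss_binomial q (n - m) k * derange_poly q t k * geom_gap t (n - m - k)))"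
  proof -
    have "(\<Sum>j<n. \<Sum>m\<le>j. gauss_binomial q n m * R ^ m * (gauss_binomial q (n - m) (j - m) * derange_poly q t (j - m) * geom_gap t (n - j)))
      = (\<Sum>(j, m)\<in>(SIGMA j:{..<n}. {..j}). gauss_binomial q n m * R ^ m * (gauss_binomial q (n - m) (j - m) * derange_poly q t (j - m) * geom_gap t (n - j)))"
      by (rule sum.Sigma) auto
    also have "\<dots> = (\<Sum>(m, k)\<in>(SIGMA m:{..<n}. {..<n - m}). gauss_binomial q n m * R ^ m * (gauss_binomial q (n - m) k * derange_poly q t k * geom_gap t (n - m - k)))"
      by (rule sum.reindex_bij_witness[where i = "\<lambda>(m, k). (m + k, m)" and j = "\<lambda>(j, m). (m, j - m)"]) auto
    also have "\<dots> = (\<Sum>m<n. \<Sum>k<n - m. gauss_binomial q n m * R ^ m * (gauss_binomial q (n - m) k * derange_poly q t k * geom_gap t (n - m - k)))"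
      by (rule sum.Sigma[symmetric]) auto
    finally show ?thesis .
  qed
  also have "\<dots> = (\<Sum>m<n. gauss_binomial q n m * R ^ m * derange_poly q t (n - m))"
    unfolding sum_distrib_left[symmetric]
  proof (rule sum.cong[OF refl])
    fix m assume "m \<in> {..<n}"
    then have "derange_poly q t (n - m) = (\<Sum>k<n - m. gauss_binomial q (n - m) k * derange_poly q t k * geom_gap t (n - m - k))" by (intro derange_poly_rec) simp
    then show "gauss_binomial q n m * R ^ m * (\<Sum>k<n - m. gauss_binomial q (n - m) k * derange_poly q t k * geom_gap t (n - m - k)) = gauss_binomial q n m * R ^ m * derange_poly q t (n - m)" by simp
  qed
  finally show ?case by (simp add: lessThan_Suc_atMost[symmetric] gauss_binomial_n_n)
qed

text \<open>\<open>R\<close> marks fixed points, so an identity that holds for all \<open>R\<close>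
  can be compared coefficient by coefficient.\<close>

lemma perm_fix_derange_poly:
  assumes q: "1 < q" and t: "t \<noteq> 1" and m: "m \<le> n"
  shows "(\<Sum>\<sigma> | \<sigma> permutes {1..n} \<and> fixpts n \<sigma> = m. q ^ maj n \<sigma> * (t / q) ^ exc n \<sigma>) = gauss_binomial q n m * derange_poly q t (n - m)"
proof -
  define E where "E m = (\<Sum>\<sigma> | \<sigma> permutes {1..n} \<and> fixpts n \<sigma> = m. q ^ maj n \<sigma> * (t / q) ^ exc n \<sigma>)" for m
  have "exmaj_poly q t R n = (\<Sum>m\<le>n. E m * R ^ m)" for R
  proof -
    have f: "fixpts n \<sigma> \<le> n" for \<sigma> using exc_fix_le[of n \<sigma>] by simp
    have "exmaj_poly q t R n = (\<Sum>m\<le>n. \<Sum>\<sigma> | \<sigma> \<in> {\<sigma>. \<sigma> permutes {1..n}} \<and> fixpts n \<sigma> = m. q ^ maj n \<sigma> * (t / q) ^ exc n \<sigma> * R ^ fixpts n \<sigma>)"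
      unfolding exmaj_poly_def by (rule sum.group[symmetric, OF finite_perms]) (use f in auto)
    also have "\<dots> = (\<Sum>m\<le>n. E m * R ^ m)"
      unfolding E_def sum_distrib_right by (intro sum.cong) auto
    finally show ?thesis .
  qed
  then have "\<forall>R. (\<Sum>m\<le>n. E m * R ^ m) = (\<Sum>m\<le>n. (gauss_binomial q n m * derange_poly q t (n - m)) * R ^ m)"
    using exmaj_poly_derange_poly[OF q t, of _ n] by (simp add: mult_ac)
  then have "\<forall>i\<le>n. E i = gauss_binomial q n i * derange_poly q t (n - i)"
    by (simp only: polyfun_eq_coeffs)
  then show ?thesis using m unfolding E_def by blast
qed

lemma geom_gap_symmetric: "t \<noteq> 0 \<Longrightarrow> t ^ m * geom_gap (1 / t) m = geom_gap t m"
proof -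
  assume t: "t \<noteq> 0"
  have "t ^ m * geom_gap (1 / t) m = (\<Sum>i\<in>{1..<m}. t ^ (m - i))"
    unfolding geom_gap_def sum_distrib_left using t by (intro sum.cong) (auto simp: power_divide power_diff)
  also have "\<dots> = geom_gap t m"
    unfolding geom_gap_def by (rule sum.reindex_bij_witness[where i = "\<lambda>i. m - i" and j = "\<lambda>i. m - i"]) auto
  finally show ?thesis .
qed

text \<open>Palindromicity passes from \<open>geom_gap\<close> through the recursion, because
  \<open>t ^ n\<close> splits into \<open>t ^ k\<close> and \<open>t ^ (n - k)\<close>.\<close>

lemma derange_poly_symmetric: "t \<noteq> 0 \<Longrightarrow> t ^ n * derange_poly q (1 / t) n = derange_poly q t n"
proof (induction n rule: less_induct)
  case (less n)
  show ?case
  proof (cases "n = 0")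
    case False
    have "t ^ n * derange_poly q (1 / t) n = (\<Sum>k<n. gauss_binomial q n k * (t ^ k * derange_poly q (1 / t) k) * (t ^ (n - k) * geom_gap (1 / t) (n - k)))"
      using False by (simp add: derange_poly_rec sum_distrib_left) (intro sum.cong refl, simp add: power_add[symmetric] mult_ac)
    also have "\<dots> = (\<Sum>k<n. gauss_binomial q n k * derange_poly q t k * geom_gap t (n - k))"
      using less geom_gap_symmetric[OF less.prems] by (intro sum.cong) auto
    finally show ?thesis using False by (simp add: derange_poly_rec)
  qed simp
qed

lemma gauss_binomial_symmetric:
  assumes "1 < q" "k \<le> n" shows "gauss_binomial q n (n - k) = gauss_binomial q n k"
  using gauss_binomial_div[of q k "n - k"] gauss_binomial_div[of q "n - k" k] assms by (simp add: mult.commute)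

text \<open>Let \<open>S m\<close> be the left side with \<open>m\<close> in place of
  \<open>r\<close>. Then \<open>S n\<close> is the sum over all permutations, and the increment from
  \<open>S j\<close> to \<open>S (Suc j)\<close> is the \<open>j\<close>-th subtracted sum. The
  claim is the telescoping from \<open>r\<close> to \<open>n\<close>.\<close>

theorem hilbert_identity:
  assumes q: "1 < q" and t: "t \<noteq> 0" "t \<noteq> 1" and r: "1 \<le> r" "r \<le> n"
  shows "(\<Sum>k<r. gauss_binomial q n k * derange_poly q t k * (\<Sum>i<r - k. t ^ i))
    = (\<Sum>\<sigma> | \<sigma> permutes {1..n}. q ^ maj n \<sigma> * (t / q) ^ exc n \<sigma>)
      - (\<Sum>j\<in>{r..n - 1}. \<Sum>\<sigma> | \<sigma> permutes {1..n} \<and> n - j \<le> fixpts n \<sigma>. q ^ maj n \<sigma> * (1 / t / q) ^ exc n \<sigma> * t ^ j)"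
proof -
  have a: "(\<Sum>\<sigma> | \<sigma> permutes {1..n}. q ^ maj n \<sigma> * (t / q) ^ exc n \<sigma>) = (\<Sum>k\<le>n. gauss_binomial q n k * derange_poly q t k)"
  proof -
    have "(\<Sum>\<sigma> | \<sigma> permutes {1..n}. q ^ maj n \<sigma> * (t / q) ^ exc n \<sigma>) = (\<Sum>m\<le>n. gauss_binomial q n m * derange_poly q t (n - m))"
      using exmaj_poly_derange_poly[OF q t(2), of 1 n] by (simp add: exmaj_poly_def)
    also have "\<dots> = (\<Sum>k\<le>n. gauss_binomial q n (n - k) * derange_poly q t k)"
      by (rule sum.reindex_bij_witness[where i = "\<lambda>i. n - i" and j = "\<lambda>i. n - i"]) auto
    finally show ?thesis using gauss_binomial_symmetric[OF q] by simp
  qed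
  \<comment> \<open>With \<open>k = n - m\<close> points that are not fixed, the bound on the fixed
    points becomes \<open>k \<le> j\<close>. The symmetry of \<open>derange_poly\<close> uses up
    \<open>t ^ k\<close> of \<open>t ^ j\<close> to turn \<open>1 / t\<close> into
    \<open>t\<close>.\<close>
  have b: "(\<Sum>\<sigma> | \<sigma> permutes {1..n} \<and> n - j \<le> fixpts n \<sigma>. q ^ maj n \<sigma> * (1 / t / q) ^ exc n \<sigma> * t ^ j)
     = (\<Sum>k\<le>j. gauss_binomial q n k * derange_poly q t k * t ^ (j - k))" if j: "j \<in> {r..n - 1}" for j
  proof -
    have jn: "j \<le> n" using j r by auto
    have t1: "1 / t \<noteq> 1" using t by simp
    have "(\<Sum>\<sigma> | \<sigma> permutes {1..n} \<and> n - j \<le> fixpts n \<sigma>. q ^ maj n \<sigma> * (1 / t / q) ^ exc n \<sigma> * t ^ j)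
      = (\<Sum>m\<in>{n - j..n}. \<Sum>\<sigma> | \<sigma> \<in> {\<sigma>. \<sigma> permutes {1..n} \<and> n - j \<le> fixpts n \<sigma>} \<and> fixpts n \<sigma> = m. q ^ maj n \<sigma> * (1 / t / q) ^ exc n \<sigma> * t ^ j)"
    proof (rule sum.group[symmetric])
      show "finite {\<sigma>. \<sigma> permutes {1..n} \<and> n - j \<le> fixpts n \<sigma>}"
        by (rule finite_subset[OF _ finite_perms[of n]]) auto
      show "fixpts n ` {\<sigma>. \<sigma> permutes {1..n} \<and> n - j \<le> fixpts n \<sigma>} \<subseteq> {n - j..n}"
        using add_leD2[OF exc_fix_le[of n]] by auto
    qed simp
    also have "\<dots> = (\<Sum>m\<in>{n - j..n}. gauss_binomial q n m * derange_poly q (1 / t) (n - m) * t ^ j)"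
    proof (rule sum.cong[OF refl])
      fix m assume m: "m \<in> {n - j..n}"
      then have "{\<sigma>. \<sigma> \<in> {\<sigma>. \<sigma> permutes {1..n} \<and> n - j \<le> fixpts n \<sigma>} \<and> fixpts n \<sigma> = m} = {\<sigma>. \<sigma> permutes {1..n} \<and> fixpts n \<sigma> = m}" by auto
      then show "(\<Sum>\<sigma> | \<sigma> \<in> {\<sigma>. \<sigma> permutes {1..n} \<and> n - j \<le> fixpts n \<sigma>} \<and> fixpts n \<sigma> = m. q ^ maj n \<sigma> * (1 / t / q) ^ exc n \<sigma> * t ^ j)
        = gauss_binomial q n m * derange_poly q (1 / t) (n - m) * t ^ j"
        using perm_fix_derange_poly[OF q t1, of m n] m by (simp add: sum_distrib_right[symmetric])
    qed
    also have "\<dots> = (\<Sum>k\<le>j. gauss_binomial q n (n - k) * derange_poly q (1 / t) k * t ^ j)"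
      by (rule sum.reindex_bij_witness[where i = "\<lambda>i. n - i" and j = "\<lambda>i. n - i"]) (use jn in auto)
    also have "\<dots> = (\<Sum>k\<le>j. gauss_binomial q n k * derange_poly q t k * t ^ (j - k))"
    proof (rule sum.cong[OF refl])
      fix k assume k: "k \<in> {..j}"
      then have "t ^ j = t ^ k * t ^ (j - k)" by (simp add: power_add[symmetric])
      then show "gauss_binomial q n (n - k) * derange_poly q (1 / t) k * t ^ j = gauss_binomial q n k * derange_poly q t k * t ^ (j - k)"
        using derange_poly_symmetric[OF t(1), of k q] gauss_binomial_symmetric[OF q, of k n] k jn by (simp add: mult_ac)
    qed
    finally show ?thesis .
  qed
  define S where "S m = (\<Sum>k<m. gauss_binomial q n k * derange_poly q t k * (\<Sum>i<m - k. t ^ i))" for m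
  have S_Suc: "S (Suc j) = S j + (\<Sum>k\<le>j. gauss_binomial q n k * derange_poly q t k * t ^ (j - k))" for j
  proof -
    have "S (Suc j) = (\<Sum>k<Suc j. gauss_binomial q n k * derange_poly q t k * (\<Sum>i<j - k. t ^ i) + gauss_binomial q n k * derange_poly q t k * t ^ (j - k))"
      unfolding S_def by (intro sum.cong refl) (auto simp: Suc_diff_le algebra_simps)
    also have "\<dots> = S j + (\<Sum>k<Suc j. gauss_binomial q n k * derange_poly q t k * t ^ (j - k))"
      by (simp add: sum.distrib S_def)
    finally show ?thesis by (simp only: lessThan_Suc_atMost)
  qed
  have S_n: "S n = (\<Sum>k\<le>n. gauss_binomial q n k * derange_poly q t k)"
  proof -
    have "(\<Sum>i<m. t ^ i) = 1 + geom_gap t m" if "m > 0" for m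
    proof -
      have "{..<m} = insert 0 {1..<m}" using that by auto
      then show ?thesis by (simp add: geom_gap_def)
    qed
    then have "S n = (\<Sum>k<n. gauss_binomial q n k * derange_poly q t k * (1 + geom_gap t (n - k)))"
      unfolding S_def by (intro sum.cong) auto
    \<comment> \<open>The \<open>geom_gap\<close> parts add up to the recursion for
      \<open>derange_poly q t n\<close>, which is the missing summand \<open>k = n\<close>.\<close>
    also have "\<dots> = (\<Sum>k<n. gauss_binomial q n k * derange_poly q t k) + derange_poly q t n"
      using r derange_poly_rec[of n q t] by (simp add: sum.distrib algebra_simps)
    finally show ?thesis by (simp add: lessThan_Suc_atMost[symmetric] gauss_binomial_n_n)
  qed
  have tele: "S m = S r + (\<Sum>j\<in>{r..<m}. \<Sum>k\<le>j. gauss_binomial q n k * derange_poly q t k * t ^ (j - k))" if "r \<le> m" for m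
    using that by (induction m rule: dec_induct) (simp_all add: S_Suc)
  have "{r..n - 1} = {r..<n}" using r by auto
  then have "(\<Sum>j\<in>{r..n - 1}. \<Sum>\<sigma> | \<sigma> permutes {1..n} \<and> n - j \<le> fixpts n \<sigma>. q ^ maj n \<sigma> * (1 / t / q) ^ exc n \<sigma> * t ^ j)
     = (\<Sum>j\<in>{r..<n}. \<Sum>k\<le>j. gauss_binomial q n k * derange_poly q t k * t ^ (j - k))"
    using b by (intro sum.cong) auto
  then show ?thesis using tele[OF r(2)] unfolding a S_n[symmetric] by (simp add: S_def)
qed

section \<open>Integer polynomials graded by degree and weight\<close>

abbreviation ks :: "('v \<Rightarrow>\<^sub>0 'c::zero) \<Rightarrow> 'v set" where "ks \<equiv> Poly_Mapping.keys"
abbreviation lk :: "('v \<Rightarrow>\<^sub>0 'c::zero) \<Rightarrow> 'v \<Rightarrow> 'c" where "lk \<equiv> Poly_Mapping.lookup"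
abbreviation sg :: "'v \<Rightarrow> 'c \<Rightarrow> ('v \<Rightarrow>\<^sub>0 'c::zero)" where "sg \<equiv> Poly_Mapping.single"

definition mon :: "('v \<Rightarrow>\<^sub>0 nat) \<Rightarrow> 'v zpoly" where "mon m = sg m 1"

lemma of_int_sg: "(of_int c :: ('a::monoid_add \<Rightarrow>\<^sub>0 int)) = sg 0 c"
  by (metis of_int_eq_id id_apply single_of_int)

lemma sg_of_int: "sg m c = of_int c * mon m" for c :: int
by (simp add: of_int_sg mon_def mult_single)

lemma mon_add: "mon (a + b) = mon a * mon b"
  by (simp add: mon_def mult_single)

lemma mon_0 [simp]: "mon 0 = 1" by (simp add: mon_def)

lemma Var_mon: "Var v = mon (sg v 1)" by (simp add: Var_def mon_def)

lemma mon_power: "mon (sg v k) = Var v ^ k"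
proof (induction k)
  case (Suc k)
  have "sg v (Suc k) = sg v 1 + sg v k" by (simp add: single_add[symmetric])
  then show ?case using Suc by (simp add: mon_add Var_mon del: One_nat_def)
qed simp

lemma ks_mon [simp]: "ks (mon m) = {m}" by (simp add: mon_def)

lemma pm_expand: "(p :: 'v \<Rightarrow>\<^sub>0 'c::comm_monoid_add) = (\<Sum>m\<in>ks p. sg m (lk p m))"
proof (rule poly_mapping_eqI)
  fix k
  have "lk (\<Sum>m\<in>ks p. sg m (lk p m)) k = (\<Sum>m\<in>ks p. if m = k then lk p m else 0)"
    by (simp add: lookup_sum lookup_single when_def)
  also have "\<dots> = lk p k" by (simp add: in_keys_iff)
  finally show "lk p k = lk (\<Sum>m\<in>ks p. sg m (lk p m)) k" by simp
qed

lemma zpoly_expand: "(p :: 'v zpoly) = (\<Sum>m\<in>ks p. of_int (lk p m) * mon m)"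
  by (subst pm_expand) (simp add: sg_of_int)

lemma zpoly_induct [case_names zero mon add]:
  fixes p :: "'v zpoly"
  assumes "P 0" "\<And>m c. P (of_int c * mon m)" "\<And>p q. P p \<Longrightarrow> P q \<Longrightarrow> P (p + q)"
  shows "P p"
proof -
  have "P (\<Sum>m\<in>S. of_int (lk p m) * mon m)" if "finite S" for S
    using that by induction (use assms in auto)
  then show ?thesis by (subst zpoly_expand) simp
qed

definition weight :: "('v \<Rightarrow> nat) \<Rightarrow> ('v \<Rightarrow>\<^sub>0 nat) \<Rightarrow> nat" where
  "weight f m = (\<Sum>v\<in>ks m. lk m v * f v)"

lemma weight_superset: "finite S \<Longrightarrow> ks m \<subseteq> S \<Longrightarrow> weight f m = (\<Sum>v\<in>S. lk m v * f v)"
  unfolding weight_def by (rule sum.mono_neutral_left) (auto simp: in_keys_iff)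

lemma weight_add: "weight f (m + n) = weight f m + weight f n"
proof -
  let ?S = "ks m \<union> ks n"
  have "weight f (m + n) = (\<Sum>v\<in>?S. lk (m + n) v * f v)"
    by (rule weight_superset) (use keys_add[of m n] in auto)
  then show ?thesis
    by (simp add: weight_superset[of ?S m] weight_superset[of ?S n] lookup_add ring_distribs sum.distrib)
qed

lemma weight_0 [simp]: "weight f 0 = 0" by (simp add: weight_def)

lemma weight_single [simp]: "weight f (sg v k) = k * f v" by (simp add: weight_def)

lemma weight_cong: "(\<And>v. v \<in> ks m \<Longrightarrow> f v = g v) \<Longrightarrow> weight f m = weight g m"
  unfolding weight_def by (intro sum.cong) auto

lemma weight_fun_add: "weight (\<lambda>v. f v + g v) m = weight f m + weight g m"
  by (simp add: weight_def ring_distribs sum.distrib)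

lemma weight_mono: "(\<And>v. v \<in> ks m \<Longrightarrow> f v \<le> g v) \<Longrightarrow> weight f m \<le> weight g m"
  unfolding weight_def by (intro sum_mono mult_left_mono) auto

lemma weight_eq_0: "weight f m = 0 \<longleftrightarrow> (\<forall>v\<in>ks m. f v = 0)"
  by (auto simp: weight_def in_keys_iff)

abbreviation deg :: "('v \<Rightarrow>\<^sub>0 nat) \<Rightarrow> nat" where "deg \<equiv> weight (\<lambda>_. 1)"

lemma deg_eq: "deg m = (\<Sum>v\<in>ks m. lk m v)" by (simp add: weight_def)

lemma pm_split: "\<exists>a b. (m :: 'v \<Rightarrow>\<^sub>0 nat) = a + b \<and> ks a = {v \<in> ks m. P v} \<and> ks b = {v \<in> ks m. \<not> P v}"
proof -
  define a where "a = (\<Sum>v | v \<in> ks m \<and> P v. sg v (lk m v))"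
  define b where "b = (\<Sum>v | v \<in> ks m \<and> \<not> P v. sg v (lk m v))"
  have "m = (\<Sum>v\<in>ks m. sg v (lk m v))" by (rule pm_expand)
  also have "\<dots> = a + b"
    unfolding a_def b_def by (subst sum.union_disjoint[symmetric]) (auto intro!: sum.cong)
  finally have 1: "m = a + b" .
  have ka: "lk (\<Sum>v\<in>S. sg v (lk m v)) k = (if k \<in> S then lk m k else 0)" if "finite S" for S k
    using that by (simp add: lookup_sum lookup_single when_def)
  have "ks a = {v \<in> ks m. P v}" unfolding a_def by (auto simp: in_keys_iff ka split: if_splits)
  moreover have "ks b = {v \<in> ks m. \<not> P v}" unfolding b_def by (auto simp: in_keys_iff ka split: if_splits)
  ultimately show ?thesis using 1 by blast
qed

lemma pm_extract: "k \<le> lk m v \<Longrightarrow> \<exists>m'. (m :: 'v \<Rightarrow>\<^sub>0 nat) = sg v k + m'"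
proof -
  assume k: "k \<le> lk m v"
  have "m = sg v k + (m - sg v k)"
    by (rule poly_mapping_eqI) (use k in \<open>auto simp: lookup_add lookup_minus lookup_single when_def\<close>)
  then show ?thesis by blast
qed

lemma ks_plus_nat: "ks (a + b) = ks a \<union> ks (b :: 'v \<Rightarrow>\<^sub>0 nat)"
  by (auto simp: in_keys_iff lookup_add)

lemma poly_ring_0 [simp]: "0 \<in> poly_ring V" and poly_ring_1 [simp]: "1 \<in> poly_ring V"
  by (auto simp: poly_ring_def)

lemma poly_ring_add: "p \<in> poly_ring V \<Longrightarrow> q \<in> poly_ring V \<Longrightarrow> p + q \<in> poly_ring V"
  using keys_add[of p q] unfolding poly_ring_def by blast

lemma poly_ring_mult: "p \<in> poly_ring V \<Longrightarrow> q \<in> poly_ring V \<Longrightarrow> p * q \<in> poly_ring V"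
proof -
  assume p: "p \<in> poly_ring V" and q: "q \<in> poly_ring V"
  have "ks m \<subseteq> V" if mk: "m \<in> ks (p * q)" for m
  proof -
    obtain a b where "m = a + b" "a \<in> ks p" "b \<in> ks q" using subsetD[OF keys_mult mk] by auto
    then show ?thesis using p q by (auto simp: poly_ring_def ks_plus_nat)
  qed
  then show ?thesis by (simp add: poly_ring_def)
qed

lemma poly_ring_mon: "ks m \<subseteq> V \<Longrightarrow> mon m \<in> poly_ring V"
  by (simp add: poly_ring_def)

lemma poly_ring_Var: "v \<in> V \<Longrightarrow> Var v \<in> poly_ring V"
  unfolding Var_mon by (intro poly_ring_mon) simp

lemma poly_ring_of_int: "of_int c \<in> poly_ring V"
by (simp add: of_int_sg poly_ring_def)

lemma poly_ring_power: "p \<in> poly_ring V \<Longrightarrow> p ^ k \<in> poly_ring V"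
  by (induction k) (auto intro: poly_ring_mult)

lemma poly_ring_sum: "(\<And>i. i \<in> S \<Longrightarrow> f i \<in> poly_ring V) \<Longrightarrow> sum f S \<in> poly_ring V"
  by (induction S rule: infinite_finite_induct) (auto intro: poly_ring_add)

lemma poly_ring_uminus: "p \<in> poly_ring V \<Longrightarrow> - p \<in> poly_ring V"
  by (simp add: poly_ring_def)

text \<open>A decreasing filtration of the homogeneous part of degree \<open>d\<close>;
  straightening moves to higher \<open>w\<close>.\<close>

definition weight_part :: "('v \<Rightarrow> nat) \<Rightarrow> 'v set \<Rightarrow> nat \<Rightarrow> nat \<Rightarrow> 'v zpoly set" where
  "weight_part f V d w = {p. \<forall>m\<in>ks p. ks m \<subseteq> V \<and> deg m = d \<and> weight f m \<ge> w}"

lemma weight_part_0 [simp]: "0 \<in> weight_part f V d w" by (simp add: weight_part_def)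

lemma weight_part_add: "p \<in> weight_part f V d w \<Longrightarrow> q \<in> weight_part f V d w \<Longrightarrow> p + q \<in> weight_part f V d w"
  using keys_add[of p q] unfolding weight_part_def by blast

lemma weight_part_uminus: "p \<in> weight_part f V d w \<Longrightarrow> - p \<in> weight_part f V d w" by (simp add: weight_part_def)

lemma weight_part_sum: "(\<And>i. i \<in> S \<Longrightarrow> g i \<in> weight_part f V d w) \<Longrightarrow> sum g S \<in> weight_part f V d w"
  by (induction S rule: infinite_finite_induct) (auto intro: weight_part_add)

lemma weight_part_mult:
  assumes p: "p \<in> weight_part f V d w" and q: "q \<in> weight_part f V d' w'"
  shows "p * q \<in> weight_part f V (d + d') (w + w')"
proof -
  have "ks m \<subseteq> V \<and> deg m = d + d' \<and> weight f m \<ge> w + w'" if mk: "m \<in> ks (p * q)" for m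
  proof -
    obtain a b where m: "m = a + b" "a \<in> ks p" "b \<in> ks q" using subsetD[OF keys_mult mk] by auto
    then have "ks a \<subseteq> V \<and> deg a = d \<and> weight f a \<ge> w" "ks b \<subseteq> V \<and> deg b = d' \<and> weight f b \<ge> w'"
      using p q unfolding weight_part_def by blast+
    then show ?thesis by (auto simp: m ks_plus_nat weight_add)
  qed
  then show ?thesis by (simp add: weight_part_def)
qed

lemma weight_part_1: "1 \<in> weight_part f V 0 0" by (simp add: weight_part_def)

lemma weight_part_power: "p \<in> weight_part f V d w \<Longrightarrow> p ^ k \<in> weight_part f V (k * d) (k * w)"
proof (induction k)
  case (Suc k)
  then show ?case using weight_part_mult[of p f V d w "p ^ k" "k * d" "k * w"] by simp
qed (simp add: weight_part_1)

lemma weight_part_mon: "ks m \<subseteq> V \<Longrightarrow> deg m = d \<Longrightarrow> weight f m \<ge> w \<Longrightarrow> mon m \<in> weight_part f V d w"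
  by (simp add: weight_part_def)

lemma weight_part_Var: "v \<in> V \<Longrightarrow> f v \<ge> w \<Longrightarrow> Var v \<in> weight_part f V 1 w"
  unfolding Var_mon by (intro weight_part_mon) auto

lemma weight_part_of_int: "p \<in> weight_part f V d w \<Longrightarrow> of_int c * p \<in> weight_part f V d w"
proof -
  have "of_int c \<in> weight_part f V 0 0" by (simp add: of_int_sg weight_part_def)
  then show "p \<in> weight_part f V d w \<Longrightarrow> ?thesis" using weight_part_mult[of "of_int c" f V 0 0 p d w] by simp
qed

lemma weight_part_hom_part: "weight_part f V d 0 = hom_part V d" unfolding weight_part_def hom_part_def deg_eq by simp

section \<open>The Chow ideal of a geometric lattice\<close>

text \<open>Meets are intersections, semimodularity is the last clause of \<open>join_ex\<close>,
  and \<open>atom_ex\<close> says that flats are separated by atoms.\<close>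

locale geometric_lattice =
  fixes L :: "'b set set" and z U :: "'b set" and rk :: "'b set \<Rightarrow> nat"
  assumes finite_L [simp]: "finite L"
    and z_in [simp]: "z \<in> L" and U_in [simp]: "U \<in> L" and z_neq_U: "z \<noteq> U"
    and bot: "F \<in> L \<Longrightarrow> z \<subseteq> F" and top: "F \<in> L \<Longrightarrow> F \<subseteq> U"
    and Int_in: "F \<in> L \<Longrightarrow> G \<in> L \<Longrightarrow> F \<inter> G \<in> L"
    and rk_z [simp]: "rk z = 0"
    and rk_mono: "F \<in> L \<Longrightarrow> G \<in> L \<Longrightarrow> F \<subset> G \<Longrightarrow> rk F < rk G"
    and join_ex: "F \<in> L \<Longrightarrow> G \<in> L \<Longrightarrow> \<exists>J\<in>L. F \<subseteq> J \<and> G \<subseteq> J \<and> (\<forall>H\<in>L. F \<subseteq> H \<longrightarrow> G \<subseteq> H \<longrightarrow> J \<subseteq> H)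
        \<and> rk J + rk (F \<inter> G) \<le> rk F + rk G"
    and atom_rk: "a \<in> lat_atoms L z \<Longrightarrow> rk a = 1"
    and atom_ex: "F \<in> L \<Longrightarrow> G \<in> L \<Longrightarrow> F \<subset> G \<Longrightarrow> \<exists>a\<in>lat_atoms L z. a \<subseteq> G \<and> \<not> a \<subseteq> F"
begin

definition P where "P = L - {z}"
definition I where "I = chow_ideal L z"
definition join where "join F G = (SOME J. J \<in> L \<and> F \<subseteq> J \<and> G \<subseteq> J \<and> (\<forall>H\<in>L. F \<subseteq> H \<longrightarrow> G \<subseteq> H \<longrightarrow> J \<subseteq> H)
        \<and> rk J + rk (F \<inter> G) \<le> rk F + rk G)"

abbreviation "r \<equiv> rk U"

lemma join:
  assumes "F \<in> L" "G \<in> L"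
  shows join_in: "join F G \<in> L" and join_1: "F \<subseteq> join F G" and join_2: "G \<subseteq> join F G"
    and join_least: "H \<in> L \<Longrightarrow> F \<subseteq> H \<Longrightarrow> G \<subseteq> H \<Longrightarrow> join F G \<subseteq> H"
    and join_rk: "rk (join F G) + rk (F \<inter> G) \<le> rk F + rk G"
proof -
  have "\<exists>J. J \<in> L \<and> F \<subseteq> J \<and> G \<subseteq> J \<and> (\<forall>H\<in>L. F \<subseteq> H \<longrightarrow> G \<subseteq> H \<longrightarrow> J \<subseteq> H) \<and> rk J + rk (F \<inter> G) \<le> rk F + rk G"
    using join_ex[OF assms] by blast
  from someI_ex[OF this, folded join_def]
  show "join F G \<in> L" "F \<subseteq> join F G" "G \<subseteq> join F G" "H \<in> L \<Longrightarrow> F \<subseteq> H \<Longrightarrow> G \<subseteq> H \<Longrightarrow> join F G \<subseteq> H"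
    "rk (join F G) + rk (F \<inter> G) \<le> rk F + rk G" by blast+
qed

lemma rk_mono_le: "F \<in> L \<Longrightarrow> G \<in> L \<Longrightarrow> F \<subseteq> G \<Longrightarrow> rk F \<le> rk G"
  using rk_mono[of F G] by (cases "F = G") (auto simp: psubset_eq)

lemma rk_le_r: "F \<in> L \<Longrightarrow> rk F \<le> r" using rk_mono_le[of F U] top by auto

lemma rk_lt_r: "F \<in> L \<Longrightarrow> F \<noteq> U \<Longrightarrow> rk F < r" using rk_mono[of F U] top[of F] by auto

lemma rk_pos: "F \<in> L \<Longrightarrow> F \<noteq> z \<Longrightarrow> rk F > 0" using rk_mono[of z F] bot[of F] by auto

lemma atom_in: "a \<in> lat_atoms L z \<Longrightarrow> a \<in> L \<and> a \<noteq> z" by (simp add: lat_atoms_def)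

lemma finite_P [simp]: "finite P" by (simp add: P_def)

lemma finite_gens [simp]: "finite (chow_gens L z)"
proof -
  have "chow_gens L z \<subseteq> (\<lambda>(F, G). Var F * Var G) ` (L \<times> L) \<union> (\<lambda>a. \<Sum>F\<in>{F\<in>L. a \<subseteq> F}. Var F) ` L"
    unfolding chow_gens_def lat_atoms_def by auto
  then show ?thesis by (rule finite_subset) simp
qed

lemma I_iff: "x \<in> I \<longleftrightarrow> (\<exists>c. (\<forall>g\<in>chow_gens L z. c g \<in> poly_ring P) \<and> x = (\<Sum>g\<in>chow_gens L z. c g * g))"
  unfolding I_def chow_ideal_def P_def by auto

lemma I_0 [simp]: "0 \<in> I"
  unfolding I_iff by (rule exI[of _ "\<lambda>_. 0"]) simp

lemma I_add: "x \<in> I \<Longrightarrow> y \<in> I \<Longrightarrow> x + y \<in> I"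
proof -
  assume "x \<in> I" "y \<in> I"
  then obtain c d where "\<forall>g\<in>chow_gens L z. c g \<in> poly_ring P" "x = (\<Sum>g\<in>chow_gens L z. c g * g)"
    "\<forall>g\<in>chow_gens L z. d g \<in> poly_ring P" "y = (\<Sum>g\<in>chow_gens L z. d g * g)"
    unfolding I_iff by blast
  then show ?thesis
    unfolding I_iff by (intro exI[of _ "\<lambda>g. c g + d g"]) (auto intro: poly_ring_add simp: ring_distribs sum.distrib)
qed

lemma I_mult: "x \<in> I \<Longrightarrow> p \<in> poly_ring P \<Longrightarrow> p * x \<in> I"
proof -
  assume "x \<in> I" and p: "p \<in> poly_ring P"
  then obtain c where "\<forall>g\<in>chow_gens L z. c g \<in> poly_ring P" "x = (\<Sum>g\<in>chow_gens L z. c g * g)"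
    unfolding I_iff by blast
  then show ?thesis
    unfolding I_iff using p by (intro exI[of _ "\<lambda>g. p * c g"]) (auto intro: poly_ring_mult simp: sum_distrib_left mult.assoc)
qed

lemma I_uminus: "x \<in> I \<Longrightarrow> - x \<in> I"
  using I_mult[OF _ poly_ring_uminus[OF poly_ring_1], of x] by simp

lemma I_diff: "x \<in> I \<Longrightarrow> y \<in> I \<Longrightarrow> x - y \<in> I"
  using I_add[OF _ I_uminus, of x y] by simp

lemma I_sum: "(\<And>i. i \<in> S \<Longrightarrow> f i \<in> I) \<Longrightarrow> sum f S \<in> I"
  by (induction S rule: infinite_finite_induct) (auto intro: I_add)

lemma I_of_int: "x \<in> I \<Longrightarrow> of_int c * x \<in> I"
  by (rule I_mult[OF _ poly_ring_of_int])

lemma I_gen: "g \<in> chow_gens L z \<Longrightarrow> g \<in> I"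
  unfolding I_iff
proof (intro exI[of _ "\<lambda>h. if h = g then 1 else 0"] conjI ballI)
  assume g: "g \<in> chow_gens L z"
  have "(\<Sum>h\<in>chow_gens L z. (if h = g then 1 else 0) * h) = (\<Sum>h\<in>chow_gens L z. if h = g then h else 0)"
    by (intro sum.cong) auto
  then show "g = (\<Sum>h\<in>chow_gens L z. (if h = g then 1 else 0) * h)" using g by simp
qed auto

lemma I_incomp: "F \<in> L \<Longrightarrow> G \<in> L \<Longrightarrow> \<not> F \<subseteq> G \<Longrightarrow> \<not> G \<subseteq> F \<Longrightarrow> Var F * Var G \<in> I"
proof (rule I_gen)
  assume *: "F \<in> L" "G \<in> L" "\<not> F \<subseteq> G" "\<not> G \<subseteq> F"
  then have "F \<noteq> z" "G \<noteq> z" using bot[of F] bot[of G] by auto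
  then show "Var F * Var G \<in> chow_gens L z" using * unfolding chow_gens_def by auto
qed

definition Y :: "'b set \<Rightarrow> 'b set zpoly" where "Y G = (\<Sum>F | F \<in> L \<and> G \<subseteq> F. Var F)"

lemma Y_atom: "a \<in> lat_atoms L z \<Longrightarrow> Y a \<in> I"
  by (rule I_gen) (auto simp: chow_gens_def Y_def)

lemma above_P: "G \<in> P \<Longrightarrow> F \<in> L \<Longrightarrow> G \<subseteq> F \<Longrightarrow> F \<in> P"
  using bot by (auto simp: P_def)

lemma Y_ring: "G \<in> P \<Longrightarrow> Y G \<in> poly_ring P"
  unfolding Y_def by (intro poly_ring_sum poly_ring_Var) (auto intro: above_P)

lemma Y_diff: "G \<subseteq> J \<Longrightarrow> Y G - Y J = (\<Sum>F | F \<in> L \<and> G \<subseteq> F \<and> \<not> J \<subseteq> F. Var F)"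
proof -
  assume *: "G \<subseteq> J"
  have "Y G = Y J + (\<Sum>F | F \<in> L \<and> G \<subseteq> F \<and> \<not> J \<subseteq> F. Var F)"
    unfolding Y_def using * by (subst sum.union_disjoint[symmetric]) (auto intro!: sum.cong)
  then show ?thesis by simp
qed

text \<open>A flat \<open>K\<close> above \<open>G\<close> cannot lie below \<open>F\<close>. So it
  is incomparable to \<open>F\<close>, and the product of the variables is in the ideal, or it
  contains \<open>F\<close> and with it the join.\<close>

lemma Var_Y_join:
  assumes "F \<in> L" "G \<in> L" "\<not> G \<subseteq> F"
  shows "Var F * Y G - Var F * Y (join F G) \<in> I"
proof -
  have "Var F * Y G - Var F * Y (join F G) = (\<Sum>K | K \<in> L \<and> G \<subseteq> K \<and> \<not> join F G \<subseteq> K. Var F * Var K)"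
    unfolding right_diff_distrib[symmetric] Y_diff[OF join_2[OF assms(1,2)]] sum_distrib_left ..
  also have "\<dots> \<in> I"
  proof (rule I_sum)
    fix K assume "K \<in> {K. K \<in> L \<and> G \<subseteq> K \<and> \<not> join F G \<subseteq> K}"
    then have K: "K \<in> L" "G \<subseteq> K" "\<not> join F G \<subseteq> K" by auto
    have "\<not> F \<subseteq> K" using K join_least[OF assms(1,2) K(1)] by blast
    moreover have "\<not> K \<subseteq> F" using K assms by blast
    ultimately show "Var F * Var K \<in> I" using assms K by (intro I_incomp)
  qed
  finally show ?thesis .
qed

lemma Var_Y_join_power:
  assumes "F \<in> P" "G \<in> P" "\<not> G \<subseteq> F"
  shows "Var F * Y G ^ e - Var F * Y (join F G) ^ e \<in> I"
proof (induction e)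
  case (Suc e)
  have FG: "F \<in> L" "G \<in> L" using assms by (auto simp: P_def)
  have J: "join F G \<in> P" using above_P[OF assms(1) join_in join_1] FG by auto
  have "Var F * Y G ^ Suc e - Var F * Y (join F G) ^ Suc e
    = Y G ^ e * (Var F * Y G - Var F * Y (join F G)) + Y (join F G) * (Var F * Y G ^ e - Var F * Y (join F G) ^ e)"
    by (simp add: algebra_simps)
  also have "\<dots> \<in> I"
    by (intro I_add I_mult Suc Var_Y_join FG assms poly_ring_power Y_ring J)
  finally show ?case .
qed simp

text \<open>Reading the variable of the bottom as 1 lets \<open>z\<close> serve as a base flat like
  any other.\<close>

definition XH where "XH H = (if H = z then 1 else Var H)"

lemma XH_ring: "H \<in> L \<Longrightarrow> XH H \<in> poly_ring P"
  by (auto simp: XH_def P_def intro: poly_ring_Var)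

text \<open>Take an atom \<open>a\<close> below \<open>G\<close> but not below \<open>H\<close> and
  write one factor \<open>Y G\<close> as \<open>Y a\<close> minus the variables of flats
  \<open>F\<close> above \<open>a\<close> and not above \<open>G\<close>. \<open>Y a\<close> is in
  the ideal. Otherwise \<open>F\<close> may be assumed above \<open>H\<close>, and next to its
  variable \<open>Y G\<close> becomes \<open>Y (join F G)\<close>. By semimodularity the rank
  difference drops, since \<open>F \<inter> G\<close> contains \<open>a\<close> and is larger than
  \<open>H\<close>.\<close>

lemma XH_Y_power:
  assumes "H \<in> L" "G \<in> L" "H \<subset> G" "e \<ge> rk G - rk H"
  shows "XH H * Y G ^ e \<in> I"
  using assms
proof (induction "rk G - rk H" arbitrary: H G e rule: less_induct)
  case less
  obtain a where a: "a \<in> lat_atoms L z" "a \<subseteq> G" "\<not> a \<subseteq> H" using atom_ex less.prems by blast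
  have aL: "a \<in> L" "a \<in> P" using atom_in[OF a(1)] by (auto simp: P_def)
  have GP: "G \<in> P" using above_P[OF aL(2) less.prems(2) a(2)] .
  have "rk H < rk G" using rk_mono less.prems by blast
  then obtain e' where e: "e = Suc e'" using less.prems(4) by (cases e) auto
  have "Y a - Y G = (\<Sum>F | F \<in> L \<and> a \<subseteq> F \<and> \<not> G \<subseteq> F. Var F)" by (rule Y_diff[OF a(2)])
  then have "XH H * Y G ^ e = (XH H * Y G ^ e') * Y a - (\<Sum>F | F \<in> L \<and> a \<subseteq> F \<and> \<not> G \<subseteq> F. XH H * Var F * Y G ^ e')"
    unfolding e by (simp add: sum_distrib_left[symmetric] sum_distrib_right[symmetric] algebra_simps)
  also have "\<dots> \<in> I"
  proof (intro I_diff I_sum)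
    show "(XH H * Y G ^ e') * Y a \<in> I"
      by (intro I_mult Y_atom a poly_ring_mult poly_ring_power XH_ring less.prems Y_ring GP)
    fix F assume "F \<in> {F. F \<in> L \<and> a \<subseteq> F \<and> \<not> G \<subseteq> F}"
    then have F: "F \<in> L" "a \<subseteq> F" "\<not> G \<subseteq> F" by auto
    have FP: "F \<in> P" using above_P[OF aL(2) F(1,2)] .
    have nFH: "\<not> F \<subseteq> H" using F a by blast
    show "XH H * Var F * Y G ^ e' \<in> I"
    proof (cases "H \<subseteq> F")
      case False
      then have "H \<noteq> z" using bot F by auto
      then have "XH H * Var F \<in> I" using I_incomp[OF less.prems(1) F(1) False nFH] by (simp add: XH_def)
      then show ?thesis using I_mult[of "XH H * Var F" "Y G ^ e'"] poly_ring_power[OF Y_ring[OF GP]] by (simp add: mult_ac)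
    next
      case True
      define J where "J = join F G"
      have J: "J \<in> L" "F \<subseteq> J" "G \<subseteq> J" "rk J + rk (F \<inter> G) \<le> rk F + rk G"
        unfolding J_def using join_in join_1 join_2 join_rk F less.prems by auto
      have HFG: "H \<subset> F \<inter> G" using True less.prems a F by blast
      then have 1: "rk H < rk (F \<inter> G)" using rk_mono[of H "F \<inter> G"] Int_in F less.prems by auto
      have "F \<subset> J" using J F by blast
      then have 2: "rk F < rk J" using rk_mono F J by blast
      have lt: "rk J - rk F < rk G - rk H" "rk J - rk F \<le> e'" using 1 2 J(4) less.prems(4) e by auto
      have "XH F * Y J ^ e' \<in> I" by (rule less.hyps[OF lt(1) F(1) J(1) \<open>F \<subset> J\<close> lt(2)])
      then have "Var F * Y J ^ e' \<in> I" using FP by (simp add: XH_def P_def)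
      then have "Var F * Y G ^ e' \<in> I"
        using I_add[OF Var_Y_join_power[OF FP GP F(3), of e']] unfolding J_def by fastforce
      then show ?thesis using I_mult[OF _ XH_ring[OF less.prems(1)]] by (simp add: mult.assoc)
    qed
  qed
  finally show ?case .
qed

end

section \<open>Spanning: straightening and vanishing by degree\<close>

context geometric_lattice begin

abbreviation V :: "'b set \<Rightarrow> 'b set set" where "V H \<equiv> {F \<in> L. H \<subset> F}"

lemma weight_part_antimono: "p \<in> weight_part f W d w \<Longrightarrow> w' \<le> w \<Longrightarrow> p \<in> weight_part f W d w'"
  unfolding weight_part_def by (blast intro: order_trans)

lemma V_P: "H \<in> L \<Longrightarrow> V H \<subseteq> P"
  using bot by (auto simp: P_def)

lemma V_z: "V z = P"
  using bot by (auto simp: P_def)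

text \<open>The Feichtner--Yuzvinsky exponents, relative to a base flat \<open>H\<close> in place of the bottom.\<close>

definition FY :: "'b set \<Rightarrow> ('b set \<Rightarrow>\<^sub>0 nat) \<Rightarrow> bool" where
  "FY H m \<longleftrightarrow> ks m \<subseteq> V H \<and> (\<forall>F\<in>ks m. \<forall>G\<in>ks m. F \<subseteq> G \<or> G \<subseteq> F)
     \<and> (\<forall>F\<in>ks m. \<forall>G\<in>insert H (ks m). G \<subset> F \<longrightarrow> lk m F < rk F - rk G)"

definition FYs :: "'b set \<Rightarrow> nat \<Rightarrow> ('b set \<Rightarrow>\<^sub>0 nat) set" where
  "FYs H d = {m. FY H m \<and> deg m = d}"

lemma mon_incomp:
  assumes "ks m \<subseteq> P" "F \<in> ks m" "G \<in> ks m" "\<not> F \<subseteq> G" "\<not> G \<subseteq> F"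
  shows "mon m \<in> I"
proof -
  obtain m1 where m1: "m = sg F 1 + m1"
    using pm_extract[of 1 m F] assms(2) by (auto simp: in_keys_iff)
  have "F \<noteq> G" using assms by auto
  then have "G \<in> ks m1" using assms(3) by (simp add: m1 in_keys_iff lookup_add lookup_single)
  then obtain m2 where m2: "m1 = sg G 1 + m2"
    using pm_extract[of 1 m1 G] by (auto simp: in_keys_iff)
  have "mon m2 * (Var F * Var G) \<in> I"
    using assms by (intro I_mult I_incomp poly_ring_mon) (auto simp: P_def m1 m2 ks_plus_nat)
  then show ?thesis by (simp add: m1 m2 mon_add Var_mon mult_ac)
qed

lemma Y_weight_part: "F \<in> V H \<Longrightarrow> Y F \<in> weight_part rk (V H) 1 (rk F)"
  unfolding Y_def by (intro weight_part_sum weight_part_Var) (auto intro: rk_mono_le)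

lemma Var_Y_weight_part: "F \<in> V H \<Longrightarrow> Var F - Y F \<in> weight_part rk (V H) 1 (Suc (rk F))"
proof -
  assume F: "F \<in> V H"
  have "{K. K \<in> L \<and> F \<subseteq> K} = insert F {K. K \<in> L \<and> F \<subset> K}" using F by auto
  then have "Y F = Var F + (\<Sum>K | K \<in> L \<and> F \<subset> K. Var K)" by (simp add: Y_def)
  then have "Var F - Y F = - (\<Sum>K | K \<in> L \<and> F \<subset> K. Var K)" by simp
  also have "\<dots> \<in> weight_part rk (V H) 1 (Suc (rk F))"
    using F by (intro weight_part_uminus weight_part_sum weight_part_Var) (auto intro: Suc_leI rk_mono)
  finally show ?thesis .
qed

lemma Var_Y_power_weight_part:
  assumes F: "F \<in> V H"
  shows "Var F ^ s - Y F ^ s \<in> weight_part rk (V H) s (Suc (s * rk F))"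
proof (induction s)
  case (Suc s)
  have "Var F ^ Suc s - Y F ^ Suc s = Var F * (Var F ^ s - Y F ^ s) + (Var F - Y F) * Y F ^ s"
    by (simp add: algebra_simps)
  moreover have "Var F * (Var F ^ s - Y F ^ s) \<in> weight_part rk (V H) (1 + s) (rk F + Suc (s * rk F))"
    by (intro weight_part_mult Suc weight_part_Var F order_refl)
  moreover have "(Var F - Y F) * Y F ^ s \<in> weight_part rk (V H) (1 + s * 1) (Suc (rk F) + s * rk F)"
    by (intro weight_part_mult weight_part_power Var_Y_weight_part Y_weight_part F)
  ultimately show ?case using weight_part_add[of _ rk "V H" "Suc s" "Suc (Suc s * rk F)"] by simp
qed simp

text \<open>The weight \<open>weight rk m\<close> is bounded in each degree, so its increase makes straightening terminate.\<close>

lemma straighten_step: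
  assumes H: "H \<in> L" and m: "ks m \<subseteq> V H" and nFY: "\<not> FY H m"
  shows "\<exists>p\<in>weight_part rk (V H) (deg m) (Suc (weight rk m)). XH H * mon m - XH H * p \<in> I"
proof (cases "\<forall>F\<in>ks m. \<forall>G\<in>ks m. F \<subseteq> G \<or> G \<subseteq> F")
  case False
  then obtain F G where FG: "F \<in> ks m" "G \<in> ks m" "\<not> F \<subseteq> G" "\<not> G \<subseteq> F" by auto
  have "ks m \<subseteq> P" using m V_P[OF H] by (rule subset_trans)
  from mon_incomp[OF this FG] have "mon m \<in> I" .
  then have "XH H * mon m \<in> I" by (intro I_mult XH_ring H)
  then show ?thesis by (intro bexI[of _ 0]) auto
next
  case True
  then obtain F G where F: "F \<in> ks m" and G: "G \<in> insert H (ks m)" and GF: "G \<subset> F" and ge: "rk F - rk G \<le> lk m F"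
  proof -
    have "\<not> (\<forall>F\<in>ks m. \<forall>G\<in>insert H (ks m). G \<subset> F \<longrightarrow> lk m F < rk F - rk G)"
      using m nFY True unfolding FY_def by simp
    then obtain F G where "F \<in> ks m" "G \<in> insert H (ks m)" "G \<subset> F" "\<not> lk m F < rk F - rk G" by blast
    then show ?thesis by (intro that) (simp_all only: not_less)
  qed
  define s where "s = rk F - rk G"
  obtain m1 where m1: "m = sg F s + m1" using pm_extract[of s m F] ge s_def by auto
  have FV: "F \<in> V H" using F m by auto
  have FL: "F \<in> L" using FV by auto
  have GL: "G \<in> L" using G m H by auto
  have k1: "ks m1 \<subseteq> V H" using m by (auto simp: m1 ks_plus_nat)
  \<comment> \<open>\<open>Var F ^ s\<close> is traded for its difference from
    \<open>Y F ^ s\<close>, where every monomial has higher weight. The discarded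
    \<open>Y F ^ s\<close> dies against the variable of \<open>G\<close>, or against
    \<open>XH H\<close> if \<open>G = H\<close>; \<open>s\<close> is the least exponent for which
    \<open>XH_Y_power\<close> applies.\<close>
  define p where "p = mon m1 * (Var F ^ s - Y F ^ s)"
  have "p \<in> weight_part rk (V H) (deg m1 + s) (weight rk m1 + Suc (s * rk F))"
    unfolding p_def by (intro weight_part_mult weight_part_mon Var_Y_power_weight_part FV k1 order_refl refl)
  then have p1: "p \<in> weight_part rk (V H) (deg m) (Suc (weight rk m))"
    by (simp add: m1 weight_add add_ac)
  have Yp: "Y F ^ s \<in> poly_ring P" by (intro poly_ring_power Y_ring) (use FV V_P[OF H] in auto)
  have "XH H * mon m - XH H * p = XH H * (mon m1 * Y F ^ s)"
    by (simp add: p_def m1 mon_add mon_power algebra_simps)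
  also have "\<dots> \<in> I"
  proof (cases "G = H")
    case True
    have "XH H * Y F ^ s \<in> I" using XH_Y_power[OF GL FL GF, of s] True by (simp add: s_def)
    moreover have "ks m1 \<subseteq> P" using k1 V_P[OF H] by (rule subset_trans)
    ultimately have "mon m1 * (XH H * Y F ^ s) \<in> I" using I_mult poly_ring_mon by blast
    then show ?thesis by (simp only: mult.left_commute)
  next
    case False
    then have "G \<in> ks m1" using G GF by (auto simp: m1 in_keys_iff lookup_add lookup_single when_def split: if_splits)
    then obtain m2 where m2: "m1 = sg G 1 + m2" using pm_extract[of 1 m1 G] by (auto simp: in_keys_iff)
    have "G \<noteq> z" using \<open>G \<in> ks m1\<close> k1 V_P[OF H] by (auto simp: P_def)
    then have "Var G * Y F ^ s \<in> I" using XH_Y_power[OF GL FL GF, of s] by (simp add: s_def XH_def)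
    moreover have "ks m2 \<subseteq> P" using k1 V_P[OF H] by (auto simp: m2 ks_plus_nat)
    ultimately have "(XH H * mon m2) * (Var G * Y F ^ s) \<in> I"
      using I_mult[OF _ poly_ring_mult[OF XH_ring[OF H] poly_ring_mon]] by blast
    moreover have "XH H * (mon m1 * Y F ^ s) = (XH H * mon m2) * (Var G * Y F ^ s)"
      unfolding m2 mon_add Var_mon by (simp only: mult.assoc mult.left_commute mult.commute)
    ultimately show ?thesis by simp
  qed
  finally show ?thesis using p1 by (intro bexI)
qed

lemma finite_FYs [simp]: "finite (FYs H d)"
proof -
  have inj: "inj_on (\<lambda>m. restrict (lk m) L) (FYs H d)"
  proof (rule inj_onI)
    fix m m' assume *: "m \<in> FYs H d" "m' \<in> FYs H d" "restrict (lk m) L = restrict (lk m') L"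
    show "m = m'"
    proof (rule poly_mapping_eqI)
      fix k show "lk m k = lk m' k"
      proof (cases "k \<in> L")
        case True then show ?thesis using fun_cong[OF *(3), of k] by simp
      next
        case False
        then have "k \<notin> ks m" "k \<notin> ks m'" using * by (auto simp: FYs_def FY_def)
        then show ?thesis by (simp add: in_keys_iff)
      qed
    qed
  qed
  have "(\<lambda>m. restrict (lk m) L) ` FYs H d \<subseteq> L \<rightarrow>\<^sub>E {..d}"
  proof (clarsimp)
    fix m F assume "m \<in> FYs H d" "F \<in> L"
    then have "(\<Sum>v\<in>ks m. lk m v) = d" by (simp only: FYs_def mem_Collect_eq deg_eq)
    then show "lk m F \<le> d"
      using member_le_sum[of F "ks m" "lk m"] by (cases "F \<in> ks m") (auto simp: in_keys_iff)
  qed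
  then have "finite ((\<lambda>m. restrict (lk m) L) ` FYs H d)" by (rule finite_subset) (simp add: finite_PiE)
  then show ?thesis using inj finite_imageD by blast
qed

lemma weight_rk_le: "ks m \<subseteq> L \<Longrightarrow> weight rk m \<le> deg m * r"
proof -
  assume "ks m \<subseteq> L"
  then have "weight rk m \<le> weight (\<lambda>_. r) m" by (intro weight_mono rk_le_r) auto
  also have "\<dots> = deg m * r" by (simp add: weight_def sum_distrib_right)
  finally show ?thesis .
qed

lemma straighten:
  assumes H: "H \<in> L" and p: "p \<in> weight_part rk (V H) d w"
  shows "\<exists>c. XH H * p - XH H * (\<Sum>m\<in>FYs H d. of_int (c m) * mon m) \<in> I"
  using p
proof (induction "Suc (d * r) - w" arbitrary: w p)
  case 0
  \<comment> \<open>Here \<open>w > d * r\<close>, and no monomial of degree \<open>d\<close> has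
    such a weight.\<close>
  have "ks p = {}"
  proof (rule ccontr)
    assume "ks p \<noteq> {}"
    then obtain m where "m \<in> ks p" by blast
    then have m: "ks m \<subseteq> V H" "deg m = d" "w \<le> weight rk m" using 0(2) unfolding weight_part_def by blast+
    then have "ks m \<subseteq> L" by auto
    from weight_rk_le[OF this] m 0(1) show False by simp
  qed
  then show ?case by (intro exI[of _ "\<lambda>_. 0"]) simp
next
  case (Suc j)
  have mk: "ks m \<subseteq> V H" "deg m = d" "w \<le> weight rk m" if "m \<in> ks p" for m
    using Suc.prems that unfolding weight_part_def by blast+
  have "\<exists>p'. m \<in> ks p \<and> \<not> FY H m \<longrightarrow> p' \<in> weight_part rk (V H) d (Suc w) \<and> XH H * mon m - XH H * p' \<in> I" for m
  proof (cases "m \<in> ks p \<and> \<not> FY H m")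
    case True
    then obtain p' where p': "p' \<in> weight_part rk (V H) (deg m) (Suc (weight rk m))" "XH H * mon m - XH H * p' \<in> I"
      using straighten_step[OF H mk(1)] by blast
    have m: "deg m = d" "w \<le> weight rk m" using mk True by blast+
    have "p' \<in> weight_part rk (V H) d (Suc w)"
      using weight_part_antimono[OF p'(1)[unfolded m(1)], of "Suc w"] m(2) by simp
    then show ?thesis using p' by blast
  qed auto
  then have "\<forall>m. \<exists>p'. m \<in> ks p \<and> \<not> FY H m \<longrightarrow> p' \<in> weight_part rk (V H) d (Suc w) \<and> XH H * mon m - XH H * p' \<in> I" by (rule allI)
  from choice[OF this] obtain g where g: "\<And>m. m \<in> ks p \<Longrightarrow> \<not> FY H m \<Longrightarrow> g m \<in> weight_part rk (V H) d (Suc w)"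
    "\<And>m. m \<in> ks p \<Longrightarrow> \<not> FY H m \<Longrightarrow> XH H * mon m - XH H * g m \<in> I" by blast
  define p' where "p' = (\<Sum>m | m \<in> ks p \<and> \<not> FY H m. of_int (lk p m) * g m)"
  have p': "p' \<in> weight_part rk (V H) d (Suc w)" unfolding p'_def by (intro weight_part_sum weight_part_of_int) (use g in auto)
  have j: "j = Suc (d * r) - Suc w" using Suc.hyps(2) by simp
  obtain c where c: "XH H * p' - XH H * (\<Sum>m\<in>FYs H d. of_int (c m) * mon m) \<in> I"
    using Suc.hyps(1)[OF j p'] by blast
  define c' where "c' m = c m + (if m \<in> ks p then lk p m else 0)" for m
  have FYp: "{m. m \<in> ks p \<and> FY H m} = FYs H d \<inter> ks p" using mk by (auto simp: FYs_def)
  have s1: "(\<Sum>m\<in>FYs H d. of_int (c' m) * mon m) = (\<Sum>m\<in>FYs H d. of_int (c m) * mon m) + (\<Sum>m | m \<in> ks p \<and> FY H m. of_int (lk p m) * mon m)"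
  proof -
    have "(\<Sum>m | m \<in> ks p \<and> FY H m. of_int (lk p m) * mon m) = (\<Sum>m\<in>FYs H d. of_int (if m \<in> ks p then lk p m else 0) * mon m)"
      unfolding FYp by (subst sum.inter_restrict) (auto intro!: sum.cong)
    then show ?thesis by (simp add: c'_def ring_distribs sum.distrib)
  qed
  have s2: "p = (\<Sum>m | m \<in> ks p \<and> FY H m. of_int (lk p m) * mon m) + (\<Sum>m | m \<in> ks p \<and> \<not> FY H m. of_int (lk p m) * mon m)"
  proof -
    have u: "ks p = {m. m \<in> ks p \<and> FY H m} \<union> {m. m \<in> ks p \<and> \<not> FY H m}" by blast
    have "(\<Sum>m\<in>ks p. of_int (lk p m) * mon m) = (\<Sum>m | m \<in> ks p \<and> FY H m. of_int (lk p m) * mon m) + (\<Sum>m | m \<in> ks p \<and> \<not> FY H m. of_int (lk p m) * mon m)"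
      by (subst (1) u, rule sum.union_disjoint) auto
    then show ?thesis using zpoly_expand[of p] by (rule trans[rotated])
  qed
  have s3: "XH H * (\<Sum>m | m \<in> ks p \<and> \<not> FY H m. of_int (lk p m) * mon m) - XH H * p' \<in> I"
  proof -
    have "XH H * (\<Sum>m | m \<in> ks p \<and> \<not> FY H m. of_int (lk p m) * mon m) - XH H * p'
      = (\<Sum>m | m \<in> ks p \<and> \<not> FY H m. of_int (lk p m) * (XH H * mon m - XH H * g m))"
      unfolding p'_def by (simp add: sum_distrib_left sum_subtractf[symmetric] algebra_simps)
    also have "\<dots> \<in> I" by (intro I_sum I_of_int) (use g in auto)
    finally show ?thesis .
  qed
  define A where "A = (\<Sum>m | m \<in> ks p \<and> FY H m. of_int (lk p m) * mon m)"
  define B where "B = (\<Sum>m | m \<in> ks p \<and> \<not> FY H m. of_int (lk p m) * mon m)"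
  define C where "C = (\<Sum>m\<in>FYs H d. of_int (c m) * mon m)"
  have pAB: "p = A + B" unfolding A_def B_def by (rule s2)
  have "XH H * p - XH H * (C + A) = (XH H * B - XH H * p') + (XH H * p' - XH H * C)"
    unfolding pAB by (simp add: algebra_simps)
  also have "\<dots> \<in> I" using I_add[OF s3 c] unfolding B_def C_def .
  finally have "XH H * p - XH H * (\<Sum>m\<in>FYs H d. of_int (c' m) * mon m) \<in> I"
    unfolding s1 A_def C_def .
  then show ?case by (rule exI[of _ c'])
qed

lemma chain_pred:
  assumes K: "finite K" "\<And>F G. F \<in> K \<Longrightarrow> G \<in> K \<Longrightarrow> F \<subseteq> G \<or> G \<subseteq> F" and H: "\<And>G. G \<in> K \<Longrightarrow> H \<subset> G" "H \<subset> F"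
  shows "\<exists>G\<in>insert H K. G \<subset> F \<and> (\<forall>G'\<in>K. G' \<subset> F \<longrightarrow> G' \<subseteq> G)"
proof -
  define S where "S = {G \<in> insert H K. G \<subset> F}"
  have "finite S" "S \<noteq> {}" using K(1) H by (auto simp: S_def)
  then obtain G where G: "G \<in> S" "\<And>G'. G' \<in> S \<Longrightarrow> G \<subseteq> G' \<Longrightarrow> G = G'"
    using finite_has_maximal[of S] by blast
  have "G' \<subseteq> G" if "G' \<in> K" "G' \<subset> F" for G'
  proof -
    have "G \<subseteq> G' \<or> G' \<subseteq> G" using K(2)[of G G'] G(1) that H(1)[of G'] unfolding S_def by blast
    then show ?thesis using G(2)[of G'] that unfolding S_def by blast
  qed
  then show ?thesis using G(1) unfolding S_def by (intro bexI[of _ G]) blast+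
qed

definition deg_below :: "'b set \<Rightarrow> ('b set \<Rightarrow>\<^sub>0 nat) \<Rightarrow> nat" where
  "deg_below F = weight (\<lambda>G. if G \<subseteq> F then 1 else 0)"

definition deg_above :: "'b set \<Rightarrow> ('b set \<Rightarrow>\<^sub>0 nat) \<Rightarrow> nat" where
  "deg_above F = weight (\<lambda>G. if F \<subset> G then 1 else 0)"

lemma deg_below_pred:
  assumes F: "F \<in> ks m" and G: "G \<subset> F" "\<And>G'. G' \<in> ks m \<Longrightarrow> G' \<subset> F \<Longrightarrow> G' \<subseteq> G"
  shows "deg_below F m = deg_below G m + lk m F"
proof -
  obtain m1 where m1: "m = sg F (lk m F) + m1" using pm_extract[of "lk m F" m F] by auto
  have "lk m1 F = 0" using arg_cong[OF m1, of "\<lambda>m. lk m F"] by (simp add: lookup_add)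
  then have F1: "F \<notin> ks m1" by (simp add: in_keys_iff)
  have k1: "ks m1 \<subseteq> ks m" using ks_plus_nat[of "sg F (lk m F)" m1] m1 by auto
  have e: "deg_below F m1 = deg_below G m1"
    unfolding deg_below_def
  proof (rule weight_cong)
    fix v assume "v \<in> ks m1"
    then have "v \<in> ks m" "v \<noteq> F" using k1 F1 by auto
    then have "v \<subseteq> F \<longleftrightarrow> v \<subseteq> G" using G by blast
    then show "(if v \<subseteq> F then 1 else 0) = (if v \<subseteq> G then 1 else (0 :: nat))" by simp
  qed
  have "deg_below F m = lk m F + deg_below F m1" by (subst m1) (simp add: deg_below_def weight_add)
  moreover have "deg_below G m = deg_below G m1" using G(1) by (subst m1) (simp add: deg_below_def weight_add)
  ultimately show ?thesis using e by simp
qed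

text \<open>The strict bounds on the exponents telescope along the chain from \<open>H\<close> up to
  \<open>F\<close>.\<close>

lemma FY_deg_below:
  assumes m: "FY H m" and F: "F \<in> ks m"
  shows "deg_below F m < rk F - rk H"
  using F
proof (induction "rk F" arbitrary: F rule: less_induct)
  case less
  have kV: "ks m \<subseteq> V H" and ch: "\<And>F G. F \<in> ks m \<Longrightarrow> G \<in> ks m \<Longrightarrow> F \<subseteq> G \<or> G \<subseteq> F"
    using m unfolding FY_def by auto
  obtain G where G: "G \<in> insert H (ks m)" "G \<subset> F" "\<And>G'. G' \<in> ks m \<Longrightarrow> G' \<subset> F \<Longrightarrow> G' \<subseteq> G"
  proof -
    have "\<exists>G\<in>insert H (ks m). G \<subset> F \<and> (\<forall>G'\<in>ks m. G' \<subset> F \<longrightarrow> G' \<subseteq> G)"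
    proof (rule chain_pred)
      show "F \<subseteq> G \<or> G \<subseteq> F" if "F \<in> ks m" "G \<in> ks m" for F G by (rule ch[OF that])
      show "H \<subset> G" if "G \<in> ks m" for G using subsetD[OF kV that] by simp
      show "H \<subset> F" using subsetD[OF kV less.prems] by simp
    qed simp
    then
    obtain G where "G \<in> insert H (ks m)" "G \<subset> F" "\<forall>G'\<in>ks m. G' \<subset> F \<longrightarrow> G' \<subseteq> G" by (elim bexE conjE)
    then show ?thesis by (intro that) auto
  qed
  have c: "deg_below F m = deg_below G m + lk m F" by (rule deg_below_pred[OF less.prems G(2,3)])
  have "\<forall>F\<in>ks m. \<forall>G\<in>insert H (ks m). G \<subset> F \<longrightarrow> lk m F < rk F - rk G" using m by (simp add: FY_def)
  from mp[OF bspec[OF bspec[OF this less.prems] G(1)] G(2)] have l: "lk m F < rk F - rk G" .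
  show ?case
  proof (cases "G = H")
    case True
    have "deg_below G m = 0" using kV by (auto simp: deg_below_def weight_eq_0 True)
    then show ?thesis using c l True by simp
  next
    case False
    then have Gk: "G \<in> ks m" using G by simp
    have "rk G < rk F" using rk_mono[of G F] kV Gk less.prems G(2) by auto
    from less.hyps[OF this Gk] show ?thesis using c l by simp
  qed
qed

lemma FY_deg:
  assumes m: "FY H m" and H: "H \<in> L" "H \<noteq> U"
  shows "deg m < r - rk H"
proof (cases "ks m = {}")
  case True
  then show ?thesis using rk_lt_r[OF H] by (simp add: deg_eq)
next
  case False
  obtain F where F: "F \<in> ks m" "\<forall>G\<in>ks m. F \<subseteq> G \<longrightarrow> F = G"
    using finite_has_maximal[OF finite_keys False] by blast
  have "G \<subseteq> F" if "G \<in> ks m" for G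
  proof -
    have "F \<subseteq> G \<or> G \<subseteq> F" using m F(1) that unfolding FY_def by simp
    then show ?thesis using F(2) that by auto
  qed
  then have "deg m = deg_below F m" unfolding deg_below_def by (intro weight_cong) auto
  moreover have "F \<in> L" using m F(1) unfolding FY_def by auto
  ultimately show ?thesis using FY_deg_below[OF m F(1)] rk_le_r[of F] by simp
qed

text \<open>By \<open>FY_deg\<close> no Feichtner--Yuzvinsky monomial over \<open>H\<close> has this
  degree, so straightening leaves the empty sum.\<close>

lemma XH_high_degree:
  assumes H: "H \<in> L" "H \<noteq> U" and m: "ks m \<subseteq> V H" and d: "deg m \<ge> r - rk H"
  shows "XH H * mon m \<in> I"
proof -
  have "x \<notin> FYs H (deg m)" for x
  proof
    assume "x \<in> FYs H (deg m)"
    then have "FY H x" "deg x = deg m" by (simp_all only: FYs_def mem_Collect_eq)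
    with FY_deg[OF _ H] d show False by (metis not_less)
  qed
  then have "FYs H (deg m) = {}" by blast
  moreover have "mon m \<in> weight_part rk (V H) (deg m) 0" using m by (intro weight_part_mon) auto
  ultimately show ?thesis using straighten[OF H(1), of "mon m" "deg m" 0] by simp
qed

text \<open>The factors strictly above \<open>H\<close> are straightened over the base
  \<open>H\<close>, and the others are multiplied back. This vanishing criterion drives both the
  evaluation of tight monomials and the triangularity of the pairing.\<close>

lemma mon_high:
  assumes M: "ks M \<subseteq> P" and H: "H \<in> ks M" "H \<noteq> U" and d: "deg_above H M \<ge> r - rk H"
  shows "mon M \<in> I"
proof -
  have HL: "H \<in> L" "H \<noteq> z" using M H by (auto simp: P_def)
  obtain M1 where M1: "M = sg H 1 + M1" using pm_extract[of 1 M H] H by (auto simp: in_keys_iff)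
  obtain a b where ab: "M1 = a + b" "ks a = {v \<in> ks M1. H \<subset> v}" "ks b = {v \<in> ks M1. \<not> H \<subset> v}"
    using pm_split[of M1 "\<lambda>v. H \<subset> v"] by blast
  have k1: "ks M1 \<subseteq> P" using M by (auto simp: M1 ks_plus_nat)
  have "deg_above H M = deg_above H a + deg_above H b" by (simp add: M1 ab(1) deg_above_def weight_add)
  also have "deg_above H b = 0" using ab(3) by (auto simp: deg_above_def weight_eq_0)
  also have "deg_above H a = deg a" unfolding deg_above_def using ab(2) by (intro weight_cong) auto
  finally have "deg a \<ge> r - rk H" using d by simp
  moreover have "ks a \<subseteq> V H" using ab(2) k1 by (auto simp: P_def)
  ultimately have "XH H * mon a \<in> I" using HL H by (intro XH_high_degree)
  moreover have "ks b \<subseteq> P" using ab(3) k1 by blast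
  ultimately have "mon b * (XH H * mon a) \<in> I" using I_mult[OF _ poly_ring_mon] by blast
  moreover have "XH H = mon (sg H 1)" unfolding XH_def Var_mon using HL by auto
  moreover have "mon M = mon (sg H 1) * (mon a * mon b)" unfolding M1 ab(1) mon_add ..
  ultimately show ?thesis by (simp only: mult.left_commute mult.commute)
qed

end

section \<open>The degree map\<close>

definition subst_mon :: "('v \<Rightarrow> 'w zpoly) \<Rightarrow> ('v \<Rightarrow>\<^sub>0 nat) \<Rightarrow> 'w zpoly" where
  "subst_mon f m = (\<Prod>v\<in>ks m. f v ^ lk m v)"

definition subst_poly :: "('v \<Rightarrow> 'w zpoly) \<Rightarrow> 'v zpoly \<Rightarrow> 'w zpoly" where
  "subst_poly f p = (\<Sum>m\<in>ks p. of_int (lk p m) * subst_mon f m)"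

lemma subst_mon_superset: "finite S \<Longrightarrow> ks m \<subseteq> S \<Longrightarrow> subst_mon f m = (\<Prod>v\<in>S. f v ^ lk m v)"
  unfolding subst_mon_def by (rule prod.mono_neutral_left) (auto simp: in_keys_iff)

lemma subst_mon_add: "subst_mon f (m + n) = subst_mon f m * subst_mon f n"
  by (simp add: subst_mon_superset[of "ks m \<union> ks n"] ks_plus_nat lookup_add power_add prod.distrib)

lemma linear_superset: "finite S \<Longrightarrow> ks p \<subseteq> S \<Longrightarrow> (\<Sum>m\<in>ks p. of_int (lk p m) * g m) = (\<Sum>m\<in>S. of_int (lk p m) * (g m :: 'a::comm_ring_1))"
  by (rule sum.mono_neutral_left) (auto simp: in_keys_iff)

lemma linear_add: "(\<Sum>m\<in>ks (p + q). of_int (lk (p + q) m) * g m) = (\<Sum>m\<in>ks p. of_int (lk p m) * g m) + (\<Sum>m\<in>ks q. of_int (lk q m) * (g m :: 'a::comm_ring_1))"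
proof -
  let ?S = "ks p \<union> ks q"
  have "(\<Sum>m\<in>ks (p + q). of_int (lk (p + q) m) * g m) = (\<Sum>m\<in>?S. of_int (lk (p + q) m) * g m)"
    by (rule linear_superset) (use keys_add[of p q] in auto)
  also have "\<dots> = (\<Sum>m\<in>?S. of_int (lk p m) * g m) + (\<Sum>m\<in>?S. of_int (lk q m) * g m)"
    by (simp add: lookup_add ring_distribs sum.distrib)
  also have "(\<Sum>m\<in>?S. of_int (lk p m) * g m) = (\<Sum>m\<in>ks p. of_int (lk p m) * g m)"
    by (rule linear_superset[symmetric]) auto
  also have "(\<Sum>m\<in>?S. of_int (lk q m) * g m) = (\<Sum>m\<in>ks q. of_int (lk q m) * g m)"
    by (rule linear_superset[symmetric]) auto
  finally show ?thesis .
qed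

lemma subst_poly_add: "subst_poly f (p + q) = subst_poly f p + subst_poly f q"
  unfolding subst_poly_def by (rule linear_add)

lemma subst_poly_0 [simp]: "subst_poly f 0 = 0" by (simp add: subst_poly_def)

lemma subst_poly_mon: "subst_poly f (of_int c * mon m) = of_int c * subst_mon f m"
  by (simp add: subst_poly_def sg_of_int[symmetric])

lemma subst_poly_Var: "subst_poly f (Var v) = f v"
  using subst_poly_mon[of f 1 "sg v 1"] by (simp add: Var_mon subst_mon_def)

lemma subst_poly_mult: "subst_poly f (p * q) = subst_poly f p * subst_poly f q"
proof (induction p rule: zpoly_induct)
  case (mon m c)
  show ?case
  proof (induction q rule: zpoly_induct)
    case (mon n d)
    have "(of_int c * mon m) * (of_int d * mon n) = of_int (c * d) * mon (m + n)"
      by (simp add: mon_add mult_ac)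
    then show ?case by (simp only: subst_poly_mon subst_mon_add) (simp add: mult_ac)
  qed (simp_all add: ring_distribs subst_poly_add)
qed (simp_all add: ring_distribs subst_poly_add)

lemma subst_poly_sum: "subst_poly f (sum g S) = (\<Sum>i\<in>S. subst_poly f (g i))"
  by (induction S rule: infinite_finite_induct) (simp_all add: subst_poly_add)

lemma subst_poly_power: "subst_poly f (p ^ k) = subst_poly f p ^ k"
proof (induction k)
  case 0
  have "subst_poly f (of_int 1 * mon 0) = of_int 1 * subst_mon f 0" by (rule subst_poly_mon)
  then show ?case by (simp add: subst_mon_def)
qed (simp add: subst_poly_mult)

section \<open>The linear form and its vanishing on the ideal\<close>

context geometric_lattice begin

text \<open>The dragon Hall--Rado condition says that any nonempty set of factors has a join of rank
  larger than its size. Here it is read flat by flat; \<open>F = U\<close> bounds the degree by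
  \<open>r - 1\<close>.\<close>

definition dragon :: "('b set \<Rightarrow>\<^sub>0 nat) \<Rightarrow> bool" where
  "dragon m \<longleftrightarrow> ks m \<subseteq> P \<and> (\<forall>F\<in>P. deg_below F m < rk F)"

text \<open>The degree of a monomial in the simplicial generators $y_F$; in the argument of \<open>D\<close>,
  \<open>Var F\<close> stands for $y_F$, not $x_F$.\<close>

definition D :: "'b set zpoly \<Rightarrow> int" where
  "D p = (\<Sum>m\<in>ks p. of_int (lk p m) * (if dragon m then 1 else 0))"

lemma D_add: "D (p + q) = D p + D q" unfolding D_def by (rule linear_add)

lemma D_0 [simp]: "D 0 = 0" by (simp add: D_def)

lemma D_uminus: "D (- p) = - D p" using D_add[of p "- p"] by simp

lemma D_diff: "D (p - q) = D p - D q" using D_add[of p "- q"] by (simp add: D_uminus)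

lemma D_sum: "D (sum g S) = (\<Sum>i\<in>S. D (g i))"
  by (induction S rule: infinite_finite_induct) (simp_all add: D_add)

lemma D_mon: "D (of_int c * mon m) = (if dragon m then c else 0)"
  by (simp add: D_def sg_of_int[symmetric])

lemma D_mon1: "D (mon m) = (if dragon m then 1 else 0)"
  using D_mon[of 1 m] by simp

lemma D_of_int: "D (of_int c * p) = c * D p"
proof (induction p rule: zpoly_induct)
  case (mon m d)
  have "of_int c * (of_int d * mon m) = of_int (c * d) * mon m" by (simp add: mult.assoc)
  then show ?case by (simp only: D_mon) simp
qed (simp_all add: ring_distribs D_add)

lemma deg_below_add: "deg_below F (m + n) = deg_below F m + deg_below F n" by (simp add: deg_below_def weight_add)

lemma deg_below_Var: "deg_below F (sg G k) = (if G \<subseteq> F then k else 0)" by (simp add: deg_below_def)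

text \<open>An atom has rank 1, so already one factor below it violates the condition.\<close>

lemma D_atom:
  assumes a: "a \<in> lat_atoms L z"
  shows "D (q * Var a) = 0"
proof (induction q rule: zpoly_induct)
  case (mon m c)
  have "\<not> deg_below a (m + sg a 1) < rk a" by (simp add: deg_below_add deg_below_Var atom_rk[OF a])
  then have "\<not> dragon (m + sg a 1)" using atom_in[OF a] unfolding dragon_def P_def by blast
  moreover have "of_int c * mon m * Var a = of_int c * mon (m + sg a 1)" by (simp add: mon_add Var_mon)
  ultimately show ?case by (simp only: D_mon) simp
qed (simp_all add: ring_distribs D_add)

lemma deg_below_modular:
  assumes "H1 \<in> L" "H2 \<in> L" "ks m \<subseteq> P"
  shows "deg_below H1 m + deg_below H2 m \<le> deg_below (join H1 H2) m + deg_below (H1 \<inter> H2) m"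
proof -
  have "weight (\<lambda>G. (if G \<subseteq> H1 then 1 else 0) + (if G \<subseteq> H2 then 1 else 0)) m
     \<le> weight (\<lambda>G. (if G \<subseteq> join H1 H2 then 1 else 0) + (if G \<subseteq> H1 \<inter> H2 then 1 else 0)) m"
    by (rule weight_mono) (use join_1[OF assms(1,2)] join_2[OF assms(1,2)] in auto)
  then show ?thesis by (simp add: deg_below_def weight_fun_add)
qed

lemma deg_below_z: "ks m \<subseteq> P \<Longrightarrow> deg_below z m = 0"
  using bot by (auto simp: deg_below_def weight_eq_0 P_def)

text \<open>Unless \<open>m\<close> satisfies the condition with room for two more factors at every
  flat above \<open>J\<close>, all four terms vanish. Otherwise each pair decouples into
  \<open>ok A \<and> ok B\<close>, \<open>ok J\<close> holds, and the identity amounts to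
  \<open>ok F \<or> ok G\<close>. If both failed, at \<open>H1\<close> above \<open>F\<close> and
  \<open>H2\<close> above \<open>G\<close>, the modular inequalities for ranks and degrees would
  contradict the room at \<open>join H1 H2\<close>, which lies above \<open>J\<close>.\<close>

lemma dragon_exchange:
  assumes F: "F \<in> P" and G: "G \<in> P"
  defines "J \<equiv> join F G"
  shows "(if dragon (m + sg F 1 + sg G 1) then 1 else 0) + (if dragon (m + sg J 1 + sg J 1) then 1 else 0)
    = (if dragon (m + sg F 1 + sg J 1) then 1 else 0) + (if dragon (m + sg J 1 + sg G 1) then 1 else (0 :: int))"
proof (cases "ks m \<subseteq> P \<and> (\<forall>H\<in>P. deg_below H m < rk H) \<and> (\<forall>H\<in>P. J \<subseteq> H \<longrightarrow> deg_below H m + 2 < rk H)")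
  case False
  have FL: "F \<in> L" "G \<in> L" using F G by (auto simp: P_def)
  have J12: "F \<subseteq> J" "G \<subseteq> J" unfolding J_def using join_1 join_2 FL by auto
  have "\<not> dragon (m + sg A 1 + sg B 1)" if "A \<subseteq> J" "B \<subseteq> J" for A B
  proof
    assume d: "dragon (m + sg A 1 + sg B 1)"
    then have "ks m \<subseteq> P" by (auto simp: dragon_def ks_plus_nat)
    moreover have "deg_below H m < rk H" if "H \<in> P" for H using d that by (force simp: dragon_def deg_below_add)
    moreover have "deg_below H m + 2 < rk H" if "H \<in> P" "J \<subseteq> H" for H
    proof -
      have "deg_below H (m + sg A 1 + sg B 1) = deg_below H m + 2" using \<open>A \<subseteq> J\<close> \<open>B \<subseteq> J\<close> that by (auto simp: deg_below_add deg_below_Var)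
      then show ?thesis using d that(1) by (metis dragon_def)
    qed
    ultimately show False using False by blast
  qed
  then show ?thesis using J12 by simp
next
  case True
  then have kP: "ks m \<subseteq> P" and c1: "\<And>H. H \<in> P \<Longrightarrow> deg_below H m < rk H" and c2: "\<And>H. H \<in> P \<Longrightarrow> J \<subseteq> H \<Longrightarrow> deg_below H m + 2 < rk H" by auto
  have FL: "F \<in> L" "G \<in> L" using F G by (auto simp: P_def)
  have J12: "F \<subseteq> J" "G \<subseteq> J" unfolding J_def using join_1 join_2 FL by auto
  have JP: "J \<in> P" using above_P[OF F _ J12(1)] join_in[OF FL] by (simp add: J_def)
  define ok where "ok A \<longleftrightarrow> (\<forall>H\<in>P. A \<subseteq> H \<longrightarrow> deg_below H m + 1 < rk H)" for A
  have "ok J" using c2 by (force simp: ok_def)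
  have dAB: "dragon (m + sg A 1 + sg B 1) \<longleftrightarrow> ok A \<and> ok B"
    if "A \<in> P" "B \<in> P" "\<And>H. H \<in> L \<Longrightarrow> A \<subseteq> H \<Longrightarrow> B \<subseteq> H \<Longrightarrow> J \<subseteq> H" for A B
  proof
    assume d: "dragon (m + sg A 1 + sg B 1)"
    show "ok A \<and> ok B" using d unfolding ok_def dragon_def deg_below_add deg_below_Var by fastforce
  next
    assume o: "ok A \<and> ok B"
    have "deg_below H (m + sg A 1 + sg B 1) < rk H" if H: "H \<in> P" for H
    proof -
      have HL: "H \<in> L" using H by (simp add: P_def)
      show ?thesis
        using o c1[OF H] c2[OF H] H \<open>\<And>H. H \<in> L \<Longrightarrow> A \<subseteq> H \<Longrightarrow> B \<subseteq> H \<Longrightarrow> J \<subseteq> H\<close>[OF HL]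
        unfolding ok_def deg_below_add deg_below_Var by (cases "A \<subseteq> H"; cases "B \<subseteq> H") auto
    qed
    then show "dragon (m + sg A 1 + sg B 1)" using kP that by (auto simp: dragon_def ks_plus_nat)
  qed
  have "ok F \<or> ok G"
  proof (rule ccontr)
    assume "\<not> (ok F \<or> ok G)"
    then obtain H1 H2 where H: "H1 \<in> P" "F \<subseteq> H1" "\<not> deg_below H1 m + 1 < rk H1" "H2 \<in> P" "G \<subseteq> H2" "\<not> deg_below H2 m + 1 < rk H2"
      unfolding ok_def by blast
    then have HL: "H1 \<in> L" "H2 \<in> L" by (auto simp: P_def)
    define K where "K = join H1 H2"
    have K: "K \<in> L" "H1 \<subseteq> K" "H2 \<subseteq> K" "rk K + rk (H1 \<inter> H2) \<le> rk H1 + rk H2"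
      unfolding K_def using join_in join_1 join_2 join_rk HL by auto
    have KP: "K \<in> P" using above_P[OF H(1) K(1,2)] .
    have "J \<subseteq> K" unfolding J_def using join_least[OF FL K(1)] H K by blast
    then have k2: "deg_below K m + 2 < rk K" using c2 KP by blast
    have k3: "deg_below H1 m + deg_below H2 m \<le> deg_below K m + deg_below (H1 \<inter> H2) m"
      unfolding K_def by (rule deg_below_modular[OF HL kP])
    have k4: "deg_below (H1 \<inter> H2) m \<le> rk (H1 \<inter> H2)"
    proof (cases "H1 \<inter> H2 = z")
      case True then show ?thesis using deg_below_z[OF kP] by simp
    next
      case False
      then have "H1 \<inter> H2 \<in> P" using Int_in[OF HL] by (simp add: P_def)
      then show ?thesis using c1 by (simp add: less_imp_le)
    qed
    show False using k2 k3 k4 K(4) H(3,6) c1[OF H(1)] c1[OF H(4)] by linarith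
  qed
  moreover have "dragon (m + sg F 1 + sg G 1) \<longleftrightarrow> ok F \<and> ok G"
    by (rule dAB[OF F G]) (use join_least[OF FL] in \<open>simp add: J_def\<close>)
  moreover have "dragon (m + sg J 1 + sg J 1)" using dAB[OF JP JP] \<open>ok J\<close> by blast
  moreover have "dragon (m + sg F 1 + sg J 1) \<longleftrightarrow> ok F" using dAB[OF F JP] \<open>ok J\<close> by blast
  moreover have "dragon (m + sg J 1 + sg G 1) \<longleftrightarrow> ok G" using dAB[OF JP G] \<open>ok J\<close> by blast
  ultimately show ?thesis by auto
qed

lemma D_quadratic:
  assumes F: "F \<in> P" and G: "G \<in> P"
  shows "D (q * ((Var F - Var (join F G)) * (Var G - Var (join F G)))) = 0"
proof (induction q rule: zpoly_induct)
  case (mon m c)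
  let ?J = "join F G"
  have "mon m * ((Var F - Var ?J) * (Var G - Var ?J))
     = mon (m + sg F 1 + sg G 1) + mon (m + sg ?J 1 + sg ?J 1) - (mon (m + sg F 1 + sg ?J 1) + mon (m + sg ?J 1 + sg G 1))"
    by (simp add: mon_add Var_mon algebra_simps)
  then have "D (mon m * ((Var F - Var ?J) * (Var G - Var ?J))) = 0"
    by (simp only: D_diff D_add D_mon1 dragon_exchange[OF F G])
  then show ?case by (simp only: mult.assoc D_of_int)
qed (simp_all only: distrib_right D_add mult_zero_left D_0 add_0)

text \<open>Moebius inversion of $y_F = \sum_{G \supseteq F} x_G$: here \<open>X F\<close> is $x_F$ in terms of the $y_G$. The iteration is
  constant from step \<open>r - rk F + 1\<close> on, as \<open>X_rec\<close> needs.\<close>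

primrec X_iter :: "nat \<Rightarrow> 'b set \<Rightarrow> 'b set zpoly" where
  "X_iter 0 F = 0"
| "X_iter (Suc i) F = Var F - (\<Sum>G | G \<in> L \<and> F \<subset> G. X_iter i G)"

definition X where "X F = X_iter (Suc r) F"

lemma X_iter_stable: "F \<in> L \<Longrightarrow> r - rk F < i \<Longrightarrow> r - rk F < j \<Longrightarrow> X_iter i F = X_iter j F"
proof (induction i arbitrary: F j)
  case (Suc i)
  then obtain j' where j: "j = Suc j'" by (cases j) auto
  have "X_iter i G = X_iter j' G" if "G \<in> L" "F \<subset> G" for G
  proof -
    have "rk F < rk G" "rk G \<le> r" using rk_mono[OF Suc.prems(1) that] rk_le_r[OF that(1)] by auto
    then show ?thesis using Suc.prems j that by (intro Suc.IH) auto
  qed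
  then have "(\<Sum>G | G \<in> L \<and> F \<subset> G. X_iter i G) = (\<Sum>G | G \<in> L \<and> F \<subset> G. X_iter j' G)" by (intro sum.cong) auto
  then show ?case by (simp add: j)
qed simp

lemma X_rec: "F \<in> L \<Longrightarrow> X F = Var F - (\<Sum>G | G \<in> L \<and> F \<subset> G. X G)"
proof -
  assume F: "F \<in> L"
  have "X_iter r G = X G" if "G \<in> L" "F \<subset> G" for G
    unfolding X_def by (rule X_iter_stable) (use rk_mono[OF F that] rk_le_r[OF that(1)] that in auto)
  then have "(\<Sum>G | G \<in> L \<and> F \<subset> G. X_iter r G) = (\<Sum>G | G \<in> L \<and> F \<subset> G. X G)" by (intro sum.cong) auto
  then show ?thesis unfolding X_def[of F] by simp
qed

lemma subst_poly_Y: "F \<in> L \<Longrightarrow> subst_poly X (Y F) = Var F"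
proof -
  assume F: "F \<in> L"
  have "{K. K \<in> L \<and> F \<subseteq> K} = insert F {K. K \<in> L \<and> F \<subset> K}" using F by auto
  then show ?thesis using X_rec[OF F] by (simp add: Y_def subst_poly_add subst_poly_sum subst_poly_Var)
qed

text \<open>In terms of \<open>X\<close>, the product in \<open>D_quadratic\<close> is a sum of
  \<open>X H * X K\<close> with \<open>H\<close> above \<open>F\<close>, \<open>K\<close> above
  \<open>G\<close> and neither above \<open>J\<close>. Such \<open>H\<close> and \<open>K\<close>
  are incomparable, because a flat above both \<open>F\<close> and \<open>G\<close> lies above
  \<open>J\<close>. All pairs but \<open>(F, G)\<close> have smaller total corank and vanish by
  induction.\<close>

lemma D_incomp:
  assumes "F \<in> P" "G \<in> P" "\<not> F \<subseteq> G" "\<not> G \<subseteq> F"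
  shows "D (q * (X F * X G)) = 0"
  using assms
proof (induction "(r - rk F) + (r - rk G)" arbitrary: F G rule: less_induct)
  case less
  have FL: "F \<in> L" "G \<in> L" using less.prems by (auto simp: P_def)
  define J where "J = join F G"
  have J: "J \<in> L" "F \<subseteq> J" "G \<subseteq> J" "\<And>H. H \<in> L \<Longrightarrow> F \<subseteq> H \<Longrightarrow> G \<subseteq> H \<Longrightarrow> J \<subseteq> H"
    unfolding J_def using join_in join_1 join_2 join_least FL by auto
  define A where "A = {H. H \<in> L \<and> F \<subseteq> H \<and> \<not> J \<subseteq> H}"
  define B where "B = {K. K \<in> L \<and> G \<subseteq> K \<and> \<not> J \<subseteq> K}"
  have fin: "finite A" "finite B" by (simp_all add: A_def B_def)
  have FA: "F \<in> A" "G \<in> B" using less.prems J FL by (auto simp: A_def B_def)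
  have e1: "Var F - Var J = (\<Sum>H\<in>A. X H)"
    using arg_cong[OF Y_diff[OF J(2)], of "subst_poly X"] subst_poly_add[of X "Y F - Y J" "Y J"] FL J(1)
    by (simp add: subst_poly_sum subst_poly_Var subst_poly_Y A_def algebra_simps)
  have e2: "Var G - Var J = (\<Sum>K\<in>B. X K)"
    using arg_cong[OF Y_diff[OF J(3)], of "subst_poly X"] subst_poly_add[of X "Y G - Y J" "Y J"] FL J(1)
    by (simp add: subst_poly_sum subst_poly_Var subst_poly_Y B_def algebra_simps)
  have "0 = D (q * ((Var F - Var J) * (Var G - Var J)))"
    unfolding J_def using D_quadratic[OF less.prems(1,2)] by simp
  also have "\<dots> = (\<Sum>(H, K)\<in>A \<times> B. D (q * (X H * X K)))"
  proof -
    have "q * (sum X A * sum X B) = (\<Sum>H\<in>A. \<Sum>K\<in>B. q * (X H * X K))"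
      unfolding sum_product by (simp add: sum_distrib_left)
    then show ?thesis unfolding e1 e2 by (simp only: D_sum) (rule sum.cartesian_product)
  qed
  also have "\<dots> = (\<Sum>(H, K)\<in>{(F, G)}. D (q * (X H * X K)))"
  proof (rule sum.mono_neutral_right)
    show "\<forall>x\<in>A \<times> B - {(F, G)}. (case x of (H, K) \<Rightarrow> D (q * (X H * X K))) = 0"
    proof (intro ballI)
      fix x assume x: "x \<in> A \<times> B - {(F, G)}"
      obtain H K where xHK: "x = (H, K)" by (cases x)
      have HK: "H \<in> A" "K \<in> B" "\<not> (H = F \<and> K = G)" using x by (auto simp: xHK)
      have H: "H \<in> L" "F \<subseteq> H" "\<not> J \<subseteq> H" and K: "K \<in> L" "G \<subseteq> K" "\<not> J \<subseteq> K"
        using HK by (auto simp: A_def B_def)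
      have P: "H \<in> P" "K \<in> P" using above_P less.prems H K by blast+
      have n: "\<not> H \<subseteq> K" "\<not> K \<subseteq> H" using J(4) H K by blast+
      have le: "rk F \<le> rk H" "rk G \<le> rk K" "rk H \<le> r" "rk K \<le> r" using rk_mono_le rk_le_r FL H K by auto
      have "rk F < rk H \<or> rk G < rk K" using rk_mono[of F H] rk_mono[of G K] FL H K HK(3) by blast
      then have "D (q * (X H * X K)) = 0" using le by (intro less.hyps P n) linarith
      then show "(case x of (H, K) \<Rightarrow> D (q * (X H * X K))) = 0" by (simp add: xHK)
    qed
  qed (use fin FA in auto)
  finally show ?case by simp
qed

definition degree_map :: "'b set zpoly \<Rightarrow> int" where "degree_map p = D (subst_poly X p)"

lemma degree_map_add: "degree_map (p + q) = degree_map p + degree_map q" by (simp add: degree_map_def subst_poly_add D_add)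

lemma degree_map_sum: "degree_map (sum g S) = (\<Sum>i\<in>S. degree_map (g i))" by (simp add: degree_map_def subst_poly_sum D_sum)

lemma degree_map_of_int: "degree_map (of_int c * p) = c * degree_map p"
proof -
  have "subst_poly X (of_int c * p) = of_int c * subst_poly X p"
    using subst_poly_mon[of X c 0] by (simp add: subst_poly_mult subst_mon_def)
  then show ?thesis by (simp add: degree_map_def D_of_int)
qed

lemma degree_map_I: "x \<in> I \<Longrightarrow> degree_map x = 0"
proof -
  assume "x \<in> I"
  then obtain c where x: "x = (\<Sum>g\<in>chow_gens L z. c g * g)" unfolding I_iff by blast
  have "degree_map (c g * g) = 0" if g: "g \<in> chow_gens L z" for g
  proof -
    from g consider F G where "g = Var F * Var G" "F \<in> P" "G \<in> P" "\<not> F \<subseteq> G" "\<not> G \<subseteq> F"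
      | a where "a \<in> lat_atoms L z" "g = Y a"
      unfolding chow_gens_def P_def Y_def by blast
    then show ?thesis
    proof cases
      case 1
      then show ?thesis using D_incomp by (simp add: degree_map_def subst_poly_mult subst_poly_Var)
    next
      case 2
      then show ?thesis using D_atom atom_in by (simp add: degree_map_def subst_poly_mult subst_poly_Y)
    qed
  qed
  then show ?thesis by (simp add: x degree_map_sum)
qed

text \<open>Nothing lies above \<open>U\<close>, so there \<open>x\<close> and \<open>y\<close>
  coincide. This fixes the normalisation.\<close>

lemma degree_map_U: "degree_map (mon (sg U (r - 1))) = 1"
proof -
  have e: "{G. G \<in> L \<and> U \<subset> G} = {}" using top by auto
  have "X U = Var U" unfolding X_rec[OF U_in] e by simp
  then have "subst_poly X (mon (sg U (r - 1))) = mon (sg U (r - 1))" by (simp add: mon_power subst_poly_power subst_poly_Var)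
  moreover have "dragon (sg U (r - 1))"
  proof -
    have "deg_below F (sg U (r - 1)) < rk F" if "F \<in> P" for F
      using that top[of F] rk_pos[of F] by (auto simp: deg_below_Var P_def)
    then show ?thesis using z_neq_U by (auto simp: dragon_def P_def)
  qed
  ultimately show ?thesis by (simp add: degree_map_def D_mon1)
qed

end

lemma ex_max_fun: "finite S \<Longrightarrow> S \<noteq> {} \<Longrightarrow> \<exists>p\<in>S. \<forall>x\<in>S. f x \<le> (f p :: nat)"
proof -
  assume S: "finite S" "S \<noteq> {}"
  then have "Max (f ` S) \<in> f ` S" by (intro Max_in) auto
  then obtain p where p: "p \<in> S" "f p = Max (f ` S)" by auto
  have "f x \<le> f p" if "x \<in> S" for x unfolding p(2) using S that by (intro Max_ge) auto
  then show ?thesis using p(1) by blast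
qed

lemma ex_min_fun: "finite S \<Longrightarrow> S \<noteq> {} \<Longrightarrow> \<exists>p\<in>S. \<forall>x\<in>S. f p \<le> (f x :: nat)"
proof -
  assume S: "finite S" "S \<noteq> {}"
  then have "Min (f ` S) \<in> f ` S" by (intro Min_in) auto
  then obtain p where p: "p \<in> S" "f p = Min (f ` S)" by auto
  have "f p \<le> f x" if "x \<in> S" for x unfolding p(2) using S that by (intro Min_le) auto
  then show ?thesis using p(1) by blast
qed

context geometric_lattice begin

text \<open>On a chain the exponents are the increments of this function of \<open>i\<close>, so
  monomials can be compared through it.\<close>

definition deg_upto :: "nat \<Rightarrow> ('b set \<Rightarrow>\<^sub>0 nat) \<Rightarrow> nat" where
  "deg_upto i = weight (\<lambda>G. if rk G \<le> i then 1 else 0)"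

lemma deg_upto_add: "deg_upto i (m + n) = deg_upto i m + deg_upto i n" by (simp add: deg_upto_def weight_add)

lemma deg_upto_sg: "deg_upto i (sg F k) = (if rk F \<le> i then k else 0)" by (simp add: deg_upto_def)

lemma deg_upto_cong: "(\<And>G. G \<in> ks m \<Longrightarrow> rk G \<le> i \<longleftrightarrow> rk G \<le> j) \<Longrightarrow> deg_upto i m = deg_upto j m"
  unfolding deg_upto_def by (rule weight_cong) simp

lemma deg_upto_deg: "ks m \<subseteq> L \<Longrightarrow> r \<le> i \<Longrightarrow> deg_upto i m = deg m"
  unfolding deg_upto_def by (rule weight_cong) (use rk_le_r in \<open>force\<close>)

lemma deg_upto_lk:
  assumes F: "rk F = Suc i" and u: "\<And>G. G \<in> ks m \<Longrightarrow> rk G = Suc i \<Longrightarrow> G = F"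
  shows "deg_upto (Suc i) m = deg_upto i m + lk m F"
proof -
  have "deg_upto (Suc i) m = weight (\<lambda>G. (if rk G \<le> i then 1 else 0) + (if G = F then 1 else 0)) m"
    unfolding deg_upto_def
  proof (rule weight_cong)
    fix G assume "G \<in> ks m"
    then have "rk G = Suc i \<longleftrightarrow> G = F" using u F by metis
    then show "(if rk G \<le> Suc i then 1 else 0) = (if rk G \<le> i then 1 else 0) + (if G = F then 1 else (0::nat))"
      using F by (auto simp: le_Suc_eq)
  qed
  also have "\<dots> = deg_upto i m + weight (\<lambda>G. if G = F then 1 else 0) m" by (simp add: weight_fun_add deg_upto_def)
  also have "weight (\<lambda>G. if G = F then 1 else 0) m = lk m F"
  proof -
    have "weight (\<lambda>G. if G = F then 1 else 0) m = (\<Sum>v\<in>ks m. if v = F then lk m v else 0)"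
      unfolding weight_def by (intro sum.cong) auto
    then show ?thesis by (simp add: in_keys_iff)
  qed
  finally show ?thesis .
qed

text \<open>A factor \<open>G\<close> is counted at the \<open>r - rk G\<close> thresholds from
  \<open>rk G\<close> to \<open>r - 1\<close>. Thus at fixed degree a larger \<open>deg_upto\<close>
  means a smaller weight.\<close>

lemma weight_rk_deg_upto: "ks m \<subseteq> L \<Longrightarrow> weight rk m + (\<Sum>i<r. deg_upto i m) = r * deg m"
proof -
  assume m: "ks m \<subseteq> L"
  have s: "(\<Sum>i<r. weight (f i) m) = weight (\<lambda>G. \<Sum>i<r. f i G) m" for f
    unfolding weight_def by (simp only: sum.swap[of _ "{..<r}"] sum_distrib_left)
  have "weight rk m + (\<Sum>i<r. deg_upto i m) = weight (\<lambda>G. rk G + (\<Sum>i<r. if rk G \<le> i then 1 else 0)) m"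
    unfolding deg_upto_def s by (simp add: weight_fun_add)
  also have "\<dots> = weight (\<lambda>_. r) m"
  proof (rule weight_cong)
    fix G assume "G \<in> ks m"
    then have le: "rk G \<le> r" using m rk_le_r by blast
    have "(\<Sum>i<r. if rk G \<le> i then 1 else 0) = card {i \<in> {..<r}. rk G \<le> i}"
      by (simp add: sum.inter_filter[symmetric])
    also have "{i \<in> {..<r}. rk G \<le> i} = {rk G..<r}" by auto
    finally show "rk G + (\<Sum>i<r. if rk G \<le> i then 1 else 0) = r" using le by simp
  qed
  also have "\<dots> = r * deg m" by (simp add: weight_def sum_distrib_left mult.commute)
  finally show ?thesis .
qed

definition comparable :: "'b set \<Rightarrow> 'b set \<Rightarrow> bool" where "comparable F G \<longleftrightarrow> F \<subseteq> G \<or> G \<subseteq> F"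

lemma comparable_rk:
  assumes "comparable F G" "F \<in> L" "G \<in> L"
  shows comparable_le: "F \<subseteq> G \<longleftrightarrow> rk F \<le> rk G" and comparable_less: "F \<subset> G \<longleftrightarrow> rk F < rk G" and comparable_eq: "rk F = rk G \<longleftrightarrow> F = G"
proof -
  consider "F = G" | "F \<subset> G" | "G \<subset> F" using assms(1) by (auto simp: comparable_def)
  then show "F \<subseteq> G \<longleftrightarrow> rk F \<le> rk G" "F \<subset> G \<longleftrightarrow> rk F < rk G" "rk F = rk G \<longleftrightarrow> F = G"
    using rk_mono[OF assms(2,3)] rk_mono[OF assms(3,2)] by (cases; auto)+
qed

lemma deg_above_deg_upto:
  assumes "\<And>G. G \<in> ks m \<Longrightarrow> G \<in> L \<and> comparable F G" "F \<in> L"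
  shows "deg_above F m + deg_upto (rk F) m = deg m"
proof -
  have "deg_above F m + deg_upto (rk F) m = weight (\<lambda>G. (if F \<subset> G then 1 else 0) + (if rk G \<le> rk F then 1 else 0)) m"
    by (simp add: deg_above_def deg_upto_def weight_fun_add)
  also have "\<dots> = deg m"
  proof (rule weight_cong)
    fix G assume "G \<in> ks m"
    then have "F \<subset> G \<longleftrightarrow> rk F < rk G" using assms comparable_less by blast
    then show "(if F \<subset> G then 1 else 0) + (if rk G \<le> rk F then 1 else 0) = (1::nat)" by simp
  qed
  finally show ?thesis .
qed

section \<open>Tight monomials and independence\<close>

definition flag :: "'b set set \<Rightarrow> bool" where
  "flag Fl \<longleftrightarrow> Fl \<subseteq> L - {z, U} \<and> (\<forall>F\<in>Fl. \<forall>G\<in>Fl. comparable F G) \<and> (\<forall>i\<in>{1..<r}. \<exists>F\<in>Fl. rk F = i)"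

lemma cover_between:
  assumes "p \<in> L" "F \<in> L" "p \<subset> F"
  obtains b where "b \<in> L" "p \<subset> b" "b \<subseteq> F" "rk b = Suc (rk p)"
proof -
  obtain a where a: "a \<in> lat_atoms L z" "a \<subseteq> F" "\<not> a \<subseteq> p" using atom_ex[OF assms] by blast
  have aL: "a \<in> L" using atom_in[OF a(1)] by simp
  define b where "b = join p a"
  have b: "b \<in> L" "p \<subseteq> b" "a \<subseteq> b" "rk b \<le> rk p + 1" "b \<subseteq> F"
    unfolding b_def using join_in[OF assms(1) aL] join_1[OF assms(1) aL] join_2[OF assms(1) aL] join_rk[OF assms(1) aL] atom_rk[OF a(1)]
      join_least[OF assms(1) aL assms(2)] assms(3) a(2) by auto
  have "p \<subset> b" using b(2,3) a(3) by auto
  moreover have "rk b = Suc (rk p)" using rk_mono[OF assms(1) b(1) \<open>p \<subset> b\<close>] b(4) by simp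
  ultimately show ?thesis using that b by blast
qed

text \<open>A chain of maximal size containing \<open>C\<close> has no gap: if rank \<open>i\<close>
  were missing, the largest element below it would have a cover inside the smallest element above
  it, and this cover could be added.\<close>

lemma flag_exists:
  assumes C: "C \<subseteq> L - {z, U}" "\<forall>F\<in>C. \<forall>G\<in>C. comparable F G"
  shows "\<exists>Fl. C \<subseteq> Fl \<and> flag Fl"
proof -
  define S where "S = {K. C \<subseteq> K \<and> K \<subseteq> L - {z, U} \<and> (\<forall>F\<in>K. \<forall>G\<in>K. comparable F G)}"
  have "finite S" by (rule finite_subset[of _ "Pow L"]) (auto simp: S_def)
  moreover have "C \<in> S" using C by (simp add: S_def)
  ultimately obtain Fl where Fl: "Fl \<in> S" "\<forall>K\<in>S. card K \<le> card Fl" using ex_max_fun[of S card] by blast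
  have FlL: "Fl \<subseteq> L - {z, U}" and ch: "\<forall>F\<in>Fl. \<forall>G\<in>Fl. comparable F G" and CF: "C \<subseteq> Fl" using Fl(1) by (simp_all add: S_def)
  have fin: "finite Fl" using FlL by (rule finite_subset) simp
  have ck: "comparable G H" if GH: "G \<in> insert z (insert U Fl)" "H \<in> insert z (insert U Fl)" for G H
  proof -
    have GL: "G \<in> L" "H \<in> L" using GH FlL by auto
    show ?thesis
    proof (cases "G \<in> Fl \<and> H \<in> Fl")
      case True then show ?thesis using ch by simp
    next
      case False
      then have "G = z \<or> G = U \<or> H = z \<or> H = U" using GH by auto
      then show ?thesis using bot[OF GL(1)] bot[OF GL(2)] top[OF GL(1)] top[OF GL(2)] by (auto simp: comparable_def)
    qed
  qed
  have "\<exists>F\<in>Fl. rk F = i" if i: "i \<in> {1..<r}" for i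
  proof (rule ccontr)
    assume no: "\<not> (\<exists>F\<in>Fl. rk F = i)"
    obtain p where p: "p \<in> {G \<in> insert z Fl. rk G < i}" "\<forall>G\<in>{G \<in> insert z Fl. rk G < i}. rk G \<le> rk p"
    proof -
      have "z \<in> {G \<in> insert z Fl. rk G < i}" using i by simp
      then have "{G \<in> insert z Fl. rk G < i} \<noteq> {}" by blast
      moreover have "finite {G \<in> insert z Fl. rk G < i}" using fin by simp
      ultimately show ?thesis using ex_max_fun[of "{G \<in> insert z Fl. rk G < i}" rk] that by blast
    qed
    obtain F where F: "F \<in> {G \<in> insert U Fl. rk G > i}" "\<forall>G\<in>{G \<in> insert U Fl. rk G > i}. rk F \<le> rk G"
    proof -
      have "U \<in> {G \<in> insert U Fl. rk G > i}" using i by simp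
      then have "{G \<in> insert U Fl. rk G > i} \<noteq> {}" by blast
      moreover have "finite {G \<in> insert U Fl. rk G > i}" using fin by simp
      ultimately show ?thesis using ex_min_fun[of "{G \<in> insert U Fl. rk G > i}" rk] that by blast
    qed
    have pL: "p \<in> L" and FL: "F \<in> L" using p(1) F(1) FlL by auto
    have pk: "p \<in> insert z (insert U Fl)" and Fk: "F \<in> insert z (insert U Fl)" using p(1) F(1) by auto
    have pF: "rk p < i" "i < rk F" using p(1) F(1) by auto
    have "p \<subset> F" using comparable_less[OF ck[OF pk Fk] pL FL] pF by simp
    then obtain b where b: "b \<in> L" "p \<subset> b" "b \<subseteq> F" "rk b = Suc (rk p)" using cover_between[OF pL FL] by blast
    have rb: "rk b \<le> i" using b(4) pF by simp
    have bn: "b \<noteq> z" "b \<noteq> U" using b(4) rb i by auto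
    have cb: "comparable b G" if "G \<in> Fl" for G
    proof -
      have GL: "G \<in> L" using that FlL by auto
      have "rk G \<noteq> i" using no that by blast
      then consider "rk G < i" | "rk G > i" by linarith
      then show ?thesis
      proof cases
        case 1
        then have "rk G \<le> rk p" using p(2) that by simp
        moreover have "comparable G p" using that by (intro ck pk) simp
        ultimately have "G \<subseteq> p" using comparable_le[OF _ GL pL] by simp
        then show ?thesis using b(2) by (auto simp: comparable_def)
      next
        case 2
        then have "rk F \<le> rk G" using F(2) that by simp
        moreover have "comparable F G" using that by (intro ck Fk) simp
        ultimately have "F \<subseteq> G" using comparable_le[OF _ FL GL] by simp
        then show ?thesis using b(3) by (auto simp: comparable_def)
      qed
    qed
    have bFl: "b \<notin> Fl"
    proof
      assume bF: "b \<in> Fl"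
      then have "rk b \<noteq> i" using no by blast
      then have "rk b \<le> rk p" using p(2) bF rb by simp
      then show False using b(4) by simp
    qed
    have "insert b Fl \<in> S"
    proof -
      have "comparable F G" if "F \<in> insert b Fl" "G \<in> insert b Fl" for F G
      proof (cases "F = b \<or> G = b")
        case True
        then show ?thesis using that cb[of F] cb[of G] by (auto simp: comparable_def)
      next
        case False
        then show ?thesis using that ch by simp
      qed
      then show ?thesis unfolding S_def using CF FlL b(1) bn by auto
    qed
    then have "card (insert b Fl) \<le> card Fl" using Fl(2) by blast
    then show False using bFl fin by simp
  qed
  then have "flag Fl" unfolding flag_def using FlL ch by blast
  then show ?thesis using CF by blast
qed

text \<open>A tight monomial has degree map $\pm 1$: inserting one flag element at a time flips the sign, up to the
  monomial supported on the whole flag.\<close>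

definition tight :: "'b set set \<Rightarrow> ('b set \<Rightarrow>\<^sub>0 nat) \<Rightarrow> bool" where
  "tight Fl m \<longleftrightarrow> ks m \<subseteq> insert U Fl \<and> deg m = r - 1 \<and> (\<forall>F\<in>ks m - {U}. deg_upto (rk F) m = rk F)"

lemma flag_comparable:
  assumes "flag Fl" "F \<in> insert U Fl" "G \<in> insert U Fl"
  shows "comparable F G" "F \<in> L" "F \<in> P" "rk F > 0" "F \<noteq> U \<Longrightarrow> rk F < r"
proof -
  have FG: "F \<in> L" "G \<in> L" "F \<noteq> z" using assms z_neq_U by (auto simp: flag_def)
  show "F \<in> L" "F \<in> P" "rk F > 0" "F \<noteq> U \<Longrightarrow> rk F < r" using FG rk_pos rk_lt_r by (auto simp: P_def)
  show "comparable F G"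
  proof (cases "F = U \<or> G = U")
    case True then show ?thesis using top[OF FG(1)] top[OF FG(2)] by (auto simp: comparable_def)
  next
    case False then show ?thesis using assms unfolding flag_def by simp
  qed
qed

lemma flag_eq: "flag Fl \<Longrightarrow> F \<in> insert U Fl \<Longrightarrow> G \<in> insert U Fl \<Longrightarrow> rk F = rk G \<Longrightarrow> F = G"
proof -
  assume fl: "flag Fl" and FG: "F \<in> insert U Fl" "G \<in> insert U Fl" "rk F = rk G"
  show "F = G"
    using comparable_eq[OF flag_comparable(1)[OF fl FG(1,2)] flag_comparable(2)[OF fl FG(1,1)] flag_comparable(2)[OF fl FG(2,2)]] FG(3) by simp
qed

text \<open>\<open>m'\<close> replaces one factor \<open>F\<close>, the lowest of the support above
  \<open>b\<close>, by \<open>b\<close>. Take an atom \<open>a\<close> below \<open>b\<close> but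
  not below the predecessor \<open>p\<close>, and multiply the relation \<open>Y a\<close> by the
  common part \<open>m1\<close>. This gives \<open>m\<close>, \<open>m'\<close> and monomials with
  another flat \<open>K\<close> above \<open>a\<close>. Such a \<open>K\<close> is incomparable to a
  factor, or it lies strictly above \<open>b = join p a\<close>, and then too much degree sits above
  \<open>K\<close> or above \<open>F\<close>.\<close>

lemma tight_step:
  assumes fl: "flag Fl" and t: "tight Fl m" and b: "b \<in> Fl" "b \<notin> ks m"
    and low: "\<And>F. F \<in> Fl \<Longrightarrow> rk F < rk b \<Longrightarrow> F \<in> ks m"
  shows "\<exists>m'. tight Fl m' \<and> b \<in> ks m' \<and> ks m \<inter> Fl \<subseteq> ks m' \<and> degree_map (mon m') = - degree_map (mon m)"
proof -
  define i where "i = rk b"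
  have kF: "ks m \<subseteq> insert U Fl" and dm: "deg m = r - 1" and tm: "\<And>F. F \<in> ks m \<Longrightarrow> F \<noteq> U \<Longrightarrow> deg_upto (rk F) m = rk F"
    using t by (auto simp: tight_def)
  have bF: "b \<in> insert U Fl" using b by simp
  have bL: "b \<in> L" and bU: "b \<noteq> U" using fl b by (auto simp: flag_def)
  have i: "0 < i" "i < r" using flag_comparable(4,5)[OF fl bF bF] bU by (simp_all add: i_def)
  have kL: "G \<in> L" "G \<in> P" "rk G > 0" if "G \<in> ks m" for G using flag_comparable[OF fl _ bF, of G] kF that by blast+
  obtain p where p: "p \<in> L" "rk p = i - 1" "p \<subset> b" "p = z \<or> p \<in> ks m" "p \<noteq> U"
  proof (cases "i = 1")
    case True
    have "b \<noteq> z"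
    proof
      assume "b = z"
      then have "rk b = 0" by simp
      then show False using i by (simp add: i_def)
    qed
    then have "z \<subset> b" using bot[OF bL] by auto
    then show ?thesis using that[of z] True z_neq_U by simp
  next
    case False
    then have "i - 1 \<in> {1..<r}" using i by auto
    then obtain p where "p \<in> Fl" "rk p = i - 1" using fl unfolding flag_def by blast
    moreover from this have "p \<in> ks m" using low i by (simp add: i_def)
    moreover have "p \<subset> b" using flag_comparable(1)[OF fl, of p b] comparable_less[of p b] fl calculation b i by (auto simp: flag_def i_def)
    ultimately show ?thesis using that[of p] fl by (auto simp: flag_def)
  qed
  have no_i: "rk G \<noteq> i" if "G \<in> ks m" for G
    using flag_eq[OF fl _ bF, of G] kF that b i_def by blast
  \<comment> \<open>No factor has rank \<open>i\<close>, and up to rank \<open>i - 1\<close> the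
    degree is fixed by tightness at \<open>p\<close>, or is 0 if \<open>p = z\<close>.\<close>
  have mri: "deg_upto i m = i - 1"
  proof -
    have "deg_upto i m = deg_upto (i - 1) m" by (rule deg_upto_cong) (use no_i in force)
    also have "\<dots> = i - 1"
    proof (cases "p = z")
      case True
      then have "i - 1 = 0" using p(2) by simp
      moreover have "deg_upto 0 m = 0" unfolding deg_upto_def weight_eq_0 using kL(3) by simp
      ultimately show ?thesis by simp
    next
      case False
      then show ?thesis using tm[of p] p by auto
    qed
    finally show ?thesis .
  qed
  have "{G \<in> ks m. rk G > i} \<noteq> {}"
  proof
    assume e: "{G \<in> ks m. rk G > i} = {}"
    have "deg_upto i m = deg m" unfolding deg_upto_def by (rule weight_cong) (use e in force)
    then show False using mri dm i by simp
  qed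
  then obtain F where F: "F \<in> {G \<in> ks m. rk G > i}" "\<forall>G\<in>{G \<in> ks m. rk G > i}. rk F \<le> rk G"
    using ex_min_fun[of "{G \<in> ks m. rk G > i}" rk] by auto
  have Fk: "F \<in> ks m" and Fi: "rk F > i" using F by auto
  have Fmin: "rk G > i \<longleftrightarrow> rk F \<le> rk G" if "G \<in> ks m" for G using F that Fi by auto
  have FL: "F \<in> L" "F \<in> P" using kL Fk by auto
  have FFl: "F \<in> insert U Fl" using kF Fk by auto
  have bsF: "b \<subset> F" using flag_comparable(1)[OF fl bF FFl] comparable_less[OF _ bL FL(1)] Fi by (simp add: i_def)
  obtain m1 where m1: "m = sg F 1 + m1" using pm_extract[of 1 m F] Fk by (auto simp: in_keys_iff)
  define m' where "m' = sg b 1 + m1"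
  have km: "ks m = insert F (ks m1)" by (simp add: m1 ks_plus_nat)
  have km': "ks m' = insert b (ks m1)" by (simp add: m'_def ks_plus_nat)
  have mrm: "deg_upto j m = (if rk F \<le> j then 1 else 0) + deg_upto j m1" for j by (simp add: m1 deg_upto_add deg_upto_sg)
  have mrm': "deg_upto j m' = (if i \<le> j then 1 else 0) + deg_upto j m1" for j by (simp add: m'_def deg_upto_add deg_upto_sg i_def)
  have dm1: "deg m = 1 + deg m1" "deg m' = 1 + deg m1" by (simp_all add: m1 m'_def weight_add)
  have mr1: "deg_upto i m1 = i - 1" using mri mrm[of i] Fi by simp
  have t': "tight Fl m'"
    unfolding tight_def
  proof (intro conjI ballI)
    show "ks m' \<subseteq> insert U Fl" using kF km km' b by auto
    show "deg m' = r - 1" using dm dm1 by simp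
    fix G assume G: "G \<in> ks m' - {U}"
    show "deg_upto (rk G) m' = rk G"
    proof (cases "G = b")
      case True
      then show ?thesis using mrm'[of i] mr1 i by (simp add: i_def)
    next
      case False
      then have Gk: "G \<in> ks m" "G \<noteq> U" using G km km' by auto
      have "i \<le> rk G \<longleftrightarrow> rk F \<le> rk G" using Fmin[OF Gk(1)] no_i[OF Gk(1)] by linarith
      then have "deg_upto (rk G) m' = deg_upto (rk G) m" unfolding mrm mrm' by simp
      then show ?thesis using tm[OF Gk] by simp
    qed
  qed
  \<comment> \<open>If \<open>F \<noteq> U\<close>, tightness gives \<open>F\<close> the exponent
    \<open>rk F - (i - 1)\<close>, which is at least 2. Removing one factor keeps \<open>F\<close>
    in the support.\<close>
  have F1: "F = U \<or> F \<in> ks m1"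
  proof (rule ccontr)
    assume n: "\<not> (F = U \<or> F \<in> ks m1)"
    have "deg_upto (rk F) m1 = deg_upto i m1"
    proof (rule deg_upto_cong)
      fix G assume G: "G \<in> ks m1"
      then have Gm: "G \<in> ks m" using km by simp
      have "rk G \<noteq> rk F" using flag_eq[OF fl _ FFl, of G] kF Gm G n by blast
      then show "rk G \<le> rk F \<longleftrightarrow> rk G \<le> i" using Fmin[OF Gm] Fi by linarith
    qed
    then have "deg_upto (rk F) m = i" using mrm[of "rk F"] mr1 i by simp
    then show False using tm[OF Fk] n Fi by simp
  qed
  obtain a where a: "a \<in> lat_atoms L z" "a \<subseteq> b" "\<not> a \<subseteq> p" using atom_ex[OF p(1) bL p(3)] by blast
  have aL: "a \<in> L" "a \<in> P" using atom_in[OF a(1)] by (auto simp: P_def)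
  have jb: "join p a = b"
  proof -
    have j: "join p a \<in> L" "p \<subseteq> join p a" "a \<subseteq> join p a" "join p a \<subseteq> b"
      using join_in[OF p(1) aL(1)] join_1[OF p(1) aL(1)] join_2[OF p(1) aL(1)] join_least[OF p(1) aL(1) bL] p(3) a(2) by auto
    have "p \<subset> join p a" using j a(3) by auto
    from rk_mono[OF p(1) j(1) this] have "i \<le> rk (join p a)" using p(2) by simp
    then show ?thesis using rk_mono[OF j(1) bL] j(4) by (auto simp: i_def psubset_eq)
  qed
  have rel: "mon m + mon m' \<in> I"
  proof -
    define R where "R = {K. K \<in> L \<and> a \<subseteq> K \<and> K \<noteq> b \<and> K \<noteq> F}"
    have k1P: "ks m1 \<subseteq> P" using kL(2) km by auto
    have bNF: "b \<noteq> F" using bsF by auto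
    have "{K. K \<in> L \<and> a \<subseteq> K} = insert F (insert b R)" using FL bL a bsF by (auto simp: R_def)
    moreover have "F \<notin> insert b R" "b \<notin> R" "finite R" using bNF by (auto simp: R_def)
    ultimately have Ya: "Y a = Var F + Var b + (\<Sum>K\<in>R. Var K)" by (simp add: Y_def add.assoc)
    have "mon m + mon m' = mon m1 * Y a - (\<Sum>K\<in>R. mon (m1 + sg K 1))"
      unfolding Ya by (simp add: m1 m'_def mon_add Var_mon distrib_left sum_distrib_left mult.commute)
    also have "\<dots> \<in> I"
    proof (intro I_diff I_sum)
      show "mon m1 * Y a \<in> I" by (intro I_mult Y_atom a poly_ring_mon k1P)
      fix K assume "K \<in> R"
      then have K: "K \<in> L" "a \<subseteq> K" "K \<noteq> b" "K \<noteq> F" by (auto simp: R_def)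
      have KP: "K \<in> P" using above_P[OF aL(2) K(1,2)] .
      define M where "M = m1 + sg K 1"
      have kM: "ks M = insert K (ks m1)" by (simp add: M_def ks_plus_nat)
      have MP: "ks M \<subseteq> P" using kM KP k1P by auto
      have "mon M \<in> I"
      proof (cases "\<forall>G\<in>ks m1. comparable K G")
        case False
        then obtain G where "G \<in> ks m1" "\<not> K \<subseteq> G" "\<not> G \<subseteq> K" by (auto simp: comparable_def)
        then show ?thesis using mon_incomp[OF MP, of K G] kM by simp
      next
        case True
        have pK: "p \<subseteq> K"
        proof (cases "p = z")
          case True then show ?thesis using bot[OF K(1)] by simp
        next
          case False
          then have "p \<in> ks m1" using p km Fi by auto
          then have "comparable K p" using True by blast
          then show ?thesis using K(2) a(3) by (auto simp: comparable_def)
        qed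
        have "b \<subset> K" using join_least[OF p(1) aL(1) K(1) pK K(2)] jb K(3) by auto
        then have Ki: "rk K > i" using rk_mono[OF bL K(1)] by (simp add: i_def)
        have m1L: "G \<in> L \<and> comparable K G" if "G \<in> ks m1" for G using True kL(1)[of G] km that by simp
        have "comparable K F" using F1
        proof
          assume "F = U" then show ?thesis using top[OF K(1)] by (simp add: comparable_def)
        next
          assume "F \<in> ks m1" then show ?thesis using True by blast
        qed
        then consider "K \<subset> F" | "F \<subset> K" using K(4) by (auto simp: comparable_def)
        then show ?thesis
        proof cases
          case 1
          have KU: "K \<noteq> U" using 1 top[OF FL(1)] by auto
          have rKF: "rk K < rk F" by (rule rk_mono[OF K(1) FL(1) 1])
          have "deg_upto (rk K) m1 = deg_upto i m1"
          proof (rule deg_upto_cong)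
            fix G assume G: "G \<in> ks m1"
            then have Gm: "G \<in> ks m" using km by simp
            show "rk G \<le> rk K \<longleftrightarrow> rk G \<le> i" using Fmin[OF Gm] rKF Ki by linarith
          qed
          moreover have "deg_above K m1 + deg_upto (rk K) m1 = deg m1" by (rule deg_above_deg_upto[OF m1L K(1)])
          moreover have "deg_above K M = deg_above K m1" by (simp add: M_def deg_above_def weight_add)
          \<comment> \<open>\<open>m1\<close> has degree \<open>r - 2\<close>, of which
            \<open>i - 1\<close> lies at ranks up to \<open>rk K\<close>; the
            \<open>r - 1 - i\<close> above suffice because \<open>rk K > i\<close>.\<close>
          ultimately have "deg_above K M \<ge> r - rk K" using mr1 dm dm1 i Ki by simp
          then show ?thesis using mon_high[OF MP, of K] kM KU by simp
        next
          case 2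
          have FU: "F \<noteq> U" using 2 top[OF K(1)] by auto
          then have Fk1: "F \<in> ks m1" using F1 by simp
          have cF: "G \<in> L \<and> comparable F G" if "G \<in> ks m" for G
            using flag_comparable(1)[OF fl FFl, of G] kF kL(1)[OF that] that by blast
          have "deg_above F m + deg_upto (rk F) m = deg m" by (rule deg_above_deg_upto[OF cF FL(1)])
          then have "deg_above F m = r - 1 - rk F" using tm[OF Fk FU] dm by simp
          moreover have "deg_above F m = deg_above F m1" by (simp add: m1 deg_above_def weight_add)
          moreover have "deg_above F M = deg_above F m1 + 1" using 2 by (simp add: M_def deg_above_def weight_add)
          \<comment> \<open>Tightness at \<open>F\<close> leaves degree \<open>r - 1 - rk F\<close>
            above it, and \<open>K\<close> adds the one that is missing.\<close>
          ultimately have "deg_above F M \<ge> r - rk F" by simp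
          then show ?thesis using mon_high[OF MP, of F] kM Fk1 FU by simp
        qed
      qed
      then show "mon (m1 + sg K 1) \<in> I" by (simp add: M_def)
    qed
    finally show ?thesis .
  qed
  have "degree_map (mon m) + degree_map (mon m') = 0" using degree_map_I[OF rel] by (simp add: degree_map_add)
  then have "degree_map (mon m') = - degree_map (mon m)" by simp
  moreover have "b \<in> ks m'" using km' by simp
  moreover have "ks m \<inter> Fl \<subseteq> ks m'"
  proof
    fix G assume G: "G \<in> ks m \<inter> Fl"
    then have "G \<noteq> U" using fl by (auto simp: flag_def)
    then show "G \<in> ks m'" using G F1 km km' by auto
  qed
  ultimately show ?thesis using t' by blast
qed

lemma tight_to_full:
  assumes fl: "flag Fl" and t: "tight Fl m"
  shows "\<exists>m0. tight Fl m0 \<and> Fl \<subseteq> ks m0 \<and> \<bar>degree_map (mon m0)\<bar> = \<bar>degree_map (mon m)\<bar>"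
  using t
proof (induction "card (Fl - ks m)" arbitrary: m rule: less_induct)
  case less
  have fin: "finite Fl" using fl by (auto simp: flag_def intro: finite_subset[OF _ finite_L])
  show ?case
  proof (cases "Fl \<subseteq> ks m")
    case True then show ?thesis using less.prems by blast
  next
    case False
    then obtain b where b: "b \<in> Fl - ks m" "\<forall>x\<in>Fl - ks m. rk b \<le> rk x"
      using ex_min_fun[of "Fl - ks m" rk] fin by auto
    have low: "F \<in> ks m" if "F \<in> Fl" "rk F < rk b" for F using b(2) that by (meson DiffI not_le)
    obtain m' where m': "tight Fl m'" "b \<in> ks m'" "ks m \<inter> Fl \<subseteq> ks m'" "degree_map (mon m') = - degree_map (mon m)"
      using tight_step[OF fl less.prems _ _ low] b(1) by auto
    have "Fl - ks m' \<subset> Fl - ks m" using m'(2,3) b(1) by auto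
    then have "card (Fl - ks m') < card (Fl - ks m)" using fin by (intro psubset_card_mono) auto
    from less.hyps[OF this m'(1)] m'(4) show ?thesis by simp
  qed
qed

lemma tight_full_deg_upto:
  assumes fl: "flag Fl" and t: "tight Fl m" "Fl \<subseteq> ks m" and i: "i < r"
  shows "deg_upto i m = i"
proof (cases "i = 0")
  case True
  have "deg_upto 0 m = 0" unfolding deg_upto_def weight_eq_0
    using flag_comparable(4)[OF fl, of _ U] t by (auto simp: tight_def)
  then show ?thesis using True by simp
next
  case False
  then have "i \<in> {1..<r}" using i by simp
  then obtain F where F: "F \<in> Fl" "rk F = i" using fl unfolding flag_def by blast
  then have "F \<in> ks m - {U}" using t fl by (auto simp: flag_def)
  then show ?thesis using t(1) F unfolding tight_def by blast
qed

text \<open>With full support \<open>deg_upto i\<close> equals \<open>i\<close> for all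
  \<open>i < r\<close>, so all exponents are determined: 1 on the flag and 0 at
  \<open>U\<close>.\<close>

lemma tight_full_unique:
  assumes fl: "flag Fl" and t: "tight Fl m" "Fl \<subseteq> ks m" "tight Fl m'" "Fl \<subseteq> ks m'"
  shows "m = m'"
proof (rule poly_mapping_eqI)
  fix F
  have kL: "ks m \<subseteq> L" "ks m' \<subseteq> L" using t flag_comparable(2)[OF fl, of _ U] by (auto simp: tight_def)
  have e: "deg_upto i m = deg_upto i m'" for i
  proof (cases "i < r")
    case True then show ?thesis using tight_full_deg_upto[OF fl] t by simp
  next
    case False
    then show ?thesis using deg_upto_deg[OF kL(1), of i] deg_upto_deg[OF kL(2), of i] t by (simp add: tight_def)
  qed
  show "lk m F = lk m' F"
  proof (cases "F \<in> insert U Fl")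
    case True
    obtain i where i: "rk F = Suc i" using flag_comparable(4)[OF fl True True] by (cases "rk F") auto
    have u: "G = F" if "G \<in> insert U Fl" "rk G = Suc i" for G using flag_eq[OF fl that(1) True] that(2) i by simp
    have k: "ks m \<subseteq> insert U Fl" "ks m' \<subseteq> insert U Fl" using t by (simp_all add: tight_def)
    have "deg_upto (Suc i) m = deg_upto i m + lk m F" by (rule deg_upto_lk[OF i], rule u, rule subsetD[OF k(1)])
    moreover have "deg_upto (Suc i) m' = deg_upto i m' + lk m' F" by (rule deg_upto_lk[OF i], rule u, rule subsetD[OF k(2)])
    ultimately show ?thesis using e by simp
  next
    case False
    then have "F \<notin> ks m" "F \<notin> ks m'" using t by (auto simp: tight_def)
    then show ?thesis by (simp add: in_keys_iff)
  qed
qed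

text \<open>The power of \<open>U\<close> is tight for every flag and has value 1. Both monomials
  reach the same full one through sign changes.\<close>

lemma tight_degree_map:
  assumes fl: "flag Fl" and t: "tight Fl m"
  shows "\<bar>degree_map (mon m)\<bar> = 1"
proof -
  have tU: "tight Fl (sg U (r - 1))" by (auto simp: tight_def)
  obtain m0 where m0: "tight Fl m0" "Fl \<subseteq> ks m0" "\<bar>degree_map (mon m0)\<bar> = \<bar>degree_map (mon m)\<bar>" using tight_to_full[OF fl t] by blast
  obtain m1 where m1: "tight Fl m1" "Fl \<subseteq> ks m1" "\<bar>degree_map (mon m1)\<bar> = \<bar>degree_map (mon (sg U (r - 1)))\<bar>" using tight_to_full[OF fl tU] by blast
  have "m0 = m1" by (rule tight_full_unique[OF fl m0(1,2) m1(1,2)])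
  then show ?thesis using m0(3) m1(3) degree_map_U by simp
qed

end

section \<open>Partners, triangularity and the rank\<close>

context geometric_lattice begin

lemma FY_base: "FY z m \<Longrightarrow> ks m \<subseteq> P"
  using V_z by (simp add: FY_def)

lemma FY_comparable: "FY z m \<Longrightarrow> F \<in> ks m \<Longrightarrow> G \<in> ks m \<Longrightarrow> comparable F G"
  by (simp add: FY_def comparable_def)

text \<open>Including \<open>z\<close> makes the value 0 at the lowest element of a chain.\<close>

definition prev_rank :: "'b set set \<Rightarrow> 'b set \<Rightarrow> nat" where
  "prev_rank C F = Max (rk ` {G \<in> insert z C. rk G < rk F})"

lemma prev_rank:
  assumes "finite C" "rk F > 0"
  shows "\<exists>G\<in>insert z C. rk G < rk F \<and> rk G = prev_rank C F \<and> (\<forall>G'\<in>insert z C. rk G' < rk F \<longrightarrow> rk G' \<le> prev_rank C F)"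
proof -
  let ?S = "{G \<in> insert z C. rk G < rk F}"
  have zS: "z \<in> ?S" using assms(2) by simp
  have fin: "finite (rk ` ?S)" using assms(1) by simp
  have "prev_rank C F \<in> rk ` ?S" unfolding prev_rank_def using fin zS by (intro Max_in) blast+
  moreover have "rk G' \<le> prev_rank C F" if "G' \<in> ?S" for G'
    unfolding prev_rank_def using fin that by (intro Max_ge) auto
  ultimately show ?thesis by auto
qed

text \<open>The exponents are the rank jumps along the chain. The jump to \<open>U\<close> is one
  short, since the total degree is \<open>r - 1\<close>.\<close>

definition tight_mon :: "'b set set \<Rightarrow> ('b set \<Rightarrow>\<^sub>0 nat)" where
  "tight_mon C = (\<Sum>F\<in>C. sg F (rk F - prev_rank C F)) + sg U (r - 1 - prev_rank C U)"

context
  fixes C :: "'b set set"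
  assumes CL: "C \<subseteq> L - {z, U}" and Cc: "\<And>F G. F \<in> C \<Longrightarrow> G \<in> C \<Longrightarrow> comparable F G"
begin

lemma finite_C: "finite C" using CL by (rule finite_subset) simp

lemma C_props: "F \<in> C \<Longrightarrow> F \<in> L \<and> F \<noteq> z \<and> F \<noteq> U \<and> rk F > 0 \<and> rk F < r"
  using CL rk_pos rk_lt_r by blast

lemma r_pos: "r > 0" using rk_pos[OF U_in] z_neq_U by simp

lemma tight_mon_lk: "lk (tight_mon C) F = (if F \<in> C then rk F - prev_rank C F else if F = U then r - 1 - prev_rank C U else 0)"
proof -
  have "lk (\<Sum>F\<in>C. sg F (rk F - prev_rank C F)) F = (\<Sum>G\<in>C. if G = F then rk G - prev_rank C G else 0)"
    by (simp add: lookup_sum lookup_single when_def)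
  also have "\<dots> = (if F \<in> C then rk F - prev_rank C F else 0)" using finite_C by simp
  finally show ?thesis using C_props[of U] by (auto simp: tight_mon_def lookup_add lookup_single when_def)
qed

lemma C_eq: "F \<in> C \<Longrightarrow> G \<in> C \<Longrightarrow> rk F = rk G \<Longrightarrow> F = G"
  using comparable_eq[OF Cc] C_props by blast

lemma tight_mon_ks: "ks (tight_mon C) \<subseteq> insert U C"
proof
  fix F assume "F \<in> ks (tight_mon C)"
  then have "lk (tight_mon C) F \<noteq> 0" by (simp add: in_keys_iff)
  then show "F \<in> insert U C" unfolding tight_mon_lk by (cases "F \<in> C"; cases "F = U") simp_all
qed

lemma tight_mon_deg_upto: "F \<in> insert z C \<Longrightarrow> deg_upto (rk F) (tight_mon C) = rk F"
proof (induction "rk F" arbitrary: F rule: less_induct)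
  case less
  show ?case
  proof (cases "F = z")
    case True
    have "deg_upto 0 (tight_mon C) = 0" unfolding deg_upto_def weight_eq_0 using tight_mon_ks C_props r_pos by fastforce
    then show ?thesis using True by simp
  next
    case False
    then have FC: "F \<in> C" using less.prems by simp
    have Fp: "rk F > 0" "rk F < r" using C_props[OF FC] by auto
    obtain G where G: "G \<in> insert z C" "rk G < rk F" "rk G = prev_rank C F"
      and mx: "\<forall>G'\<in>insert z C. rk G' < rk F \<longrightarrow> rk G' \<le> prev_rank C F" using prev_rank[OF finite_C Fp(1)] by blast
    obtain j where j: "rk F = Suc j" using Fp by (cases "rk F") auto
    have "deg_upto (Suc j) (tight_mon C) = deg_upto j (tight_mon C) + lk (tight_mon C) F"
    proof (rule deg_upto_lk[OF j])
      fix H assume H: "H \<in> ks (tight_mon C)" "rk H = Suc j"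
      then have "H \<noteq> U" using Fp j by auto
      then have "H \<in> C" using H tight_mon_ks by auto
      then show "H = F" using C_eq[OF _ FC] H j by simp
    qed
    moreover have "deg_upto j (tight_mon C) = deg_upto (rk G) (tight_mon C)"
    proof (rule deg_upto_cong)
      fix H assume H: "H \<in> ks (tight_mon C)"
      then have "H = U \<or> H \<in> C" using tight_mon_ks by auto
      then show "rk H \<le> j \<longleftrightarrow> rk H \<le> rk G"
      proof
        assume "H = U" then show ?thesis using Fp j G(2) by simp
      next
        assume HC: "H \<in> C"
        then have "rk H < rk F \<Longrightarrow> rk H \<le> rk G" using mx G(3) by simp
        then show ?thesis using j G(2) by linarith
      qed
    qed
    moreover have "deg_upto (rk G) (tight_mon C) = rk G" by (rule less.hyps[OF G(2,1)])
    moreover have "lk (tight_mon C) F = rk F - rk G" using FC G(3) by (simp add: tight_mon_lk)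
    ultimately show ?thesis using j G(2) by simp
  qed
qed

lemma tight_mon_deg: "deg (tight_mon C) = r - 1"
proof -
  obtain G where G: "G \<in> insert z C" "rk G < r" "rk G = prev_rank C U"
    and mx: "\<forall>G'\<in>insert z C. rk G' < r \<longrightarrow> rk G' \<le> prev_rank C U" using prev_rank[OF finite_C r_pos] by blast
  obtain j where j: "r = Suc j" using r_pos by (cases r) auto
  have kL: "ks (tight_mon C) \<subseteq> L" using tight_mon_ks C_props by fastforce
  have "deg_upto (Suc j) (tight_mon C) = deg_upto j (tight_mon C) + lk (tight_mon C) U"
  proof (rule deg_upto_lk[OF j])
    fix H assume H: "H \<in> ks (tight_mon C)" "rk H = Suc j"
    show "H = U" using H tight_mon_ks C_props[of H] j by auto
  qed
  moreover have "deg_upto j (tight_mon C) = deg_upto (rk G) (tight_mon C)"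
  proof (rule deg_upto_cong)
    fix H assume H: "H \<in> ks (tight_mon C)"
    then have "H = U \<or> H \<in> C" using tight_mon_ks by auto
    then show "rk H \<le> j \<longleftrightarrow> rk H \<le> rk G"
    proof
      assume "H = U" then show ?thesis using j G(2) by simp
    next
      assume HC: "H \<in> C"
      then have "rk H \<le> rk G" "rk H < r" using mx G(3) C_props[OF HC] by simp_all
      then show ?thesis using j by linarith
    qed
  qed
  moreover have "deg_upto (rk G) (tight_mon C) = rk G" by (rule tight_mon_deg_upto[OF G(1)])
  moreover have "lk (tight_mon C) U = r - 1 - rk G" using C_props[of U] G(3) by (auto simp: tight_mon_lk)
  moreover have "deg_upto (Suc j) (tight_mon C) = deg (tight_mon C)" by (rule deg_upto_deg[OF kL]) (simp add: j)
  ultimately show ?thesis using G(2) j by simp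
qed

lemma tight_mon_degree_map: "\<bar>degree_map (mon (tight_mon C))\<bar> = 1"
proof -
  obtain Fl where Fl: "C \<subseteq> Fl" "flag Fl" using flag_exists[OF CL] Cc by blast
  have "tight Fl (tight_mon C)"
    unfolding tight_def using tight_mon_ks Fl(1) tight_mon_deg tight_mon_deg_upto by auto
  then show ?thesis by (rule tight_degree_map[OF Fl(2)])
qed

text \<open>\<open>deg_upto\<close> is constant between the ranks occurring in \<open>C\<close> and
  equals \<open>i\<close> at them, so it stays on or below the diagonal and touches it only there or
  at 0.\<close>

lemma tight_mon_deg_upto_le:
  assumes "i < r"
  shows "deg_upto i (tight_mon C) \<le> i" and "deg_upto i (tight_mon C) = i \<Longrightarrow> i = 0 \<or> (\<exists>F\<in>C. rk F = i)"
proof -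
  have "0 < Suc i" by simp
  let ?S = "{G \<in> insert z C. rk G \<le> i}"
  have zS: "z \<in> ?S" by simp
  have "finite ?S" using finite_C by simp
  moreover have "?S \<noteq> {}" using zS by blast
  ultimately obtain F where F: "F \<in> ?S" "\<forall>G\<in>?S. rk G \<le> rk F" using ex_max_fun[of ?S rk] by blast
  have "deg_upto i (tight_mon C) = deg_upto (rk F) (tight_mon C)"
  proof (rule deg_upto_cong)
    fix H assume H: "H \<in> ks (tight_mon C)"
    then have "H = U \<or> H \<in> C" using tight_mon_ks by auto
    then show "rk H \<le> i \<longleftrightarrow> rk H \<le> rk F"
    proof
      assume "H = U" then show ?thesis using assms F(1) by simp
    next
      assume HC: "H \<in> C"
      show ?thesis
      proof
        assume "rk H \<le> i" then show "rk H \<le> rk F" using F(2) HC by simp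
      next
        assume "rk H \<le> rk F" then show "rk H \<le> i" using F(1) by simp
      qed
    qed
  qed
  also have "\<dots> = rk F" using F(1) by (intro tight_mon_deg_upto) simp
  finally have e: "deg_upto i (tight_mon C) = rk F" .
  show "deg_upto i (tight_mon C) \<le> i" using e F(1) by simp
  assume "deg_upto i (tight_mon C) = i"
  then have "rk F = i" using e by simp
  then show "i = 0 \<or> (\<exists>F\<in>C. rk F = i)" using F(1) by (cases "F = z") auto
qed

end

text \<open>The partner of \<open>m\<close> completes it to the tight monomial with the same support.\<close>

lemma FY_dual:
  assumes m: "FY z m"
  shows "\<exists>ms. ks ms \<subseteq> P \<and> \<bar>degree_map (mon (m + ms))\<bar> = 1 \<and>
    (\<forall>m'. FY z m' \<longrightarrow> deg m' = deg m \<longrightarrow> degree_map (mon (m' + ms)) \<noteq> 0 \<longrightarrow> m' = m \<or> weight rk m' < weight rk m)"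
proof -
  define C where "C = ks m - {U}"
  have kP: "ks m \<subseteq> P" by (rule FY_base[OF m])
  have CL: "C \<subseteq> L - {z, U}" using kP by (auto simp: C_def P_def)
  have Cc: "comparable F G" if "F \<in> C" "G \<in> C" for F G using FY_comparable[OF m] that by (simp add: C_def)
  note Cprops = C_props[OF CL Cc]
  define T where "T = tight_mon C"
  have finC: "finite C" by (simp add: C_def)
  have less: "lk m F < rk F - prev_rank C F" if F: "F \<in> ks m" for F
  proof -
    have FP: "F \<in> L" "F \<noteq> z" using kP F by (auto simp: P_def)
    obtain G where G: "G \<in> insert z C" "rk G < rk F" "rk G = prev_rank C F" using prev_rank[OF finC rk_pos[OF FP]] by blast
    have GL: "G \<in> L" using G(1) CL by auto
    have Gk: "G \<in> insert z (ks m)" using G(1) by (auto simp: C_def)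
    have "comparable G F"
    proof (cases "G = z")
      case True then show ?thesis using bot[OF FP(1)] by (simp add: comparable_def)
    next
      case False then show ?thesis using FY_comparable[OF m] Gk F by simp
    qed
    then have "G \<subset> F" using comparable_less[OF _ GL FP(1)] G(2) by simp
    have all: "\<forall>F\<in>ks m. \<forall>G\<in>insert z (ks m). G \<subset> F \<longrightarrow> lk m F < rk F - rk G" using m by (simp add: FY_def)
    from mp[OF bspec[OF bspec[OF all F] Gk] \<open>G \<subset> F\<close>] show ?thesis using G(3) by simp
  qed
  have mT: "lk m F \<le> lk T F" for F
  proof (cases "F \<in> ks m")
    case True
    then show ?thesis using less[OF True] tight_mon_lk[OF CL Cc, of F] by (auto simp: T_def C_def)
  next
    case False then show ?thesis by (simp add: in_keys_iff)
  qed
  \<comment> \<open>The exponents of \<open>m\<close> are smaller than the rank jumps. So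
    \<open>m\<close> divides \<open>T\<close>, and all of \<open>C\<close> remains in the support of
    the quotient; hence \<open>m' + ms\<close> contains \<open>C\<close> whatever \<open>m'\<close>
    is.\<close>
  define ms where "ms = T - m"
  have T: "T = m + ms"
    by (rule poly_mapping_eqI) (use mT in \<open>simp add: ms_def lookup_add lookup_minus\<close>)
  have Cms: "F \<in> ks ms" if "F \<in> C" for F
  proof -
    have "lk m F < lk T F" using less[of F] tight_mon_lk[OF CL Cc, of F] that by (simp add: T_def C_def)
    then show ?thesis by (simp add: in_keys_iff ms_def lookup_minus)
  qed
  have kms: "ks ms \<subseteq> insert U C" using tight_mon_ks[OF CL Cc] T by (auto simp: T_def[symmetric] ks_plus_nat)
  have UP: "U \<in> P" using z_neq_U by (auto simp: P_def)
  have r0: "r > 0" using rk_pos[OF U_in] z_neq_U by simp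
  have main: "m' = m \<or> weight rk m' < weight rk m"
    if m': "FY z m'" and d: "deg m' = deg m" and nz: "degree_map (mon (m' + ms)) \<noteq> 0" for m'
  proof -
    define E where "E = m' + ms"
    have k'P: "ks m' \<subseteq> P" by (rule FY_base[OF m'])
    have EP: "ks E \<subseteq> P" using k'P kms CL UP by (auto simp: E_def ks_plus_nat P_def)
    have nI: "mon E \<notin> I" using nz degree_map_I by (auto simp: E_def)
    have Ecmp: "comparable F G" if "F \<in> ks E" "G \<in> ks E" for F G
      using mon_incomp[OF EP that] nI by (auto simp: comparable_def)
    have EL: "F \<in> L" if "F \<in> ks E" for F using EP that by (auto simp: P_def)
    have degE: "deg E = r - 1"
      using tight_mon_deg[OF CL Cc] d T by (simp add: E_def weight_add T_def)
    \<comment> \<open>As \<open>E\<close> is outside the ideal, \<open>mon_high\<close> bounds the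
      degree above each factor, so much of the total degree \<open>r - 1\<close> has to lie at or
      below it.\<close>
    have mrE: "deg_upto (rk H) E \<ge> rk H" if H: "H \<in> ks E" "H \<noteq> U" for H
    proof -
      have "deg_above H E < r - rk H" using mon_high[OF EP H] nI by (simp add: not_le[symmetric]) (meson not_le)
      moreover have "deg_above H E + deg_upto (rk H) E = deg E"
        by (rule deg_above_deg_upto) (use EL Ecmp H in auto)
      ultimately show ?thesis using degE by linarith
    qed
    have mrT: "deg_upto i E + deg_upto i m = deg_upto i m' + deg_upto i T" for i by (simp add: E_def T deg_upto_add)
    have Ck: "F \<in> ks E" if "F \<in> C" for F using Cms[OF that] by (simp add: E_def ks_plus_nat)
    \<comment> \<open>At the ranks of its factors \<open>E\<close> is on or above the diagonal while
      \<open>T\<close> is on or below it. Cancelling the common part \<open>ms\<close> compares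
      \<open>m'\<close> with \<open>m\<close>, and equality forces \<open>T\<close> to touch the
      diagonal, which happens only at ranks from \<open>C\<close>.\<close>
    have key: "deg_upto (rk H) m' \<ge> deg_upto (rk H) m \<and> (deg_upto (rk H) m' = deg_upto (rk H) m \<longrightarrow> H \<in> C)"
      if H: "H \<in> ks E" "H \<noteq> U" for H
    proof -
      have HL: "H \<in> L" "H \<noteq> z" using EP H by (auto simp: P_def)
      have lt: "rk H < r" by (rule rk_lt_r[OF HL(1) H(2)])
      have le: "deg_upto (rk H) T \<le> rk H" unfolding T_def by (rule tight_mon_deg_upto_le(1)[OF CL Cc lt])
      have ge: "deg_upto (rk H) E \<ge> rk H" by (rule mrE[OF H])
      have "H \<in> C" if "deg_upto (rk H) m' = deg_upto (rk H) m"
      proof -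
        have "deg_upto (rk H) T = rk H" using mrT[of "rk H"] le ge that by linarith
        then obtain F where F: "F \<in> C" "rk F = rk H"
          using tight_mon_deg_upto_le(2)[OF CL Cc lt] rk_pos[OF HL] by (auto simp: T_def)
        have "F = H" using comparable_eq[OF Ecmp[OF Ck[OF F(1)] H(1)] EL[OF Ck[OF F(1)]] HL(1)] F(2) by simp
        then show ?thesis using F(1) by simp
      qed
      then show ?thesis using mrT[of "rk H"] le ge by linarith
    qed
    \<comment> \<open>Between the ranks of factors of \<open>E\<close> neither side changes, so the
      comparison extends to all thresholds.\<close>
    have deg_upto_ge: "deg_upto i m' \<ge> deg_upto i m" if i: "i < r" for i
    proof (cases "{H \<in> ks E - {U}. rk H \<le> i} = {}")
      case True
      have "rk G > i" if "G \<in> ks m" for G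
      proof (cases "G = U")
        case False
        then have "G \<in> ks E" using Ck that by (simp add: C_def)
        then show ?thesis using True False by force
      qed (use i in simp)
      then have "deg_upto i m = 0" unfolding deg_upto_def weight_eq_0 by (simp add: not_le)
      then show ?thesis by simp
    next
      case False
      then obtain H where H: "H \<in> {H \<in> ks E - {U}. rk H \<le> i}" "\<forall>G\<in>{H \<in> ks E - {U}. rk H \<le> i}. rk G \<le> rk H"
        using ex_max_fun[of "{H \<in> ks E - {U}. rk H \<le> i}" rk] by auto
      have Hi: "H \<in> ks E" "H \<noteq> U" "rk H \<le> i" using H(1) by auto
      have c: "rk G \<le> i \<longleftrightarrow> rk G \<le> rk H" if "G \<in> insert U (ks E)" for G
      proof (cases "G = U")
        case True then show ?thesis using i Hi(3) by simp
      next
        case False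
        then have "rk G \<le> i \<Longrightarrow> rk G \<le> rk H" using H(2) that by simp
        then show ?thesis using Hi(3) by linarith
      qed
      have "deg_upto i m' = deg_upto (rk H) m'" by (rule deg_upto_cong, rule c) (simp add: E_def ks_plus_nat)
      moreover have "deg_upto i m = deg_upto (rk H) m"
      proof (rule deg_upto_cong, rule c)
        fix G assume "G \<in> ks m"
        then show "G \<in> insert U (ks E)" using Ck[of G] by (auto simp: C_def)
      qed
      ultimately show ?thesis using key[OF Hi(1,2)] by simp
    qed
    show ?thesis
    proof (rule disjCI)
      assume nlt: "\<not> weight rk m' < weight rk m"
      have kL: "ks m \<subseteq> L" "ks m' \<subseteq> L" using kP k'P by (auto simp: P_def)
      \<comment> \<open>By this identity the threshold inequalities bound the weight of
        \<open>m'\<close> by that of \<open>m\<close>. Without strict decrease they are all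
        equalities, and then the exponents agree as well.\<close>
      have "weight rk m + (\<Sum>i<r. deg_upto i m) = weight rk m' + (\<Sum>i<r. deg_upto i m')"
        using weight_rk_deg_upto[OF kL(1)] weight_rk_deg_upto[OF kL(2)] d by simp
      then have le: "(\<Sum>i<r. deg_upto i m') \<le> (\<Sum>i<r. deg_upto i m)" using nlt by linarith
      have eq: "deg_upto i m' = deg_upto i m" for i
      proof (cases "i < r")
        case True
        show ?thesis
        proof (rule ccontr)
          assume "deg_upto i m' \<noteq> deg_upto i m"
          then have "deg_upto i m < deg_upto i m'" using deg_upto_ge[OF True] by simp
          then have "(\<Sum>i<r. deg_upto i m) < (\<Sum>i<r. deg_upto i m')"
            using True deg_upto_ge by (intro sum_strict_mono_ex1) auto
          then show False using le by simp
        qed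
      next
        case False
        then show ?thesis using deg_upto_deg[OF kL(1), of i] deg_upto_deg[OF kL(2), of i] d by simp
      qed
      have k'C: "ks m' \<subseteq> insert U C"
      proof
        fix H assume "H \<in> ks m'"
        then have "H \<in> ks E" by (simp add: E_def ks_plus_nat)
        then show "H \<in> insert U C" using key[of H] eq by auto
      qed
      have kC: "ks m \<subseteq> insert U C" by (auto simp: C_def)
      have ueq: "G = F" if "G \<in> insert U C" "F \<in> insert U C" "rk G = rk F" for F G
        using that Cprops(1)[of F] Cprops(1)[of G] C_eq[OF CL Cc, of G F] by auto
      show "m' = m"
      proof (rule poly_mapping_eqI)
        fix F show "lk m' F = lk m F"
        proof (cases "F \<in> insert U C")
          case True
          then have "rk F > 0" using Cprops(1)[of F] r0 by auto
          then obtain i where i: "rk F = Suc i" by (cases "rk F") auto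
          have u: "G = F" if "G \<in> insert U C" "rk G = Suc i" for G using ueq[OF that(1) True] that(2) i by simp
          have "deg_upto (Suc i) m = deg_upto i m + lk m F" by (rule deg_upto_lk[OF i], rule u, rule subsetD[OF kC])
          moreover have "deg_upto (Suc i) m' = deg_upto i m' + lk m' F" by (rule deg_upto_lk[OF i], rule u, rule subsetD[OF k'C])
          ultimately show ?thesis using eq by simp
        next
          case False
          then have "F \<notin> ks m" "F \<notin> ks m'" using kC k'C by auto
          then show ?thesis by (simp add: in_keys_iff)
        qed
      qed
    qed
  qed
  have "\<bar>degree_map (mon (m + ms))\<bar> = 1" unfolding T[symmetric] T_def by (rule tight_mon_degree_map[OF CL Cc])
  moreover have "ks ms \<subseteq> P" using kms CL UP by (auto simp: P_def)
  ultimately show ?thesis using main by blast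
qed

text \<open>Choose \<open>a\<close> of least weight among the monomials with nonzero coefficient.
  Its partner pairs to 0 with every other monomial of that kind, since a nonzero pairing would
  require smaller weight; only the coefficient of \<open>a\<close> survives, up to sign.\<close>

lemma FYs_independent:
  assumes I: "(\<Sum>m\<in>FYs z d. of_int (c m) * mon m) \<in> I" and m: "m \<in> FYs z d"
  shows "c m = 0"
proof (rule ccontr)
  assume "c m \<noteq> 0"
  then have ne: "{m \<in> FYs z d. c m \<noteq> 0} \<noteq> {}" using m by blast
  then obtain a where a: "a \<in> {m \<in> FYs z d. c m \<noteq> 0}" "\<forall>x\<in>{m \<in> FYs z d. c m \<noteq> 0}. weight rk a \<le> weight rk x"
    using ex_min_fun[of "{m \<in> FYs z d. c m \<noteq> 0}" "weight rk"] by auto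
  have aM: "a \<in> FYs z d" "c a \<noteq> 0" using a(1) by simp_all
  have "FY z a \<and> deg a = d" using aM(1) unfolding FYs_def mem_Collect_eq .
  then have aF: "FY z a" "deg a = d" "a \<in> FYs z d" "c a \<noteq> 0" using aM by blast+
  obtain ms where ms: "ks ms \<subseteq> P" "\<bar>degree_map (mon (a + ms))\<bar> = 1"
    "\<forall>m'. FY z m' \<longrightarrow> deg m' = deg a \<longrightarrow> degree_map (mon (m' + ms)) \<noteq> 0 \<longrightarrow> m' = a \<or> weight rk m' < weight rk a"
    using FY_dual[OF aF(1)] by blast
  have msP: "mon ms \<in> poly_ring P" using ms(1) by (rule poly_ring_mon)
  have "mon ms * (\<Sum>m\<in>FYs z d. of_int (c m) * mon m) = (\<Sum>m\<in>FYs z d. of_int (c m) * mon (m + ms))"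
    by (simp add: sum_distrib_left mon_add mult_ac)
  then have "0 = degree_map (\<Sum>m\<in>FYs z d. of_int (c m) * mon (m + ms))"
    using degree_map_I[OF I_mult[OF I msP]] by simp
  also have "\<dots> = (\<Sum>m\<in>FYs z d. c m * degree_map (mon (m + ms)))" by (simp only: degree_map_sum degree_map_of_int)
  also have "\<dots> = (\<Sum>m\<in>{a}. c m * degree_map (mon (m + ms)))"
  proof (rule sum.mono_neutral_right)
    show "\<forall>m\<in>FYs z d - {a}. c m * degree_map (mon (m + ms)) = 0"
    proof
      fix m assume m: "m \<in> FYs z d - {a}"
      show "c m * degree_map (mon (m + ms)) = 0"
      proof (rule ccontr)
        assume n: "c m * degree_map (mon (m + ms)) \<noteq> 0"
        then have "weight rk a \<le> weight rk m" using a(2) m by simp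
        moreover have fm: "FY z m" "deg m = d" using m unfolding FYs_def by blast+
        moreover have "deg m = deg a" using fm(2) aF(2) by (rule trans[OF _ sym])
        moreover have "degree_map (mon (m + ms)) \<noteq> 0" using n by simp
        ultimately show False using ms(3) m by (metis Diff_iff insertI1 not_le)
      qed
    qed
  qed (use aF in auto)
  finally show False using aF(4) ms(2) by auto
qed

lemma chow_has_rank_FYs: "chow_has_rank L z d (card (FYs z d))"
  unfolding chow_has_rank_def
proof (intro exI[of _ "mon ` FYs z d"] conjI ballI allI impI)
  have inj: "inj_on mon (FYs z d)"
    by (rule inj_onI) (metis ks_mon singleton_inject)
  show "finite (mon ` FYs z d)" by simp
  show "card (mon ` FYs z d) = card (FYs z d)" by (rule card_image[OF inj])
  show "mon ` FYs z d \<subseteq> hom_part (L - {z}) d"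
  proof (rule image_subsetI)
    fix m assume "m \<in> FYs z d"
    then have m: "FY z m" "deg m = d" unfolding FYs_def by blast+
    then show "mon m \<in> hom_part (L - {z}) d"
      using FY_base[OF m(1)] unfolding hom_part_def P_def deg_eq by simp
  qed
  show "\<exists>c. p - (\<Sum>b\<in>mon ` FYs z d. of_int (c b) * b) \<in> chow_ideal L z" if p: "p \<in> hom_part (L - {z}) d" for p
  proof -
    have "p \<in> weight_part rk (V z) d 0"
    proof -
      have "p \<in> weight_part rk (L - {z}) d 0" unfolding weight_part_hom_part by (rule p)
      then show ?thesis unfolding V_z P_def .
    qed
    from straighten[OF z_in this] obtain c where c: "p - (\<Sum>m\<in>FYs z d. of_int (c m) * mon m) \<in> I" by (auto simp: XH_def)
    define c' where "c' b = c (the_inv_into (FYs z d) mon b)" for b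
    have "(\<Sum>b\<in>mon ` FYs z d. of_int (c' b) * b) = (\<Sum>m\<in>FYs z d. of_int (c m) * mon m)"
      by (subst sum.reindex[OF inj]) (simp add: c'_def the_inv_into_f_f[OF inj])
    then show ?thesis using c unfolding I_def by (intro exI[of _ c']) simp
  qed
  show "c b = 0" if c: "(\<Sum>b\<in>mon ` FYs z d. of_int (c b) * b) \<in> chow_ideal L z" and b: "b \<in> mon ` FYs z d" for c b
  proof -
    have "(\<Sum>m\<in>FYs z d. of_int ((c \<circ> mon) m) * mon m) \<in> I"
      using c unfolding I_def by (subst (asm) sum.reindex[OF inj]) simp
    from FYs_independent[OF this] b show ?thesis by auto
  qed
qed

text \<open>A subset of the first basis is determined by the parities of the coefficients of its sum in the second one,
  whence $2^k \le 2^{k'}$.\<close>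

lemma rank_le:
  assumes "chow_has_rank L z d k" "chow_has_rank L z d k'"
  shows "k \<le> k'"
proof -
  obtain B where B: "finite B" "card B = k" "B \<subseteq> hom_part (L - {z}) d"
    and Bspan: "\<forall>p\<in>hom_part (L - {z}) d. \<exists>c::'b set zpoly \<Rightarrow> int. p - (\<Sum>b\<in>B. of_int (c b) * b) \<in> I"
    and Bind: "\<forall>c::'b set zpoly \<Rightarrow> int. (\<Sum>b\<in>B. of_int (c b) * b) \<in> I \<longrightarrow> (\<forall>b\<in>B. c b = 0)"
    using assms(1) unfolding chow_has_rank_def I_def[symmetric] by (elim exE conjE) (rule that; assumption)
  obtain B' where B': "finite B'" "card B' = k'" "B' \<subseteq> hom_part (L - {z}) d"
    and Bspan': "\<forall>p\<in>hom_part (L - {z}) d. \<exists>c::'b set zpoly \<Rightarrow> int. p - (\<Sum>b\<in>B'. of_int (c b) * b) \<in> I"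
    using assms(2) unfolding chow_has_rank_def I_def[symmetric] by (elim exE conjE) (rule that; assumption)
  have "\<forall>b'. \<exists>g::'b set zpoly \<Rightarrow> int. b' \<in> B' \<longrightarrow> b' - (\<Sum>b\<in>B. of_int (g b) * b) \<in> I"
  proof
    fix b' show "\<exists>g::'b set zpoly \<Rightarrow> int. b' \<in> B' \<longrightarrow> b' - (\<Sum>b\<in>B. of_int (g b) * b) \<in> I"
    proof (cases "b' \<in> B'")
      case True
      from bspec[OF Bspan subsetD[OF B'(3) True]] show ?thesis by (elim exE) (rule exI, rule impI, assumption)
    qed simp
  qed
  from choice[OF this] obtain g :: "'b set zpoly \<Rightarrow> 'b set zpoly \<Rightarrow> int"
    where g: "\<forall>b'. b' \<in> B' \<longrightarrow> b' - (\<Sum>b\<in>B. of_int (g b' b) * b) \<in> I" by blast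
  have "\<forall>b. \<exists>f::'b set zpoly \<Rightarrow> int. b \<in> B \<longrightarrow> b - (\<Sum>b'\<in>B'. of_int (f b') * b') \<in> I"
  proof
    fix b show "\<exists>f::'b set zpoly \<Rightarrow> int. b \<in> B \<longrightarrow> b - (\<Sum>b'\<in>B'. of_int (f b') * b') \<in> I"
    proof (cases "b \<in> B")
      case True
      from bspec[OF Bspan' subsetD[OF B(3) True]] show ?thesis by (elim exE) (rule exI, rule impI, assumption)
    qed simp
  qed
  from choice[OF this] obtain f :: "'b set zpoly \<Rightarrow> 'b set zpoly \<Rightarrow> int"
    where f: "\<forall>b. b \<in> B \<longrightarrow> b - (\<Sum>b'\<in>B'. of_int (f b b') * b') \<in> I" by blast
  define row where "row S b' = (\<Sum>b\<in>S. f b b')" for S b'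
  define \<phi> where "\<phi> S = {b' \<in> B'. odd (row S b')}" for S
  have expand: "(\<Sum>b\<in>S. b) - (\<Sum>b'\<in>B'. of_int (row S b') * b') \<in> I" if "S \<subseteq> B" for S
  proof -
    have "(\<Sum>b'\<in>B'. of_int (row S b') * b') = (\<Sum>b\<in>S. \<Sum>b'\<in>B'. of_int (f b b') * b')"
      unfolding row_def by (subst sum.swap) (simp add: sum_distrib_right)
    then have "(\<Sum>b\<in>S. b) - (\<Sum>b'\<in>B'. of_int (row S b') * b') = (\<Sum>b\<in>S. b - (\<Sum>b'\<in>B'. of_int (f b b') * b'))"
      by (simp add: sum_subtractf)
    also have "\<dots> \<in> I" by (rule I_sum) (use f that in auto)
    finally show ?thesis .
  qed
  have inj: "inj_on \<phi> (Pow B)"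
  proof (rule inj_onI)
    fix S T assume S: "S \<in> Pow B" and T: "T \<in> Pow B" and eq: "\<phi> S = \<phi> T"
    have parity: "even (row S b' - row T b')" if "b' \<in> B'" for b'
      using eq that by (auto simp: \<phi>_def)
    define h where "h b' = (row S b' - row T b') div 2" for b'
    have h: "row S b' - row T b' = 2 * h b'" if "b' \<in> B'" for b' using parity[OF that] by (simp add: h_def)
    \<comment> \<open>The coordinates, in the basis \<open>B\<close>, of the difference of the two
      subset sums minus twice its half in \<open>B'\<close>. Independence makes them 0, so the
      indicators of \<open>S\<close> and \<open>T\<close> agree modulo 2.\<close>
    define e where "e b = (if b \<in> S then 1 else 0) - (if b \<in> T then 1 else (0::int)) - 2 * (\<Sum>b'\<in>B'. h b' * g b' b)" for b
    have ind: "(\<Sum>b\<in>S. b) = (\<Sum>b\<in>B. of_int (if b \<in> S then 1 else 0) * b)" if "S \<subseteq> B" for S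
    proof -
      have "(\<Sum>b\<in>B. of_int (if b \<in> S then 1 else 0) * b) = (\<Sum>b\<in>B. if b \<in> S then b else 0)" by (intro sum.cong) auto
      also have "\<dots> = (\<Sum>b\<in>B \<inter> S. b)" using B(1) by (simp add: sum.inter_restrict)
      finally show ?thesis using that by (simp add: Int_absorb1)
    qed
    have 1: "(\<Sum>b\<in>S. b) - (\<Sum>b\<in>T. b) - (\<Sum>b'\<in>B'. of_int (2 * h b') * b') \<in> I"
    proof -
      have "(\<Sum>b'\<in>B'. of_int (2 * h b') * b') = (\<Sum>b'\<in>B'. of_int (row S b') * b') - (\<Sum>b'\<in>B'. of_int (row T b') * b')"
        unfolding sum_subtractf[symmetric] by (intro sum.cong refl) (simp add: h[symmetric] left_diff_distrib)
      then have "(\<Sum>b\<in>S. b) - (\<Sum>b\<in>T. b) - (\<Sum>b'\<in>B'. of_int (2 * h b') * b')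
        = ((\<Sum>b\<in>S. b) - (\<Sum>b'\<in>B'. of_int (row S b') * b')) - ((\<Sum>b\<in>T. b) - (\<Sum>b'\<in>B'. of_int (row T b') * b'))" by simp
      also have "\<dots> \<in> I" using S T by (intro I_diff expand) auto
      finally show ?thesis .
    qed
    have 2: "(\<Sum>b'\<in>B'. of_int (2 * h b') * (b' - (\<Sum>b\<in>B. of_int (g b' b) * b))) \<in> I"
      by (intro I_sum I_of_int) (use g in auto)
    have 3: "(\<Sum>b'\<in>B'. of_int (2 * h b') * (\<Sum>b\<in>B. of_int (g b' b) * b)) = (\<Sum>b\<in>B. of_int (2 * (\<Sum>b'\<in>B'. h b' * g b' b)) * b)"
      unfolding sum_distrib_left by (subst sum.swap) (simp add: sum_distrib_left sum_distrib_right mult_ac)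
    have "(\<Sum>b\<in>B. of_int (e b) * b) = (\<Sum>b\<in>S. b) - (\<Sum>b\<in>T. b) - (\<Sum>b'\<in>B'. of_int (2 * h b') * (\<Sum>b\<in>B. of_int (g b' b) * b))"
      unfolding 3 using S T by (simp add: ind e_def of_int_diff left_diff_distrib sum_subtractf del: of_int_mult of_int_sum)
    also have "\<dots> = ((\<Sum>b\<in>S. b) - (\<Sum>b\<in>T. b) - (\<Sum>b'\<in>B'. of_int (2 * h b') * b')) + (\<Sum>b'\<in>B'. of_int (2 * h b') * (b' - (\<Sum>b\<in>B. of_int (g b' b) * b)))"
      by (simp only: right_diff_distrib sum_subtractf) simp
    also have "\<dots> \<in> I" by (rule I_add[OF 1 2])
    finally have "(\<Sum>b\<in>B. of_int (e b) * b) \<in> I" .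
    from mp[OF spec[OF Bind] this] have "\<forall>b\<in>B. e b = 0" .
    have "b \<in> S \<longleftrightarrow> b \<in> T" if "b \<in> B" for b
    proof -
      have "e b = 0" using \<open>\<forall>b\<in>B. e b = 0\<close> that by blast
      then have "(if b \<in> S then 1 else 0) - (if b \<in> T then 1 else (0::int)) = 2 * (\<Sum>b'\<in>B'. h b' * g b' b)" by (simp add: e_def)
      then have "even ((if b \<in> S then 1 else 0) - (if b \<in> T then 1 else (0::int)))" by simp
      then show ?thesis by (auto split: if_splits)
    qed
    then show "S = T" using S T by blast
  qed
  have "\<phi> ` Pow B \<subseteq> Pow B'" by (auto simp: \<phi>_def)
  then have "card (Pow B) \<le> card (Pow B')" using card_inj_on_le[OF inj] B'(1) by simp
  then have "2 ^ k \<le> (2 ^ k' :: nat)" using B B' by (simp add: card_Pow)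
  then show ?thesis by simp
qed

text \<open>\<open>rank_le\<close> in both directions gives the uniqueness on which the definite
  description rests.\<close>

theorem chow_rank_FYs: "chow_rank L z d = card (FYs z d)"
  unfolding chow_rank_def
proof (rule the_equality)
  show "chow_has_rank L z d (card (FYs z d))" by (rule chow_has_rank_FYs)
  fix k assume k: "chow_has_rank L z d k"
  show "k = card (FYs z d)"
    by (rule le_antisym[OF rank_le[OF k chow_has_rank_FYs] rank_le[OF chow_has_rank_FYs k]])
qed

end

context geometric_lattice begin

section \<open>Counting Feichtner--Yuzvinsky monomials\<close>

text \<open>The empty monomial has top \<open>z\<close>, which starts the recursion over
  flats.\<close>

definition is_top :: "('b set \<Rightarrow>\<^sub>0 nat) \<Rightarrow> 'b set \<Rightarrow> bool" where
  "is_top m F \<longleftrightarrow> F \<in> insert z (ks m) \<and> (\<forall>G\<in>ks m. G \<subseteq> F)"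

definition FY_top :: "'b set \<Rightarrow> ('b set \<Rightarrow>\<^sub>0 nat) set" where
  "FY_top F = {m. FY z m \<and> is_top m F}"

definition hilbert_at :: "real \<Rightarrow> 'b set \<Rightarrow> real" where
  "hilbert_at t F = (\<Sum>m\<in>FY_top F. t ^ deg m)"

lemma FYs_Union: "(\<Union>d<r. FYs z d) = {m. FY z m}"
proof
  show "(\<Union>d<r. FYs z d) \<subseteq> {m. FY z m}" by (auto simp: FYs_def)
  show "{m. FY z m} \<subseteq> (\<Union>d<r. FYs z d)"
  proof
    fix m assume "m \<in> {m. FY z m}"
    then have m: "FY z m" by simp
    have "deg m < r" using FY_deg[OF m z_in z_neq_U] unfolding rk_z diff_zero .
    moreover have "m \<in> FYs z (deg m)" using m unfolding FYs_def by blast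
    ultimately show "m \<in> (\<Union>d<r. FYs z d)" by blast
  qed
qed

lemma FY_finite: "finite {m. FY z m}"
  unfolding FYs_Union[symmetric] by simp

lemma finite_FY_top [simp]: "finite (FY_top F)"
  by (rule finite_subset[OF _ FY_finite]) (auto simp: FY_top_def)

lemma is_top_unique:
  assumes "FY z m" "is_top m F" "is_top m G"
  shows "F = G"
proof -
  have k: "H \<noteq> z \<and> z \<subseteq> H" if "H \<in> ks m" for H
    using FY_base[OF assms(1)] that bot[of H] by (auto simp: P_def)
  have "F \<subseteq> G" if "is_top m F" "is_top m G" for F G
    using that k[of G] k[of F] by (auto simp: is_top_def)
  then show ?thesis using assms(2,3) by blast
qed

lemma is_top_ex:
  assumes m: "FY z m"
  shows "\<exists>F\<in>L. is_top m F"
proof -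
  have kL: "H \<in> L" if "H \<in> ks m" for H using FY_base[OF m] that by (auto simp: P_def)
  have "finite (insert z (ks m))" "insert z (ks m) \<noteq> {}" by simp_all
  from ex_max_fun[OF this, of rk] obtain F where F: "F \<in> insert z (ks m)" "\<forall>G\<in>insert z (ks m). rk G \<le> rk F" by blast
  have FL: "F \<in> L" using F(1) kL by auto
  have "G \<subseteq> F" if G: "G \<in> ks m" for G
  proof (cases "F = z")
    case True
    then have "rk G = 0" using F(2) G by simp
    then show ?thesis using rk_pos[OF kL[OF G]] True by auto
  next
    case False
    then have "comparable G F" using FY_comparable[OF m G] F(1) by simp
    then show ?thesis using comparable_le[OF _ kL[OF G] FL] F(2) G by simp
  qed
  then show ?thesis using F(1) FL by (auto simp: is_top_def)
qed

lemma sum_rank_hilbert_at: "(\<Sum>d<r. real (card (FYs z d)) * t ^ d) = (\<Sum>F\<in>L. hilbert_at t F)"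
proof -
  have U2: "(\<Union>F\<in>L. FY_top F) = {m. FY z m}"
    using is_top_ex by (auto simp: FY_top_def)
  have "(\<Sum>d<r. real (card (FYs z d)) * t ^ d) = (\<Sum>d<r. \<Sum>m\<in>FYs z d. t ^ deg m)"
  proof (rule sum.cong[OF refl])
    fix d
    have "(\<Sum>m\<in>FYs z d. t ^ deg m) = (\<Sum>m\<in>FYs z d. t ^ d)" by (rule sum.cong[OF refl]) (simp only: FYs_def mem_Collect_eq)
    then show "real (card (FYs z d)) * t ^ d = (\<Sum>m\<in>FYs z d. t ^ deg m)" by simp
  qed
  also have "\<dots> = (\<Sum>m\<in>(\<Union>d<r. FYs z d). t ^ deg m)"
  proof (rule sum.UNION_disjoint[symmetric])
    show "\<forall>i\<in>{..<r}. \<forall>j\<in>{..<r}. i \<noteq> j \<longrightarrow> FYs z i \<inter> FYs z j = {}" unfolding FYs_def by blast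
  qed simp_all
  also have "\<dots> = (\<Sum>m\<in>(\<Union>F\<in>L. FY_top F). t ^ deg m)" unfolding FYs_Union U2 ..
  also have "\<dots> = (\<Sum>F\<in>L. hilbert_at t F)"
    unfolding hilbert_at_def
  proof (rule sum.UNION_disjoint)
    show "\<forall>i\<in>L. \<forall>j\<in>L. i \<noteq> j \<longrightarrow> FY_top i \<inter> FY_top j = {}" using is_top_unique by (auto simp: FY_top_def)
  qed (simp_all add: finite_L)
  finally show ?thesis .
qed

lemma hilbert_at_z: "hilbert_at t z = 1"
proof -
  have "FY_top z = {0}"
  proof
    show "FY_top z \<subseteq> {0}"
    proof
      fix m assume "m \<in> FY_top z"
      then have m: "FY z m" "\<forall>G\<in>ks m. G \<subseteq> z" by (auto simp: FY_top_def is_top_def)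
      have "ks m = {}" using FY_base[OF m(1)] m(2) bot by (fastforce simp: P_def)
      then show "m \<in> {0}" by simp
    qed
    show "{0} \<subseteq> FY_top z" by (simp add: FY_top_def is_top_def FY_def)
  qed
  then show ?thesis by (simp add: hilbert_at_def)
qed

text \<open>The bounds that are new concern the exponent of \<open>F\<close>, and among them the one
  from \<open>G\<close> is the strictest, because all other factors lie below
  \<open>G\<close>.\<close>

lemma FY_top_add:
  assumes F: "F \<in> L" and G: "G \<in> L" "G \<subset> F" and m: "m \<in> FY_top G" and a: "a \<in> {1..<rk F - rk G}"
  shows "m + sg F a \<in> FY_top F" and "F \<notin> ks m" and "lk (m + sg F a) F = a"
proof -
  have mF: "FY z m" and ml: "G \<in> insert z (ks m)" "\<And>H. H \<in> ks m \<Longrightarrow> H \<subseteq> G" using m by (auto simp: FY_top_def is_top_def)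
  have sub: "H \<subset> F" if "H \<in> ks m" for H using ml(2)[OF that] G(2) by auto
  show Fn: "F \<notin> ks m" using sub[of F] by auto
  then show "lk (m + sg F a) F = a" by (simp add: lookup_add in_keys_iff)
  have k: "ks (m + sg F a) = insert F (ks m)" using a by (simp add: ks_plus_nat)
  have Fz: "z \<subset> F" using bot[OF G(1)] G(2) by auto
  have kL: "H \<in> L" if "H \<in> insert z (ks m)" for H using FY_base[OF mF] that by (auto simp: P_def)
  have FYm: "\<forall>H\<in>ks m. \<forall>K\<in>insert z (ks m). K \<subset> H \<longrightarrow> lk m H < rk H - rk K" using mF by (simp add: FY_def)
  have lkH: "lk (m + sg F a) H = lk m H" if "H \<in> ks m" for H
    using that Fn by (auto simp: lookup_add lookup_single when_def)
  have c3: "lk (m + sg F a) H < rk H - rk K"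
    if H: "H \<in> insert F (ks m)" and K: "K \<in> insert z (insert F (ks m))" and KH: "K \<subset> H" for H K
  proof (cases "H = F")
    case True
    then have K': "K \<in> insert z (ks m)" using K KH by auto
    have "K \<subseteq> G" using K' ml(2) bot[OF G(1)] by auto
    then have "rk K \<le> rk G" using rk_mono_le[OF kL[OF K'] G(1)] by simp
    then show ?thesis using a True \<open>lk (m + sg F a) F = a\<close> by auto
  next
    case False
    then have Hm: "H \<in> ks m" using H by simp
    have "K \<noteq> F" using sub[OF Hm] KH by auto
    then have K': "K \<in> insert z (ks m)" using K by simp
    from mp[OF bspec[OF bspec[OF FYm Hm] K'] KH] show ?thesis using lkH[OF Hm] by simp
  qed
  have c2: "H \<subseteq> K \<or> K \<subseteq> H" if "H \<in> insert F (ks m)" "K \<in> insert F (ks m)" for H K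
  proof (cases "H = F \<or> K = F")
    case True then show ?thesis using that sub by auto
  next
    case False then show ?thesis using that FY_comparable[OF mF, of H K] by (simp add: comparable_def)
  qed
  have c1: "ks m \<subseteq> V z" using mF by (simp add: FY_def)
  have "FY z (m + sg F a)"
    unfolding FY_def k
  proof (intro conjI ballI impI)
    show "insert F (ks m) \<subseteq> V z" using c1 F Fz by simp
  qed (use c2 c3 in blast)+
  moreover have "is_top (m + sg F a) F" unfolding is_top_def k using sub by auto
  ultimately show "m + sg F a \<in> FY_top F" by (simp add: FY_top_def)
qed

lemma FY_top_dest:
  assumes F: "F \<in> L" "F \<noteq> z" and m: "m \<in> FY_top F"
  shows "\<exists>G m0 a. G \<in> L \<and> G \<subset> F \<and> m0 \<in> FY_top G \<and> a \<in> {1..<rk F - rk G} \<and> m = m0 + sg F a"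
proof -
  have mF: "FY z m" and Fk: "F \<in> ks m" and ml: "\<And>H. H \<in> ks m \<Longrightarrow> H \<subseteq> F" using m F by (auto simp: FY_top_def is_top_def)
  obtain m0 where m0: "m = sg F (lk m F) + m0" using pm_extract[of "lk m F" m F] by auto
  have "lk m0 F = 0" using arg_cong[OF m0, of "\<lambda>m. lk m F"] by (simp add: lookup_add)
  then have Fn: "F \<notin> ks m0" by (simp add: in_keys_iff)
  have k0: "ks m0 \<subseteq> ks m" using ks_plus_nat[of "sg F (lk m F)" m0] m0 by auto
  have a1: "lk m F \<ge> 1" using Fk by (simp add: in_keys_iff)
  have FYm: "\<forall>H\<in>ks m. \<forall>K\<in>insert z (ks m). K \<subset> H \<longrightarrow> lk m H < rk H - rk K" using mF by (simp add: FY_def)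
  have lkH: "lk m0 H = lk m H" if "H \<in> ks m0" for H
  proof -
    have "H \<noteq> F" using that Fn by auto
    then show ?thesis using arg_cong[OF m0, of "\<lambda>m. lk m H"] by (simp add: lookup_add lookup_single)
  qed
  have "FY z m0"
    unfolding FY_def
  proof (intro conjI ballI impI)
    show "ks m0 \<subseteq> V z" using k0 mF unfolding FY_def by (meson subset_trans)
    show "H \<subseteq> K \<or> K \<subseteq> H" if "H \<in> ks m0" "K \<in> ks m0" for H K
      using FY_comparable[OF mF subsetD[OF k0 that(1)] subsetD[OF k0 that(2)]] by (simp add: comparable_def)
    show "lk m0 H < rk H - rk K" if "H \<in> ks m0" "K \<in> insert z (ks m0)" "K \<subset> H" for H K
    proof -
      have "K \<in> insert z (ks m)" using that(2) k0 by auto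
      from mp[OF bspec[OF bspec[OF FYm subsetD[OF k0 that(1)]] this] that(3)] show ?thesis using lkH[OF that(1)] by simp
    qed
  qed
  then obtain G where G: "G \<in> L" "is_top m0 G" using is_top_ex by blast
  have Gk: "G \<in> insert z (ks m0)" using G(2) by (simp add: is_top_def)
  have GF: "G \<subset> F"
  proof (cases "G = z")
    case True then show ?thesis using bot[OF F(1)] F(2) by auto
  next
    case False
    then have "G \<in> ks m0" using Gk by simp
    then have "G \<in> ks m" "G \<noteq> F" using k0 Fn by auto
    then show ?thesis using ml by auto
  qed
  have "G \<in> insert z (ks m)" using Gk k0 by auto
  from mp[OF bspec[OF bspec[OF FYm Fk] this] GF] have "lk m F < rk F - rk G" .
  then have "lk m F \<in> {1..<rk F - rk G}" using a1 by simp
  moreover have "m0 \<in> FY_top G" using \<open>FY z m0\<close> G(2) by (simp add: FY_top_def)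
  moreover have "m = m0 + sg F (lk m F)" using m0 by (simp add: add.commute)
  ultimately show ?thesis using G(1) GF by blast
qed

text \<open>Removing the power of the largest flat is a bijection: if \<open>G\<close> is the next
  top, the exponent ranges over \<open>{1..<rk F - rk G}\<close>.\<close>

lemma hilbert_at_rec:
  assumes F: "F \<in> L" "F \<noteq> z"
  shows "hilbert_at t F = (\<Sum>G | G \<in> L \<and> G \<subset> F. hilbert_at t G * geom_gap t (rk F - rk G))"
proof -
  define S where "S = (SIGMA G:{G. G \<in> L \<and> G \<subset> F}. FY_top G \<times> {1..<rk F - rk G})"
  define \<psi> where "\<psi> = (\<lambda>(G :: 'b set, m0 :: 'b set \<Rightarrow>\<^sub>0 nat, a). m0 + sg F a)"
  have inj: "inj_on \<psi> S"
  proof (rule inj_onI)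
    fix x y assume x: "x \<in> S" and y: "y \<in> S" and e: "\<psi> x = \<psi> y"
    obtain G m a G' m' a' where xy: "x = (G, m, a)" "y = (G', m', a')" by (cases x, cases y) auto
    have 1: "G \<in> L" "G \<subset> F" "m \<in> FY_top G" "a \<in> {1..<rk F - rk G}" using x by (auto simp: S_def xy)
    have 2: "G' \<in> L" "G' \<subset> F" "m' \<in> FY_top G'" "a' \<in> {1..<rk F - rk G'}" using y by (auto simp: S_def xy)
    have eq: "m + sg F a = m' + sg F a'" using e by (simp add: \<psi>_def xy)
    have aa: "a = a'" using FY_top_add(3)[OF F(1) 1] FY_top_add(3)[OF F(1) 2] eq by simp
    then have mm: "m = m'" using eq by simp
    have "G = G'" using is_top_unique[of m G G'] 1(3) 2(3) mm by (simp add: FY_top_def)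
    then show "x = y" using aa mm xy by simp
  qed
  have im: "\<psi> ` S = FY_top F"
  proof
    show "\<psi> ` S \<subseteq> FY_top F"
    proof (rule image_subsetI)
      fix x assume x: "x \<in> S"
      obtain G m a where xx: "x = (G, m, a)" by (cases x) auto
      have "G \<in> L" "G \<subset> F" "m \<in> FY_top G" "a \<in> {1..<rk F - rk G}" using x by (auto simp: S_def xx)
      from FY_top_add(1)[OF F(1) this] show "\<psi> x \<in> FY_top F" by (simp add: \<psi>_def xx)
    qed
    show "FY_top F \<subseteq> \<psi> ` S"
    proof
      fix m assume "m \<in> FY_top F"
      from FY_top_dest[OF F this] obtain G m0 a where g: "G \<in> L" "G \<subset> F" "m0 \<in> FY_top G" "a \<in> {1..<rk F - rk G}" "m = m0 + sg F a" by blast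
      then have "(G, m0, a) \<in> S" by (simp add: S_def)
      then show "m \<in> \<psi> ` S" by (rule rev_image_eqI) (simp add: \<psi>_def g(5))
    qed
  qed
  have "hilbert_at t F = (\<Sum>x\<in>S. t ^ deg (\<psi> x))" unfolding hilbert_at_def im[symmetric] by (simp add: sum.reindex[OF inj])
  also have "\<dots> = (\<Sum>(G, m, a)\<in>S. t ^ deg m * t ^ a)"
    by (rule sum.cong[OF refl]) (auto simp: \<psi>_def weight_add power_add)
  also have "\<dots> = (\<Sum>G | G \<in> L \<and> G \<subset> F. \<Sum>(m, a)\<in>FY_top G \<times> {1..<rk F - rk G}. t ^ deg m * t ^ a)"
    unfolding S_def by (subst sum.Sigma) auto
  also have "\<dots> = (\<Sum>G | G \<in> L \<and> G \<subset> F. hilbert_at t G * geom_gap t (rk F - rk G))"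
    by (intro sum.cong refl) (simp add: hilbert_at_def geom_gap_def sum_product sum.cartesian_product)
  finally show ?thesis .
qed

end

unbundle no fps_syntax
unbundle vec_syntax

section \<open>Counting subspaces\<close>

definition indep_lists :: "('a::{finite,field} ^ 'n) set \<Rightarrow> nat \<Rightarrow> ('a ^ 'n) list set" where
  "indep_lists W k = {xs. length xs = k \<and> distinct xs \<and> set xs \<subseteq> W \<and> vec.independent (set xs)}"

lemma finite_vec_set [simp]: "finite (A :: ('a::finite ^ 'n::finite) set)"
  by (rule finite_subset[OF subset_UNIV]) simp

lemma finite_indep_lists [simp]: "finite (indep_lists W k)"
  by (rule finite_subset[OF _ finite_lists_length_eq[of W k]]) (auto simp: indep_lists_def)

lemma card_span_independent:
  fixes B :: "('a::{finite,field} ^ 'n) set"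
  assumes "vec.independent B"
  shows "card (vec.span B) = CARD('a) ^ card B"
proof -
  have "finite B" by simp
  then show ?thesis using assms
  proof (induction B)
    case empty
    then show ?case by simp
  next
    case (insert b B)
    have iB: "vec.independent B" and b: "b \<notin> vec.span B"
      using insert.prems insert.hyps by (auto simp: vec.independent_insert)
    define f where "f = (\<lambda>(c :: 'a, v). c *s b + v)"
    have inj: "inj_on f (UNIV \<times> vec.span B)"
    proof (rule inj_onI, clarify)
      fix c d v w assume v: "v \<in> vec.span B" and w: "w \<in> vec.span B" and e: "f (c, v) = f (d, w)"
      have "(c - d) *s b = w - v" using e by (simp add: f_def vec.scale_left_diff_distrib algebra_simps)
      then have s: "(c - d) *s b \<in> vec.span B" using vec.span_diff[OF w v] by simp
      have "c = d"
      proof (rule ccontr)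
        assume "c \<noteq> d"
        then have "inverse (c - d) * (c - d) = 1" by (intro left_inverse) simp
        then have "b = inverse (c - d) *s ((c - d) *s b)" by (simp only: vec.scale_scale vec.scale_one)
        then show False using b vec.span_scale[OF s, of "inverse (c - d)"] by simp
      qed
      then show "c = d \<and> v = w" using e by (simp add: f_def)
    qed
    have im: "f ` (UNIV \<times> vec.span B) = vec.span (insert b B)"
    proof
      show "f ` (UNIV \<times> vec.span B) \<subseteq> vec.span (insert b B)"
      proof (rule image_subsetI, clarify)
        fix c v assume "v \<in> vec.span B"
        then have "v \<in> vec.span (insert b B)" using vec.span_mono[of B "insert b B"] by auto
        moreover have "c *s b \<in> vec.span (insert b B)" by (intro vec.span_scale vec.span_base) simp
        ultimately show "f (c, v) \<in> vec.span (insert b B)"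
          unfolding f_def prod.case by (intro vec.span_add)
      qed
      show "vec.span (insert b B) \<subseteq> f ` (UNIV \<times> vec.span B)"
      proof
        fix x assume "x \<in> vec.span (insert b B)"
        then obtain k where "x - k *s b \<in> vec.span B" by (auto simp: vec.span_insert)
        then show "x \<in> f ` (UNIV \<times> vec.span B)" by (intro image_eqI[of _ _ "(k, x - k *s b)"]) (auto simp: f_def)
      qed
    qed
    have "card (vec.span (insert b B)) = card (UNIV \<times> vec.span B :: ('a \<times> _) set)"
      unfolding im[symmetric] by (rule card_image[OF inj])
    then show ?case using insert.IH[OF iB] insert.hyps by (simp add: card_cartesian_product)
  qed
qed

lemma card_subspace:
  fixes W :: "('a::{finite,field} ^ 'n) set"
  assumes "vec.subspace W"
  shows "card W = CARD('a) ^ vec.dim W"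
proof -
  obtain B where B: "B \<subseteq> W" "vec.independent B" "W \<subseteq> vec.span B" "card B = vec.dim W" by (rule vec.basis_exists)
  have "vec.span B = W" using B(1,3) assms by (metis vec.span_minimal subset_antisym)
  then show ?thesis using card_span_independent[OF B(2)] B(4) by simp
qed

text \<open>An independent list is extended by a vector outside its span. For
  \<open>k > vec.dim W\<close> the factor with \<open>i = vec.dim W\<close> vanishes, so the formula
  needs no bound on \<open>k\<close>.\<close>

lemma card_indep_lists:
  fixes W :: "('a::{finite,field} ^ 'n) set"
  assumes W: "vec.subspace W"
  shows "real (card (indep_lists W k)) = (\<Prod>i<k. real CARD('a) ^ vec.dim W - real CARD('a) ^ i)"
proof (induction k)
  case 0
  have "indep_lists W 0 = {[]}" by (auto simp: indep_lists_def vec.independent_empty)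
  then show ?case by simp
next
  case (Suc k)
  have eq: "indep_lists W (Suc k) = (\<lambda>(xs, x). x # xs) ` (SIGMA xs:indep_lists W k. W - vec.span (set xs))"
  proof
    show "indep_lists W (Suc k) \<subseteq> (\<lambda>(xs, x). x # xs) ` (SIGMA xs:indep_lists W k. W - vec.span (set xs))"
    proof
      fix ys assume ys: "ys \<in> indep_lists W (Suc k)"
      then obtain x xs where yx: "ys = x # xs" by (cases ys) (auto simp: indep_lists_def)
      then have p: "length xs = k" "distinct xs" "x \<notin> set xs" "set xs \<subseteq> W" "x \<in> W" "vec.independent (insert x (set xs))"
        using ys by (auto simp: indep_lists_def)
      then have "vec.independent (set xs)" "x \<notin> vec.span (set xs)" by (auto simp: vec.independent_insert)
      then have "(xs, x) \<in> (SIGMA xs:indep_lists W k. W - vec.span (set xs))" using p by (simp add: indep_lists_def)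
      then show "ys \<in> (\<lambda>(xs, x). x # xs) ` (SIGMA xs:indep_lists W k. W - vec.span (set xs))"
        by (rule rev_image_eqI) (simp add: yx)
    qed
    show "(\<lambda>(xs, x). x # xs) ` (SIGMA xs:indep_lists W k. W - vec.span (set xs)) \<subseteq> indep_lists W (Suc k)"
    proof (rule image_subsetI)
      fix p assume p: "p \<in> (SIGMA xs:indep_lists W k. W - vec.span (set xs))"
      obtain xs x where px: "p = (xs, x)" by (cases p)
      have xs: "length xs = k" "distinct xs" "set xs \<subseteq> W" "vec.independent (set xs)" "x \<in> W" "x \<notin> vec.span (set xs)"
        using p by (auto simp: indep_lists_def px)
      have "x \<notin> set xs" using xs(6) vec.span_base by blast
      moreover have "vec.independent (insert x (set xs))" by (rule vec.independent_insertI[OF xs(6,4)])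
      ultimately show "(case p of (xs, x) \<Rightarrow> x # xs) \<in> indep_lists W (Suc k)" using xs by (simp add: indep_lists_def px)
    qed
  qed
  have inj: "inj_on (\<lambda>(xs, x). x # xs) (SIGMA xs:indep_lists W k. W - vec.span (set xs))"
    by (auto simp: inj_on_def)
  have c: "card (W - vec.span (set xs)) = CARD('a) ^ vec.dim W - CARD('a) ^ k" if "xs \<in> indep_lists W k" for xs
  proof -
    have xs: "length xs = k" "distinct xs" "set xs \<subseteq> W" "vec.independent (set xs)" using that by (auto simp: indep_lists_def)
    have "vec.span (set xs) \<subseteq> W" using xs(3) W by (simp add: vec.span_minimal)
    moreover have "card (vec.span (set xs)) = CARD('a) ^ k"
      using card_span_independent[OF xs(4)] xs(1,2) by (simp add: distinct_card)
    ultimately show ?thesis using card_subspace[OF W] by (simp add: card_Diff_subset)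
  qed
  have le: "CARD('a) ^ k \<le> CARD('a) ^ vec.dim W" if "indep_lists W k \<noteq> {}"
  proof -
    from that obtain xs where "xs \<in> indep_lists W k" by blast
    then have "length xs = k" "distinct xs" "set xs \<subseteq> W" "vec.independent (set xs)" by (auto simp: indep_lists_def)
    then have "k \<le> vec.dim W" using vec.independent_card_le_dim[of "set xs" W] by (simp add: distinct_card)
    then show ?thesis by (intro power_increasing) (auto simp: Suc_leI)
  qed
  have "card (indep_lists W (Suc k)) = card (SIGMA xs:indep_lists W k. W - vec.span (set xs))"
    unfolding eq by (rule card_image[OF inj])
  also have "\<dots> = (\<Sum>xs\<in>indep_lists W k. card (W - vec.span (set xs)))" by (rule card_SigmaI) auto
  also have "\<dots> = card (indep_lists W k) * (CARD('a) ^ vec.dim W - CARD('a) ^ k)" using c by simp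
  finally have "real (card (indep_lists W (Suc k))) = real (card (indep_lists W k)) * real (CARD('a) ^ vec.dim W - CARD('a) ^ k)" by simp
  also have "\<dots> = real (card (indep_lists W k)) * (real CARD('a) ^ vec.dim W - real CARD('a) ^ k)"
    using le by (cases "indep_lists W k = {}") (simp_all add: of_nat_diff)
  finally show ?case using Suc by simp
qed

text \<open>A list of \<open>k\<close> independent vectors belongs to exactly one subspace of
  dimension \<open>k\<close>, its span.\<close>

lemma indep_lists_dim:
  fixes W :: "('a::{finite,field} ^ 'n) set"
  assumes W: "vec.subspace W"
  shows "card (indep_lists W k) = (\<Sum>W' | vec.subspace W' \<and> W' \<subseteq> W \<and> vec.dim W' = k. card (indep_lists W' k))"
proof -
  let ?S = "{W'. vec.subspace W' \<and> W' \<subseteq> W \<and> vec.dim W' = k}"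
  have span: "vec.span (set xs) = W'" if "xs \<in> indep_lists W' k" "vec.subspace W'" "vec.dim W' = k" for xs W'
  proof -
    have xs: "length xs = k" "distinct xs" "set xs \<subseteq> W'" "vec.independent (set xs)" using that by (auto simp: indep_lists_def)
    have "vec.dim (vec.span (set xs)) = k"
      using vec.dim_span_eq_card_independent[OF xs(4)] xs(1,2) by (simp only: distinct_card)
    then show ?thesis using that xs by (intro vec.subspace_dim_equal) (auto simp: vec.span_minimal)
  qed
  have "indep_lists W k = (\<Union>W'\<in>?S. indep_lists W' k)"
  proof
    show "(\<Union>W'\<in>?S. indep_lists W' k) \<subseteq> indep_lists W k" by (auto simp: indep_lists_def)
    show "indep_lists W k \<subseteq> (\<Union>W'\<in>?S. indep_lists W' k)"
    proof
      fix xs assume "xs \<in> indep_lists W k"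
      then have xs: "length xs = k" "distinct xs" "set xs \<subseteq> W" "vec.independent (set xs)" by (auto simp: indep_lists_def)
      have "vec.dim (vec.span (set xs)) = k"
        using vec.dim_span_eq_card_independent[OF xs(4)] xs(1,2) by (simp only: distinct_card)
      then have "vec.span (set xs) \<in> ?S" using vec.span_minimal[OF xs(3) W] by (simp del: vec.dim_span)
      moreover have "xs \<in> indep_lists (vec.span (set xs)) k" using xs vec.span_superset by (simp add: indep_lists_def)
      ultimately show "xs \<in> (\<Union>W'\<in>?S. indep_lists W' k)" by blast
    qed
  qed
  moreover have "card (\<Union>W'\<in>?S. indep_lists W' k) = (\<Sum>W'\<in>?S. card (indep_lists W' k))"
  proof (rule card_UN_disjoint)
    show "\<forall>i\<in>?S. \<forall>j\<in>?S. i \<noteq> j \<longrightarrow> indep_lists i k \<inter> indep_lists j k = {}"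
    proof (intro ballI impI)
      fix i j assume ij: "i \<in> ?S" "j \<in> ?S" "i \<noteq> j"
      have "\<not> (x \<in> indep_lists i k \<and> x \<in> indep_lists j k)" for x using span[of x i] span[of x j] ij by auto
      then show "indep_lists i k \<inter> indep_lists j k = {}" by blast
    qed
  qed simp_all
  ultimately show ?thesis by simp
qed

text \<open>Taking \<open>- (q ^ i)\<close> out of each factor leaves
  \<open>1 - q ^ (m - i)\<close>, and these are the last \<open>k\<close> factors of
  \<open>q_prod q m\<close>.\<close>

lemma prod_q_prod:
  fixes q :: real
  shows "k \<le> m \<Longrightarrow> (\<Prod>i<k. q ^ m - q ^ i) * q_prod q (m - k) = (\<Prod>i<k. - (q ^ i)) * q_prod q m"
proof (induction k)
  case (Suc k)
  then have e: "m - k = Suc (m - Suc k)" and km: "q ^ m = q ^ k * q ^ (m - k)" by (simp_all add: power_add[symmetric])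
  have "q_prod q (m - k) = q_prod q (m - Suc k) * (1 - q ^ (m - k))" unfolding e q_prod_Suc by simp
  moreover have "q ^ m - q ^ k = - (q ^ k) * (1 - q ^ (m - k))" using km by (simp add: algebra_simps)
  ultimately have "(\<Prod>i<Suc k. q ^ m - q ^ i) * q_prod q (m - Suc k) = - (q ^ k) * ((\<Prod>i<k. q ^ m - q ^ i) * q_prod q (m - k))"
    by (simp only: prod.lessThan_Suc mult_ac)
  then show ?case using Suc by simp
qed simp

text \<open>Counting independent lists of length \<open>k\<close> in \<open>W\<close> by their span
  expresses the number as a quotient of two products; rewriting both through \<open>q_prod\<close>,
  the powers and signs cancel.\<close>

theorem card_subspaces:
  fixes W :: "('a::{finite,field} ^ 'n) set"
  assumes W: "vec.subspace W"
  shows "real (card {W'. vec.subspace W' \<and> W' \<subseteq> W \<and> vec.dim W' = k}) = gauss_binomial (real CARD('a)) (vec.dim W) k"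
proof (cases "k \<le> vec.dim W")
  case False
  have "{W'. vec.subspace W' \<and> W' \<subseteq> W \<and> vec.dim W' = k} = {}" using vec.dim_subset[of _ W] False by auto
  then show ?thesis using False by (simp add: gauss_binomial_eq_0)
next
  case True
  define q where "q = real CARD('a)"
  have "CARD('a) > 1" using card_mono[of "UNIV :: 'a set" "{0, 1}"] by simp
  then have q: "q > 1" by (simp add: q_def)
  have nz: "(\<Prod>i<k. q ^ k - q ^ i) \<noteq> 0" using q by (auto simp: power_inject_exp)
  have qn: "q_prod q i \<noteq> 0" for i using q_prod_nonzero[of q i] q by simp
  have sg: "(\<Prod>i<k. - (q ^ i)) \<noteq> 0" using q by auto
  have "real (card (indep_lists W k)) = (\<Sum>W' | vec.subspace W' \<and> W' \<subseteq> W \<and> vec.dim W' = k. real (card (indep_lists W' k)))"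
    unfolding indep_lists_dim[OF W] by simp
  also have "\<dots> = (\<Sum>W' | vec.subspace W' \<and> W' \<subseteq> W \<and> vec.dim W' = k. \<Prod>i<k. q ^ k - q ^ i)"
    by (rule sum.cong[OF refl]) (auto simp: card_indep_lists q_def)
  finally have 1: "(\<Prod>i<k. q ^ vec.dim W - q ^ i) = real (card {W'. vec.subspace W' \<and> W' \<subseteq> W \<and> vec.dim W' = k}) * (\<Prod>i<k. q ^ k - q ^ i)"
    using card_indep_lists[OF W, of k] by (simp add: q_def)
  have 2: "(\<Prod>i<k. q ^ vec.dim W - q ^ i) * q_prod q (vec.dim W - k) = (\<Prod>i<k. - (q ^ i)) * q_prod q (vec.dim W)"
    by (rule prod_q_prod[OF True])
  have 3: "(\<Prod>i<k. q ^ k - q ^ i) = (\<Prod>i<k. - (q ^ i)) * q_prod q k"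
    using prod_q_prod[of k k q] by simp
  have g: "gauss_binomial q (vec.dim W) k * q_prod q k * q_prod q (vec.dim W - k) = q_prod q (vec.dim W)"
    using gauss_binomial_q_prod[of q k "vec.dim W - k"] True by simp
  have "(\<Prod>i<k. - (q ^ i)) * (q_prod q k * q_prod q (vec.dim W - k)) * real (card {W'. vec.subspace W' \<and> W' \<subseteq> W \<and> vec.dim W' = k})
    = (\<Prod>i<k. - (q ^ i)) * (q_prod q k * q_prod q (vec.dim W - k)) * gauss_binomial q (vec.dim W) k"
    using 2 unfolding 1 3 g[symmetric] by (simp add: mult_ac)
  then show ?thesis using qn sg unfolding q_def[symmetric] by simp
qed

section \<open>The lattice of flats\<close>

definition flat_rank :: "nat \<Rightarrow> ('a::field ^ 'n) set \<Rightarrow> nat" where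
  "flat_rank r F = (if F = UNIV then r else vec.dim F)"

lemma vec_dim_psubset:
  assumes "vec.subspace F" "vec.subspace G" "F \<subset> (G :: ('a::field ^ 'n) set)"
  shows "vec.dim F < vec.dim G"
proof (rule ccontr)
  assume "\<not> vec.dim F < vec.dim G"
  then have "F = G" using vec.subspace_dim_equal[of F G] assms by auto
  then show False using assms(3) by blast
qed

lemma vec_dim_0D: "vec.subspace F \<Longrightarrow> vec.dim F = 0 \<Longrightarrow> F = {0 :: 'a::field ^ 'n}"
  using vec.dim_eq_0[of F] vec.subspace_0[of F] by blast

lemma vec_dim_line: "x \<noteq> (0 :: 'a::field ^ 'n) \<Longrightarrow> vec.dim (vec.span {x}) = 1"
  using vec.dim_singleton[of x] by simp

context
  fixes r :: nat and T :: "('a::{finite,field} ^ 'n::finite) itself"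
  assumes r1: "1 \<le> r" and rn: "r \<le> CARD('n)"
begin

abbreviation (input) "flats \<equiv> (flats_Mr r :: ('a ^ 'n) set set)"

lemma flat_iff: "F \<in> flats \<longleftrightarrow> F = UNIV \<or> (vec.subspace F \<and> vec.dim F < r)"
  using r1 by (auto simp: flats_Mr_def)

lemma flat_subspace: "F \<in> flats \<Longrightarrow> vec.subspace F"
  by (auto simp: flat_iff)

lemma proper_neq_UNIV: "vec.dim F < r \<Longrightarrow> F \<noteq> (UNIV :: ('a ^ 'n) set)"
  using rn vec_dim_card[where 'a = 'a and 'n = 'n] by auto

lemma flat_rank_proper: "vec.dim F < r \<Longrightarrow> flat_rank r (F :: ('a ^ 'n) set) = vec.dim F"
  using proper_neq_UNIV by (simp add: flat_rank_def)

lemma flat_rank_UNIV: "flat_rank r (UNIV :: ('a ^ 'n) set) = r"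
  by (simp add: flat_rank_def)

text \<open>At the whole space this is the hypothesis \<open>r \<le> CARD('n)\<close>. It says that
  truncation can only lower ranks.\<close>

lemma flat_rank_le: "flat_rank r (F :: ('a ^ 'n) set) \<le> vec.dim F"
proof (cases "F = UNIV")
  case True
  show ?thesis using rn unfolding True flat_rank_UNIV vec_dim_card .
qed (simp add: flat_rank_def)

lemma zero_neq_UNIV: "{0 :: 'a ^ 'n} \<noteq> UNIV"
  using proper_neq_UNIV[of "{0}"] r1 by simp

lemma zero_flat: "{0} \<in> flats" using r1 by (simp add: flat_iff vec.subspace_single_0)

lemma flat_cases:
  assumes "F \<in> flats"
  obtains "F = UNIV" | "vec.subspace F" "vec.dim F < r" "F \<noteq> UNIV" "flat_rank r F = vec.dim F"
  using assms flat_iff[of F] flat_rank_proper[of F] proper_neq_UNIV[of F] by blast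

lemma flat_rank_mono:
  assumes F: "F \<in> flats" and G: "G \<in> flats" and FG: "F \<subset> G"
  shows "flat_rank r F < flat_rank r G"
proof -
  have "F \<noteq> UNIV" using FG by auto
  then have f: "vec.subspace F" "vec.dim F < r" "flat_rank r F = vec.dim F" using flat_cases[OF F] by auto
  show ?thesis
  proof (cases rule: flat_cases[OF G])
    case 1 then show ?thesis using f flat_rank_UNIV by simp
  next
    case 2 then show ?thesis using f vec_dim_psubset[OF f(1) 2(1) FG] by simp
  qed
qed

text \<open>The join is the sum of the subspaces if its dimension is below \<open>r\<close>, and the
  whole space otherwise. Modularity of the dimension carries over as an inequality, since truncation
  lowers the left side only.\<close>

lemma flat_join:
  assumes F: "F \<in> flats" and G: "G \<in> flats"
  shows "\<exists>J\<in>flats. F \<subseteq> J \<and> G \<subseteq> J \<and> (\<forall>H\<in>flats. F \<subseteq> H \<longrightarrow> G \<subseteq> H \<longrightarrow> J \<subseteq> H)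
        \<and> flat_rank r J + flat_rank r (F \<inter> G) \<le> flat_rank r F + flat_rank r G"
proof (cases "F = UNIV \<or> G = UNIV")
  case True
  show ?thesis
  proof (rule bexI[of _ UNIV])
    show "UNIV \<in> flats" by (simp add: flat_iff)
  qed (use True flat_rank_UNIV in auto)
next
  case False
  have f: "vec.subspace F" "flat_rank r F = vec.dim F" using False by (auto intro: flat_cases[OF F])
  have g: "vec.subspace G" "flat_rank r G = vec.dim G" using False by (auto intro: flat_cases[OF G])
  define S where "S = {x + y | x y. x \<in> F \<and> y \<in> G}"
  have dim: "vec.dim S + vec.dim (F \<inter> G) = vec.dim F + vec.dim G"
    unfolding S_def using vec.dim_sums_Int[OF f(1) g(1)] by simp
  have sub: "vec.subspace S" unfolding S_def by (rule vec.subspace_sums[OF f(1) g(1)])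
  have "x \<in> S" if "x \<in> F" for x using that vec.subspace_0[OF g(1)] unfolding S_def by force
  then have FS: "F \<subseteq> S" by blast
  have "x \<in> S" if "x \<in> G" for x using that vec.subspace_0[OF f(1)] unfolding S_def by force
  then have GS: "G \<subseteq> S" by blast
  have least: "S \<subseteq> H" if "vec.subspace H" "F \<subseteq> H" "G \<subseteq> H" for H
    unfolding S_def using that vec.subspace_add[OF that(1)] by auto
  define J where "J = (if vec.dim S < r then S else UNIV)"
  have JS: "flat_rank r J \<le> vec.dim S" using flat_rank_le[of S] flat_rank_UNIV by (simp add: J_def)
  show ?thesis
  proof (intro bexI[of _ J] conjI ballI impI)
    show "J \<in> flats" using sub by (simp add: J_def flat_iff)
    show "F \<subseteq> J" "G \<subseteq> J" using FS GS by (auto simp: J_def)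
    show "J \<subseteq> H" if H: "H \<in> flats" "F \<subseteq> H" "G \<subseteq> H" for H
    proof (cases rule: flat_cases[OF H(1)])
      case 2
      then have "vec.dim S < r" using vec.dim_subset[OF least[OF 2(1) H(2,3)]] by simp
      then show ?thesis using least[OF 2(1) H(2,3)] by (simp add: J_def)
    qed simp
    show "flat_rank r J + flat_rank r (F \<inter> G) \<le> flat_rank r F + flat_rank r G"
      using JS flat_rank_le[of "F \<inter> G"] dim f g by simp
  qed
qed

lemma line_atom:
  assumes r2: "r \<ge> 2" and x: "x \<noteq> 0"
  shows "vec.span {x} \<in> lat_atoms flats {0}"
proof -
  have d: "vec.dim (vec.span {x}) = 1" by (rule vec_dim_line[OF x])
  have 1: "vec.span {x} \<in> flats" using r2 d by (simp add: flat_iff)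
  have 2: "vec.span {x} \<noteq> {0}" using vec.span_base[of x "{x}"] x by auto
  have "\<not> (\<exists>H\<in>flats. {0} \<subset> H \<and> H \<subset> vec.span {x})"
  proof
    assume "\<exists>H\<in>flats. {0} \<subset> H \<and> H \<subset> vec.span {x}"
    then obtain H where H: "H \<in> flats" "{0} \<subset> H" "H \<subset> vec.span {x}" by blast
    have "vec.dim H < 1" using vec_dim_psubset[OF flat_subspace[OF H(1)] vec.subspace_span H(3)] d by simp
    then show False using vec_dim_0D[OF flat_subspace[OF H(1)]] H(2) by auto
  qed
  then show ?thesis using 1 2 unfolding lat_atoms_def by blast
qed

text \<open>For \<open>r = 1\<close> the whole space is the atom, although it need not be a line;
  the lemmas on atoms treat this case separately.\<close>

lemma flats_rank_1:
  assumes "r = 1" "F \<in> flats" "F \<noteq> {0}"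
  shows "F = UNIV"
  using assms(2)
proof (cases rule: flat_cases)
  case 2
  then show ?thesis using vec_dim_0D[OF 2(1)] assms by simp
qed

lemma flat_atom_rank:
  assumes "a \<in> lat_atoms flats {0}"
  shows "flat_rank r a = 1"
proof -
  have a: "a \<in> flats" "a \<noteq> {0}" and no: "\<not> (\<exists>F\<in>flats. {0} \<subset> F \<and> F \<subset> a)" using assms by (auto simp: lat_atoms_def)
  show ?thesis
  proof (cases "r = 1")
    case True
    then show ?thesis using flats_rank_1[OF True a] flat_rank_UNIV by simp
  next
    case False
    then have r2: "r \<ge> 2" using r1 by simp
    have "0 \<in> a" using vec.subspace_0[OF flat_subspace[OF a(1)]] .
    then obtain x where x: "x \<in> a" "x \<noteq> 0" using a(2) by blast
    have sub: "vec.span {x} \<subseteq> a" using vec.span_minimal[of "{x}" a] flat_subspace[OF a(1)] x(1) by simp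
    have at: "vec.span {x} \<in> flats" "vec.span {x} \<noteq> {0}" using line_atom[OF r2 x(2)] by (simp_all add: lat_atoms_def)
    have "{0} \<subset> vec.span {x}" using at(2) vec.span_zero[of "{x}"] by blast
    then have "a = vec.span {x}" using no at(1) sub by blast
    then have "vec.dim a = 1" using vec_dim_line[OF x(2)] by simp
    then show ?thesis using flat_rank_proper[of a] r2 by simp
  qed
qed

lemma flat_atom_ex:
  assumes F: "F \<in> flats" and G: "G \<in> flats" and FG: "F \<subset> G"
  shows "\<exists>a\<in>lat_atoms flats {0}. a \<subseteq> G \<and> \<not> a \<subseteq> F"
proof -
  obtain x where x: "x \<in> G" "x \<notin> F" using FG by blast
  then have x0: "x \<noteq> 0" using vec.subspace_0[OF flat_subspace[OF F]] by auto
  show ?thesis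
  proof (cases "r = 1")
    case True
    have "G \<noteq> {0}" using x x0 by auto
    then have "G = UNIV" using flats_rank_1[OF True G] by simp
    moreover have "UNIV \<in> lat_atoms flats {0}"
    proof -
      have "\<not> (\<exists>H\<in>flats. {0} \<subset> H \<and> H \<subset> UNIV)"
      proof
        assume "\<exists>H\<in>flats. {0} \<subset> H \<and> H \<subset> UNIV"
        then obtain H where H: "H \<in> flats" "{0} \<subset> H" "H \<subset> UNIV" by blast
        then have "H \<noteq> {0}" by auto
        then have "H = UNIV" by (rule flats_rank_1[OF True H(1)])
        then show False using H(3) by simp
      qed
      moreover have "UNIV \<in> flats" by (simp add: flat_iff)
      ultimately show ?thesis unfolding lat_atoms_def using zero_neq_UNIV by blast
    qed
    ultimately show ?thesis using x(2) by blast
  next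
    case False
    then have "vec.span {x} \<in> lat_atoms flats {0}" using line_atom[OF _ x0] r1 by simp
    moreover have "vec.span {x} \<subseteq> G" using vec.span_minimal[of "{x}" G] flat_subspace[OF G] x(1) by simp
    moreover have "\<not> vec.span {x} \<subseteq> F" using vec.span_base[of x "{x}"] x(2) by auto
    ultimately show ?thesis by blast
  qed
qed

lemma flats_geometric: "geometric_lattice flats {0} UNIV (flat_rank r)"
proof
  show "finite flats" by simp
  show "{0} \<in> flats" by (rule zero_flat)
  show "UNIV \<in> flats" by (simp add: flat_iff)
  show "{0 :: 'a ^ 'n} \<noteq> UNIV" by (rule zero_neq_UNIV)
  show "flat_rank r {0 :: 'a ^ 'n} = 0" using flat_rank_le[of "{0}"] by simp
  fix F G assume F: "F \<in> flats"
  show "{0} \<subseteq> F" using vec.subspace_0[OF flat_subspace[OF F]] by simp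
  show "F \<subseteq> UNIV" by simp
  assume G: "G \<in> flats"
  show "F \<inter> G \<in> flats"
  proof (cases "F = UNIV \<or> G = UNIV")
    case True then show ?thesis using F G by auto
  next
    case False
    then have "vec.subspace F" "vec.dim F < r" "vec.subspace G" using F G by (auto simp: flat_iff)
    then show ?thesis using vec.subspace_inter[of F G] vec.dim_subset[of "F \<inter> G" F] by (simp add: flat_iff)
  qed
qed (fact flat_rank_mono flat_join flat_atom_rank flat_atom_ex)+

lemma sum_subspaces_by_dim:
  assumes W: "vec.subspace W"
  shows "(\<Sum>G | vec.subspace (G :: ('a ^ 'n) set) \<and> G \<subseteq> W \<and> vec.dim G < M. f (vec.dim G))
    = (\<Sum>k<M. gauss_binomial (real CARD('a)) (vec.dim W) k * f k)"
proof -
  let ?S = "{G :: ('a ^ 'n) set. vec.subspace G \<and> G \<subseteq> W \<and> vec.dim G < M}"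
  have "(\<Sum>G\<in>?S. f (vec.dim G)) = (\<Sum>k<M. \<Sum>G\<in>{G\<in>?S. vec.dim G = k}. f (vec.dim G))"
    by (rule sum.group[symmetric]) auto
  also have "\<dots> = (\<Sum>k<M. gauss_binomial (real CARD('a)) (vec.dim W) k * f k)"
  proof (rule sum.cong[OF refl])
    fix k assume k: "k \<in> {..<M}"
    have e: "{G\<in>?S. vec.dim G = k} = {G. vec.subspace G \<and> G \<subseteq> W \<and> vec.dim G = k}" using k by auto
    have "(\<Sum>G\<in>{G\<in>?S. vec.dim G = k}. f (vec.dim G)) = (\<Sum>G\<in>{G\<in>?S. vec.dim G = k}. f k)" by (rule sum.cong) auto
    then show "(\<Sum>G\<in>{G\<in>?S. vec.dim G = k}. f (vec.dim G)) = gauss_binomial (real CARD('a)) (vec.dim W) k * f k"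
      unfolding e using card_subspaces[OF W, of k] by simp
  qed
  finally show ?thesis .
qed

text \<open>One description serves both kinds of \<open>F\<close>: for a proper flat the dimension
  bound only excludes \<open>F\<close> itself, for the whole space it is the truncation at
  \<open>r\<close>.\<close>

lemma proper_flats_below:
  assumes "F \<in> flats"
  shows "{G. G \<in> flats \<and> G \<subset> F} = {G. vec.subspace G \<and> G \<subseteq> F \<and> vec.dim G < flat_rank r F}"
proof (rule set_eqI, unfold mem_Collect_eq, rule iffI)
  fix G assume G: "G \<in> flats \<and> G \<subset> F"
  then have "G \<noteq> UNIV" by auto
  then have "flat_rank r G = vec.dim G" by (simp add: flat_rank_def)
  then show "vec.subspace G \<and> G \<subseteq> F \<and> vec.dim G < flat_rank r F"
    using G flat_rank_mono[of G F] assms flat_subspace[of G] by auto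
next
  fix G assume G: "vec.subspace G \<and> G \<subseteq> F \<and> vec.dim G < flat_rank r F"
  have "flat_rank r F \<le> r" using flat_cases[OF assms] flat_rank_UNIV by (metis less_or_eq_imp_le)
  then have "G \<in> flats" using G by (simp add: flat_iff)
  moreover have "G \<noteq> F" using G flat_rank_le[of F] by auto
  ultimately show "G \<in> flats \<and> G \<subset> F" using G by blast
qed

text \<open>Below a proper flat nothing is truncated, so its contribution follows the recursion of
  \<open>derange_poly\<close> in its dimension. The whole space combines all subspaces of dimension
  below \<open>r\<close> with the gaps \<open>r - k\<close>; adding the proper flats themselves
  completes \<open>geom_gap t (r - k)\<close> to the full geometric sum.\<close>

lemma hilbert_series_flats:
  "(\<Sum>d<r. real (chow_rank flats {0} d) * t ^ d)
    = (\<Sum>k<r. gauss_binomial (real CARD('a)) CARD('n) k * derange_poly (real CARD('a)) t k * (\<Sum>i<r - k. t ^ i))"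
proof -
  define q where "q = real CARD('a)"
  interpret G: geometric_lattice flats "{0}" UNIV "flat_rank r" by (rule flats_geometric)
  have ru: "flat_rank r (UNIV :: ('a ^ 'n) set) = r" by (rule flat_rank_UNIV)
  have below: "(\<Sum>G | G \<in> flats \<and> G \<subset> F. h G) = (\<Sum>k<flat_rank r F. gauss_binomial q (vec.dim F) k * f k)"
    if F: "F \<in> flats" and h: "\<And>G. G \<in> flats \<Longrightarrow> G \<subset> F \<Longrightarrow> h G = f (vec.dim G)" for F h f
  proof -
    have "(\<Sum>G | G \<in> flats \<and> G \<subset> F. h G) = (\<Sum>G | G \<in> flats \<and> G \<subset> F. f (vec.dim G))" by (rule sum.cong[OF refl]) (simp add: h)
    also have "\<dots> = (\<Sum>k<flat_rank r F. gauss_binomial q (vec.dim F) k * f k)"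
      unfolding proper_flats_below[OF F] q_def by (rule sum_subspaces_by_dim[OF flat_subspace[OF F]])
    finally show ?thesis .
  qed
  have rkG: "flat_rank r G = vec.dim G" if "G \<subset> F" for F G :: "('a ^ 'n) set"
    using that by (auto simp: flat_rank_def)
  have proper_flat: "G.hilbert_at t F = derange_poly q t (vec.dim F)" if "F \<in> flats" "F \<noteq> UNIV" for F
    using that
  proof (induction "vec.dim F" arbitrary: F rule: less_induct)
    case less
    have rF: "flat_rank r F = vec.dim F" using less.prems by (simp add: flat_rank_def)
    show ?case
    proof (cases "F = {0}")
      case True then show ?thesis using G.hilbert_at_z[of t] by simp
    next
      case False
      have "vec.dim F \<noteq> 0" using vec_dim_0D[OF flat_subspace[OF less.prems(1)]] False by blast
      have "G.hilbert_at t F = (\<Sum>G | G \<in> flats \<and> G \<subset> F. G.hilbert_at t G * geom_gap t (flat_rank r F - flat_rank r G))"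
        by (rule G.hilbert_at_rec[OF less.prems(1) False])
      also have "\<dots> = (\<Sum>k<flat_rank r F. gauss_binomial q (vec.dim F) k * (derange_poly q t k * geom_gap t (flat_rank r F - k)))"
      proof (rule below[OF less.prems(1)])
        fix G assume G: "G \<in> flats" "G \<subset> F"
        have "G \<noteq> UNIV" using G(2) by auto
        have "vec.dim G < vec.dim F" by (rule vec_dim_psubset[OF flat_subspace[OF G(1)] flat_subspace[OF less.prems(1)] G(2)])
        then show "G.hilbert_at t G * geom_gap t (flat_rank r F - flat_rank r G) = derange_poly q t (vec.dim G) * geom_gap t (flat_rank r F - vec.dim G)"
          using less.hyps[OF _ G(1) \<open>G \<noteq> UNIV\<close>] rkG[OF G(2)] by simp
      qed
      also have "\<dots> = derange_poly q t (vec.dim F)" unfolding rF using derange_poly_rec[of "vec.dim F" q t] \<open>vec.dim F \<noteq> 0\<close> by (simp add: mult.assoc)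
      finally show ?thesis .
    qed
  qed
  have U: "UNIV \<in> flats" by (simp add: flat_iff)
  have top: "G.hilbert_at t UNIV = (\<Sum>k<r. gauss_binomial q CARD('n) k * (derange_poly q t k * geom_gap t (r - k)))"
  proof -
    have "G.hilbert_at t UNIV = (\<Sum>G | G \<in> flats \<and> G \<subset> UNIV. G.hilbert_at t G * geom_gap t (flat_rank r (UNIV :: ('a ^ 'n) set) - flat_rank r G))"
      by (rule G.hilbert_at_rec[OF U]) (use zero_neq_UNIV in blast)
    also have "\<dots> = (\<Sum>k<flat_rank r (UNIV :: ('a ^ 'n) set). gauss_binomial q (vec.dim (UNIV :: ('a ^ 'n) set)) k * (derange_poly q t k * geom_gap t (r - k)))"
    proof (rule below[OF U])
      fix G assume G: "G \<in> flats" "G \<subset> UNIV"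
      then have "G \<noteq> UNIV" by auto
      then show "G.hilbert_at t G * geom_gap t (flat_rank r (UNIV :: ('a ^ 'n) set) - flat_rank r G) = derange_poly q t (vec.dim G) * geom_gap t (r - vec.dim G)"
        using proper_flat[OF G(1)] rkG[OF G(2)] ru by simp
    qed
    finally show ?thesis unfolding ru vec_dim_card .
  qed
  have proper: "(\<Sum>G | G \<in> flats \<and> G \<subset> UNIV. G.hilbert_at t G) = (\<Sum>k<r. gauss_binomial q CARD('n) k * derange_poly q t k)"
  proof -
    have "(\<Sum>G | G \<in> flats \<and> G \<subset> UNIV. G.hilbert_at t G) = (\<Sum>k<flat_rank r (UNIV :: ('a ^ 'n) set). gauss_binomial q (vec.dim (UNIV :: ('a ^ 'n) set)) k * derange_poly q t k)"
      by (rule below[OF U]) (use proper_flat in blast)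
    then show ?thesis unfolding ru vec_dim_card .
  qed
  have split: "flats = insert UNIV {G. G \<in> flats \<and> G \<subset> UNIV}" using U by auto
  have geo: "1 + geom_gap t m = (\<Sum>i<m. t ^ i)" if "m > 0" for m
  proof -
    have "{..<m} = insert 0 {1..<m}" using that by auto
    then show ?thesis by (simp add: geom_gap_def)
  qed
  have "(\<Sum>d<r. real (chow_rank flats {0} d) * t ^ d) = (\<Sum>F\<in>flats. G.hilbert_at t F)"
    using G.sum_rank_hilbert_at[of t] unfolding ru by (simp only: G.chow_rank_FYs)
  also have "\<dots> = G.hilbert_at t UNIV + (\<Sum>G | G \<in> flats \<and> G \<subset> UNIV. G.hilbert_at t G)"
    by (subst split, subst sum.insert) auto
  also have "\<dots> = (\<Sum>k<r. gauss_binomial q CARD('n) k * derange_poly q t k * (1 + geom_gap t (r - k)))"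
    unfolding top proper by (simp add: sum.distrib[symmetric] algebra_simps)
  also have "\<dots> = (\<Sum>k<r. gauss_binomial q CARD('n) k * derange_poly q t k * (\<Sum>i<r - k. t ^ i))"
    by (rule sum.cong[OF refl]) (simp add: geo)
  finally show ?thesis unfolding q_def .
qed

lemma chow_rank_flats_top: "d \<ge> r \<Longrightarrow> chow_rank flats {0} d = 0"
proof -
  interpret G: geometric_lattice flats "{0}" UNIV "flat_rank r" by (rule flats_geometric)
  assume d: "d \<ge> r"
  have "G.FYs {0} d = {}"
  proof (rule ccontr)
    assume "G.FYs {0} d \<noteq> {}"
    then obtain m where m: "m \<in> G.FYs {0} d" by blast
    then have "G.FY {0} m" and dm: "weight (\<lambda>_. 1) m = d" unfolding G.FYs_def by blast+
    then have "weight (\<lambda>_. 1) m < flat_rank r (UNIV :: ('a ^ 'n) set) - flat_rank r {0 :: 'a ^ 'n}"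
      using G.FY_deg[OF _ zero_flat zero_neq_UNIV] by blast
    then show False using d unfolding dm flat_rank_UNIV by simp
  qed
  then show ?thesis unfolding G.chow_rank_FYs by simp
qed

end

section \<open>Comparison of coefficients\<close>

lemma polynomial_coeffs_zero:
  fixes c :: "nat \<Rightarrow> real"
  assumes "\<And>t. t > 1 \<Longrightarrow> (\<Sum>i\<le>n. c i * t ^ i) = 0" and "i \<le> n"
  shows "c i = 0"
proof -
  have "{1<..} \<subseteq> {t. (\<Sum>i\<le>n. c i * t ^ i) = 0}" using assms(1) by auto
  then have "\<not> finite {t. (\<Sum>i\<le>n. c i * t ^ i) = 0}" using infinite_Ioi[of "1 :: real"] finite_subset by blast
  then show ?thesis using polyfun_finite_roots[of c n] assms(2) by blast
qed

lemma sum_by_degree: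
  fixes t :: real
  assumes "finite S" "\<And>x. x \<in> S \<Longrightarrow> g x \<le> N"
  shows "(\<Sum>d\<le>N. (\<Sum>x\<in>{x\<in>S. g x = d}. f x) * t ^ d) = (\<Sum>x\<in>S. f x * t ^ g x)"
proof -
  have "(\<Sum>d\<le>N. (\<Sum>x\<in>{x\<in>S. g x = d}. f x) * t ^ d) = (\<Sum>d\<le>N. \<Sum>x\<in>{x\<in>S. g x = d}. f x * t ^ g x)"
    unfolding sum_distrib_right by (intro sum.cong refl) auto
  also have "\<dots> = (\<Sum>x\<in>S. f x * t ^ g x)" by (rule sum.group) (use assms in auto)
  finally show ?thesis .
qed

theorem theorem1p1:
  fixes r :: nat
  assumes "1 \<le> r" and "r \<le> CARD('n::finite)"
  shows "\<forall>d::nat.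
    real (chow_rank (flats_Mr r :: ('a::{finite,field} ^ 'n) set set) {0} d) =
      (\<Sum>\<sigma>\<in>{\<sigma>. \<sigma> permutes {1..CARD('n)} \<and> exc CARD('n) \<sigma> = d}.
          real CARD('a) powi (int (maj CARD('n) \<sigma>) - int (exc CARD('n) \<sigma>)))
    - (\<Sum>j\<in>{r..CARD('n) - 1}.
        \<Sum>\<sigma>\<in>{\<sigma>. \<sigma> permutes {1..CARD('n)} \<and> CARD('n) - j \<le> fixpts CARD('n) \<sigma>
                  \<and> int j - int (exc CARD('n) \<sigma>) = int d}.
          real CARD('a) powi (int (maj CARD('n) \<sigma>) - int (exc CARD('n) \<sigma>)))"
proof -
  define n where "n = CARD('n)"
  define q where "q = real CARD('a)"
  define w where "w = (\<lambda>\<sigma>. q powi (int (maj n \<sigma>) - int (exc n \<sigma>)))"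
  define P where "P = {\<sigma>. \<sigma> permutes {1..n}}"
  define Q where "Q = (\<lambda>j. {\<sigma>. \<sigma> permutes {1..n} \<and> n - j \<le> fixpts n \<sigma>})"
  define A where "A = (\<lambda>d. real (chow_rank (flats_Mr r :: ('a ^ 'n) set set) {0} d))"
  define R where "R = (\<lambda>d. (\<Sum>\<sigma>\<in>{\<sigma>\<in>P. exc n \<sigma> = d}. w \<sigma>) - (\<Sum>j\<in>{r..n - 1}. \<Sum>\<sigma>\<in>{\<sigma>\<in>Q j. j - exc n \<sigma> = d}. w \<sigma>))"
  have "CARD('a) > 1" using card_mono[of "UNIV :: 'a set" "{0, 1}"] by simp
  then have q: "q > 1" by (simp add: q_def)
  have r: "1 \<le> r" "r \<le> n" using assms by (simp_all add: n_def)
  have finP: "finite P" unfolding P_def by (rule finite_permutations) simp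
  have finQ: "finite (Q j)" for j by (rule finite_subset[OF _ finP]) (auto simp: Q_def P_def)
  have wexp: "w \<sigma> * t ^ exc n \<sigma> = q ^ maj n \<sigma> * (t / q) ^ exc n \<sigma>" for \<sigma> t
    using q by (simp add: w_def power_int_diff power_divide)
  \<comment> \<open>At least \<open>n - j\<close> fixed points leave at most \<open>j\<close>
    excedances, so \<open>j - exc n \<sigma>\<close> agrees with the integer difference in the
    theorem.\<close>
  have excj: "exc n \<sigma> \<le> j" if "\<sigma> \<in> Q j" "j \<in> {r..n - 1}" for \<sigma> j
  proof -
    have "n - j \<le> fixpts n \<sigma>" "j \<le> n - 1" using that by (auto simp: Q_def)
    then show ?thesis using exc_fix_le[of n \<sigma>] by linarith
  qed
  have excn: "exc n \<sigma> \<le> n" for \<sigma> using exc_fix_le[of n \<sigma>] by simp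
  have Atop: "A i = 0" if "r \<le> i" for i
  proof -
    have "chow_rank (flats_Mr r :: ('a ^ 'n) set set) {0} i = 0" by (rule chow_rank_flats_top[OF assms that])
    then show ?thesis by (simp add: A_def)
  qed
  \<comment> \<open>\<open>t > 1\<close> avoids the values 0 and 1 excluded in
    \<open>hilbert_identity\<close>, and infinitely many \<open>t\<close> suffice.\<close>
  have zero: "(\<Sum>i\<le>n. (A i - R i) * t ^ i) = 0" if t: "t > 1" for t
  proof -
    have "(\<Sum>i\<le>n. A i * t ^ i) = (\<Sum>i<r. A i * t ^ i)"
    proof (rule sum.mono_neutral_right)
      show "\<forall>i\<in>{..n} - {..<r}. A i * t ^ i = 0"
      proof
        fix i assume "i \<in> {..n} - {..<r}"
        then have "r \<le> i" by simp
        then show "A i * t ^ i = 0" using Atop by simp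
      qed
    qed (use r in auto)
    also have "\<dots> = (\<Sum>k<r. gauss_binomial q n k * derange_poly q t k * (\<Sum>i<r - k. t ^ i))"
      unfolding A_def q_def n_def by (rule hilbert_series_flats[OF assms])
    also have "\<dots> = (\<Sum>\<sigma>\<in>P. q ^ maj n \<sigma> * (t / q) ^ exc n \<sigma>)
        - (\<Sum>j\<in>{r..n - 1}. \<Sum>\<sigma>\<in>Q j. q ^ maj n \<sigma> * (1 / t / q) ^ exc n \<sigma> * t ^ j)"
      unfolding P_def Q_def using hilbert_identity[of q t r n] q t r by simp
    also have "(\<Sum>\<sigma>\<in>P. q ^ maj n \<sigma> * (t / q) ^ exc n \<sigma>) = (\<Sum>i\<le>n. (\<Sum>\<sigma>\<in>{\<sigma>\<in>P. exc n \<sigma> = i}. w \<sigma>) * t ^ i)"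
      by (subst sum_by_degree[OF finP excn]) (simp add: wexp)
    also have "(\<Sum>j\<in>{r..n - 1}. \<Sum>\<sigma>\<in>Q j. q ^ maj n \<sigma> * (1 / t / q) ^ exc n \<sigma> * t ^ j)
        = (\<Sum>j\<in>{r..n - 1}. \<Sum>i\<le>n. (\<Sum>\<sigma>\<in>{\<sigma>\<in>Q j. j - exc n \<sigma> = i}. w \<sigma>) * t ^ i)"
    proof (rule sum.cong[OF refl])
      fix j assume j: "j \<in> {r..n - 1}"
      have "(\<Sum>i\<le>n. (\<Sum>\<sigma>\<in>{\<sigma>\<in>Q j. j - exc n \<sigma> = i}. w \<sigma>) * t ^ i) = (\<Sum>\<sigma>\<in>Q j. w \<sigma> * t ^ (j - exc n \<sigma>))"
        by (rule sum_by_degree[OF finQ]) (use j in auto)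
      also have "\<dots> = (\<Sum>\<sigma>\<in>Q j. q ^ maj n \<sigma> * (1 / t / q) ^ exc n \<sigma> * t ^ j)"
      proof (rule sum.cong[OF refl])
        fix \<sigma> assume \<sigma>: "\<sigma> \<in> Q j"
        have "w \<sigma> * t ^ (j - exc n \<sigma>) = w \<sigma> * (1 / t) ^ exc n \<sigma> * t ^ j"
          using excj[OF \<sigma> j] t by (simp add: power_diff power_divide)
        then show "w \<sigma> * t ^ (j - exc n \<sigma>) = q ^ maj n \<sigma> * (1 / t / q) ^ exc n \<sigma> * t ^ j"
          unfolding wexp .
      qed
      finally show "(\<Sum>\<sigma>\<in>Q j. q ^ maj n \<sigma> * (1 / t / q) ^ exc n \<sigma> * t ^ j)
        = (\<Sum>i\<le>n. (\<Sum>\<sigma>\<in>{\<sigma>\<in>Q j. j - exc n \<sigma> = i}. w \<sigma>) * t ^ i)" by simp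
    qed
    also have "\<dots> = (\<Sum>i\<le>n. (\<Sum>j\<in>{r..n - 1}. \<Sum>\<sigma>\<in>{\<sigma>\<in>Q j. j - exc n \<sigma> = i}. w \<sigma>) * t ^ i)"
      unfolding sum_distrib_right[of _ "{r..n - 1}"] by (rule sum.swap)
    finally show ?thesis
      unfolding R_def by (simp only: left_diff_distrib sum_subtractf)
  qed
  have low: "A d = R d" if "d \<le> n" for d
  proof -
    have "A d - R d = 0" by (rule polynomial_coeffs_zero[of "\<lambda>i. A i - R i" n d, OF zero that])
    then show ?thesis by simp
  qed
  \<comment> \<open>The polynomial comparison stops at degree \<open>n\<close>; beyond it every sum
    is empty and the rank is 0.\<close>
  have high: "A d = R d" if d: "d > n" for d
  proof -
    have e: "{\<sigma>\<in>P. exc n \<sigma> = d} = {}" using excn d by (auto simp: not_le[symmetric])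
    have "(\<Sum>j\<in>{r..n - 1}. \<Sum>\<sigma>\<in>{\<sigma>\<in>Q j. j - exc n \<sigma> = d}. w \<sigma>) = 0"
    proof (rule sum.neutral, rule ballI)
      fix j assume "j \<in> {r..n - 1}"
      then have "{\<sigma>\<in>Q j. j - exc n \<sigma> = d} = {}" using d by auto
      then show "(\<Sum>\<sigma>\<in>{\<sigma>\<in>Q j. j - exc n \<sigma> = d}. w \<sigma>) = 0" by (simp only: sum.empty)
    qed
    moreover have "A d = 0" using Atop[of d] r d by simp
    ultimately show ?thesis unfolding R_def e by (simp only: sum.empty)
  qed
  have "A d = (\<Sum>\<sigma>\<in>{\<sigma>. \<sigma> permutes {1..n} \<and> exc n \<sigma> = d}. w \<sigma>)
    - (\<Sum>j\<in>{r..n - 1}. \<Sum>\<sigma>\<in>{\<sigma>. \<sigma> permutes {1..n} \<and> n - j \<le> fixpts n \<sigma> \<and> int j - int (exc n \<sigma>) = int d}. w \<sigma>)" for d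
  proof -
    have e: "{\<sigma>. \<sigma> permutes {1..n} \<and> n - j \<le> fixpts n \<sigma> \<and> int j - int (exc n \<sigma>) = int d} = {\<sigma>\<in>Q j. j - exc n \<sigma> = d}"
      if j: "j \<in> {r..n - 1}" for j
    proof (rule set_eqI)
      fix \<sigma>
      have "int j - int (exc n \<sigma>) = int d \<longleftrightarrow> j - exc n \<sigma> = d" if "\<sigma> \<in> Q j" using excj[OF that j] by auto
      then show "\<sigma> \<in> {\<sigma>. \<sigma> permutes {1..n} \<and> n - j \<le> fixpts n \<sigma> \<and> int j - int (exc n \<sigma>) = int d} \<longleftrightarrow> \<sigma> \<in> {\<sigma>\<in>Q j. j - exc n \<sigma> = d}"
        by (auto simp: Q_def)
    qed
    have "(\<Sum>j\<in>{r..n - 1}. \<Sum>\<sigma>\<in>{\<sigma>. \<sigma> permutes {1..n} \<and> n - j \<le> fixpts n \<sigma> \<and> int j - int (exc n \<sigma>) = int d}. w \<sigma>)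
      = (\<Sum>j\<in>{r..n - 1}. \<Sum>\<sigma>\<in>{\<sigma>\<in>Q j. j - exc n \<sigma> = d}. w \<sigma>)"
      by (rule sum.cong[OF refl]) (simp only: e)
    moreover have "A d = R d" using low[of d] high[of d] by linarith
    ultimately show ?thesis unfolding R_def P_def by (simp only: mem_Collect_eq)
  qed
  then show ?thesis unfolding A_def w_def n_def q_def by blast
qed

end
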